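(* Let $1<\alpha<2$, $T>0$, and let $\Omega\subset\mathbb R^d$ ($d\in\{1,2,3\}$) be a convex $d$-polytope. Let $f\in G^*$, $u_0\in G_0^*$ and $u_1\in G_1^*$. Then there exists a unique $u\in L^2(0,T;L^2(\Omega))$ such that $$\langle u,D_{T-}^\alpha v-\Delta v\rangle_{\Omega\times(0,T)}=\langle f,v\rangle_G+\big\langle u_0,(D_{T-}^{\alpha-1}v)(0)\big\rangle_{G_0}+\big\langle u_1,(D_{T-}^{\alpha-2}v)(0)\big\rangle_{G_1}\quad\text{for all }v\in G,$$ and, with a constant $C_\alpha>0$ depending only on $\alpha$, $$\|u\|_{L^2(0,T;L^2(\Omega))}\le C_\alpha\big(\|f\|_{G^*}+\|u_0\|_{G_0^*}+\|u_1\|_{G_1^*}\big).$$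
   Context: All functions are real-valued; $\langle p,q\rangle_\omega=\int_\omega pq$; $\langle\cdot,\cdot\rangle_Y$ is the duality pairing between $Y^*$ and $Y$. $\{\phi_n\}_{n\in\mathbb N}$ is an orthonormal basis of $L^2(\Omega)$ with $-\Delta\phi_n=\lambda_n\phi_n$ in $\Omega$, $\phi_n=0$ on $\partial\Omega$, $0<\lambda_0\le\lambda_1\le\dots\to\infty$; $\dot H^2(\Omega)=\{\sum_n c_n\phi_n:\sum_n\lambda_n^2c_n^2<\infty\}$ with norm $(\sum_n\lambda_n^2c_n^2)^{1/2}$. For $m\in\mathbb N=\{0,1,\dots\}$, ${}^0H^m(0,T)=\{v\in H^m(0,T):v^{(k)}(T)=0,\ 0\le k<m\}$ with norm $\|v^{(m)}\|_{L^2(0,T)}$; for $k-1<\gamma<k$ ($k\ge1$ an integer) ${}^0H^\gamma(0,T)=[{}^0H^{k-1}(0,T),{}^0H^k(0,T)]_{\gamma-k+1,2}$ (real interpolation, $K$-method). For a separable Hilbert space $X$ with orthonormal basis $\{e_n\}$, ${}^0H^\gamma(0,T;X)=\{\sum c_ne_n:\sum\|c_n\|_{{}^0H^\gamma(0,T)}^2<\infty\}$ with the corresponding norm. For $\gamma>0$, $(D_{T-}^{-\gamma}v)(t)=\frac1{\Gamma(\gamma)}\int_t^T(s-t)^{\gamma-1}v(s)\,ds$; for $j-1<\gamma\le j$ with $j\ge1$ an integer, $D_{T-}^\gamma v=(-D)^jD_{T-}^{\gamma-j}v$, $D$ being the distributional time derivative. $G={}^0H^\alpha(0,T;L^2(\Omega))\cap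 L^2(0,T;\dot H^2(\Omega))$ with norm $\|\cdot\|_G=\max\{\|\cdot\|_{{}^0H^\alpha(0,T;L^2(\Omega))},\|\cdot\|_{L^2(0,T;\dot H^2(\Omega))}\}$. $G_0=\{(D_{T-}^{\alpha-1}v)(0):v\in G\}$ with norm $\|v_0\|_{G_0}=\inf\{\|v\|_G:v\in G,\ (D_{T-}^{\alpha-1}v)(0)=v_0\}$; $G_1=\{(D_{T-}^{\alpha-2}v)(0):v\in G\}$ with norm $\|v_1\|_{G_1}=\inf\{\|v\|_G:v\in G,\ (D_{T-}^{\alpha-2}v)(0)=v_1\}$. *)

theory Defs
  imports "HOL-Analysis.Analysis"
begin

text \<open>
  Elements of function spaces are represented by functions. All spaces below are closed under
  measurable modification on null sets (and off the domain), all norms are seminorms invariant under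
  it, and equality in a function space is equality almost everywhere. Every class of
  square-integrable functions has a Borel representative, so Borel measurability loses nothing.
  Throughout, a function of time and space takes arguments (t, x).
\<close>


section \<open>Square-integrable functions\<close>

abbreviation mon :: "'a::euclidean_space set \<Rightarrow> 'a measure" where
  "mon S \<equiv> restrict_space lborel S"

abbreviation cylinder :: "real \<Rightarrow> 'a::euclidean_space set \<Rightarrow> (real \<times> 'a) measure" where
  "cylinder T \<Omega> \<equiv> mon {0<..<T} \<Otimes>\<^sub>M mon \<Omega>"

definition L2 :: "'a measure \<Rightarrow> ('a \<Rightarrow> real) set" where
  "L2 M = {f \<in> borel_measurable M. integrable M (\<lambda>x. (f x)\<^sup>2)}"

definition ip :: "'a measure \<Rightarrow> ('a \<Rightarrow> real) \<Rightarrow> ('a \<Rightarrow> real) \<Rightarrow> real" where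
  "ip M f g = (\<integral>x. f x * g x \<partial>M)"

definition L2norm :: "'a measure \<Rightarrow> ('a \<Rightarrow> real) \<Rightarrow> real" where
  "L2norm M f = sqrt (\<integral>x. (f x)\<^sup>2 \<partial>M)"


section \<open>Test functions and distributional derivatives\<close>

definition partial :: "'a::euclidean_space \<Rightarrow> ('a \<Rightarrow> real) \<Rightarrow> 'a \<Rightarrow> real" where
  "partial b f x = frechet_derivative f (at x) b"

definition smooth :: "('a::euclidean_space \<Rightarrow> real) \<Rightarrow> bool" where
  "smooth f \<longleftrightarrow> (\<forall>bs. set bs \<subseteq> Basis \<longrightarrow> foldr partial bs f differentiable_on UNIV)"

definition test_functions :: "'a::euclidean_space set \<Rightarrow> ('a \<Rightarrow> real) set" where
  "test_functions S =
     {\<psi>. smooth \<psi> \<and> compact (closure {x. \<psi> x \<noteq> 0}) \<and> closure {x. \<psi> x \<noteq> 0} \<subseteq> S}"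

definition has_weak_deriv :: "real \<Rightarrow> nat \<Rightarrow> (real \<Rightarrow> real) \<Rightarrow> (real \<Rightarrow> real) \<Rightarrow> bool" where
  "has_weak_deriv T k v w \<longleftrightarrow> w \<in> L2 (mon {0<..<T}) \<and>
     (\<forall>\<psi>\<in>test_functions {0<..<T}.
        ip (mon {0<..<T}) v ((deriv ^^ k) \<psi>) = (-1) ^ k * ip (mon {0<..<T}) w \<psi>)"

definition weak_deriv :: "real \<Rightarrow> nat \<Rightarrow> (real \<Rightarrow> real) \<Rightarrow> real \<Rightarrow> real" where
  "weak_deriv T k v = (SOME w. has_weak_deriv T k v w)"

definition has_laplacian :: "'a::euclidean_space set \<Rightarrow> ('a \<Rightarrow> real) \<Rightarrow> ('a \<Rightarrow> real) \<Rightarrow> bool" where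
  "has_laplacian \<Omega> f g \<longleftrightarrow> g \<in> L2 (mon \<Omega>) \<and>
     (\<forall>\<psi>\<in>test_functions \<Omega>.
        ip (mon \<Omega>) f (\<lambda>x. \<Sum>b\<in>Basis. partial b (partial b \<psi>) x) = ip (mon \<Omega>) g \<psi>)"

text \<open>The Laplacian acts on the space variable only.\<close>

definition laplacian ::
  "real \<Rightarrow> 'a::euclidean_space set \<Rightarrow> (real \<times> 'a \<Rightarrow> real) \<Rightarrow> real \<times> 'a \<Rightarrow> real" where
  "laplacian T \<Omega> v = (SOME w. w \<in> L2 (cylinder T \<Omega>) \<and>
     (AE t in mon {0<..<T}. has_laplacian \<Omega> (\<lambda>x. v (t, x)) (\<lambda>x. w (t, x))))"


section \<open>Domain and Dirichlet eigenfunctions\<close>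

text \<open>Library polytopes are compact; the domain is the interior of a full-dimensional one.\<close>

definition convex_polytope_domain :: "'a::euclidean_space set \<Rightarrow> bool" where
  "convex_polytope_domain \<Omega> \<longleftrightarrow>
     (\<exists>P. polytope P \<and> aff_dim P = int DIM('a) \<and> \<Omega> = interior P)"

text \<open>The closure of the test functions in the first-order Sobolev space: zero boundary values.\<close>

definition H10 :: "'a::euclidean_space set \<Rightarrow> ('a \<Rightarrow> real) set" where
  "H10 \<Omega> = {f \<in> L2 (mon \<Omega>). \<exists>g \<psi>.
     (\<forall>b\<in>Basis. g b \<in> L2 (mon \<Omega>)) \<and> (\<forall>k. \<psi> k \<in> test_functions \<Omega>) \<and>
     (\<lambda>k. L2norm (mon \<Omega>) (\<lambda>x. \<psi> k x - f x)) \<longlonglongrightarrow> 0 \<and>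
     (\<forall>b\<in>Basis. (\<lambda>k. L2norm (mon \<Omega>) (\<lambda>x. partial b (\<psi> k) x - g b x)) \<longlonglongrightarrow> 0)}"

definition orthonormal_basis :: "'a measure \<Rightarrow> (nat \<Rightarrow> 'a \<Rightarrow> real) \<Rightarrow> bool" where
  "orthonormal_basis M \<phi> \<longleftrightarrow>
     (\<forall>n. \<phi> n \<in> L2 M) \<and>
     (\<forall>m n. ip M (\<phi> m) (\<phi> n) = (if m = n then 1 else 0)) \<and>
     (\<forall>f\<in>L2 M. (\<lambda>N. L2norm M (\<lambda>x. f x - (\<Sum>n<N. ip M f (\<phi> n) * \<phi> n x))) \<longlonglongrightarrow> 0)"

definition dirichlet_eigenbasis ::
  "'a::euclidean_space set \<Rightarrow> (nat \<Rightarrow> 'a \<Rightarrow> real) \<Rightarrow> (nat \<Rightarrow> real) \<Rightarrow> bool" where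
  "dirichlet_eigenbasis \<Omega> \<phi> lam \<longleftrightarrow>
     orthonormal_basis (mon \<Omega>) \<phi> \<and>
     (\<forall>n. \<phi> n \<in> H10 \<Omega> \<and> has_laplacian \<Omega> (\<phi> n) (\<lambda>x. - lam n * \<phi> n x)) \<and>
     0 < lam 0 \<and> mono lam \<and> filterlim lam at_top sequentially"

definition Hdot2 ::
  "'a::euclidean_space set \<Rightarrow> (nat \<Rightarrow> 'a \<Rightarrow> real) \<Rightarrow> (nat \<Rightarrow> real) \<Rightarrow> ('a \<Rightarrow> real) set" where
  "Hdot2 \<Omega> \<phi> lam =
     {f \<in> L2 (mon \<Omega>). summable (\<lambda>n. (lam n)\<^sup>2 * (ip (mon \<Omega>) f (\<phi> n))\<^sup>2)}"

definition Hdot2_norm ::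
  "'a::euclidean_space set \<Rightarrow> (nat \<Rightarrow> 'a \<Rightarrow> real) \<Rightarrow> (nat \<Rightarrow> real) \<Rightarrow> ('a \<Rightarrow> real) \<Rightarrow> real" where
  "Hdot2_norm \<Omega> \<phi> lam f = sqrt (\<Sum>n. (lam n)\<^sup>2 * (ip (mon \<Omega>) f (\<phi> n))\<^sup>2)"


section \<open>Real interpolation (K-method, second index 2)\<close>

definition K_functional ::
  "('a \<Rightarrow> real) set \<Rightarrow> (('a \<Rightarrow> real) \<Rightarrow> real) \<Rightarrow> ('a \<Rightarrow> real) set \<Rightarrow> (('a \<Rightarrow> real) \<Rightarrow> real) \<Rightarrow>
   real \<Rightarrow> ('a \<Rightarrow> real) \<Rightarrow> real" where
  "K_functional A nA B nB s v =
     Inf {nA a + s * nB b | a b. a \<in> A \<and> b \<in> B \<and> v = (\<lambda>x. a x + b x)}"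

definition interp_sq ::
  "('a \<Rightarrow> real) set \<Rightarrow> (('a \<Rightarrow> real) \<Rightarrow> real) \<Rightarrow> ('a \<Rightarrow> real) set \<Rightarrow> (('a \<Rightarrow> real) \<Rightarrow> real) \<Rightarrow>
   real \<Rightarrow> ('a \<Rightarrow> real) \<Rightarrow> ennreal" where
  "interp_sq A nA B nB \<theta> v =
     (\<integral>\<^sup>+s\<in>{0<..}. ennreal ((s powr (-\<theta>) * K_functional A nA B nB s v)\<^sup>2 / s) \<partial>lborel)"

definition interp_space ::
  "('a \<Rightarrow> real) set \<Rightarrow> (('a \<Rightarrow> real) \<Rightarrow> real) \<Rightarrow> ('a \<Rightarrow> real) set \<Rightarrow> (('a \<Rightarrow> real) \<Rightarrow> real) \<Rightarrow>
   real \<Rightarrow> ('a \<Rightarrow> real) set" where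
  "interp_space A nA B nB \<theta> =
     {v. (\<exists>a\<in>A. \<exists>b\<in>B. v = (\<lambda>x. a x + b x)) \<and> interp_sq A nA B nB \<theta> v < \<infinity>}"

definition interp_norm ::
  "('a \<Rightarrow> real) set \<Rightarrow> (('a \<Rightarrow> real) \<Rightarrow> real) \<Rightarrow> ('a \<Rightarrow> real) set \<Rightarrow> (('a \<Rightarrow> real) \<Rightarrow> real) \<Rightarrow>
   real \<Rightarrow> ('a \<Rightarrow> real) \<Rightarrow> real" where
  "interp_norm A nA B nB \<theta> v = sqrt (enn2real (interp_sq A nA B nB \<theta> v))"


section \<open>Time Sobolev spaces vanishing at the final time\<close>

text \<open>Point values are those of the continuous representative.\<close>

definition has_value_at :: "real \<Rightarrow> (real \<Rightarrow> real) \<Rightarrow> real \<Rightarrow> real \<Rightarrow> bool" where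
  "has_value_at T v t0 y \<longleftrightarrow>
     (\<exists>c. continuous_on {0..T} c \<and> (AE t in mon {0<..<T}. v t = c t) \<and> c t0 = y)"

definition H0_int :: "real \<Rightarrow> nat \<Rightarrow> (real \<Rightarrow> real) set" where
  "H0_int T m = {v \<in> L2 (mon {0<..<T}).
     (\<forall>k\<le>m. \<exists>w. has_weak_deriv T k v w) \<and>
     (\<forall>k<m. has_value_at T (weak_deriv T k v) T 0)}"

definition H0_int_norm :: "real \<Rightarrow> nat \<Rightarrow> (real \<Rightarrow> real) \<Rightarrow> real" where
  "H0_int_norm T m v = L2norm (mon {0<..<T}) (weak_deriv T m v)"

definition H0 :: "real \<Rightarrow> real \<Rightarrow> (real \<Rightarrow> real) set" where
  "H0 T \<gamma> = (let k = nat \<lceil>\<gamma>\<rceil> in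
     if \<gamma> = real k then H0_int T k
     else interp_space (H0_int T (k - 1)) (H0_int_norm T (k - 1)) (H0_int T k) (H0_int_norm T k)
            (\<gamma> - real k + 1))"

definition H0_norm :: "real \<Rightarrow> real \<Rightarrow> (real \<Rightarrow> real) \<Rightarrow> real" where
  "H0_norm T \<gamma> = (let k = nat \<lceil>\<gamma>\<rceil> in
     if \<gamma> = real k then H0_int_norm T k
     else interp_norm (H0_int T (k - 1)) (H0_int_norm T (k - 1)) (H0_int T k) (H0_int_norm T k)
            (\<gamma> - real k + 1))"

text \<open>
  An element of L2(0,T; L2(\<Omega>)) expands in an orthonormal basis of L2(\<Omega>) with its Fourier
  coefficient functions, and with no others up to null sets; so membership and norm are read off them.
\<close>

definition coeff ::
  "'a::euclidean_space set \<Rightarrow> (nat \<Rightarrow> 'a \<Rightarrow> real) \<Rightarrow> nat \<Rightarrow> (real \<times> 'a \<Rightarrow> real) \<Rightarrow> real \<Rightarrow> real" where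
  "coeff \<Omega> \<phi> n v t = ip (mon \<Omega>) (\<lambda>x. v (t, x)) (\<phi> n)"

definition H0_L2 ::
  "real \<Rightarrow> 'a::euclidean_space set \<Rightarrow> (nat \<Rightarrow> 'a \<Rightarrow> real) \<Rightarrow> real \<Rightarrow> (real \<times> 'a \<Rightarrow> real) set" where
  "H0_L2 T \<Omega> \<phi> \<gamma> = {v \<in> L2 (cylinder T \<Omega>).
     (\<forall>n. coeff \<Omega> \<phi> n v \<in> H0 T \<gamma>) \<and> summable (\<lambda>n. (H0_norm T \<gamma> (coeff \<Omega> \<phi> n v))\<^sup>2)}"

definition H0_L2_norm ::
  "real \<Rightarrow> 'a::euclidean_space set \<Rightarrow> (nat \<Rightarrow> 'a \<Rightarrow> real) \<Rightarrow> real \<Rightarrow> (real \<times> 'a \<Rightarrow> real) \<Rightarrow> real" where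
  "H0_L2_norm T \<Omega> \<phi> \<gamma> v = sqrt (\<Sum>n. (H0_norm T \<gamma> (coeff \<Omega> \<phi> n v))\<^sup>2)"

definition L2_Hdot2 ::
  "real \<Rightarrow> 'a::euclidean_space set \<Rightarrow> (nat \<Rightarrow> 'a \<Rightarrow> real) \<Rightarrow> (nat \<Rightarrow> real) \<Rightarrow>
   (real \<times> 'a \<Rightarrow> real) set" where
  "L2_Hdot2 T \<Omega> \<phi> lam = {v \<in> L2 (cylinder T \<Omega>).
     (AE t in mon {0<..<T}. (\<lambda>x. v (t, x)) \<in> Hdot2 \<Omega> \<phi> lam) \<and>
     integrable (mon {0<..<T}) (\<lambda>t. (Hdot2_norm \<Omega> \<phi> lam (\<lambda>x. v (t, x)))\<^sup>2)}"

definition L2_Hdot2_norm ::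
  "real \<Rightarrow> 'a::euclidean_space set \<Rightarrow> (nat \<Rightarrow> 'a \<Rightarrow> real) \<Rightarrow> (nat \<Rightarrow> real) \<Rightarrow>
   (real \<times> 'a \<Rightarrow> real) \<Rightarrow> real" where
  "L2_Hdot2_norm T \<Omega> \<phi> lam v =
     sqrt (\<integral>t. (Hdot2_norm \<Omega> \<phi> lam (\<lambda>x. v (t, x)))\<^sup>2 \<partial>mon {0<..<T})"


section \<open>Backward Riemann--Liouville operators\<close>

text \<open>Derivatives of positive order are taken as square-integrable functions, which they are on G.\<close>

definition frac_int :: "real \<Rightarrow> real \<Rightarrow> (real \<times> 'a \<Rightarrow> real) \<Rightarrow> real \<times> 'a \<Rightarrow> real" where
  "frac_int T \<beta> v = (\<lambda>(t, x).
     if \<beta> = 0 then v (t, x)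
     else 1 / Gamma \<beta> * (\<integral>s\<in>{t<..<T}. (s - t) powr (\<beta> - 1) * v (s, x) \<partial>lborel))"

text \<open>
  g is (-D)^j w in the sense of distributions on (0,T) with values in L2(\<Omega>): the signs of
  (-D)^j and of the j-fold transposition cancel, and for each test function the two sides are
  equal as elements of L2(\<Omega>).
\<close>

definition has_neg_deriv ::
  "real \<Rightarrow> 'a::euclidean_space set \<Rightarrow> nat \<Rightarrow> (real \<times> 'a \<Rightarrow> real) \<Rightarrow> (real \<times> 'a \<Rightarrow> real) \<Rightarrow> bool" where
  "has_neg_deriv T \<Omega> j w g \<longleftrightarrow> g \<in> L2 (cylinder T \<Omega>) \<and>
     (\<forall>\<psi>\<in>test_functions {0<..<T}. AE x in mon \<Omega>.
        ip (mon {0<..<T}) (\<lambda>t. w (t, x)) ((deriv ^^ j) \<psi>) =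
        ip (mon {0<..<T}) (\<lambda>t. g (t, x)) \<psi>)"

definition frac_deriv ::
  "real \<Rightarrow> 'a::euclidean_space set \<Rightarrow> real \<Rightarrow> (real \<times> 'a \<Rightarrow> real) \<Rightarrow> real \<times> 'a \<Rightarrow> real" where
  "frac_deriv T \<Omega> \<gamma> v =
     (if \<gamma> \<le> 0 then frac_int T (-\<gamma>) v
      else (let j = nat \<lceil>\<gamma>\<rceil> in SOME g. has_neg_deriv T \<Omega> j (frac_int T (real j - \<gamma>) v) g))"

text \<open>The value at time 0, in L2(\<Omega>), of the representative continuous from [0,T] to L2(\<Omega>).\<close>

definition has_initial_value ::
  "real \<Rightarrow> 'a::euclidean_space set \<Rightarrow> (real \<times> 'a \<Rightarrow> real) \<Rightarrow> ('a \<Rightarrow> real) \<Rightarrow> bool" where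
  "has_initial_value T \<Omega> w g \<longleftrightarrow> g \<in> L2 (mon \<Omega>) \<and> (\<exists>W.
     (\<forall>t\<in>{0..T}. W t \<in> L2 (mon \<Omega>)) \<and>
     (\<forall>t\<in>{0..T}. ((\<lambda>s. L2norm (mon \<Omega>) (\<lambda>x. W s x - W t x)) \<longlongrightarrow> 0) (at t within {0..T})) \<and>
     (AE t in mon {0<..<T}. AE x in mon \<Omega>. w (t, x) = W t x) \<and>
     (AE x in mon \<Omega>. g x = W 0 x))"

definition initial_value ::
  "real \<Rightarrow> 'a::euclidean_space set \<Rightarrow> (real \<times> 'a \<Rightarrow> real) \<Rightarrow> 'a \<Rightarrow> real" where
  "initial_value T \<Omega> w = (SOME g. has_initial_value T \<Omega> w g)"


section \<open>The test space, its trace spaces, and dual spaces\<close>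

definition dual_space ::
  "('b \<Rightarrow> real) set \<Rightarrow> (('b \<Rightarrow> real) \<Rightarrow> real) \<Rightarrow> (('b \<Rightarrow> real) \<Rightarrow> real) set" where
  "dual_space A nA = {F.
     (\<forall>v\<in>A. \<forall>w\<in>A. F (\<lambda>x. v x + w x) = F v + F w) \<and>
     (\<forall>c. \<forall>v\<in>A. F (\<lambda>x. c * v x) = c * F v) \<and>
     (\<exists>C. \<forall>v\<in>A. \<bar>F v\<bar> \<le> C * nA v)}"

definition dual_norm ::
  "('b \<Rightarrow> real) set \<Rightarrow> (('b \<Rightarrow> real) \<Rightarrow> real) \<Rightarrow> (('b \<Rightarrow> real) \<Rightarrow> real) \<Rightarrow> real" where
  "dual_norm A nA F = Sup {\<bar>F v\<bar> | v. v \<in> A \<and> nA v \<le> 1}"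

definition G ::
  "real \<Rightarrow> real \<Rightarrow> 'a::euclidean_space set \<Rightarrow> (nat \<Rightarrow> 'a \<Rightarrow> real) \<Rightarrow> (nat \<Rightarrow> real) \<Rightarrow>
   (real \<times> 'a \<Rightarrow> real) set" where
  "G \<alpha> T \<Omega> \<phi> lam = H0_L2 T \<Omega> \<phi> \<alpha> \<inter> L2_Hdot2 T \<Omega> \<phi> lam"

definition G_norm ::
  "real \<Rightarrow> real \<Rightarrow> 'a::euclidean_space set \<Rightarrow> (nat \<Rightarrow> 'a \<Rightarrow> real) \<Rightarrow> (nat \<Rightarrow> real) \<Rightarrow>
   (real \<times> 'a \<Rightarrow> real) \<Rightarrow> real" where
  "G_norm \<alpha> T \<Omega> \<phi> lam v = max (H0_L2_norm T \<Omega> \<phi> \<alpha> v) (L2_Hdot2_norm T \<Omega> \<phi> lam v)"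

definition G0 ::
  "real \<Rightarrow> real \<Rightarrow> 'a::euclidean_space set \<Rightarrow> (nat \<Rightarrow> 'a \<Rightarrow> real) \<Rightarrow> (nat \<Rightarrow> real) \<Rightarrow>
   ('a \<Rightarrow> real) set" where
  "G0 \<alpha> T \<Omega> \<phi> lam =
     {g. \<exists>v\<in>G \<alpha> T \<Omega> \<phi> lam. has_initial_value T \<Omega> (frac_deriv T \<Omega> (\<alpha> - 1) v) g}"

definition G0_norm ::
  "real \<Rightarrow> real \<Rightarrow> 'a::euclidean_space set \<Rightarrow> (nat \<Rightarrow> 'a \<Rightarrow> real) \<Rightarrow> (nat \<Rightarrow> real) \<Rightarrow>
   ('a \<Rightarrow> real) \<Rightarrow> real" where
  "G0_norm \<alpha> T \<Omega> \<phi> lam g =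
     Inf {G_norm \<alpha> T \<Omega> \<phi> lam v | v.
       v \<in> G \<alpha> T \<Omega> \<phi> lam \<and> has_initial_value T \<Omega> (frac_deriv T \<Omega> (\<alpha> - 1) v) g}"

definition G1 ::
  "real \<Rightarrow> real \<Rightarrow> 'a::euclidean_space set \<Rightarrow> (nat \<Rightarrow> 'a \<Rightarrow> real) \<Rightarrow> (nat \<Rightarrow> real) \<Rightarrow>
   ('a \<Rightarrow> real) set" where
  "G1 \<alpha> T \<Omega> \<phi> lam =
     {g. \<exists>v\<in>G \<alpha> T \<Omega> \<phi> lam. has_initial_value T \<Omega> (frac_deriv T \<Omega> (\<alpha> - 2) v) g}"

definition G1_norm ::
  "real \<Rightarrow> real \<Rightarrow> 'a::euclidean_space set \<Rightarrow> (nat \<Rightarrow> 'a \<Rightarrow> real) \<Rightarrow> (nat \<Rightarrow> real) \<Rightarrow>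
   ('a \<Rightarrow> real) \<Rightarrow> real" where
  "G1_norm \<alpha> T \<Omega> \<phi> lam g =
     Inf {G_norm \<alpha> T \<Omega> \<phi> lam v | v.
       v \<in> G \<alpha> T \<Omega> \<phi> lam \<and> has_initial_value T \<Omega> (frac_deriv T \<Omega> (\<alpha> - 2) v) g}"

definition weak_solution ::
  "real \<Rightarrow> real \<Rightarrow> 'a::euclidean_space set \<Rightarrow> (nat \<Rightarrow> 'a \<Rightarrow> real) \<Rightarrow> (nat \<Rightarrow> real) \<Rightarrow>
   ((real \<times> 'a \<Rightarrow> real) \<Rightarrow> real) \<Rightarrow> (('a \<Rightarrow> real) \<Rightarrow> real) \<Rightarrow> (('a \<Rightarrow> real) \<Rightarrow> real) \<Rightarrow>
   (real \<times> 'a \<Rightarrow> real) \<Rightarrow> bool" where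
  "weak_solution \<alpha> T \<Omega> \<phi> lam f u0 u1 u \<longleftrightarrow> u \<in> L2 (cylinder T \<Omega>) \<and>
     (\<forall>v\<in>G \<alpha> T \<Omega> \<phi> lam.
        ip (cylinder T \<Omega>) u (\<lambda>p. frac_deriv T \<Omega> \<alpha> v p - laplacian T \<Omega> v p) =
        f v + u0 (initial_value T \<Omega> (frac_deriv T \<Omega> (\<alpha> - 1) v))
            + u1 (initial_value T \<Omega> (frac_deriv T \<Omega> (\<alpha> - 2) v)))"

end

theory Submission
  imports Defs
begin

text \<open>
  Let \<open>V\<close> be backward integration on \<open>L\<^sup>2(0,T)\<close>, so that \<open>V\<^sup>\<gamma>\<close> is the fractional integral, with resolvents
  \<open>R\<^sub>r\<close> given by the kernel \<open>exp (-u / r) / r\<close>. Since \<open>V\<^sup>\<theta>\<close> (\<open>0 < \<theta> < 1\<close>) is a weighted integral over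
  \<open>r\<close> of powers of \<open>R\<^sub>r\<close> and \<open>R\<^sub>r\<close> is accretive, \<open>W = V\<^sup>\<alpha>\<^sup>/\<^sup>2\<close> satisfies a sector bound
  \<open>|(W x, y)| \<le> K ((W x, x) + (W y, y))\<close> with \<open>K\<close> depending on \<open>\<alpha>\<close> only. It implies
  \<open>\<parallel>g\<parallel> \<le> C \<parallel>g + l V\<^sup>\<alpha> g\<parallel>\<close> uniformly in \<open>l \<ge> 0\<close> and in \<open>T\<close>, and likewise for the adjoint of \<open>V\<^sup>\<alpha>\<close>.

  The \<open>K\<close>-functional of \<open>V x\<close> at \<open>s\<close> is comparable to \<open>\<parallel>x - R\<^sub>s x\<parallel>\<close>. A quadratic estimate for
  \<open>R\<^sub>r - R\<^sub>r\<^sup>2\<close>, combined with Schur's test, identifies the interpolation space of order \<open>\<alpha>\<close> with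
  \<open>V\<^sup>\<alpha> L\<^sup>2\<close>, with equivalence constants depending on \<open>\<alpha>\<close> only.

  Hence \<open>v \<in> G\<close> has Fourier coefficients \<open>V\<^sup>\<alpha> g\<^sub>n\<close>, and \<open>B v = D\<^sup>\<alpha> v - \<Delta> v\<close> has the coefficients
  \<open>g\<^sub>n + \<lambda>\<^sub>n V\<^sup>\<alpha> g\<^sub>n\<close>, so that \<open>\<parallel>v\<parallel>\<^sub>G \<le> C \<parallel>B v\<parallel>\<close>. The right-hand side is therefore a bounded functional of
  \<open>B v\<close>, represented by some \<open>u\<close> by Riesz' theorem. The estimate for the adjoint shows that the range
  of \<open>B\<close> is dense, which gives uniqueness.
\<close>

section \<open>Square-integrable functions as a Hilbert space\<close>

text \<open>For \<alpha> > 1 the form (V^\<alpha> g, g) has no sign, so g + l V^\<alpha> g cannot be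
  bounded below by testing with g. The square root W has order below one: its form is nonnegative,
  and the sector bound controls its skew part. The price is a coercivity constant of size 1 / (2 -
  \<alpha>).

  The final constant may depend neither on T nor on the eigenvalues. Therefore all quantitative
  steps rest on accretivity of the resolvents and on integrals against dr / r, which are invariant
  under scaling; operator bounds that depend on T only show that functions are square-integrable.
  Uniformity in l allows the estimates of the single modes to be squared and summed.

  The Riesz argument runs over the values B v themselves, so the functional need not be known to be
  well defined on the range. Traces are fixed only up to null sets; their functionals are handled
  through the relation \<open>has_initial_value\<close>. The norm of G is compared with that of a
  multiple only up to the factor \<open>trial_const\<close>, which comes from identifying the
  interpolation space with V^\<alpha> L2.\<close>

lemma L2_measurable: "f \<in> L2 M \<Longrightarrow> f \<in> borel_measurable M"
  by (simp add: L2_def)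

lemma L2_iff_nn:
  "f \<in> L2 M \<longleftrightarrow> f \<in> borel_measurable M \<and> (\<integral>\<^sup>+x. ennreal ((f x)\<^sup>2) \<partial>M) < \<infinity>"
  unfolding L2_def integrable_iff_bounded by auto

lemma L2_mult_integrable:
  assumes "f \<in> L2 M" "g \<in> L2 M"
  shows "integrable M (\<lambda>x. f x * g x)"
proof (rule Bochner_Integration.integrable_bound)
  show "integrable M (\<lambda>x. (f x)\<^sup>2 + (g x)\<^sup>2)"
    using assms by (auto simp: L2_def)
  show "(\<lambda>x. f x * g x) \<in> borel_measurable M"
    using assms by (auto simp: L2_def)
  show "AE x in M. norm (f x * g x) \<le> norm ((f x)\<^sup>2 + (g x)\<^sup>2)"
  proof (rule AE_I2)
    fix x
    have "2 * (\<bar>f x\<bar> * \<bar>g x\<bar>) \<le> \<bar>f x\<bar>\<^sup>2 + \<bar>g x\<bar>\<^sup>2"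
      using sum_squares_bound[of "\<bar>f x\<bar>" "\<bar>g x\<bar>"] by simp
    then show "norm (f x * g x) \<le> norm ((f x)\<^sup>2 + (g x)\<^sup>2)"
      by (simp add: abs_mult) (smt (verit) mult_nonneg_nonneg abs_ge_zero)
  qed
qed

lemma L2_add [intro]:
  assumes "f \<in> L2 M" "g \<in> L2 M"
  shows "(\<lambda>x. f x + g x) \<in> L2 M"
proof -
  have "integrable M (\<lambda>x. (f x)\<^sup>2 + 2 * (f x * g x) + (g x)\<^sup>2)"
    using assms L2_mult_integrable[OF assms] by (auto simp: L2_def)
  moreover have "(\<lambda>x. (f x)\<^sup>2 + 2 * (f x * g x) + (g x)\<^sup>2) = (\<lambda>x. (f x + g x)\<^sup>2)"
    by (simp add: power2_sum algebra_simps)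
  ultimately show ?thesis using assms by (auto simp: L2_def)
qed

lemma L2_cmult [intro]: "f \<in> L2 M \<Longrightarrow> (\<lambda>x. c * f x) \<in> L2 M"
  by (auto simp: L2_def power_mult_distrib)

lemma L2_zero [intro, simp]: "(\<lambda>x. 0) \<in> L2 M"
  by (auto simp: L2_def)

lemma L2_uminus [intro]: "f \<in> L2 M \<Longrightarrow> (\<lambda>x. - f x) \<in> L2 M"
  using L2_cmult[of f M "-1"] by simp

lemma L2_diff [intro]: "f \<in> L2 M \<Longrightarrow> g \<in> L2 M \<Longrightarrow> (\<lambda>x. f x - g x) \<in> L2 M"
  using L2_add[of f M "\<lambda>x. - g x"] by auto

lemma L2_sum [intro]: "(\<And>i. i \<in> I \<Longrightarrow> f i \<in> L2 M) \<Longrightarrow> (\<lambda>x. \<Sum>i\<in>I. f i x) \<in> L2 M"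
  by (induction I rule: infinite_finite_induct) auto

lemma L2_bounded_by:
  assumes "g \<in> L2 M" "f \<in> borel_measurable M" "AE x in M. \<bar>f x\<bar> \<le> \<bar>g x\<bar>"
  shows "f \<in> L2 M"
proof -
  have "integrable M (\<lambda>x. (f x)\<^sup>2)"
    by (rule Bochner_Integration.integrable_bound[where f = "\<lambda>x. (g x)\<^sup>2"])
      (use assms in \<open>auto simp: L2_def abs_le_square_iff\<close>)
  then show ?thesis using assms by (simp add: L2_def)
qed

lemma L2_AE_cong:
  "f \<in> L2 M \<Longrightarrow> g \<in> borel_measurable M \<Longrightarrow> AE x in M. f x = g x \<Longrightarrow> g \<in> L2 M"
  by (rule L2_bounded_by[of f M g]) auto

lemma L2_abs [intro]: "f \<in> L2 M \<Longrightarrow> (\<lambda>x. \<bar>f x\<bar>) \<in> L2 M"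
  by (rule L2_bounded_by[of f M]) (auto simp: L2_def)

lemma L2_indicator_mult [intro]:
  "S \<in> sets M \<Longrightarrow> f \<in> L2 M \<Longrightarrow> (\<lambda>x. indicator S x * f x) \<in> L2 M"
  by (rule L2_bounded_by[of f M]) (auto simp: L2_def indicator_def)

text \<open>A partial equivalence: a function outside L2 is related to nothing, so every class of
  the quotient is square-integrable. The measure is Lebesgue measure on the whole space; functions
  on an interval, a domain or a cylinder enter later as extensions by zero.\<close>

definition l2_eq :: "('a::euclidean_space \<Rightarrow> real) \<Rightarrow> ('a \<Rightarrow> real) \<Rightarrow> bool" where
  "l2_eq f g \<longleftrightarrow> f \<in> L2 lborel \<and> g \<in> L2 lborel \<and> (AE x in lborel. f x = g x)"

quotient_type (overloaded) 'a l2 = "'a::euclidean_space \<Rightarrow> real" / partial: l2_eq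
proof (rule part_equivpI)
  show "\<exists>x. l2_eq x x" by (rule exI[of _ "\<lambda>x. 0"]) (auto simp: l2_eq_def)
  show "symp l2_eq" by (auto simp: symp_def l2_eq_def)
  show "transp l2_eq" by (auto simp: transp_def l2_eq_def)
qed

instantiation l2 :: (euclidean_space) real_inner
begin

lift_definition zero_l2 :: "'a l2" is "\<lambda>x. 0"
  by (auto simp: l2_eq_def)

lift_definition plus_l2 :: "'a l2 \<Rightarrow> 'a l2 \<Rightarrow> 'a l2" is "\<lambda>f g x. f x + g x"
  by (auto simp: l2_eq_def elim!: AE_mp)

lift_definition uminus_l2 :: "'a l2 \<Rightarrow> 'a l2" is "\<lambda>f x. - f x"
  by (auto simp: l2_eq_def elim!: AE_mp)

lift_definition minus_l2 :: "'a l2 \<Rightarrow> 'a l2 \<Rightarrow> 'a l2" is "\<lambda>f g x. f x - g x"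
  by (auto simp: l2_eq_def elim!: AE_mp)

lift_definition scaleR_l2 :: "real \<Rightarrow> 'a l2 \<Rightarrow> 'a l2" is "\<lambda>c f x. c * f x"
  by (auto simp: l2_eq_def elim!: AE_mp)

lift_definition inner_l2 :: "'a l2 \<Rightarrow> 'a l2 \<Rightarrow> real" is "ip lborel"
proof -
  fix f f' g g' :: "'a \<Rightarrow> real" assume "l2_eq f f'" "l2_eq g g'"
  then show "ip lborel f g = ip lborel f' g'"
    unfolding ip_def by (intro integral_cong_AE) (auto simp: l2_eq_def L2_def elim!: AE_mp)
qed

definition norm_l2 :: "'a l2 \<Rightarrow> real" where "norm_l2 x = sqrt (inner x x)"

definition sgn_l2 :: "'a l2 \<Rightarrow> 'a l2" where "sgn_l2 x = scaleR (inverse (norm x)) x"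

definition dist_l2 :: "'a l2 \<Rightarrow> 'a l2 \<Rightarrow> real" where "dist_l2 x y = norm (x - y)"

definition uniformity_l2 :: "('a l2 \<times> 'a l2) filter" where
  "uniformity_l2 = (INF e\<in>{0<..}. principal {(x, y). dist x y < e})"

definition open_l2 :: "'a l2 set \<Rightarrow> bool" where
  "open_l2 U = (\<forall>x\<in>U. \<forall>\<^sub>F (x', y) in uniformity. x' = x \<longrightarrow> y \<in> U)"

instance
proof
  fix x y z :: "'a l2" and a b :: real
  show "x + y + z = x + (y + z)"
    by transfer (auto simp: l2_eq_def add.assoc)
  show "x + y = y + x"
    by transfer (auto simp: l2_eq_def add.commute)
  show "0 + x = x"
    by transfer (auto simp: l2_eq_def)
  show "- x + x = 0"
    by transfer (auto simp: l2_eq_def)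
  show "x - y = x + - y"
    by transfer (auto simp: l2_eq_def)
  show "a *\<^sub>R (x + y) = a *\<^sub>R x + a *\<^sub>R y"
    by transfer (auto simp: l2_eq_def algebra_simps intro: L2_add L2_cmult)
  show "(a + b) *\<^sub>R x = a *\<^sub>R x + b *\<^sub>R x"
    by transfer (auto simp: l2_eq_def distrib_right intro: L2_add L2_cmult)
  show "a *\<^sub>R b *\<^sub>R x = (a * b) *\<^sub>R x"
    by transfer (auto simp: l2_eq_def mult.assoc intro: L2_cmult)
  show "1 *\<^sub>R x = x"
    by transfer (auto simp: l2_eq_def)
  show "inner x y = inner y x"
    by transfer (auto simp: ip_def mult.commute)
  show "inner (x + y) z = inner x z + inner y z"
    by transfer (auto simp: l2_eq_def ip_def distrib_right L2_mult_integrable)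
  show "inner (a *\<^sub>R x) y = a * inner x y"
    by transfer (auto simp: l2_eq_def ip_def mult.assoc)
  show "0 \<le> inner x x"
    by transfer (auto simp: ip_def)
  show "inner x x = 0 \<longleftrightarrow> x = 0"
  proof (transfer)
    fix f :: "'a \<Rightarrow> real" assume f: "l2_eq f f"
    then have "integrable lborel (\<lambda>x. f x * f x)" using L2_mult_integrable[of f lborel f]
      by (auto simp: l2_eq_def)
    from integral_nonneg_eq_0_iff_AE[OF this] show "(ip lborel f f = 0) = l2_eq f (\<lambda>x. 0)"
      using f by (auto simp: l2_eq_def ip_def)
  qed
qed (simp_all add: norm_l2_def sgn_l2_def dist_l2_def uniformity_l2_def open_l2_def)

end

definition mk :: "('a::euclidean_space \<Rightarrow> real) \<Rightarrow> 'a l2" where "mk f = abs_l2 f"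

lemma mk_surj: obtains f where "f \<in> L2 lborel" "x = mk f"
proof -
  have "l2_eq (rep_l2 x) (rep_l2 x)" using Quotient_rep_reflp[OF Quotient_l2] .
  then show ?thesis
    using that[of "rep_l2 x"] Quotient_abs_rep[OF Quotient_l2, of x]
    by (auto simp: mk_def l2_eq_def)
qed

lemma mk_eq_iff: "f \<in> L2 lborel \<Longrightarrow> g \<in> L2 lborel \<Longrightarrow> mk f = mk g \<longleftrightarrow> (AE x in lborel. f x = g x)"
  unfolding mk_def using Quotient_rel[OF Quotient_l2, of f g] by (simp add: l2_eq_def)

lemma mk_cong: "f \<in> L2 lborel \<Longrightarrow> g \<in> L2 lborel \<Longrightarrow> AE x in lborel. f x = g x \<Longrightarrow> mk f = mk g"
  by (simp add: mk_eq_iff)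

lemma mk_add: "f \<in> L2 lborel \<Longrightarrow> g \<in> L2 lborel \<Longrightarrow> mk (\<lambda>x. f x + g x) = mk f + mk g"
  unfolding mk_def by (rule plus_l2.abs_eq[symmetric]) (auto simp: l2_eq_def)

lemma mk_diff: "f \<in> L2 lborel \<Longrightarrow> g \<in> L2 lborel \<Longrightarrow> mk (\<lambda>x. f x - g x) = mk f - mk g"
  unfolding mk_def by (rule minus_l2.abs_eq[symmetric]) (auto simp: l2_eq_def)

lemma mk_scale: "f \<in> L2 lborel \<Longrightarrow> mk (\<lambda>x. c * f x) = c *\<^sub>R mk f"
  unfolding mk_def by (rule scaleR_l2.abs_eq[symmetric]) (auto simp: l2_eq_def)

lemma mk_zero: "mk (\<lambda>x. 0) = 0"
  unfolding mk_def by (simp add: zero_l2_def)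

lemma inner_mk: "f \<in> L2 lborel \<Longrightarrow> g \<in> L2 lborel \<Longrightarrow> inner (mk f) (mk g) = ip lborel f g"
  unfolding mk_def by (rule inner_l2.abs_eq) (auto simp: l2_eq_def)

lemma nn_integral_sq_mk: "f \<in> L2 lborel \<Longrightarrow> (\<integral>\<^sup>+x. ennreal ((f x)\<^sup>2) \<partial>lborel) = ennreal ((norm (mk f))\<^sup>2)"
  by (subst nn_integral_eq_integral)
     (auto simp: L2_def norm_eq_sqrt_inner inner_mk ip_def power2_eq_square)

lemma norm_mk_mono:
  assumes "f \<in> L2 lborel" "g \<in> L2 lborel" "AE x in lborel. \<bar>f x\<bar> \<le> \<bar>g x\<bar>"
  shows "norm (mk f) \<le> norm (mk g)"
proof -
  have "(\<integral>\<^sup>+x. ennreal ((f x)\<^sup>2) \<partial>lborel) \<le> (\<integral>\<^sup>+x. ennreal ((g x)\<^sup>2) \<partial>lborel)"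
    by (rule nn_integral_mono_AE) (use assms(3) in \<open>auto simp: abs_le_square_iff elim!: AE_mp intro!: ennreal_leI\<close>)
  then show ?thesis using assms by (simp add: nn_integral_sq_mk)
qed

text \<open>The increments have summable norms, so by monotone convergence the series of their
  absolute values is finite almost everywhere and the sequence converges pointwise. Fatou's lemma
  then turns the pointwise limit into a limit in norm.\<close>

lemma l2_fast_Cauchy_converges:
  fixes f :: "nat \<Rightarrow> 'a::euclidean_space \<Rightarrow> real"
  assumes f: "\<And>n. f n \<in> L2 lborel"
    and fast: "\<And>n. norm (mk (f (Suc n)) - mk (f n)) \<le> (1/2)^n"
  shows "\<exists>g\<in>L2 lborel. (\<lambda>n. mk (f n)) \<longlonglongrightarrow> mk g"
proof -
  define d where "d n x = \<bar>f (Suc n) x - f n x\<bar>" for n x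
  have dL: "d n \<in> L2 lborel" for n unfolding d_def by (intro L2_abs L2_diff f)
  have nd: "norm (mk (d n)) \<le> (1/2)^n" for n
    using fast[of n] f dL[of n] norm_mk_mono[of "d n" "\<lambda>x. f (Suc n) x - f n x"] L2_diff[of "f (Suc n)" _ "f n"]
    by (simp add: mk_diff d_def)
  have [measurable]: "f n \<in> borel_measurable lborel" "d n \<in> borel_measurable lborel" for n
    using f dL by (auto simp: L2_def)
  define s where "s N x = (\<Sum>n<N. d n x)" for N x
  have sL: "s N \<in> L2 lborel" for N unfolding s_def using dL by auto
  have "norm (mk (s N)) \<le> (\<Sum>n<N. (1/2)^n)" for N
  proof (induction N)
    case 0 then show ?case by (simp add: s_def mk_zero)
  next
    case (Suc N)
    have "mk (s (Suc N)) = mk (s N) + mk (d N)"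
      using mk_add[OF sL dL, of N N] by (simp add: s_def[abs_def])
    then show ?case using norm_triangle_ineq[of "mk (s N)" "mk (d N)"] Suc nd[of N] by simp
  qed
  also have "(\<Sum>n<N. (1/2::real)^n) \<le> 2" for N by (simp add: geometric_sum)
  finally have sn: "norm (mk (s N)) \<le> 2" for N .
  have s_mono: "s N x \<le> s (Suc N) x" "0 \<le> s N x" for N x
    by (auto simp: s_def d_def intro: sum_nonneg)
  have "(\<integral>\<^sup>+x. (SUP N. ennreal ((s N x)\<^sup>2)) \<partial>lborel) = (SUP N. \<integral>\<^sup>+x. ennreal ((s N x)\<^sup>2) \<partial>lborel)"
  proof (rule nn_integral_monotone_convergence_SUP)
    show "incseq (\<lambda>N x. ennreal ((s N x)\<^sup>2))"
      by (auto intro!: incseq_SucI le_funI ennreal_leI power_mono s_mono)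
  qed (use L2_measurable[OF sL] in measurable)
  also have "\<dots> \<le> ennreal 4"
  proof (rule SUP_least)
    fix N
    have "(norm (mk (s N)))\<^sup>2 \<le> 2\<^sup>2" by (intro power_mono sn) auto
    then have "ennreal ((norm (mk (s N)))\<^sup>2) \<le> ennreal 4" by (intro ennreal_leI) simp
    then show "(\<integral>\<^sup>+x. ennreal ((s N x)\<^sup>2) \<partial>lborel) \<le> ennreal 4"
      by (simp only: nn_integral_sq_mk[OF sL])
  qed
  finally have fin: "(\<integral>\<^sup>+x. (SUP N. ennreal ((s N x)\<^sup>2)) \<partial>lborel) \<noteq> \<infinity>" by (auto simp: top_unique)
  have sm: "s N \<in> borel_measurable lborel" for N using sL by (auto simp: L2_def)
  have "AE x in lborel. (SUP N. ennreal ((s N x)\<^sup>2)) \<noteq> \<infinity>"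
    by (rule nn_integral_PInf_AE[OF _ fin]) (use sm in measurable)
  then have conv: "AE x in lborel. convergent (\<lambda>n. f n x)"
  proof (rule AE_mp, intro AE_I2 impI)
    fix x assume fi: "(SUP N. ennreal ((s N x)\<^sup>2)) \<noteq> \<infinity>"
    then obtain B where B: "(SUP N. ennreal ((s N x)\<^sup>2)) = ennreal B" "B \<ge> 0"
      by (cases "SUP N. ennreal ((s N x)\<^sup>2)") auto
    have "(s N x)\<^sup>2 \<le> B" for N
      using SUP_upper[of N UNIV "\<lambda>N. ennreal ((s N x)\<^sup>2)"] B by simp
    then have "s N x \<le> sqrt B" for N by (simp add: real_le_rsqrt)
    then have "summable (\<lambda>n. d n x)"
      by (intro bounded_imp_summable[of _ "sqrt B"])
         (simp_all only: s_def lessThan_Suc_atMost[symmetric], simp add: d_def)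
    then have "summable (\<lambda>n. f (Suc n) x - f n x)"
      using summable_rabs_cancel[of "\<lambda>n. f (Suc n) x - f n x"] by (simp add: d_def)
    then have "convergent (\<lambda>n. \<Sum>i<n. f (Suc i) x - f i x)"
      by (simp add: summable_iff_convergent)
    moreover have "(\<lambda>n. \<Sum>i<n. f (Suc i) x - f i x) = (\<lambda>n. f n x - f 0 x)"
      using sum_lessThan_telescope[of "\<lambda>n. f n x"] by auto
    ultimately have "convergent (\<lambda>n. f n x - f 0 x)" by simp
    from convergent_add[OF this convergent_const[of "f 0 x"]] show "convergent (\<lambda>n. f n x)" by simp
  qed
  define g where "g x = lim (\<lambda>n. f n x)" for x
  have lim: "AE x in lborel. (\<lambda>n. f n x) \<longlonglongrightarrow> g x"
    using conv by (auto simp: g_def convergent_LIMSEQ_iff elim!: AE_mp)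
  have gm: "g \<in> borel_measurable lborel"
    unfolding g_def[abs_def] by (rule borel_measurable_lim_metric) measurable
  have tail: "norm (mk (f (m + k)) - mk (f m)) \<le> 2 * (1/2)^m" for m k
  proof -
    have "norm (mk (f (m + k)) - mk (f m)) \<le> (\<Sum>i<k. (1/2)^(m+i))"
    proof (induction k)
      case (Suc k)
      have "norm (mk (f (m + Suc k)) - mk (f m)) \<le> norm (mk (f (Suc (m + k))) - mk (f (m+k))) + norm (mk (f (m + k)) - mk (f m))"
        using norm_triangle_ineq[of "mk (f (Suc (m + k))) - mk (f (m+k))" "mk (f (m + k)) - mk (f m)"] by simp
      with Suc fast[of "m+k"] show ?case by simp
    qed simp
    also have "\<dots> = (1/2)^m * (\<Sum>i<k. (1/2)^i)" by (simp add: sum_distrib_left power_add)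
    also have "\<dots> \<le> (1/2)^m * 2" by (intro mult_left_mono) (auto simp: geometric_sum)
    finally show ?thesis by simp
  qed
  \<comment> \<open>Fatou's lemma in n for fixed m; the bound from \<open>tail\<close> does not
    depend on n.\<close>
  have fatou: "(\<integral>\<^sup>+x. ennreal ((g x - f m x)\<^sup>2) \<partial>lborel) \<le> ennreal ((2 * (1/2)^m)\<^sup>2)" for m
  proof -
    have "(\<integral>\<^sup>+x. ennreal ((g x - f m x)\<^sup>2) \<partial>lborel) = (\<integral>\<^sup>+x. liminf (\<lambda>n. ennreal ((f (m + n) x - f m x)\<^sup>2)) \<partial>lborel)"
    proof (rule nn_integral_cong_AE, rule AE_mp[OF lim], intro AE_I2 impI)
      fix x assume "(\<lambda>n. f n x) \<longlonglongrightarrow> g x"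
      then have "(\<lambda>n. f (m + n) x) \<longlonglongrightarrow> g x"
        using LIMSEQ_ignore_initial_segment[of "\<lambda>n. f n x" "g x" m] by (simp add: add.commute)
      then have "(\<lambda>n. ennreal ((f (m + n) x - f m x)\<^sup>2)) \<longlonglongrightarrow> ennreal ((g x - f m x)\<^sup>2)"
        by (intro tendsto_intros)
      then show "ennreal ((g x - f m x)\<^sup>2) = liminf (\<lambda>n. ennreal ((f (m + n) x - f m x)\<^sup>2))"
        by (intro lim_imp_Liminf[symmetric]) simp_all
    qed
    also have "\<dots> \<le> liminf (\<lambda>n. \<integral>\<^sup>+x. ennreal ((f (m + n) x - f m x)\<^sup>2) \<partial>lborel)"
      by (rule nn_integral_liminf) measurable
    also have "\<dots> \<le> limsup (\<lambda>n. \<integral>\<^sup>+x. ennreal ((f (m + n) x - f m x)\<^sup>2) \<partial>lborel)"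
      by (rule Liminf_le_Limsup) simp
    also have "\<dots> \<le> ennreal ((2 * (1/2)^m)\<^sup>2)"
    proof (rule Limsup_bounded, rule always_eventually, rule allI)
      fix n show "(\<integral>\<^sup>+x. ennreal ((f (m + n) x - f m x)\<^sup>2) \<partial>lborel) \<le> ennreal ((2 * (1/2)^m)\<^sup>2)"
        using power_mono[OF tail[of m n] norm_ge_zero, of 2] f nn_integral_sq_mk[OF L2_diff[OF f[of "m+n"] f[of m]]]
        by (simp add: mk_diff ennreal_leI)
    qed
    finally show ?thesis .
  qed
  have "(\<lambda>x. g x - f 0 x) \<in> L2 lborel"
    unfolding L2_iff_nn infinity_ennreal_def using le_less_trans[OF fatou[of 0] ennreal_less_top] gm by simp
  from L2_add[OF this f[of 0]] have gL: "g \<in> L2 lborel" by simp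
  have "norm (mk (f m) - mk g) \<le> 2 * (1/2)^m" for m
  proof -
    have "ennreal ((norm (mk g - mk (f m)))\<^sup>2) \<le> ennreal ((2 * (1/2)^m)\<^sup>2)"
      using fatou[of m] nn_integral_sq_mk[OF L2_diff[OF gL f[of m]]] gL f by (simp add: mk_diff)
    then have "(norm (mk g - mk (f m)))\<^sup>2 \<le> (2 * (1/2)^m)\<^sup>2"
      by (subst (asm) ennreal_le_iff) (simp_all only: zero_le_power2)
    then have "norm (mk g - mk (f m)) \<le> 2 * (1/2)^m"
      by (rule power2_le_imp_le) simp
    then show ?thesis by (simp add: norm_minus_commute)
  qed
  moreover have "(\<lambda>m. 2 * (1/2::real)^m) \<longlonglongrightarrow> 0"
    by (intro tendsto_mult_right_zero LIMSEQ_realpow_zero) auto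
  ultimately have "(\<lambda>n. mk (f n)) \<longlonglongrightarrow> mk g"
    by (subst LIM_zero_iff[symmetric]) (rule Lim_null_comparison[of _ "\<lambda>m. 2 * (1/2::real)^m"], auto)
  then show ?thesis using gL by blast
qed

instance l2 :: (euclidean_space) complete_space
proof
  fix X :: "nat \<Rightarrow> 'a l2" assume X: "Cauchy X"
  have "\<exists>N. \<forall>m\<ge>N. \<forall>n\<ge>N. dist (X m) (X n) < (1/2)^k" for k
    using X by (auto simp: Cauchy_def)
  then obtain N where N: "\<And>k m n. m \<ge> N k \<Longrightarrow> n \<ge> N k \<Longrightarrow> dist (X m) (X n) < (1/2)^k"
    by metis
  \<comment> \<open>The summand k makes M strictly increasing, and the sum lets it dominate
    N.\<close>
  define M where "M k = k + (\<Sum>j\<le>k. N j)" for k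
  have MN: "M k \<ge> N k" for k unfolding M_def
    using member_le_sum[of k "{..k}" N] by simp
  have Mmono: "strict_mono M" by (rule strict_mono_Suc_iff[THEN iffD2]) (auto simp: M_def)
  have "\<forall>k. \<exists>f. f \<in> L2 lborel \<and> X (M k) = mk f" by (metis mk_surj)
  then obtain f where f: "\<And>k. f k \<in> L2 lborel" "\<And>k. X (M k) = mk (f k)" by metis
  have "norm (mk (f (Suc k)) - mk (f k)) \<le> (1/2)^k" for k
  proof -
    have "M k \<le> M (Suc k)" using Mmono by (simp add: strict_mono_less_eq)
    then have "N k \<le> M (Suc k)" using MN[of k] by linarith
    then show ?thesis using N[of k "M (Suc k)" "M k"] MN[of k] by (simp add: f(2)[symmetric] dist_norm)
  qed
  then obtain g where "(\<lambda>n. mk (f n)) \<longlonglongrightarrow> mk g"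
    using l2_fast_Cauchy_converges[of f] f by blast
  then have "(X \<circ> M) \<longlonglongrightarrow> mk g" by (simp add: f(2) comp_def)
  then have "X \<longlonglongrightarrow> mk g"
    using Cauchy_converges_subseq[OF X Mmono] by simp
  then show "convergent X" by (auto simp: convergent_def)
qed

text \<open>The Riesz representation is stated for a functional given through a parametrisation
  \<^term>\<open>B\<close> of its domain, so that it need not be well-defined a priori.\<close>

lemma riesz_parametrised:
  fixes B :: "'b \<Rightarrow> 'h::{real_inner,complete_space}" and L :: "'b \<Rightarrow> real"
  assumes ne: "A \<noteq> {}"
    and add: "\<And>v w. v \<in> A \<Longrightarrow> w \<in> A \<Longrightarrow> \<exists>z\<in>A. B z = B v + B w \<and> L z = L v + L w"
    and scale: "\<And>c v. v \<in> A \<Longrightarrow> \<exists>z\<in>A. B z = c *\<^sub>R B v \<and> L z = c * L v"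
    and bound: "\<And>v. v \<in> A \<Longrightarrow> \<bar>L v\<bar> \<le> C * norm (B v)"
    and C: "C \<ge> 0"
  shows "\<exists>u. norm u \<le> C \<and> (\<forall>v\<in>A. inner u (B v) = L v)"
proof -
  \<comment> \<open>The Dirichlet principle: along a minimising sequence of J the values B v
    converge to the representing vector.\<close>
  define J where "J v = (norm (B v))\<^sup>2 - 2 * L v" for v
  have J_lower: "J v \<ge> - C\<^sup>2" if "v \<in> A" for v
  proof -
    have "2 * L v \<le> 2 * (C * norm (B v))" using bound[OF that] by simp
    also have "\<dots> \<le> C\<^sup>2 + (norm (B v))\<^sup>2" using sum_squares_bound[of C "norm (B v)"] by simp
    finally show ?thesis by (simp add: J_def)
  qed
  define m where "m = Inf (J ` A)"
  have bdd: "bdd_below (J ` A)" using J_lower by (auto simp: bdd_below_def intro!: exI[of _ "- C\<^sup>2"])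
  have mle: "m \<le> J v" if "v \<in> A" for v unfolding m_def by (rule cINF_lower[OF bdd that])
  have "\<exists>v\<in>A. J v < m + inverse (Suc n)" for n
    using cINF_less_iff[OF ne bdd, of "m + inverse (Suc n)"] by (simp add: m_def)
  then obtain v where v: "\<And>n. v n \<in> A" "\<And>n. J (v n) < m + inverse (real (Suc n))" by metis
  \<comment> \<open>Parallelogram identity for the midpoint w, whose energy is at least m. It makes
    the minimising sequence Cauchy.\<close>
  have par: "(norm (B x - B y))\<^sup>2 \<le> 2 * (J x - m) + 2 * (J y - m)" if xy: "x \<in> A" "y \<in> A" for x y
  proof -
    obtain z where z: "z \<in> A" "B z = B x + B y" "L z = L x + L y" using add[OF xy] by blast
    obtain w where w: "w \<in> A" "B w = (1/2) *\<^sub>R B z" "L w = (1/2) * L z" using scale[OF z(1)] by blast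
    have "m \<le> J w" using mle w by blast
    moreover have "(norm (B w))\<^sup>2 = (norm (B x + B y))\<^sup>2 / 4" by (simp add: w z power_divide)
    moreover have "(norm (B x + B y))\<^sup>2 + (norm (B x - B y))\<^sup>2 = 2 * (norm (B x))\<^sup>2 + 2 * (norm (B y))\<^sup>2"
      by (simp add: power2_norm_eq_inner inner_add inner_diff)
    moreover have "J w = (norm (B w))\<^sup>2 - (L x + L y)" by (simp add: J_def w(3) z(3) field_simps)
    ultimately show ?thesis unfolding J_def by argo
  qed
  have dv: "dist (B (v i)) (B (v j)) \<le> sqrt (4 * inverse (real (Suc (min i j))))" for i j
  proof -
    have "J (v i) - m \<le> inverse (real (Suc (min i j)))" for i j
    proof -
      have "inverse (real (Suc i)) \<le> inverse (real (Suc (min i j)))" by (intro le_imp_inverse_le) auto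
      then show ?thesis using v(2)[of i] by linarith
    qed
    from this[of i j] this[of j i] have "(norm (B (v i) - B (v j)))\<^sup>2 \<le> 4 * inverse (real (Suc (min i j)))"
      using par[OF v(1) v(1), of i j] by (simp add: min.commute)
    then show ?thesis by (simp add: dist_norm real_le_rsqrt)
  qed
  have "Cauchy (\<lambda>n. B (v n))"
  proof (rule metric_CauchyI)
    fix e :: real assume e: "e > 0"
    have "(\<lambda>n. sqrt (4 * inverse (real (Suc n)))) \<longlonglongrightarrow> sqrt (4 * 0)"
      by (intro tendsto_intros LIMSEQ_inverse_real_of_nat)
    then have "(\<lambda>n. sqrt (4 * inverse (real (Suc n)))) \<longlonglongrightarrow> 0" by simp
    from order_tendstoD(2)[OF this e] obtain M where M: "\<And>n. n \<ge> M \<Longrightarrow> sqrt (4 * inverse (real (Suc n))) < e"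
      by (auto simp: eventually_sequentially)
    show "\<exists>M. \<forall>i\<ge>M. \<forall>n\<ge>M. dist (B (v i)) (B (v n)) < e"
      using le_less_trans[OF dv M] by (intro exI[of _ M]) auto
  qed
  then obtain u where u: "(\<lambda>n. B (v n)) \<longlonglongrightarrow> u" by (auto simp: Cauchy_convergent_iff convergent_def)
  have lim0: "(\<lambda>n. inverse (real (Suc n))) \<longlonglongrightarrow> 0" by (rule LIMSEQ_inverse_real_of_nat)
  have eq: "inner u (B w) = L w" if w: "w \<in> A" for w
  proof -
    \<comment> \<open>First variation: moving v n by t times w cannot lower J below its infimum, and
      the error 1 / (n + 1) vanishes in the limit.\<close>
    have quad: "0 \<le> t\<^sup>2 * (norm (B w))\<^sup>2 + 2 * t * (inner u (B w) - L w)" for t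
    proof -
      have "- inverse (real (Suc n)) \<le> t\<^sup>2 * (norm (B w))\<^sup>2 + 2 * t * (inner (B (v n)) (B w) - L w)" for n
      proof -
        obtain y where y: "y \<in> A" "B y = t *\<^sub>R B w" "L y = t * L w" using scale[OF w] by blast
        obtain z where z: "z \<in> A" "B z = B (v n) + B y" "L z = L (v n) + L y" using add[OF v(1) y(1)] by blast
        have "m \<le> J z" using mle z by blast
        moreover have "(norm (B (v n) + t *\<^sub>R B w))\<^sup>2 = (norm (B (v n)))\<^sup>2 + t\<^sup>2 * (norm (B w))\<^sup>2 + 2 * t * inner (B (v n)) (B w)"
          unfolding power2_norm_eq_inner by (simp add: inner_add inner_commute algebra_simps power2_eq_square)
        then have "J z = J (v n) + (t\<^sup>2 * (norm (B w))\<^sup>2 + 2 * t * (inner (B (v n)) (B w) - L w))"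
          by (simp add: J_def z y algebra_simps)
        ultimately show ?thesis using v(2)[of n] by linarith
      qed
      moreover have "(\<lambda>n. t\<^sup>2 * (norm (B w))\<^sup>2 + 2 * t * (inner (B (v n)) (B w) - L w)) \<longlonglongrightarrow>
         t\<^sup>2 * (norm (B w))\<^sup>2 + 2 * t * (inner u (B w) - L w)"
        by (intro tendsto_intros u)
      moreover have "(\<lambda>n. - inverse (real (Suc n))) \<longlonglongrightarrow> - 0" by (intro tendsto_minus lim0)
      ultimately show ?thesis using LIMSEQ_le[of "\<lambda>n. - inverse (real (Suc n))" "- 0"] by auto
    qed
    define b where "b = inner u (B w) - L w"
    define a where "a = (norm (B w))\<^sup>2"
    \<comment> \<open>The minimiser of the quadratic in t would be - b / a. The denominator a + 1
      stays positive when B w = 0 and still forces b = 0.\<close>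
    define e where "e = a + 1"
    have e: "e > 0" unfolding e_def a_def by (smt (verit) zero_le_power2)
    have "0 \<le> (- b / e)\<^sup>2 * (e - 1) + 2 * (- b / e) * b" using quad[of "- b / e"] by (simp add: a_def b_def e_def)
    also have "\<dots> = - (b\<^sup>2 * (e + 1) / e\<^sup>2)"
      using e by (simp add: field_simps power2_eq_square)
    finally have "b\<^sup>2 * (a + 2) / (a + 1)\<^sup>2 \<le> 0" by (simp add: e_def add.commute)
    moreover have "a \<ge> 0" by (simp add: a_def)
    moreover have "0 < b\<^sup>2 * (a + 2) / (a + 1)\<^sup>2" if "b \<noteq> 0"
      using that \<open>a \<ge> 0\<close> by (intro divide_pos_pos mult_pos_pos) auto
    ultimately have "b = 0" by fastforce
    then show ?thesis by (simp add: b_def)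
  qed
  have "(norm u)\<^sup>2 \<le> C * norm u"
  proof (rule LIMSEQ_le)
    show "(\<lambda>n. inner u (B (v n))) \<longlonglongrightarrow> (norm u)\<^sup>2"
      unfolding power2_norm_eq_inner by (intro tendsto_intros u)
    show "(\<lambda>n. C * norm (B (v n))) \<longlonglongrightarrow> C * norm u" by (intro tendsto_intros u)
    show "\<exists>N. \<forall>n\<ge>N. inner u (B (v n)) \<le> C * norm (B (v n))"
      using eq[OF v(1)] bound[OF v(1)] by (metis abs_le_D1)
  qed
  then have "norm u \<le> C" using C
    by (cases "norm u = 0") (auto simp: power2_eq_square)
  then show ?thesis using eq by blast
qed

section \<open>Resolvents of accretive operators\<close>

text \<open>The model is R r = (1 + r A)^-1 with A accretive. Then x - R r x = r A (R r x), so
  \<open>accretive\<close> says that (y, A y) is nonnegative for y = R r x, and \<open>resid\<close>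
  is the resolvent identity. The unbounded A itself never appears.\<close>

locale resolvent =
  fixes R :: "real \<Rightarrow> 'h::real_inner \<Rightarrow> 'h"
  assumes lin: "r > 0 \<Longrightarrow> linear (R r)"
    and accretive: "r > 0 \<Longrightarrow> 0 \<le> inner (R r x) (x - R r x)"
    and resid: "r > 0 \<Longrightarrow> s > 0 \<Longrightarrow> R r x - R s x = (s / r - 1) *\<^sub>R R s (x - R r x)"
begin

text \<open>In the model this is r A (1 + r A)^-2, that is, - r times the derivative of R r in r. It
  is the quantity whose square is integrable against dr / r.\<close>

definition Q :: "real \<Rightarrow> 'h \<Rightarrow> 'h" where "Q r x = R r (x - R r x)"

lemma R_diff: "r > 0 \<Longrightarrow> R r (x - y) = R r x - R r y"
  by (rule linear_diff[OF lin])

lemma norm_split: "(norm x)\<^sup>2 = (norm (R r x))\<^sup>2 + 2 * inner (R r x) (x - R r x) + (norm (x - R r x))\<^sup>2"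
  unfolding power2_norm_eq_inner by (simp add: inner_diff inner_commute)

lemma norm_R_le: "r > 0 \<Longrightarrow> norm (R r x) \<le> norm x"
  using norm_split[of x r] accretive[of r x] zero_le_power2[of "norm (x - R r x)"]
  by (intro power2_le_imp_le[of "norm (R r x)"]) (simp, simp)

lemma norm_compl_le: "r > 0 \<Longrightarrow> norm (x - R r x) \<le> norm x"
  using norm_split[of x r] accretive[of r x] zero_le_power2[of "norm (R r x)"]
  by (intro power2_le_imp_le[of "norm (x - R r x)"]) (simp, simp)

lemma inner_R_ge: "r > 0 \<Longrightarrow> (norm (R r x))\<^sup>2 \<le> inner (R r x) x"
  using accretive[of r x] by (simp add: inner_diff power2_norm_eq_inner)

lemma inner_compl_ge: "r > 0 \<Longrightarrow> (norm (x - R r x))\<^sup>2 \<le> inner (x - R r x) x"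
  using accretive[of r x] by (simp add: inner_diff power2_norm_eq_inner inner_commute)

text \<open>Exchanging the roles of r and s in (1 - R s) R r gains the factor s / r; this is the
  decay behind the Schur kernel.\<close>

lemma compl_R: "r > 0 \<Longrightarrow> s > 0 \<Longrightarrow> R r x - R s (R r x) = (s / r) *\<^sub>R R s (x - R r x)"
  using resid[of r s x] by (simp add: R_diff algebra_simps)

lemma R_R_scaled:
  assumes "r > 0" "s > 0"
  shows "(s - r) *\<^sub>R R s (R r x) = s *\<^sub>R R s x - r *\<^sub>R R r x"
proof -
  have "r *\<^sub>R (R r x - R s x) = (s - r) *\<^sub>R (R s x - R s (R r x))"
  proof -
    have "r * (s / r - 1) = s - r" using assms by (simp add: field_simps)
    then show ?thesis using resid[OF assms, of x] assms by (simp add: R_diff)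
  qed
  then show ?thesis by (simp add: algebra_simps)
qed

lemma R_commute:
  assumes "r > 0" "s > 0"
  shows "R s (R r x) = R r (R s x)"
proof (cases "r = s")
  case False
  have "(s - r) *\<^sub>R R s (R r x) = (s - r) *\<^sub>R R r (R s x)"
    using R_R_scaled[of r s x] R_R_scaled[of s r x] assms
    by (metis (no_types, lifting) minus_diff_eq scaleR_minus_left)
  then show ?thesis using False by simp
qed simp

lemma norm_R_diff_le: "r > 0 \<Longrightarrow> s > 0 \<Longrightarrow> norm (R r x - R s x) \<le> \<bar>s / r - 1\<bar> * norm x"
  unfolding resid by (simp, intro mult_left_mono order_trans[OF norm_R_le norm_compl_le]) auto

lemma eventually_pos: "s > 0 \<Longrightarrow> (\<And>r. r > 0 \<Longrightarrow> P r) \<Longrightarrow> eventually P (at (s::real))"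
  using eventually_at_in_open'[of "{0<..}" s] by (auto elim: eventually_mono)

lemma tendsto_R: "s > 0 \<Longrightarrow> ((\<lambda>r. R r x) \<longlongrightarrow> R s x) (at s)"
proof (subst LIM_zero_iff[symmetric], rule Lim_null_comparison)
  assume s: "s > 0"
  show "eventually (\<lambda>r. norm (R r x - R s x) \<le> \<bar>s / r - 1\<bar> * norm x) (at s)"
    by (rule eventually_pos[OF s]) (rule norm_R_diff_le[OF _ s])
  have "((\<lambda>r. \<bar>s / r - 1\<bar> * norm x) \<longlongrightarrow> \<bar>s / s - 1\<bar> * norm x) (at s)"
    using s by (intro tendsto_intros) auto
  then show "((\<lambda>r. \<bar>s / r - 1\<bar> * norm x) \<longlongrightarrow> 0) (at s)" using s by simp
qed

lemma continuous_on_R: "continuous_on {0<..} (\<lambda>r. R r x)"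
  unfolding continuous_on_def by (rule ballI, rule Lim_at_imp_Lim_at_within, rule tendsto_R) simp

lemma continuous_on_RR: "continuous_on {0<..} (\<lambda>r. R r (R r x))"
proof -
  have "((\<lambda>r. R r (R r x)) \<longlongrightarrow> R s (R s x)) (at s)" if s: "s > 0" for s
  proof -
    have "((\<lambda>r. R r (R r x - R s x)) \<longlongrightarrow> 0) (at s)"
    proof (rule Lim_null_comparison)
      show "eventually (\<lambda>r. norm (R r (R r x - R s x)) \<le> norm (R r x - R s x)) (at s)"
        by (rule eventually_pos[OF s]) (rule norm_R_le)
      show "((\<lambda>r. norm (R r x - R s x)) \<longlongrightarrow> 0) (at s)"
        using tendsto_R[OF s, of x] by (simp add: LIM_zero_iff tendsto_norm_zero_iff)
    qed
    from tendsto_add[OF this tendsto_R[OF s, of "R s x"]]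
    have "((\<lambda>r. R r (R r x - R s x) + R r (R s x)) \<longlongrightarrow> R s (R s x)) (at s)" by simp
    moreover have "eventually (\<lambda>r. R r (R r x - R s x) + R r (R s x) = R r (R r x)) (at s)"
      by (rule eventually_pos[OF s]) (simp add: R_diff)
    ultimately show ?thesis by (rule Lim_transform_eventually)
  qed
  then show ?thesis
    unfolding continuous_on_def by (intro ballI, rule Lim_at_imp_Lim_at_within) simp
qed

lemma continuous_on_Q: "continuous_on {0<..} (\<lambda>r. Q r x)"
proof -
  have "continuous_on {0<..} (\<lambda>r. R r x - R r (R r x))"
    by (intro continuous_intros continuous_on_R continuous_on_RR)
  then show ?thesis
    by (rule continuous_on_eq) (auto simp: Q_def R_diff)
qed

text \<open>By the resolvent identity the derivative of R r x is - Q r x / r. The difference of the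
  squares is factored first, so that this identity can be inserted into the difference
  quotient.\<close>

lemma DERIV_norm_R:
  assumes s: "s > 0"
  shows "((\<lambda>r. (norm (R r x))\<^sup>2) has_real_derivative - (2 / s) * inner (Q s x) (R s x)) (at s)"
proof -
  have ev: "eventually (\<lambda>r. - (1 / r) * inner (R s (x - R r x)) (R r x + R s x) =
      ((norm (R r x))\<^sup>2 - (norm (R s x))\<^sup>2) / (r - s)) (at s)"
  proof -
    have "eventually (\<lambda>r. r \<in> {0<..} \<and> r \<noteq> s) (at s)"
      using eventually_at_in_open'[of "{0<..}" s] s by (auto simp: eventually_conj_iff eventually_neq_at_within)
    then show ?thesis
    proof (elim eventually_mono)
      fix r assume r: "r \<in> {0<..} \<and> r \<noteq> s"
      have "(norm (R r x))\<^sup>2 - (norm (R s x))\<^sup>2 = inner (R r x - R s x) (R r x + R s x)"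
        unfolding power2_norm_eq_inner by (simp add: inner_diff inner_add inner_commute)
      also have "\<dots> = (s / r - 1) * inner (R s (x - R r x)) (R r x + R s x)"
        using r s resid[of r s x] by simp
      also have "s / r - 1 = - (1 / r) * (r - s)" using r by (simp add: field_simps)
      finally show "- (1 / r) * inner (R s (x - R r x)) (R r x + R s x) =
          ((norm (R r x))\<^sup>2 - (norm (R s x))\<^sup>2) / (r - s)" using r by simp
    qed
  qed
  have l: "((\<lambda>r. R s (x - R r x)) \<longlongrightarrow> Q s x) (at s)"
  proof (subst LIM_zero_iff[symmetric], rule Lim_null_comparison)
    show "eventually (\<lambda>r. norm (R s (x - R r x) - Q s x) \<le> norm (R r x - R s x)) (at s)"
    proof (rule always_eventually, rule allI)
      fix r
      have "R s (x - R r x) - Q s x = R s (R s x - R r x)" using s by (simp add: Q_def R_diff)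
      then show "norm (R s (x - R r x) - Q s x) \<le> norm (R r x - R s x)"
        using norm_R_le[OF s, of "R s x - R r x"] by (simp add: norm_minus_commute)
    qed
    show "((\<lambda>r. norm (R r x - R s x)) \<longlongrightarrow> 0) (at s)"
      using tendsto_R[OF s, of x] by (simp add: LIM_zero_iff tendsto_norm_zero_iff)
  qed
  have "((\<lambda>r. - (1 / r) * inner (R s (x - R r x)) (R r x + R s x)) \<longlongrightarrow>
      - (1 / s) * inner (Q s x) (R s x + R s x)) (at s)"
    using s by (intro tendsto_intros l tendsto_R) auto
  then have "((\<lambda>r. - (1 / r) * inner (R s (x - R r x)) (R r x + R s x)) \<longlongrightarrow>
      - (2 / s) * inner (Q s x) (R s x)) (at s)"
    by (simp add: inner_add)
  from Lim_transform_eventually[OF this ev] show ?thesis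
    unfolding has_field_derivative_iff .
qed

text \<open>With y = R s x one has Q s x = y - R s y, and accretivity is applied to y.\<close>

lemma norm_Q_sq_le: "s > 0 \<Longrightarrow> (norm (Q s x))\<^sup>2 \<le> inner (Q s x) (R s x)"
  using inner_compl_ge[of s "R s x"] by (simp add: Q_def R_diff)

lemma measurable_on_pos:
  fixes f :: "real \<Rightarrow> real"
  assumes "continuous_on {0<..} f"
  shows "(\<lambda>r. indicator {0<..} r * f r) \<in> borel_measurable borel"
  using borel_measurable_continuous_on_indicator[OF _ assms] by simp

lemma nn_sup_pos:
  fixes f :: "real \<Rightarrow> ennreal"
  assumes f[measurable]: "f \<in> borel_measurable borel"
    and le: "\<And>a b. 0 < a \<Longrightarrow> a \<le> b \<Longrightarrow> (\<integral>\<^sup>+r. f r * indicator {a..b} r \<partial>lborel) \<le> C"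
  shows "(\<integral>\<^sup>+r\<in>{0<..}. f r \<partial>lborel) \<le> C"
proof -
  define A where "A n = {inverse (real (Suc n))..real (Suc n)}" for n
  have inc: "incseq A"
  proof (rule incseq_SucI)
    fix n
    have "inverse (real (Suc (Suc n))) \<le> inverse (real (Suc n))" by (intro le_imp_inverse_le) auto
    then show "A n \<subseteq> A (Suc n)" by (auto simp: A_def)
  qed
  have Un: "(\<Union>n. A n) = {0<..}"
  proof (intro equalityI subsetI)
    fix r :: real assume "r \<in> {0<..}"
    then have r: "r > 0" by simp
    obtain n where n: "inverse (real (Suc n)) < r" using reals_Archimedean[OF r] by blast
    obtain m where m: "r < real m" using reals_Archimedean2 by blast
    have "r \<in> A (max n m)"
    proof -
      have "inverse (real (Suc (max n m))) \<le> inverse (real (Suc n))" by (intro le_imp_inverse_le) auto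
      then have "inverse (real (Suc (max n m))) \<le> r" "r \<le> real (Suc (max n m))" using n m by linarith+
      then show ?thesis by (simp only: A_def atLeastAtMost_iff)
    qed
    then show "r \<in> (\<Union>n. A n)" by blast
  next
    fix r assume "r \<in> (\<Union>n. A n)"
    then obtain n where "inverse (real (Suc n)) \<le> r" by (auto simp: A_def)
    moreover have "0 < inverse (real (Suc n))" by simp
    ultimately show "r \<in> {0<..}" by (metis greaterThan_iff less_le_trans)
  qed
  have "(\<integral>\<^sup>+r\<in>{0<..}. f r \<partial>lborel) = (\<integral>\<^sup>+r. (SUP n. f r * indicator (A n) r) \<partial>lborel)"
  proof (rule nn_integral_cong)
    fix r
    have "(SUP n. f r * indicator (A n) r) = f r * (SUP n. indicator (A n) r)"
      by (rule SUP_mult_left_ennreal[symmetric])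
    also have "(SUP n. indicator (A n) r :: ennreal) = indicator (\<Union>n. A n) r"
      by (rule LIMSEQ_unique[OF LIMSEQ_SUP LIMSEQ_indicator_incseq[OF inc]])
         (use inc in \<open>auto simp: incseq_def indicator_def\<close>)
    finally show "f r * indicator {0<..} r = (SUP n. f r * indicator (A n) r)" by (simp add: Un)
  qed
  also have "\<dots> = (SUP n. \<integral>\<^sup>+r. f r * indicator (A n) r \<partial>lborel)"
  proof (rule nn_integral_monotone_convergence_SUP)
    show "incseq (\<lambda>n r. f r * indicator (A n) r)"
      using inc by (auto simp: incseq_def le_fun_def indicator_def)
    show "(\<lambda>r. f r * indicator (A n) r) \<in> borel_measurable lborel" for n
      unfolding A_def by measurable
  qed
  also have "\<dots> \<le> C"
    by (rule SUP_least, unfold A_def, rule le) (auto simp: field_simps intro: order_trans[of _ 1])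
  finally show ?thesis .
qed

text \<open>The integrand is dominated by (Q r x, R r x) / r, which is exactly - 1/2 times the
  derivative of the squared norm of R r x. The integral telescopes, and contractivity bounds what is
  left at the lower end.\<close>

lemma quadratic_estimate:
  "(\<integral>\<^sup>+r\<in>{0<..}. ennreal ((norm (Q r x))\<^sup>2 / r) \<partial>lborel) \<le> ennreal ((norm x)\<^sup>2 / 2)"
proof -
  define f where "f r = indicator {0<..} r * (inner (Q r x) (R r x) / r)" for r
  have fm [measurable]: "f \<in> borel_measurable borel"
    unfolding f_def[abs_def]
    by (rule measurable_on_pos) (auto intro!: continuous_intros continuous_on_Q continuous_on_R)
  have f0: "0 \<le> f r" for r
    using order_trans[OF zero_le_power2 norm_Q_sq_le[of r x]]
    by (auto simp: f_def indicator_def)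
  have "(\<integral>\<^sup>+r\<in>{0<..}. ennreal ((norm (Q r x))\<^sup>2 / r) \<partial>lborel) \<le> (\<integral>\<^sup>+r\<in>{0<..}. ennreal (f r) \<partial>lborel)"
    by (intro nn_integral_mono) (auto simp: f_def indicator_def intro!: ennreal_leI divide_right_mono norm_Q_sq_le)
  also have "\<dots> \<le> ennreal ((norm x)\<^sup>2 / 2)"
  proof (rule nn_sup_pos)
    fix a b :: real assume ab: "0 < a" "a \<le> b"
    have "(\<integral>\<^sup>+r. ennreal (f r) * indicator {a..b} r \<partial>lborel) =
        ennreal (- (norm (R b x))\<^sup>2 / 2 - (- (norm (R a x))\<^sup>2 / 2))"
    proof (rule nn_integral_FTC_Icc[OF fm _ f0 ab(2), where F = "\<lambda>r. - (norm (R r x))\<^sup>2 / 2"])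
      fix r assume "r \<in> {a..b}"
      then have "r > 0" using ab by auto
      then show "((\<lambda>r. - (norm (R r x))\<^sup>2 / 2) has_real_derivative f r) (at r)"
        using DERIV_cdivide[OF DERIV_minus[OF DERIV_norm_R[of r x]], of 2] by (simp add: f_def)
    qed
    also have "\<dots> \<le> ennreal ((norm x)\<^sup>2 / 2)"
    proof (rule ennreal_leI)
      have "(norm (R a x))\<^sup>2 \<le> (norm x)\<^sup>2" by (intro power_mono norm_R_le ab) simp
      then show "- (norm (R b x))\<^sup>2 / 2 - - (norm (R a x))\<^sup>2 / 2 \<le> (norm x)\<^sup>2 / 2"
        using zero_le_power2[of "norm (R b x)"] by linarith
    qed
    finally show "(\<integral>\<^sup>+r. ennreal (f r) * indicator {a..b} r \<partial>lborel) \<le> ennreal ((norm x)\<^sup>2 / 2)" .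
  qed measurable
  finally show ?thesis .
qed

end

section \<open>Schur's test for the kernel of the interpolation estimate\<close>

lemma nn_integral_powr_0:
  assumes "a > -1" "c \<ge> 0"
  shows "(\<integral>\<^sup>+r. ennreal (r powr a) * indicator {0..c} r \<partial>lborel) = ennreal (c powr (a + 1) / (a + 1))"
  by (rule nn_integral_has_integral_lebesgue'[OF _ has_integral_powr_from_0]) (use assms in auto)

lemma nn_integral_powr_inf:
  assumes "e < -1" "c > 0"
  shows "(\<integral>\<^sup>+r. ennreal (r powr e) * indicator {c..} r \<partial>lborel) = ennreal (- (c powr (e + 1)) / (e + 1))"
  by (rule nn_integral_has_integral_lebesgue'[OF _ has_integral_powr_to_inf]) (use assms in auto)

text \<open>The bound min 1 (s / r) for (1 - R s) R r, weighted with the powers of r and s from the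
  interpolation norm. It depends on r / s only and decays at both ends, so its integral against dr /
  r is bounded independently of s.\<close>

definition schur_kernel :: "real \<Rightarrow> real \<Rightarrow> real \<Rightarrow> real" where
  "schur_kernel \<theta> s r = (r / s) powr \<theta> * min 1 (s / r)"

lemma schur_kernel_nonneg: "0 < s \<Longrightarrow> 0 < r \<Longrightarrow> 0 \<le> schur_kernel \<theta> s r"
  by (simp add: schur_kernel_def)

text \<open>Splitting at r = s: the part below contributes 1 / \<theta>, the part above 1 / (1 -
  \<theta>).\<close>

lemma schur_kernel_integral:
  assumes \<theta>: "0 < \<theta>" "\<theta> < 1" and s: "s > 0"
  shows "(\<integral>\<^sup>+r\<in>{0<..}. ennreal (schur_kernel \<theta> s r / r) \<partial>lborel) \<le> ennreal (1 / \<theta> + 1 / (1 - \<theta>))"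
proof -
  have "(\<integral>\<^sup>+r\<in>{0<..}. ennreal (schur_kernel \<theta> s r / r) \<partial>lborel) \<le>
    (\<integral>\<^sup>+r. ennreal (s powr (-\<theta>)) * (ennreal (r powr (\<theta> - 1)) * indicator {0..s} r) +
       ennreal (s powr (1 - \<theta>)) * (ennreal (r powr (\<theta> - 2)) * indicator {s..} r) \<partial>lborel)"
  proof (rule nn_integral_mono)
    fix r :: real
    show "ennreal (schur_kernel \<theta> s r / r) * indicator {0<..} r \<le>
      ennreal (s powr (-\<theta>)) * (ennreal (r powr (\<theta> - 1)) * indicator {0..s} r) +
       ennreal (s powr (1 - \<theta>)) * (ennreal (r powr (\<theta> - 2)) * indicator {s..} r)"
    proof (cases "r > 0")
      case r: True
      show ?thesis
      proof (cases "r \<le> s")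
        case True
        then have "min 1 (s / r) = 1" using r by simp
        then have "schur_kernel \<theta> s r / r = s powr (-\<theta>) * r powr (\<theta> - 1)"
          using r s by (simp add: schur_kernel_def powr_divide powr_minus powr_diff field_simps)
        then show ?thesis using True r by (simp add: ennreal_mult)
      next
        case False
        then have "min 1 (s / r) = s / r" using r by simp
        moreover have "r powr (\<theta> - 2) = r powr \<theta> / (r * r)"
          using r powr_add[of r 1 1] by (simp add: powr_diff)
        ultimately have "schur_kernel \<theta> s r / r = s powr (1 - \<theta>) * r powr (\<theta> - 2)"
          using r s by (simp add: schur_kernel_def powr_divide powr_diff field_simps)
        then show ?thesis using False r by (simp add: ennreal_mult)
      qed
    qed simp
  qed
  also have "\<dots> = ennreal (s powr (-\<theta>)) * ennreal (s powr \<theta> / \<theta>) +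
      ennreal (s powr (1 - \<theta>)) * ennreal (- (s powr (\<theta> - 1)) / (\<theta> - 1))"
    using \<theta> s nn_integral_powr_0[of "\<theta> - 1" s] nn_integral_powr_inf[of "\<theta> - 2" s]
    by (subst nn_integral_add) (auto simp: nn_integral_cmult)
  also have "\<dots> = ennreal (s powr (-\<theta>) * (s powr \<theta> / \<theta>) + s powr (1 - \<theta>) * (- (s powr (\<theta> - 1)) / (\<theta> - 1)))"
    using \<theta> by (simp add: ennreal_mult[symmetric] ennreal_plus[symmetric] divide_nonneg_neg del: ennreal_plus)
  also have "s powr (-\<theta>) * (s powr \<theta> / \<theta>) + s powr (1 - \<theta>) * (- (s powr (\<theta> - 1)) / (\<theta> - 1)) = 1 / \<theta> + 1 / (1 - \<theta>)"
  proof -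
    have "s powr (-\<theta>) * s powr \<theta> = 1" "s powr (1 - \<theta>) * s powr (\<theta> - 1) = 1"
      using s by (simp_all add: powr_add[symmetric])
    moreover have "s powr (-\<theta>) * (s powr \<theta> / \<theta>) = (s powr (-\<theta>) * s powr \<theta>) / \<theta>"
      "s powr (1 - \<theta>) * (- (s powr (\<theta> - 1)) / (\<theta> - 1)) = - (s powr (1 - \<theta>) * s powr (\<theta> - 1)) / (\<theta> - 1)"
      by simp_all
    moreover have "- 1 / (\<theta> - 1) = 1 / (1 - \<theta>)" using \<theta> by (simp add: divide_simps)
    ultimately show ?thesis by (simp only:)
  qed
  finally show ?thesis .
qed

text \<open>Exchanging the variables replaces \<theta> by 1 - \<theta>, which leaves 1 / \<theta> +
  1 / (1 - \<theta>) unchanged; hence both marginals of the kernel obey the same bound.\<close>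

lemma schur_kernel_sym: "0 < s \<Longrightarrow> 0 < r \<Longrightarrow> schur_kernel \<theta> s r = schur_kernel (1 - \<theta>) r s"
proof -
  assume sr: "0 < s" "0 < r"
  have "(r / s) powr \<theta> * (s / r) = (s / r) powr (1 - \<theta>)"
    using sr by (simp add: powr_diff powr_divide field_simps)
  moreover have "(s / r) powr (1 - \<theta>) * (r / s) = (r / s) powr \<theta>"
    using sr by (simp add: powr_diff powr_divide field_simps)
  ultimately show ?thesis using sr
    by (cases "s \<le> r") (auto simp: schur_kernel_def min_def divide_simps)
qed

text \<open>Cauchy-Schwarz with the kernel split into two square roots uses one marginal bound;
  Tonelli and the symmetry of the kernel supply the other.\<close>

lemma schur_test:
  fixes q :: "real \<Rightarrow> ennreal"
  assumes \<theta>: "0 < \<theta>" "\<theta> < 1" and q[measurable]: "q \<in> borel_measurable borel"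
  defines "K \<equiv> 1 / \<theta> + 1 / (1 - \<theta>)"
  shows "(\<integral>\<^sup>+s\<in>{0<..}. (\<integral>\<^sup>+r\<in>{0<..}. ennreal (schur_kernel \<theta> s r / r) * q r \<partial>lborel)\<^sup>2 * ennreal (1 / s) \<partial>lborel)
     \<le> ennreal (K\<^sup>2) * (\<integral>\<^sup>+r\<in>{0<..}. (q r)\<^sup>2 * ennreal (1 / r) \<partial>lborel)"
proof -
  have K: "K > 0" using \<theta> by (simp add: K_def add_pos_pos)
  have cs: "(\<integral>\<^sup>+r\<in>{0<..}. ennreal (schur_kernel \<theta> s r / r) * q r \<partial>lborel)\<^sup>2 \<le>
      ennreal K * (\<integral>\<^sup>+r\<in>{0<..}. ennreal (schur_kernel \<theta> s r / r) * (q r)\<^sup>2 \<partial>lborel)" if s: "s > 0" for s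
  proof -
    define w where "w r = ennreal (indicator {0<..} r * sqrt (schur_kernel \<theta> s r / r))" for r
    have w2: "w r ^ 2 = ennreal (schur_kernel \<theta> s r / r) * indicator {0<..} r" for r
      using s schur_kernel_nonneg[of s r \<theta>] by (auto simp: w_def indicator_def ennreal_power)
    have [measurable]: "w \<in> borel_measurable borel" unfolding w_def[abs_def] schur_kernel_def by measurable
    have "(\<integral>\<^sup>+r\<in>{0<..}. ennreal (schur_kernel \<theta> s r / r) * q r \<partial>lborel) = (\<integral>\<^sup>+r. w r * (w r * q r) \<partial>lborel)"
    proof (rule nn_integral_cong)
      fix r
      have "w r * (w r * q r) = (w r)\<^sup>2 * q r" by (simp add: power2_eq_square mult.assoc)
      then show "ennreal (schur_kernel \<theta> s r / r) * q r * indicator {0<..} r = w r * (w r * q r)"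
        unfolding w2 by (simp add: mult_ac)
    qed
    then have "(\<integral>\<^sup>+r\<in>{0<..}. ennreal (schur_kernel \<theta> s r / r) * q r \<partial>lborel)\<^sup>2 \<le>
        (\<integral>\<^sup>+r. w r ^ 2 \<partial>lborel) * (\<integral>\<^sup>+r. (w r * q r)^2 \<partial>lborel)"
      by (simp only:) (rule Cauchy_Schwarz_nn_integral; measurable)
    also have "\<dots> \<le> ennreal K * (\<integral>\<^sup>+r\<in>{0<..}. ennreal (schur_kernel \<theta> s r / r) * (q r)\<^sup>2 \<partial>lborel)"
      using schur_kernel_integral[OF \<theta> s] unfolding power_mult_distrib w2 K_def
      by (intro mult_mono) (auto simp: mult_ac)
    finally show ?thesis .
  qed
  have "(\<integral>\<^sup>+s\<in>{0<..}. (\<integral>\<^sup>+r\<in>{0<..}. ennreal (schur_kernel \<theta> s r / r) * q r \<partial>lborel)\<^sup>2 * ennreal (1 / s) \<partial>lborel)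
    \<le> (\<integral>\<^sup>+s. ennreal K * (\<integral>\<^sup>+r. ennreal (schur_kernel \<theta> s r / r) * (q r)\<^sup>2 * indicator {0<..} r * (ennreal (1 / s) * indicator {0<..} s) \<partial>lborel) \<partial>lborel)"
  proof (rule nn_integral_mono)
    fix s :: real
    show "(\<integral>\<^sup>+r\<in>{0<..}. ennreal (schur_kernel \<theta> s r / r) * q r \<partial>lborel)\<^sup>2 * ennreal (1 / s) * indicator {0<..} s \<le>
      ennreal K * (\<integral>\<^sup>+r. ennreal (schur_kernel \<theta> s r / r) * (q r)\<^sup>2 * indicator {0<..} r * (ennreal (1 / s) * indicator {0<..} s) \<partial>lborel)"
    proof (cases "s > 0")
      case True
      have "(\<integral>\<^sup>+r. ennreal (schur_kernel \<theta> s r / r) * (q r)\<^sup>2 * indicator {0<..} r * (ennreal (1 / s) * indicator {0<..} s) \<partial>lborel)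
        = (\<integral>\<^sup>+r\<in>{0<..}. ennreal (schur_kernel \<theta> s r / r) * (q r)\<^sup>2 \<partial>lborel) * ennreal (1 / s)"
        using True by (subst nn_integral_multc) (auto simp: schur_kernel_def)
      then show ?thesis using mult_right_mono[OF cs[OF True], of "ennreal (1 / s)"] True by (simp add: mult_ac)
    qed simp
  qed
  also have "\<dots> = ennreal K * (\<integral>\<^sup>+s. (\<integral>\<^sup>+r. ennreal (schur_kernel \<theta> s r / r) * (q r)\<^sup>2 * indicator {0<..} r * (ennreal (1 / s) * indicator {0<..} s) \<partial>lborel) \<partial>lborel)"
    by (rule nn_integral_cmult) (unfold schur_kernel_def, measurable)
  also have "(\<integral>\<^sup>+s. (\<integral>\<^sup>+r. ennreal (schur_kernel \<theta> s r / r) * (q r)\<^sup>2 * indicator {0<..} r * (ennreal (1 / s) * indicator {0<..} s) \<partial>lborel) \<partial>lborel)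
     = (\<integral>\<^sup>+r. (\<integral>\<^sup>+s. ennreal (schur_kernel \<theta> s r / r) * (q r)\<^sup>2 * indicator {0<..} r * (ennreal (1 / s) * indicator {0<..} s) \<partial>lborel) \<partial>lborel)"
    by (rule lborel_pair.Fubini') (unfold schur_kernel_def, measurable)
  finally have I: "(\<integral>\<^sup>+s\<in>{0<..}. (\<integral>\<^sup>+r\<in>{0<..}. ennreal (schur_kernel \<theta> s r / r) * q r \<partial>lborel)\<^sup>2 * ennreal (1 / s) \<partial>lborel)
    \<le> ennreal K * (\<integral>\<^sup>+r. (\<integral>\<^sup>+s. ennreal (schur_kernel \<theta> s r / r) * (q r)\<^sup>2 * indicator {0<..} r * (ennreal (1 / s) * indicator {0<..} s) \<partial>lborel) \<partial>lborel)" .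
  have "(\<integral>\<^sup>+r. (\<integral>\<^sup>+s. ennreal (schur_kernel \<theta> s r / r) * (q r)\<^sup>2 * indicator {0<..} r * (ennreal (1 / s) * indicator {0<..} s) \<partial>lborel) \<partial>lborel)
    \<le> (\<integral>\<^sup>+r. ennreal K * ((q r)\<^sup>2 * ennreal (1 / r) * indicator {0<..} r) \<partial>lborel)"
  proof (rule nn_integral_mono)
    fix r :: real
    show "(\<integral>\<^sup>+s. ennreal (schur_kernel \<theta> s r / r) * (q r)\<^sup>2 * indicator {0<..} r * (ennreal (1 / s) * indicator {0<..} s) \<partial>lborel)
       \<le> ennreal K * ((q r)\<^sup>2 * ennreal (1 / r) * indicator {0<..} r)"
    proof (cases "r > 0")
      case True
      have "(\<integral>\<^sup>+s. ennreal (schur_kernel \<theta> s r / r) * (q r)\<^sup>2 * indicator {0<..} r * (ennreal (1 / s) * indicator {0<..} s) \<partial>lborel)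
        = (\<integral>\<^sup>+s. (ennreal (schur_kernel (1 - \<theta>) r s / s) * indicator {0<..} s) * ((q r)\<^sup>2 * ennreal (1 / r)) \<partial>lborel)"
      proof (rule nn_integral_cong)
        fix s :: real
        show "ennreal (schur_kernel \<theta> s r / r) * (q r)\<^sup>2 * indicator {0<..} r * (ennreal (1 / s) * indicator {0<..} s) =
          (ennreal (schur_kernel (1 - \<theta>) r s / s) * indicator {0<..} s) * ((q r)\<^sup>2 * ennreal (1 / r))"
        proof (cases "s > 0")
          case s: True
          have "ennreal (schur_kernel \<theta> s r / r) * ennreal (1 / s) = ennreal (schur_kernel (1 - \<theta>) r s / s) * ennreal (1 / r)"
            using s True schur_kernel_sym[OF s True, of \<theta>] schur_kernel_nonneg[OF s True, of \<theta>]
            by (simp add: ennreal_mult[symmetric] mult.commute)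
          then have "ennreal (schur_kernel \<theta> s r / r) * ennreal (1 / s) * (q r)\<^sup>2 =
              ennreal (schur_kernel (1 - \<theta>) r s / s) * ennreal (1 / r) * (q r)\<^sup>2" by (simp only:)
          then show ?thesis using s True by (simp only: mult_ac) (simp add: mult_ac)
        qed simp
      qed
      also have "\<dots> = (\<integral>\<^sup>+s\<in>{0<..}. ennreal (schur_kernel (1 - \<theta>) r s / s) \<partial>lborel) * ((q r)\<^sup>2 * ennreal (1 / r))"
        by (rule nn_integral_multc) (unfold schur_kernel_def, measurable)
      also have "\<dots> \<le> ennreal K * ((q r)\<^sup>2 * ennreal (1 / r))"
        using schur_kernel_integral[of "1 - \<theta>" r] \<theta> True by (intro mult_right_mono) (auto simp: K_def add.commute)
      finally show ?thesis using True by simp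
    qed simp
  qed
  also have "\<dots> = ennreal K * (\<integral>\<^sup>+r\<in>{0<..}. (q r)\<^sup>2 * ennreal (1 / r) \<partial>lborel)"
    by (rule nn_integral_cmult) measurable
  finally have J: "(\<integral>\<^sup>+r. (\<integral>\<^sup>+s. ennreal (schur_kernel \<theta> s r / r) * (q r)\<^sup>2 * indicator {0<..} r * (ennreal (1 / s) * indicator {0<..} s) \<partial>lborel) \<partial>lborel)
    \<le> ennreal K * (\<integral>\<^sup>+r\<in>{0<..}. (q r)\<^sup>2 * ennreal (1 / r) \<partial>lborel)" .
  have "ennreal (K\<^sup>2) = ennreal K * ennreal K" using K by (simp add: power2_eq_square ennreal_mult)
  then show ?thesis using order_trans[OF I mult_left_mono[OF J, of "ennreal K"]] by (simp only: mult.assoc zero_le)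
qed

lemma ennreal_power2_le_imp_le: "(a::ennreal)\<^sup>2 \<le> b\<^sup>2 \<Longrightarrow> a \<le> b"
proof (cases b)
  case (real b')
  assume le: "a\<^sup>2 \<le> b\<^sup>2"
  show ?thesis
  proof (cases a)
    case (real a')
    then show ?thesis using le \<open>b = ennreal b'\<close> \<open>0 \<le> b'\<close>
      by (simp add: ennreal_power)
  next
    case top
    then show ?thesis using le \<open>b = ennreal b'\<close> \<open>0 \<le> b'\<close> by (simp add: ennreal_power top_unique)
  qed
qed simp

section \<open>Interpolation norms of fractional powers of an accretive operator\<close>

context resolvent
begin

text \<open>In the model W is A^-\<theta>, represented weakly by R r (Q r x). The defect W x - R s
  (W x) is W applied to x - R s x. Testing it with itself bounds its norm by an integral of norms of
  Q r x against the Schur kernel; Schur's test and the quadratic estimate finish.\<close>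

lemma interp_upper:
  fixes W :: "'h \<Rightarrow> 'h"
  assumes \<theta>: "0 < \<theta>" "\<theta> < 1" and c: "c > 0" and W: "linear W"
    and rep: "\<And>x y. has_bochner_integral lborel (\<lambda>r. indicator {0<..} r * (r powr (\<theta> - 1) * inner (R r (Q r x)) y)) (c * inner (W x) y)"
    and comm: "\<And>s x. s > 0 \<Longrightarrow> R s (W x) = W (R s x)"
  defines "K \<equiv> (1 / \<theta> + 1 / (1 - \<theta>)) / c"
  shows "(\<integral>\<^sup>+s\<in>{0<..}. ennreal ((s powr (-\<theta>) * norm (W x - R s (W x)))\<^sup>2 / s) \<partial>lborel) \<le> ennreal (K\<^sup>2 * (norm x)\<^sup>2 / 2)"
proof -
  define q where "q r = ennreal (indicator {0<..} r * norm (Q r x))" for r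
  have [measurable]: "q \<in> borel_measurable borel"
    unfolding q_def[abs_def]
    by (intro measurable_compose[OF measurable_on_pos measurable_ennreal] continuous_intros continuous_on_Q)
  have key: "ennreal (c * (s powr (-\<theta>) * norm (W x - R s (W x)))) \<le>
     (\<integral>\<^sup>+r\<in>{0<..}. ennreal (schur_kernel \<theta> s r / r) * q r \<partial>lborel)" if s: "s > 0" for s
  proof -
    define z where "z = x - R s x"
    define y where "y = W x - R s (W x)"
    have y: "y = W z" using s by (simp add: y_def z_def comm linear_diff[OF W])
    \<comment> \<open>Two bounds for (1 - R s) R r: contractivity gives 1, and
      \<open>compl_R\<close> gives s / r.\<close>
    have bd: "\<bar>inner (R r (Q r z)) y\<bar> \<le> min 1 (s / r) * norm (Q r x) * norm y" if r: "r > 0" for r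
    proof -
      have cR: "R r (u - R s u) = R r u - R s (R r u)" for u using r s by (simp add: R_diff R_commute[of r s])
      have "Q r z = Q r x - R s (Q r x)"
        unfolding z_def Q_def using r s by (simp add: R_diff R_commute[of r s])
      then have e: "R r (Q r z) = R r (Q r x) - R s (R r (Q r x))" using cR by simp
      have "norm (R r (Q r z)) \<le> norm (Q r x)"
        unfolding e using norm_compl_le[OF s] norm_R_le[OF r] order_trans by blast
      moreover have "norm (R r (Q r z)) \<le> (s / r) * norm (Q r x)"
      proof -
        have "norm (R r (Q r z)) = (s / r) * norm (R s (Q r x - R r (Q r x)))"
          unfolding e using compl_R[OF r s] r s by simp
        also have "\<dots> \<le> (s / r) * norm (Q r x)"
          using r s order_trans[OF norm_R_le[OF s] norm_compl_le[OF r]] by (intro mult_left_mono) auto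
        finally show ?thesis .
      qed
      ultimately have "norm (R r (Q r z)) \<le> min 1 (s / r) * norm (Q r x)" by (simp add: min_def)
      then show ?thesis using Cauchy_Schwarz_ineq2[of "R r (Q r z)" y] mult_right_mono[of "norm (R r (Q r z))" _ "norm y"] by force
    qed
    have int: "integrable lborel (\<lambda>r. indicator {0<..} r * (r powr (\<theta> - 1) * inner (R r (Q r z)) y))"
      and val: "(\<integral>r. indicator {0<..} r * (r powr (\<theta> - 1) * inner (R r (Q r z)) y) \<partial>lborel) = c * (norm y)\<^sup>2"
      using rep[of z y] by (auto simp: has_bochner_integral_iff y power2_norm_eq_inner)
    have "ennreal (c * (norm y)\<^sup>2) = ennreal \<bar>\<integral>r. indicator {0<..} r * (r powr (\<theta> - 1) * inner (R r (Q r z)) y) \<partial>lborel\<bar>"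
      using c by (simp add: val)
    also have "\<dots> \<le> (\<integral>\<^sup>+r. ennreal (norm (indicator {0<..} r * (r powr (\<theta> - 1) * inner (R r (Q r z)) y))) \<partial>lborel)"
      using integral_norm_bound_ennreal[OF int] by simp
    also have "\<dots> \<le> (\<integral>\<^sup>+r. ennreal (s powr \<theta> * norm y) * (ennreal (schur_kernel \<theta> s r / r) * q r * indicator {0<..} r) \<partial>lborel)"
    proof (rule nn_integral_mono)
      fix r :: real
      show "ennreal (norm (indicator {0<..} r * (r powr (\<theta> - 1) * inner (R r (Q r z)) y))) \<le>
        ennreal (s powr \<theta> * norm y) * (ennreal (schur_kernel \<theta> s r / r) * q r * indicator {0<..} r)"
      proof (cases "r > 0")
        case r: True
        have "r powr (\<theta> - 1) * \<bar>inner (R r (Q r z)) y\<bar> \<le> r powr (\<theta> - 1) * (min 1 (s / r) * norm (Q r x) * norm y)"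
          using bd[OF r] by (intro mult_left_mono) auto
        also have "\<dots> = (s powr \<theta> * norm y) * (schur_kernel \<theta> s r / r * norm (Q r x))"
          using r s by (simp add: schur_kernel_def powr_divide powr_diff field_simps)
        finally show ?thesis using r s schur_kernel_nonneg[OF s r, of \<theta>]
          by (simp add: q_def ennreal_mult[symmetric] abs_mult ennreal_leI)
      qed simp
    qed
    also have "\<dots> = ennreal (s powr \<theta> * norm y) * (\<integral>\<^sup>+r\<in>{0<..}. ennreal (schur_kernel \<theta> s r / r) * q r \<partial>lborel)"
      by (rule nn_integral_cmult) (unfold schur_kernel_def, measurable)
    finally have le: "ennreal (c * (norm y)\<^sup>2) \<le> ennreal (s powr \<theta> * norm y) * (\<integral>\<^sup>+r\<in>{0<..}. ennreal (schur_kernel \<theta> s r / r) * q r \<partial>lborel)" (is "_ \<le> _ * ?I") .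
    show ?thesis
    \<comment> \<open>Outside these trivial cases one factor \<open>norm y\<close> cancels from both
      sides.\<close>
    proof (cases "norm y = 0 \<or> ?I = \<infinity>")
      case True then show ?thesis by (auto simp: y_def[symmetric])
    next
      case False
      then obtain I where I: "?I = ennreal I" "I \<ge> 0" by (cases ?I) auto
      have "ennreal (c * (norm y)\<^sup>2) \<le> ennreal (s powr \<theta> * norm y * I)"
        using le unfolding I(1) using I(2) by (simp add: ennreal_mult[symmetric])
      then have "c * (norm y)\<^sup>2 \<le> s powr \<theta> * norm y * I" using I by (subst (asm) ennreal_le_iff) auto
      then have "c * norm y \<le> s powr \<theta> * I" using False by (simp add: power2_eq_square)
      then have "s powr (-\<theta>) * (c * norm y) \<le> s powr (-\<theta>) * (s powr \<theta> * I)" by (intro mult_left_mono) auto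
      also have "\<dots> = I" using s by (simp add: powr_minus)
      finally show ?thesis unfolding I(1) y_def[symmetric] by (simp add: ennreal_leI mult_ac)
    qed
  qed
  have "ennreal (c\<^sup>2) * (\<integral>\<^sup>+s\<in>{0<..}. ennreal ((s powr (-\<theta>) * norm (W x - R s (W x)))\<^sup>2 / s) \<partial>lborel)
      \<le> (\<integral>\<^sup>+s\<in>{0<..}. ennreal (c\<^sup>2) * ennreal ((s powr (-\<theta>) * norm (W x - R s (W x)))\<^sup>2 / s) \<partial>lborel)"
  proof -
    have "(\<lambda>s. indicator {0<..} s * ((s powr (-\<theta>) * norm (W x - R s (W x)))\<^sup>2 / s)) \<in> borel_measurable borel"
      by (rule measurable_on_pos) (auto intro!: continuous_intros continuous_on_R)
    then have "(\<lambda>s. ennreal (indicator {0<..} s * ((s powr (-\<theta>) * norm (W x - R s (W x)))\<^sup>2 / s))) \<in> borel_measurable borel"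
      by measurable
    then have F: "(\<lambda>s. ennreal (indicator {0<..} s * ((s powr (-\<theta>) * norm (W x - R s (W x)))\<^sup>2 / s))) \<in> borel_measurable lborel"
      by simp
    have e: "ennreal (indicator {0<..} s * a) = ennreal a * indicator {0<..} s" for s a :: real
      by (simp add: indicator_def)
    show ?thesis
      using nn_integral_cmult[OF F, of "ennreal (c\<^sup>2)"] unfolding e by (simp add: mult.assoc)
  qed
  also have "\<dots> \<le> (\<integral>\<^sup>+s\<in>{0<..}. (\<integral>\<^sup>+r\<in>{0<..}. ennreal (schur_kernel \<theta> s r / r) * q r \<partial>lborel)\<^sup>2 * ennreal (1 / s) \<partial>lborel)"
  proof (rule nn_integral_mono)
    fix s :: real
    show "ennreal (c\<^sup>2) * ennreal ((s powr (-\<theta>) * norm (W x - R s (W x)))\<^sup>2 / s) * indicator {0<..} s \<le>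
       (\<integral>\<^sup>+r\<in>{0<..}. ennreal (schur_kernel \<theta> s r / r) * q r \<partial>lborel)\<^sup>2 * ennreal (1 / s) * indicator {0<..} s"
    proof (cases "s > 0")
      case s: True
      have "ennreal (c\<^sup>2) * ennreal ((s powr (-\<theta>) * norm (W x - R s (W x)))\<^sup>2 / s) =
         (ennreal (c * (s powr (-\<theta>) * norm (W x - R s (W x)))))\<^sup>2 * ennreal (1 / s)"
        using s c by (simp add: ennreal_mult[symmetric] ennreal_power power_mult_distrib)
      also have "\<dots> \<le> (\<integral>\<^sup>+r\<in>{0<..}. ennreal (schur_kernel \<theta> s r / r) * q r \<partial>lborel)\<^sup>2 * ennreal (1 / s)"
        by (intro mult_right_mono power_mono key s) auto
      finally show ?thesis using s by simp
    qed simp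
  qed
  also have "\<dots> \<le> ennreal ((1 / \<theta> + 1 / (1 - \<theta>))\<^sup>2) * (\<integral>\<^sup>+r\<in>{0<..}. (q r)\<^sup>2 * ennreal (1 / r) \<partial>lborel)"
    by (rule schur_test[OF \<theta>]) simp
  also have "(\<integral>\<^sup>+r\<in>{0<..}. (q r)\<^sup>2 * ennreal (1 / r) \<partial>lborel) = (\<integral>\<^sup>+r\<in>{0<..}. ennreal ((norm (Q r x))\<^sup>2 / r) \<partial>lborel)"
    by (intro nn_integral_cong) (auto simp: q_def indicator_def ennreal_power ennreal_mult[symmetric])
  also have "ennreal ((1 / \<theta> + 1 / (1 - \<theta>))\<^sup>2) * \<dots> \<le> ennreal ((1 / \<theta> + 1 / (1 - \<theta>))\<^sup>2) * ennreal ((norm x)\<^sup>2 / 2)"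
    by (intro mult_left_mono quadratic_estimate) simp
  also have "\<dots> = ennreal ((1 / \<theta> + 1 / (1 - \<theta>))\<^sup>2 * ((norm x)\<^sup>2 / 2))"
    by (rule ennreal_mult[symmetric]) auto
  finally have fin: "ennreal (c\<^sup>2) * (\<integral>\<^sup>+s\<in>{0<..}. ennreal ((s powr (-\<theta>) * norm (W x - R s (W x)))\<^sup>2 / s) \<partial>lborel)
     \<le> ennreal ((1 / \<theta> + 1 / (1 - \<theta>))\<^sup>2 * ((norm x)\<^sup>2 / 2))" (is "_ * ?J \<le> _") .
  have "?J = ennreal (1 / c\<^sup>2) * (ennreal (c\<^sup>2) * ?J)"
    using c by (simp add: mult.assoc[symmetric] ennreal_mult[symmetric])
  also have "\<dots> \<le> ennreal (1 / c\<^sup>2) * ennreal ((1 / \<theta> + 1 / (1 - \<theta>))\<^sup>2 * ((norm x)\<^sup>2 / 2))"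
    by (intro mult_left_mono fin) simp
  also have "\<dots> = ennreal (K\<^sup>2 * (norm x)\<^sup>2 / 2)"
    by (subst ennreal_mult[symmetric]) (simp_all add: K_def power_divide)
  finally show ?thesis .
qed

text \<open>The converse direction works by duality: Cauchy-Schwarz in ds / s pairs the
  interpolation norm of x with the quadratic estimate of a second resolvent family, which later is
  the adjoint one. The weight s powr (-\<theta> - 1) is shared as s powr (-\<theta> - 1/2) times s
  powr (-1/2).\<close>

lemma interp_lower:
  fixes R' :: "real \<Rightarrow> 'h \<Rightarrow> 'h"
  assumes R': "resolvent R'"
    and N: "(\<integral>\<^sup>+s\<in>{0<..}. ennreal ((s powr (-\<theta>) * norm (x - R s x))\<^sup>2 / s) \<partial>lborel) \<le> ennreal N" "N \<ge> 0"
  shows "(\<integral>\<^sup>+s\<in>{0<..}. ennreal (s powr (-\<theta> - 1) * (norm (x - R s x) * norm (resolvent.Q R' s y))) \<partial>lborel) \<le> ennreal (sqrt N * norm y)"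
proof -
  interpret R': resolvent R' by (rule R')
  define f where "f s = ennreal (indicator {0<..} s * (s powr (-\<theta>) * norm (x - R s x) / sqrt s))" for s
  define g where "g s = ennreal (indicator {0<..} s * (norm (R'.Q s y) / sqrt s))" for s
  have fg: "f \<in> borel_measurable borel" "g \<in> borel_measurable borel"
    unfolding f_def[abs_def] g_def[abs_def]
    by (intro measurable_compose[OF measurable_on_pos measurable_ennreal]; auto intro!: continuous_intros continuous_on_R R'.continuous_on_Q)+
  have "(\<integral>\<^sup>+s\<in>{0<..}. ennreal (s powr (-\<theta> - 1) * (norm (x - R s x) * norm (R'.Q s y))) \<partial>lborel) = (\<integral>\<^sup>+s. f s * g s \<partial>lborel)"
  proof (rule nn_integral_cong)
    fix s :: real
    show "ennreal (s powr (-\<theta> - 1) * (norm (x - R s x) * norm (R'.Q s y))) * indicator {0<..} s = f s * g s"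
      by (cases "s > 0") (auto simp: f_def g_def ennreal_mult[symmetric] powr_diff)
  qed
  then have "(\<integral>\<^sup>+s\<in>{0<..}. ennreal (s powr (-\<theta> - 1) * (norm (x - R s x) * norm (R'.Q s y))) \<partial>lborel)\<^sup>2 \<le>
      (\<integral>\<^sup>+s. (f s)\<^sup>2 \<partial>lborel) * (\<integral>\<^sup>+s. (g s)\<^sup>2 \<partial>lborel)"
    using Cauchy_Schwarz_nn_integral[of f lborel g] fg by simp
  also have "(\<integral>\<^sup>+s. (f s)\<^sup>2 \<partial>lborel) = (\<integral>\<^sup>+s\<in>{0<..}. ennreal ((s powr (-\<theta>) * norm (x - R s x))\<^sup>2 / s) \<partial>lborel)"
    by (intro nn_integral_cong) (auto simp: f_def indicator_def ennreal_power power_divide)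
  also have "(\<integral>\<^sup>+s. (g s)\<^sup>2 \<partial>lborel) = (\<integral>\<^sup>+s\<in>{0<..}. ennreal ((norm (R'.Q s y))\<^sup>2 / s) \<partial>lborel)"
    by (intro nn_integral_cong) (auto simp: g_def indicator_def ennreal_power power_divide)
  also have "(\<integral>\<^sup>+s\<in>{0<..}. ennreal ((s powr (-\<theta>) * norm (x - R s x))\<^sup>2 / s) \<partial>lborel) *
     (\<integral>\<^sup>+s\<in>{0<..}. ennreal ((norm (R'.Q s y))\<^sup>2 / s) \<partial>lborel) \<le> ennreal N * ennreal ((norm y)\<^sup>2)"
  proof (rule mult_mono[OF N(1)])
    have "(\<integral>\<^sup>+s\<in>{0<..}. ennreal ((norm (R'.Q s y))\<^sup>2 / s) \<partial>lborel) \<le> ennreal ((norm y)\<^sup>2 / 2)"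
      by (rule R'.quadratic_estimate)
    also have "\<dots> \<le> ennreal ((norm y)\<^sup>2)" by (intro ennreal_leI) simp
    finally show "(\<integral>\<^sup>+s\<in>{0<..}. ennreal ((norm (R'.Q s y))\<^sup>2 / s) \<partial>lborel) \<le> ennreal ((norm y)\<^sup>2)" .
  qed auto
  also have "\<dots> = (ennreal (sqrt N * norm y))\<^sup>2"
    using N(2) by (simp add: ennreal_power ennreal_mult[symmetric] power_mult_distrib)
  finally show ?thesis by (rule ennreal_power2_le_imp_le)
qed

end

section \<open>Sector bound and coercivity\<close>

lemma sector_bound:
  fixes R R' :: "real \<Rightarrow> 'h::real_inner \<Rightarrow> 'h" and W :: "'h \<Rightarrow> 'h"
  assumes R: "resolvent R" "resolvent R'"
    and adj: "\<And>r x y. r > 0 \<Longrightarrow> inner (R r x) y = inner x (R' r y)"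
    and c: "c2 > 0" "c1 \<ge> 0"
    and rep1: "\<And>x y. has_bochner_integral lborel (\<lambda>r. indicator {0<..} r * (r powr p * inner (R r x) y)) (c1 * inner (W x) y)"
    and rep2: "\<And>x y. has_bochner_integral lborel (\<lambda>r. indicator {0<..} r * (r powr p * inner (R r (R r x)) y)) (c2 * inner (W x) y)"
  shows "\<bar>inner (W x) y\<bar> \<le> c1 / (2 * c2) * (inner (W x) x + inner (W y) y)"
proof -
  interpret R: resolvent R by fact
  interpret R': resolvent R' by fact
  let ?f = "\<lambda>r. indicator {0<..} r * (r powr p * inner (R r (R r x)) y)"
  let ?g = "\<lambda>r. (1/2) * (indicator {0<..} r * (r powr p * inner (R r x) x) + indicator {0<..} r * (r powr p * inner (R r y) y))"
  have f: "has_bochner_integral lborel ?f (c2 * inner (W x) y)" by (rule rep2)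
  have g: "has_bochner_integral lborel ?g ((1/2) * (c1 * inner (W x) x + c1 * inner (W y) y))"
    by (intro has_bochner_integral_mult_right has_bochner_integral_add rep1)
  have "c2 * \<bar>inner (W x) y\<bar> = \<bar>\<integral>r. ?f r \<partial>lborel\<bar>"
    using f c by (simp add: has_bochner_integral_iff abs_mult)
  also have "\<dots> \<le> (\<integral>r. ?g r \<partial>lborel)"
  proof (rule integral_abs_bound_integral)
    show "integrable lborel ?f" "integrable lborel ?g" using f g by (auto simp: has_bochner_integral_iff)
    fix r :: real
    show "\<bar>?f r\<bar> \<le> ?g r"
    proof (cases "r > 0")
      case r: True
      \<comment> \<open>One resolvent is moved to y as its adjoint. Both squared norms are then
        below the forms of the first power of R r, so the representation of W by second powers is
        dominated by the one by first powers.\<close>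
      have "\<bar>inner (R r (R r x)) y\<bar> \<le> norm (R r x) * norm (R' r y)"
        using adj[OF r] Cauchy_Schwarz_ineq2 by metis
      also have "2 * \<dots> \<le> (norm (R r x))\<^sup>2 + (norm (R' r y))\<^sup>2"
        using sum_squares_bound[of "norm (R r x)" "norm (R' r y)"] by simp
      also have "(norm (R' r y))\<^sup>2 \<le> inner (R r y) y"
        using R'.inner_R_ge[OF r, of y] adj[OF r, of y y] by (simp add: inner_commute)
      also have "(norm (R r x))\<^sup>2 \<le> inner (R r x) x" by (rule R.inner_R_ge[OF r])
      finally have "\<bar>inner (R r (R r x)) y\<bar> \<le> (1/2) * (inner (R r x) x + inner (R r y) y)" by simp
      from mult_left_mono[OF this, of "r powr p"] show ?thesis using r by (simp add: abs_mult algebra_simps)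
    qed simp
  qed
  also have "\<dots> = (1/2) * (c1 * inner (W x) x + c1 * inner (W y) y)"
    using g by (simp only: has_bochner_integral_iff)
  finally show ?thesis using c by (simp add: field_simps)
qed

text \<open>With \<open>b = - \<mu> W g\<close> the equation \<open>h = g + \<mu>\<^sup>2 W (W g)\<close> is the complex equation
  \<open>(1 + i \<mu> W) (g + i b) = h\<close>, and the sector bound keeps \<open>1 + i \<mu> W\<close> away from zero.\<close>

lemma sector_coercive:
  fixes W :: "'h::real_inner \<Rightarrow> 'h"
  assumes W: "linear W" and K: "K \<ge> 0" and \<mu>: "\<mu> \<ge> 0"
    and sector: "\<And>x y. \<bar>inner (W x) y\<bar> \<le> K * (inner (W x) x + inner (W y) y)"
  shows "norm g \<le> (1 + 2 * K) * norm (g + \<mu>\<^sup>2 *\<^sub>R W (W g))"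
proof -
  define b where "b = (- \<mu>) *\<^sub>R W g"
  define h where "h = g + \<mu>\<^sup>2 *\<^sub>R W (W g)"
  \<comment> \<open>The norm of the complex vector g + i b.\<close>
  define \<rho> where "\<rho> = sqrt ((norm g)\<^sup>2 + (norm b)\<^sup>2)"
  have h: "h = g - \<mu> *\<^sub>R W b" by (simp add: h_def b_def linear_scale[OF W] linear_neg[OF W] power2_eq_square)
  \<comment> \<open>Pairing h with b yields, up to the sign, \<mu> times the sum of forms on the
    right of the sector bound.\<close>
  have hb: "inner h b = - \<mu> * (inner (W g) g + inner (W b) b)"
    unfolding h by (simp add: inner_diff b_def inner_commute algebra_simps)
  have ha: "inner h g = (norm g)\<^sup>2 - \<mu> * inner (W b) g"
    unfolding h by (simp add: inner_diff power2_norm_eq_inner)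
  have bb: "(norm b)\<^sup>2 = - \<mu> * inner (W g) b"
    unfolding power2_norm_eq_inner by (simp add: b_def)
  \<comment> \<open>What remains beside (h, g) is the skew part of W, which the sector bound
    replaces by a multiple of - (h, b).\<close>
  have "(norm g)\<^sup>2 + (norm b)\<^sup>2 = inner h g + \<mu> * (inner (W b) g - inner (W g) b)"
    using ha bb by (simp add: algebra_simps)
  also have "inner (W b) g - inner (W g) b \<le> 2 * (K * (inner (W g) g + inner (W b) b))"
    using sector[of b g] sector[of g b] by (simp add: add.commute)
  finally have "(norm g)\<^sup>2 + (norm b)\<^sup>2 \<le> inner h g + \<mu> * (2 * (K * (inner (W g) g + inner (W b) b)))"
    using \<mu> by (simp add: mult_left_mono)
  also have "\<dots> = inner h g - 2 * K * inner h b" unfolding hb by simp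
  also have "\<dots> \<le> norm h * norm g + 2 * K * (norm h * norm b)"
  proof -
    have "- inner h b \<le> norm h * norm b" using Cauchy_Schwarz_ineq2[of h b] by linarith
    then have "2 * K * - inner h b \<le> 2 * K * (norm h * norm b)" using K by (intro mult_left_mono) auto
    moreover have "inner h g \<le> norm h * norm g" by (rule norm_cauchy_schwarz)
    ultimately show ?thesis by (simp add: algebra_simps)
  qed
  also have "\<dots> \<le> norm h * \<rho> + 2 * K * (norm h * \<rho>)"
    using K by (intro add_mono mult_left_mono) (auto simp: \<rho>_def real_le_rsqrt)
  finally have "\<rho>\<^sup>2 \<le> (1 + 2 * K) * norm h * \<rho>"
    by (simp add: \<rho>_def algebra_simps)
  then have "\<rho> \<le> (1 + 2 * K) * norm h"
  proof (cases "\<rho> = 0")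
    case True
    then show ?thesis using K by simp
  next
    case False
    moreover have "\<rho> \<ge> 0" by (simp add: \<rho>_def)
    ultimately have "\<rho> > 0" by simp
    moreover assume "\<rho>\<^sup>2 \<le> (1 + 2 * K) * norm h * \<rho>"
    ultimately show ?thesis by (simp add: power2_eq_square)
  qed
  moreover have "norm g \<le> \<rho>" by (simp add: \<rho>_def real_le_rsqrt)
  ultimately show ?thesis by (simp add: h_def)
qed

section \<open>Test functions on an interval\<close>

text \<open>Polynomials in 1 / x times exp (- 1 / x), extended by zero. The family is closed under
  differentiation, also at the origin, which proves smoothness without formulas for the higher
  derivatives.\<close>

definition flat :: "real poly \<Rightarrow> real \<Rightarrow> real" where
  "flat p x = (if x > 0 then poly p (1 / x) * exp (- (1 / x)) else 0)"

lemma poly_exp_tendsto_0: "((\<lambda>t. poly p t * exp (- t)) \<longlongrightarrow> (0::real)) at_top"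
proof -
  have "((\<lambda>t. \<Sum>i\<le>degree p. poly.coeff p i * (t ^ i / exp t)) \<longlongrightarrow> (\<Sum>i\<le>degree p. poly.coeff p i * 0)) at_top"
    by (intro tendsto_intros tendsto_power_div_exp_0)
  moreover have "(\<lambda>t. \<Sum>i\<le>degree p. poly.coeff p i * (t ^ i / exp t)) = (\<lambda>t. poly p t * exp (- t))"
    by (simp add: poly_altdef sum_distrib_right exp_minus divide_inverse mult.assoc fun_eq_iff)
  ultimately show ?thesis by simp
qed

lemma flat_tendsto_0: "(flat p \<longlongrightarrow> 0) (at 0)"
proof -
  have "((\<lambda>x. poly p (1 / x) * exp (- (1 / x))) \<longlongrightarrow> 0) (at_right (0::real))"
    using filterlim_compose[OF poly_exp_tendsto_0[of p] filterlim_inverse_at_top_right]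
    by (simp add: inverse_eq_divide)
  then have "(flat p \<longlongrightarrow> 0) (at_right 0)"
    by (rule Lim_transform_eventually) (auto simp: flat_def eventually_at_right_less intro: eventually_mono[OF eventually_at_right_less])
  moreover have "(flat p \<longlongrightarrow> 0) (at_left 0)"
    by (rule tendsto_eventually) (auto simp: flat_def eventually_at_filter)
  ultimately show ?thesis by (simp add: filterlim_at_split)
qed

lemma flat_deriv: "\<exists>q. \<forall>x. (flat p has_real_derivative flat q x) (at x)"
\<comment> \<open>The chain rule contributes the factor 1 / x^2, which multiplies the polynomial by
  the square of its variable.\<close>
proof (rule exI[of _ "monom 1 2 * (p - pderiv p)"], rule allI)
  fix x :: real
  let ?q = "monom 1 2 * (p - pderiv p)"
  consider "x > 0" | "x < 0" | "x = 0" by linarith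
  then show "(flat p has_real_derivative flat ?q x) (at x)"
  proof cases
    case 1
    have "((\<lambda>x. poly p (1 / x) * exp (- (1 / x))) has_real_derivative flat ?q x) (at x)"
      using 1 by (auto intro!: derivative_eq_intros simp: flat_def poly_monom field_simps power2_eq_square)
    then show ?thesis
      by (rule has_field_derivative_transform_within_open[of _ _ _ "{0<..}"]) (use 1 in \<open>auto simp: flat_def\<close>)
  next
    case 2
    have "((\<lambda>x. 0) has_real_derivative flat ?q x) (at x)" using 2 by (auto simp: flat_def)
    then show ?thesis
      by (rule has_field_derivative_transform_within_open[of _ _ _ "{..<0}"]) (use 2 in \<open>auto simp: flat_def\<close>)
  next
    case 3
    \<comment> \<open>Dividing by y multiplies the polynomial in 1 / y by its variable, so the
      difference quotient at 0 belongs to the family again and tends to 0.\<close>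
    have "(\<lambda>y. (flat p y - flat p 0) / (y - 0)) = flat (pCons 0 p)"
      by (auto simp: flat_def fun_eq_iff)
    then show ?thesis unfolding 3 has_field_derivative_iff
      using flat_tendsto_0[of "pCons 0 p"] by (simp add: flat_def)
  qed
qed

text \<open>Closed under sums because the product rule turns one product of flat functions into two;
  m is the steepness of both edges.\<close>

inductive_set bumps :: "real \<Rightarrow> real \<Rightarrow> real \<Rightarrow> (real \<Rightarrow> real) set" for m a b where
  base: "(\<lambda>x. c * (flat p (m * (x - a)) * flat q (m * (b - x)))) \<in> bumps m a b"
| add: "f \<in> bumps m a b \<Longrightarrow> g \<in> bumps m a b \<Longrightarrow> (\<lambda>x. f x + g x) \<in> bumps m a b"

lemma bumps_deriv: "f \<in> bumps m a b \<Longrightarrow> \<exists>g\<in>bumps m a b. \<forall>x. (f has_real_derivative g x) (at x)"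
proof (induction rule: bumps.induct)
  case (base c p q)
  obtain p' q' where p': "\<And>x. (flat p has_real_derivative flat p' x) (at x)"
    and q': "\<And>x. (flat q has_real_derivative flat q' x) (at x)" using flat_deriv by metis
  have "(\<lambda>x. c * m * (flat p' (m * (x - a)) * flat q (m * (b - x))) + (- c * m) * (flat p (m * (x - a)) * flat q' (m * (b - x)))) \<in> bumps m a b"
    by (intro bumps.intros)
  moreover have "((\<lambda>x. c * (flat p (m * (x - a)) * flat q (m * (b - x)))) has_real_derivative
     c * m * (flat p' (m * (x - a)) * flat q (m * (b - x))) + (- c * m) * (flat p (m * (x - a)) * flat q' (m * (b - x)))) (at x)" for x
  proof -
    have a: "((\<lambda>x. flat p (m * (x - a))) has_real_derivative flat p' (m * (x - a)) * m) (at x)"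
      by (rule DERIV_chain2[OF p']) (auto intro!: derivative_eq_intros)
    have b: "((\<lambda>x. flat q (m * (b - x))) has_real_derivative flat q' (m * (b - x)) * (- m)) (at x)"
      by (rule DERIV_chain2[OF q']) (auto intro!: derivative_eq_intros)
    from DERIV_cmult[OF DERIV_mult[OF a b], of c] show ?thesis by (simp add: algebra_simps)
  qed
  ultimately show ?case by (intro bexI[of _ "\<lambda>x. c * m * (flat p' (m * (x - a)) * flat q (m * (b - x))) + (- c * m) * (flat p (m * (x - a)) * flat q' (m * (b - x)))"]) auto
next
  case (add f g)
  then obtain f' g' where "f' \<in> bumps m a b" "\<And>x. (f has_real_derivative f' x) (at x)"
    "g' \<in> bumps m a b" "\<And>x. (g has_real_derivative g' x) (at x)" by blast
  then show ?case by (intro bexI[of _ "\<lambda>x. f' x + g' x"]) (auto intro: bumps.intros derivative_intros)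
qed

lemma bumps_support: "f \<in> bumps m a b \<Longrightarrow> m > 0 \<Longrightarrow> x \<notin> {a<..<b} \<Longrightarrow> f x = 0"
proof (induction rule: bumps.induct)
  case (base c p q)
  then consider "x - a \<le> 0" | "b - x \<le> 0" by fastforce
  then show ?case
  proof cases
    case 1
    then have "\<not> 0 < m * (x - a)" using base by (simp add: not_less mult_le_0_iff)
    then show ?thesis by (simp add: flat_def)
  next
    case 2
    then have "\<not> 0 < m * (b - x)" using base by (simp add: not_less mult_le_0_iff)
    then show ?thesis by (simp add: flat_def)
  qed
qed simp

lemma partial_real: "(f has_real_derivative D) (at x) \<Longrightarrow> partial 1 f x = D"
  unfolding partial_def
  by (subst frechet_derivative_at[symmetric, of f "\<lambda>h. D * h"]) (auto simp: has_field_derivative_def mult_commute_abs)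

text \<open>A coinductive principle: in a class closed under differentiation every iterated partial
  derivative stays in the class and is therefore differentiable. On the real line the only basis
  vector is 1.\<close>

lemma smooth_real_induct:
  assumes "f \<in> F" and F: "\<And>f. f \<in> F \<Longrightarrow> \<exists>g\<in>F. \<forall>x. (f has_real_derivative g x) (at x)"
  shows "smooth f"
  unfolding smooth_def
proof (intro allI impI)
  fix bs :: "real list" assume "set bs \<subseteq> Basis"
  then have "foldr partial bs f \<in> F"
  proof (induction bs)
    case (Cons b bs)
    then obtain g where g: "g \<in> F" "\<forall>x. (foldr partial bs f has_real_derivative g x) (at x)" 
      using F[of "foldr partial bs f"] by force
    moreover have "partial b (foldr partial bs f) = g" using Cons.prems g partial_real by (auto simp: fun_eq_iff)
    ultimately show ?case by simp
  qed (use assms in simp)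
  from F[OF this] show "foldr partial bs f differentiable_on UNIV"
    by (auto simp: differentiable_on_def real_differentiable_def)
qed

lemma test_functionsI:
  assumes "smooth f" "\<And>x. x \<notin> {a..b} \<Longrightarrow> f x = 0" "0 < a" "b < T"
  shows "f \<in> test_functions {0<..<T::real}"
proof -
  have sub: "closure {x. f x \<noteq> 0} \<subseteq> {a..b}"
    by (rule closure_minimal) (use assms(2) in blast, simp)
  then have "bounded {x. f x \<noteq> 0}"
    using bounded_subset[OF bounded_closed_interval[of a b]] closure_subset by blast
  then show ?thesis unfolding test_functions_def using sub assms by auto
qed

lemma test_functionsE:
  assumes "f \<in> test_functions {0<..<T::real}" "T > 0"
  obtains a b where "0 < a" "a < b" "b < T" "\<And>x. x \<notin> {a..b} \<Longrightarrow> f x = 0"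
proof (cases "closure {x. f x \<noteq> 0} = {}")
  case True
  then have "{x. f x \<noteq> 0} = {}" by (simp add: closure_eq_empty)
  then show ?thesis using that[of "T/3" "T/2"] assms by auto
next
  case False
  let ?S = "closure {x. f x \<noteq> 0}"
  have c: "compact ?S" "?S \<subseteq> {0<..<T}" using assms by (auto simp: test_functions_def)
  obtain u where u: "u \<in> ?S" "\<And>x. x \<in> ?S \<Longrightarrow> u \<le> x" using compact_attains_inf[OF c(1) False] by blast
  obtain v where v: "v \<in> ?S" "\<And>x. x \<in> ?S \<Longrightarrow> x \<le> v" using compact_attains_sup[OF c(1) False] by blast
  have uv: "0 < u" "u \<le> v" "v < T" 
  proof -
    have "u \<in> {0<..<T}" "v \<in> {0<..<T}" using u(1) v(1) c(2) by blast+
    then show "0 < u" "u \<le> v" "v < T" using v(2)[OF u(1)] by simp_all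
  qed
  \<comment> \<open>The right end lies strictly beyond v, so that the interval is nondegenerate even
    if u = v.\<close>
  have "f x = 0" if "x \<notin> {u..(v + T) / 2}" for x
  proof (rule ccontr)
    assume "f x \<noteq> 0"
    then have "x \<in> ?S" using closure_subset[of "{x. f x \<noteq> 0}"] by auto
    from u(2)[OF this] v(2)[OF this] show False using uv that by auto
  qed
  moreover have "0 < u" "u < (v + T) / 2" "(v + T) / 2 < T" using uv by auto
  ultimately show ?thesis using that[of u "(v + T) / 2"] by blast
qed

lemma smooth_realD:
  assumes "smooth (f :: real \<Rightarrow> real)"
  shows "(f has_real_derivative deriv f x) (at x)" "smooth (deriv f)"
proof -
  have d: "(f has_real_derivative deriv f x) (at x)" if "smooth f" for f :: "real \<Rightarrow> real" and x
    using that[unfolded smooth_def, rule_format, of "[]"]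
    by (auto simp: differentiable_on_def real_differentiable_def DERIV_deriv_iff_real_differentiable)
  show "(f has_real_derivative deriv f x) (at x)" by (rule d[OF assms])
  have "partial 1 f = deriv f" using partial_real[OF d[OF assms]] by auto
  then show "smooth (deriv f)"
    unfolding smooth_def
  proof (intro allI impI)
    fix bs :: "real list" assume "set bs \<subseteq> Basis"
    then have "foldr partial (bs @ [1]) f differentiable_on UNIV"
      using assms unfolding smooth_def by (intro assms[unfolded smooth_def, rule_format]) auto
    then show "foldr partial bs (deriv f) differentiable_on UNIV" using \<open>partial 1 f = deriv f\<close> by simp
  qed
qed

lemma smooth_antideriv:
  assumes "smooth f" "\<And>x. (g has_real_derivative f x) (at x)"
  shows "smooth g"
  unfolding smooth_def
proof (intro allI impI)
  fix bs :: "real list" assume bs: "set bs \<subseteq> Basis"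
  show "foldr partial bs g differentiable_on UNIV"
  proof (cases bs rule: rev_cases)
    case Nil
    then show ?thesis using assms(2) by (auto simp: differentiable_on_def real_differentiable_def)
  next
    case (snoc cs c)
    then have "partial c g = f" using bs partial_real[OF assms(2)] by auto
    then show ?thesis using assms(1) bs snoc by (simp add: smooth_def)
  qed
qed

lemma test_deriv:
  assumes "f \<in> test_functions {0<..<T::real}" "T > 0"
  shows "deriv f \<in> test_functions {0<..<T}"
proof -
  obtain a b where ab: "0 < a" "a < b" "b < T" "\<And>x. x \<notin> {a..b} \<Longrightarrow> f x = 0" using test_functionsE[OF assms] by blast
  have s: "smooth f" using assms by (simp add: test_functions_def)
  show ?thesis
  proof (rule test_functionsI[OF smooth_realD(2)[OF s] _ ab(1) ab(3)])
    fix x assume x: "x \<notin> {a..b}"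
    have "((\<lambda>x. 0) has_real_derivative 0) (at x)" by simp
    then have "(f has_real_derivative 0) (at x)"
      by (rule has_field_derivative_transform_within_open[of _ _ _ "- {a..b}"]) (use x ab(4) in auto)
    then show "deriv f x = 0" by (rule DERIV_imp_deriv)
  qed
qed

lemma smooth_cont: "smooth (f :: real \<Rightarrow> real) \<Longrightarrow> continuous_on S f"
  by (meson DERIV_continuous_on smooth_realD(1) has_field_derivative_at_within)

lemma test_smooth: "f \<in> test_functions S \<Longrightarrow> smooth f" by (simp add: test_functions_def)

lemma smooth_lin:
  assumes "smooth (f :: real \<Rightarrow> real)" "smooth g"
  shows "smooth (\<lambda>x. f x + c * g x)"
proof (rule smooth_real_induct[of _ "{h. \<exists>f g. smooth f \<and> smooth g \<and> h = (\<lambda>x. f x + c * g x)}"])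
  show "(\<lambda>x. f x + c * g x) \<in> {h. \<exists>f g. smooth f \<and> smooth g \<and> h = (\<lambda>x. f x + c * g x)}" using assms by blast
  fix h :: "real \<Rightarrow> real" assume "h \<in> {h. \<exists>f g. smooth f \<and> smooth g \<and> h = (\<lambda>x. f x + c * g x)}"
  then obtain f g where fg: "smooth f" "smooth g" "h = (\<lambda>x. f x + c * g x)" by blast
  then show "\<exists>h'\<in>{h. \<exists>f g. smooth f \<and> smooth g \<and> h = (\<lambda>x. f x + c * g x)}. \<forall>x. (h has_real_derivative h' x) (at x)"
    by (intro bexI[of _ "\<lambda>x. deriv f x + c * deriv g x"])
       (auto intro!: derivative_eq_intros smooth_realD intro: exI[of _ "deriv f"])
qed

lemma test_bounded:
  assumes "f \<in> test_functions {0<..<T::real}" "T > 0"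
  obtains B where "\<And>x. \<bar>f x\<bar> \<le> B"
proof -
  obtain a b where ab: "0 < a" "a < b" "b < T" "\<And>x. x \<notin> {a..b} \<Longrightarrow> f x = 0" using test_functionsE[OF assms] by blast
  have "continuous_on {a..b} f" by (rule smooth_cont[OF test_smooth[OF assms(1)]])
  then have "bounded (f ` {a..b})" by (intro compact_imp_bounded compact_continuous_image) auto
  then obtain B where "\<forall>y\<in>f ` {a..b}. norm y \<le> B" unfolding bounded_iff by blast
  then have B: "\<And>x. x \<in> {a..b} \<Longrightarrow> \<bar>f x\<bar> \<le> B" by simp
  have "\<bar>f x\<bar> \<le> max B 0" for x using B[of x] ab(4)[of x] by (cases "x \<in> {a..b}") auto
  then show ?thesis using that by blast
qed

lemma test_measurable: "f \<in> test_functions S \<Longrightarrow> f \<in> borel_measurable (borel::real measure)"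
  by (intro borel_measurable_continuous_onI smooth_cont test_smooth)

lemma finite_measure_mon: "finite_measure (mon {0<..<T::real})"
  by (rule finite_measureI, cases "0 \<le> T") (simp_all add: emeasure_restrict_space space_restrict_space)

lemma L2_bounded_mon:
  assumes "f \<in> borel_measurable (mon {0<..<T::real})" "\<And>x. x \<in> {0<..<T} \<Longrightarrow> \<bar>f x\<bar> \<le> B"
  shows "f \<in> L2 (mon {0<..<T})"
proof -
  interpret finite_measure "mon {0<..<T}" by (rule finite_measure_mon)
  show ?thesis
    unfolding L2_def using assms
    by (auto intro!: integrable_const_bound[of _ "B\<^sup>2"] AE_I2 simp: space_restrict_space abs_le_square_iff[symmetric])
       (meson abs_ge_self order_trans)
qed

lemma test_L2:
  assumes "f \<in> test_functions {0<..<T::real}" "T > 0"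
  shows "f \<in> L2 (mon {0<..<T})"
proof -
  obtain B where "\<And>x. \<bar>f x\<bar> \<le> B" using test_bounded[OF assms] by blast
  then show ?thesis
    using test_measurable[OF assms(1)] by (intro L2_bounded_mon[of _ _ B]) (auto intro: measurable_restrict_space1)
qed

lemma L2_integrable_mon: "f \<in> L2 (mon {0<..<T::real}) \<Longrightarrow> integrable (mon {0<..<T}) f"
  using L2_mult_integrable[of f "mon {0<..<T}" "\<lambda>x. 1"] L2_bounded_mon[of "\<lambda>x. 1" T 1] by simp

text \<open>Bounded by 1 and tending pointwise to the indicator of the open interval as n grows, so
  that dominated convergence passes from test functions to indicators.\<close>

definition bump :: "nat \<Rightarrow> real \<Rightarrow> real \<Rightarrow> real \<Rightarrow> real" where
  "bump n a b x = flat 1 (real (Suc n) * (x - a)) * flat 1 (real (Suc n) * (b - x))"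

lemma bump_test: "0 < a \<Longrightarrow> b < T \<Longrightarrow> bump n a b \<in> test_functions {0<..<T}"
proof -
  assume ab: "0 < a" "b < T"
  have "(\<lambda>x. 1 * (flat 1 (real (Suc n) * (x - a)) * flat 1 (real (Suc n) * (b - x)))) \<in> bumps (real (Suc n)) a b"
    by (rule bumps.base)
  then have B: "bump n a b \<in> bumps (real (Suc n)) a b" by (simp add: bump_def[abs_def])
  show ?thesis
  proof (rule test_functionsI[OF _ _ ab])
    show "smooth (bump n a b)" by (rule smooth_real_induct[OF B bumps_deriv])
    show "bump n a b x = 0" if "x \<notin> {a..b}" for x
      by (rule bumps_support[OF B]) (use that in auto)
  qed
qed

lemma bump_bounds: "0 \<le> bump n a b x" "bump n a b x \<le> 1"
  by (auto simp: bump_def flat_def intro!: mult_le_one)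

lemma bump_pos: "x \<in> {a<..<b} \<Longrightarrow> 0 < bump n a b x"
  by (simp add: bump_def flat_def)

lemma bump_tendsto: "(\<lambda>n. bump n a b x) \<longlonglongrightarrow> indicator {a<..<b} x"
proof (cases "x \<in> {a<..<b}")
  case True
  have l: "(\<lambda>n. 1 / (real (Suc n) * y)) \<longlonglongrightarrow> 0" for y :: real
    using tendsto_mult_right[OF LIMSEQ_inverse_real_of_nat, of "1 / y"] by (simp add: divide_inverse)
  have "(\<lambda>n. exp (- (1 / (real (Suc n) * (x - a)))) * exp (- (1 / (real (Suc n) * (b - x))))) \<longlonglongrightarrow> exp (- 0) * exp (- 0)"
    by (intro tendsto_intros l)
  moreover have "bump n a b x = exp (- (1 / (real (Suc n) * (x - a)))) * exp (- (1 / (real (Suc n) * (b - x))))" for n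
    using True by (simp add: bump_def flat_def)
  ultimately show ?thesis using True by simp
next
  case False
  have "bump n a b x = 0" for n
    using False by (auto simp: bump_def flat_def zero_less_mult_iff)
  then show ?thesis using False by simp
qed

text \<open>Approximating indicators by bumps shows that w integrates to zero over all intervals
  inside (0,T), hence over all half-lines. The measures with the positive and the negative part of w
  as densities then agree, so the densities do.\<close>

lemma test_functions_separating:
  fixes T :: real
  assumes w: "w \<in> L2 (mon {0<..<T})" and T: "T > 0"
    and 0: "\<And>\<psi>. \<psi> \<in> test_functions {0<..<T} \<Longrightarrow> ip (mon {0<..<T}) w \<psi> = 0"
  shows "AE t in mon {0<..<T}. w t = 0"
proof -
  let ?M = "mon {0<..<T}"
  have int: "integrable ?M w" by (rule L2_integrable_mon[OF w])
  define W where "W t = indicator {0<..<T} t * w t" for t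
  have W: "integrable lborel W"
    using int by (simp add: integrable_restrict_space W_def[abs_def])
  have [measurable]: "w \<in> borel_measurable ?M" "W \<in> borel_measurable borel"
    using w W by (auto simp: L2_def)
  have z: "(\<integral>t. W t * indicator {a<..<b} t \<partial>lborel) = 0" if ab: "0 < a" "b < T" for a b
  proof -
    have "(\<lambda>n. \<integral>t. w t * bump n a b t \<partial>?M) \<longlonglongrightarrow> (\<integral>t. w t * indicator {a<..<b} t \<partial>?M)"
    proof (rule integral_dominated_convergence[where w = "\<lambda>t. \<bar>w t\<bar>"])
      show "(\<lambda>t. w t * bump n a b t) \<in> borel_measurable ?M" for n
        by (intro borel_measurable_times L2_measurable[OF w] measurable_restrict_space1)
           (simp add: test_measurable[OF bump_test[OF ab]])
      show "AE t in ?M. norm (w t * bump n a b t) \<le> \<bar>w t\<bar>" for n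
        using bump_bounds[of n a b] by (auto simp: abs_mult intro!: mult_left_le)
      show "AE t in ?M. (\<lambda>n. w t * bump n a b t) \<longlonglongrightarrow> w t * indicator {a<..<b} t"
        by (intro AE_I2 tendsto_intros bump_tendsto)
      show "(\<lambda>t. w t * indicator {a<..<b} t) \<in> borel_measurable ?M"
        by (intro borel_measurable_times L2_measurable[OF w] measurable_restrict_space1) simp
    qed (use int in auto)
    moreover have "(\<integral>t. w t * bump n a b t \<partial>?M) = 0" for n
      using 0[OF bump_test[OF ab]] by (simp add: ip_def)
    ultimately have "(\<integral>t. w t * indicator {a<..<b} t \<partial>?M) = 0" using LIMSEQ_unique[of "\<lambda>n. 0"] by auto
    then show ?thesis by (simp add: integral_restrict_space W_def mult.assoc)
  qed
  have z2: "(\<integral>t. W t * indicator {x<..} t \<partial>lborel) = 0" for x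
  proof -
    \<comment> \<open>The left ends stay positive and the right ends stay below T, as the bumps
      require.\<close>
    define a where "a n = max x 0 + inverse (real (Suc n))" for n
    define b where "b n = T - inverse (real (Suc n))" for n
    have i0: "(\<lambda>n. inverse (real (Suc n))) \<longlonglongrightarrow> 0" by (rule LIMSEQ_inverse_real_of_nat)
    have la: "a \<longlonglongrightarrow> max x 0" unfolding a_def using tendsto_add[OF tendsto_const i0, of "max x 0"] by simp
    have lb: "b \<longlonglongrightarrow> T" unfolding b_def using tendsto_diff[OF tendsto_const i0, of T] by simp
    have "(\<lambda>n. \<integral>t. W t * indicator {a n<..<b n} t \<partial>lborel) \<longlonglongrightarrow> (\<integral>t. W t * indicator {x<..} t \<partial>lborel)"
    proof (rule integral_dominated_convergence[where w = "\<lambda>t. \<bar>W t\<bar>"])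
      show "AE t in lborel. (\<lambda>n. W t * indicator {a n<..<b n} t) \<longlonglongrightarrow> W t * indicator {x<..} t"
      proof (rule AE_I2)
        fix t
        show "(\<lambda>n. W t * indicator {a n<..<b n} t) \<longlonglongrightarrow> W t * indicator {x<..} t"
        proof (cases "t \<in> {0<..<T} \<and> x < t")
          case True
          then have "eventually (\<lambda>n. a n < t) sequentially" "eventually (\<lambda>n. t < b n) sequentially"
            using order_tendstoD(2)[OF la, of t] order_tendstoD(1)[OF lb, of t] by auto
          then have "eventually (\<lambda>n. W t * indicator {a n<..<b n} t = W t * indicator {x<..} t) sequentially"
            by eventually_elim (use True in auto)
          then show ?thesis by (rule tendsto_eventually)
        next
          case False
          have "a n > max x 0" for n by (simp add: a_def)
          then have "W t * indicator {a n<..<b n} t = W t * indicator {x<..} t" for n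
            using False by (auto simp: W_def indicator_def) (metis less_trans max.strict_boundedE)
          then show ?thesis by (simp only: tendsto_const)
        qed
      qed
    qed (use W in \<open>auto simp: abs_mult indicator_def\<close>)
    moreover have "(\<integral>t. W t * indicator {a n<..<b n} t \<partial>lborel) = 0" for n
      by (rule z) (auto simp: a_def b_def add_nonneg_pos)
    ultimately show ?thesis using LIMSEQ_unique[of "\<lambda>n. 0"] by auto
  qed
  \<comment> \<open>\<open>ennreal\<close> cuts off negative values, so the two densities are the
    positive and the negative part of W.\<close>
  have "density lborel (\<lambda>t. ennreal (W t)) = density lborel (\<lambda>t. ennreal (- W t))"
  proof (rule measure_eqI_lessThan)
    fix x :: real
    have pI: "integrable lborel (\<lambda>t. max 0 (W t) * indicator {x<..} t)" "integrable lborel (\<lambda>t. max 0 (- W t) * indicator {x<..} t)"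
      by (rule Bochner_Integration.integrable_bound[OF W]; auto simp: indicator_def)+
    have e1: "emeasure (density lborel (\<lambda>t. ennreal (W t))) {x<..} = ennreal (\<integral>t. max 0 (W t) * indicator {x<..} t \<partial>lborel)"
      by (subst nn_integral_eq_integral[OF pI(1), symmetric])
         (auto simp: emeasure_density ennreal_mult max_def ennreal_neg indicator_def intro!: nn_integral_cong)
    have e2: "emeasure (density lborel (\<lambda>t. ennreal (- W t))) {x<..} = ennreal (\<integral>t. max 0 (- W t) * indicator {x<..} t \<partial>lborel)"
      by (subst nn_integral_eq_integral[OF pI(2), symmetric])
         (auto simp: emeasure_density ennreal_mult max_def ennreal_neg indicator_def intro!: nn_integral_cong)
    show "emeasure (density lborel (\<lambda>t. ennreal (W t))) {x<..} < \<infinity>" unfolding e1 by simp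
    have "(\<integral>t. max 0 (W t) * indicator {x<..} t \<partial>lborel) - (\<integral>t. max 0 (- W t) * indicator {x<..} t \<partial>lborel) =
       (\<integral>t. max 0 (W t) * indicator {x<..} t - max 0 (- W t) * indicator {x<..} t \<partial>lborel)"
      by (rule Bochner_Integration.integral_diff[OF pI, symmetric])
    also have "\<dots> = (\<integral>t. W t * indicator {x<..} t \<partial>lborel)"
      by (intro Bochner_Integration.integral_cong) (auto simp: max_def indicator_def)
    finally show "emeasure (density lborel (\<lambda>t. ennreal (W t))) {x<..} = emeasure (density lborel (\<lambda>t. ennreal (- W t))) {x<..}"
      unfolding e1 e2 z2 by simp
  qed auto
  then have "AE t in lborel. ennreal (W t) = ennreal (- W t)"
    by (intro sigma_finite_measure.density_unique[OF sigma_finite_lborel]) auto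
  then have "AE t in lborel. W t = 0"
    by (rule AE_mp, intro AE_I2 impI) (metis ennreal_eq_0_iff ennreal_neg linorder_linear neg_0_le_iff_le order_antisym neg_le_0_iff_le)
  then show ?thesis
    by (subst AE_restrict_space_iff) (auto simp: W_def elim!: AE_mp)
qed

text \<open>A test function with integral zero is the derivative of a test function. Subtracting
  from \<psi> the right multiple of one fixed bump makes its integral zero; the constant is the mean
  of v weighted by that bump.\<close>

lemma du_Bois_Reymond:
  fixes T :: real
  assumes v: "v \<in> L2 (mon {0<..<T})" and T: "T > 0"
    and 0: "\<And>\<psi>. \<psi> \<in> test_functions {0<..<T} \<Longrightarrow> ip (mon {0<..<T}) v (deriv \<psi>) = 0"
  shows "\<exists>c. AE t in mon {0<..<T}. v t = c"
proof -
  let ?M = "mon {0<..<T}"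
  define \<eta>0 where "\<eta>0 = bump 0 (T/4) (T/2)"
  have e0: "\<eta>0 \<in> test_functions {0<..<T}" unfolding \<eta>0_def by (rule bump_test) (use T in auto)
  define I where "I f = (\<integral>t. f t \<partial>?M)" for f :: "real \<Rightarrow> real"
  have int_test: "integrable ?M \<psi>" if "\<psi> \<in> test_functions {0<..<T}" for \<psi>
    using L2_integrable_mon[OF test_L2[OF that T]] .
  have Ipos: "I \<eta>0 \<noteq> 0"
  proof
    assume "I \<eta>0 = 0"
    then have "AE t in ?M. \<eta>0 t = 0"
      using integral_nonneg_eq_0_iff_AE[OF int_test[OF e0]] bump_bounds by (auto simp: I_def \<eta>0_def)
    then have "AE t in lborel. t \<notin> {T/4<..<T/2}"
    proof (subst (asm) AE_restrict_space_iff, simp, elim AE_mp, intro AE_I2 impI notI)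
      fix t assume "t \<in> {0<..<T} \<longrightarrow> \<eta>0 t = 0" "t \<in> {T/4<..<T/2}"
      then show False using bump_pos[of t "T/4" "T/2" 0] T by (auto simp: \<eta>0_def)
    qed
    then have "emeasure lborel {t \<in> space lborel. \<not> t \<notin> {T/4<..<T/2}} = 0" by (subst (asm) AE_iff_null) (auto simp: null_sets_def)
    moreover have "{t \<in> space lborel. \<not> t \<notin> {T/4<..<T/2}} = {T/4<..<T/2}" by auto
    ultimately have "emeasure lborel {T/4<..<T/2} = 0" by (simp only:)
    then show False using T by simp
  qed
  define c where "c = ip ?M v \<eta>0 / I \<eta>0"
  have vc: "(\<lambda>t. v t - c) \<in> L2 ?M" by (rule L2_diff[OF v L2_bounded_mon[of _ _ "\<bar>c\<bar>"]]) auto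
  have "AE t in ?M. v t - c = 0"
  proof (rule test_functions_separating[OF vc T])
    fix \<psi> assume psi: "\<psi> \<in> test_functions {0<..<T}"
    define k where "k = I \<psi> / I \<eta>0"
    define f where "f t = \<psi> t + (- k) * \<eta>0 t" for t
    have fs: "smooth f" unfolding f_def[abs_def] by (intro smooth_lin test_smooth[OF psi] test_smooth[OF e0])
    obtain a1 b1 where 1: "0 < a1" "a1 < b1" "b1 < T" "\<And>x. x \<notin> {a1..b1} \<Longrightarrow> \<psi> x = 0" using test_functionsE[OF psi T] by blast
    obtain a2 b2 where 2: "0 < a2" "a2 < b2" "b2 < T" "\<And>x. x \<notin> {a2..b2} \<Longrightarrow> \<eta>0 x = 0" using test_functionsE[OF e0 T] by blast
    define a b where "a = min a1 a2" and "b = max b1 b2"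
    have ab: "0 < a" "a < b" "b < T"
      using 1 2 by (auto simp: a_def b_def)
    have f0: "f x = 0" if "x \<notin> {a..b}" for x
    proof -
      have "x \<notin> {a1..b1}" "x \<notin> {a2..b2}" using that by (auto simp: a_def b_def)
      then show ?thesis using 1(4) 2(4) by (simp add: f_def)
    qed
    have fc: "continuous_on S f" for S by (rule smooth_cont[OF fs])
    \<comment> \<open>An interval larger than [0,T] gives two-sided derivatives at 0 and T.\<close>
    obtain g where g: "\<And>x. x \<in> {-1..T+1} \<Longrightarrow> (g has_vector_derivative f x) (at x within {-1..T+1})"
      by (rule antiderivative_continuous[OF fc[of "{-1..T+1}"]]) (rule that)
    have gd: "(g has_real_derivative f x) (at x)" if "x \<in> {-1<..<T+1}" for x
    proof -
      have "(g has_vector_derivative f x) (at x within {-1<..<T+1})"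
        by (rule has_vector_derivative_within_subset[OF g]) (use that in auto)
      moreover have "at x within {-1<..<T+1} = at x" by (rule at_within_open) (use that in auto)
      ultimately show ?thesis by (simp add: has_real_derivative_iff_has_vector_derivative)
    qed
    have fL: "f \<in> test_functions {0<..<T}" by (rule test_functionsI[OF fs f0 ab(1) ab(3)])
    have "I f = I \<psi> - k * I \<eta>0"
      using int_test[OF psi] int_test[OF e0] by (simp add: I_def f_def)
    then have If: "I f = 0" using Ipos by (simp add: k_def)
    have "(\<integral>t. f t * indicator {0..T} t \<partial>lborel) = g T - g 0"
      by (rule integral_FTC_Icc_real) (use T gd fc[of UNIV] in \<open>auto simp: continuous_on_eq_continuous_at\<close>)
    moreover have "(\<integral>t. f t * indicator {0..T} t \<partial>lborel) = I f"
      unfolding I_def by (subst integral_restrict_space)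
        (auto intro!: Bochner_Integration.integral_cong simp: indicator_def f0 ab not_less, insert f0[of 0] f0[of T] ab, auto)
    ultimately have gT: "g T = g 0" using If by simp
    have gconst: "g y = g x" if "x \<le> y" "x \<in> {-1<..<T+1}" "y \<in> {-1<..<T+1}" "\<And>t. t \<in> {x<..<y} \<Longrightarrow> f t = 0" for x y
    proof (cases "x = y")
      case False
      then have "x < y" using that by simp
      show ?thesis
      proof (rule DERIV_isconst_end[OF \<open>x < y\<close>])
        show "continuous_on {x..y} g"
          by (rule continuous_at_imp_continuous_on, rule ballI, rule DERIV_isCont[OF gd]) (use that in auto)
        fix t assume t: "x < t" "t < y"
        then have "f t = 0" "t \<in> {-1<..<T+1}" using that by auto
        then show "(g has_real_derivative 0) (at t)" using gd[of t] by simp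
      qed
    qed simp
    \<comment> \<open>On its domain the antiderivative is constant on each side of [a,b], with equal
      values on both sides because f has integral zero; so it can be extended by zero without losing
      smoothness.\<close>
    define X where "X t = (if -1 < t \<and> t < T + 1 then g t - g 0 else 0)" for t
    have chi0: "X t = 0" if "t \<notin> {a..b}" for t
    proof -
      have "\<not> (a \<le> t \<and> t \<le> b)" using that by simp
      then have "-1 < t \<and> t \<le> 0 \<or> 0 < t \<and> t < a \<or> b < t \<and> t \<le> T \<or> T \<le> t \<and> t < T + 1 \<or> \<not> (-1 < t \<and> t < T + 1)"
        using ab by (smt (verit))
      then consider "t \<in> {-1<..0}" | "t \<in> {0<..<a}" | "t \<in> {b<..T}" | "t \<in> {T..<T+1}" | "t \<notin> {-1<..<T+1}"
        by fastforce
      then show ?thesis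
      proof cases
        case 1 then show ?thesis using gconst[of t 0] f0 ab by (auto simp: X_def)
      next
        case 2 then show ?thesis using gconst[of 0 t] f0 ab by (auto simp: X_def)
      next
        case 3 then show ?thesis using gconst[of t T] f0 ab gT by (auto simp: X_def)
      next
        case 4 then show ?thesis using gconst[of T t] f0 ab gT by (auto simp: X_def)
      qed (auto simp: X_def)
    qed
    have chid: "(X has_real_derivative f t) (at t)" for t
    proof (cases "t \<in> {-1<..<T+1}")
      case True
      have "((\<lambda>t. g t - g 0) has_real_derivative f t) (at t)" using gd[OF True] by (auto intro!: derivative_eq_intros)
      then show ?thesis
        by (rule has_field_derivative_transform_within_open[of _ _ _ "{-1<..<T+1}"]) (use True in \<open>auto simp: X_def\<close>)
    next
      case False
      then have t: "t \<notin> {a..b}" using ab by auto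
      have "((\<lambda>t. 0) has_real_derivative f t) (at t)" using f0[OF t] by simp
      then show ?thesis
        by (rule has_field_derivative_transform_within_open[of _ _ _ "- {a..b}"]) (use t chi0 in auto)
    qed
    have "X \<in> test_functions {0<..<T}"
      by (rule test_functionsI[OF smooth_antideriv[OF fs chid] chi0 ab(1) ab(3)])
    from 0[OF this] have "ip ?M v f = 0"
      using DERIV_imp_deriv[OF chid] by (simp add: ip_def)
    then have "ip ?M v \<psi> - k * ip ?M v \<eta>0 = 0"
      using L2_mult_integrable[OF v test_L2[OF psi T]] L2_mult_integrable[OF v test_L2[OF e0 T]]
      by (simp add: ip_def f_def algebra_simps mult.left_commute)
    moreover have "ip ?M (\<lambda>t. v t - c) \<psi> = ip ?M v \<psi> - c * I \<psi>"
      using L2_mult_integrable[OF v test_L2[OF psi T]] int_test[OF psi]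
      by (simp add: ip_def I_def algebra_simps)
    ultimately show "ip ?M (\<lambda>t. v t - c) \<psi> = 0" by (simp add: c_def k_def)
  qed
  then show ?thesis by (auto elim!: AE_mp)
qed

section \<open>Integral operators with nonnegative Schur kernels\<close>

text \<open>Nonnegativity is part of the notion because it lets operator identities be proved by
  Tonelli on nonnegative functions and then be extended by linearity. The last condition bounds row
  and column integrals.\<close>

definition schur :: "(real \<Rightarrow> real \<Rightarrow> real) \<Rightarrow> bool" where
  "schur \<kappa> \<longleftrightarrow> (\<lambda>(t, s). \<kappa> t s) \<in> borel_measurable (borel \<Otimes>\<^sub>M borel) \<and> (\<forall>t s. 0 \<le> \<kappa> t s) \<and>
     (\<exists>N::real. N \<ge> 0 \<and> (\<forall>t. (\<integral>\<^sup>+s. ennreal (\<kappa> t s) \<partial>lborel) \<le> ennreal N \<and> (\<integral>\<^sup>+s. ennreal (\<kappa> s t) \<partial>lborel) \<le> ennreal N))"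

definition iop :: "(real \<Rightarrow> real \<Rightarrow> real) \<Rightarrow> (real \<Rightarrow> real) \<Rightarrow> real \<Rightarrow> real" where
  "iop \<kappa> f t = (\<integral>s. \<kappa> t s * f s \<partial>lborel)"

definition transp :: "(real \<Rightarrow> real \<Rightarrow> real) \<Rightarrow> real \<Rightarrow> real \<Rightarrow> real" where
  "transp \<kappa> t s = \<kappa> s t"

lemma schur_meas:
  assumes "schur \<kappa>"
  shows "(\<lambda>x. \<kappa> (fst x) (snd x)) \<in> borel_measurable (borel \<Otimes>\<^sub>M borel)"
    and "f \<in> borel_measurable M \<Longrightarrow> g \<in> borel_measurable M \<Longrightarrow> (\<lambda>x. \<kappa> (f x) (g x)) \<in> borel_measurable M"
proof -
  have *: "(\<lambda>(t, s). \<kappa> t s) \<in> borel_measurable (borel \<Otimes>\<^sub>M borel)" using assms by (simp add: schur_def)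
  then show "(\<lambda>x. \<kappa> (fst x) (snd x)) \<in> borel_measurable (borel \<Otimes>\<^sub>M borel)" by (simp add: case_prod_beta')
  assume "f \<in> borel_measurable M" "g \<in> borel_measurable M"
  from measurable_compose[OF measurable_Pair[OF this] *]
  show "(\<lambda>x. \<kappa> (f x) (g x)) \<in> borel_measurable M" by simp
qed

lemma schur_nonneg: "schur \<kappa> \<Longrightarrow> 0 \<le> \<kappa> t s"
  by (simp add: schur_def)

lemma schur_transp: "schur \<kappa> \<Longrightarrow> schur (transp \<kappa>)"
  unfolding schur_def[of "transp \<kappa>"] transp_def case_prod_beta'
  using schur_meas(2)[of \<kappa> snd "borel \<Otimes>\<^sub>M borel" fst] by (auto simp: schur_def)

text \<open>Schur's test with constant weights: Cauchy-Schwarz uses the row bound, Tonelli the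
  column bound.\<close>

lemma schur_young:
  fixes f :: "real \<Rightarrow> ennreal"
  assumes "schur \<kappa>"
  obtains N :: real where "N \<ge> 0" "\<And>f. f \<in> borel_measurable borel \<Longrightarrow>
    (\<integral>\<^sup>+t. (\<integral>\<^sup>+s. ennreal (\<kappa> t s) * f s \<partial>lborel)\<^sup>2 \<partial>lborel) \<le> ennreal (N\<^sup>2) * (\<integral>\<^sup>+s. (f s)\<^sup>2 \<partial>lborel)"
proof -
  obtain N :: real where N: "N \<ge> 0" "\<And>t. (\<integral>\<^sup>+s. ennreal (\<kappa> t s) \<partial>lborel) \<le> ennreal N" "\<And>t. (\<integral>\<^sup>+s. ennreal (\<kappa> s t) \<partial>lborel) \<le> ennreal N"
    using assms by (auto simp: schur_def)
  note [measurable] = schur_meas(2)[OF assms]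
  have "(\<integral>\<^sup>+t. (\<integral>\<^sup>+s. ennreal (\<kappa> t s) * f s \<partial>lborel)\<^sup>2 \<partial>lborel) \<le> ennreal (N\<^sup>2) * (\<integral>\<^sup>+s. (f s)\<^sup>2 \<partial>lborel)"
    if f[measurable]: "f \<in> borel_measurable borel" for f :: "real \<Rightarrow> ennreal"
  proof -
    have cs: "(\<integral>\<^sup>+s. ennreal (\<kappa> t s) * f s \<partial>lborel)\<^sup>2 \<le> ennreal N * (\<integral>\<^sup>+s. ennreal (\<kappa> t s) * (f s)\<^sup>2 \<partial>lborel)" for t
    proof -
      define w where "w s = ennreal (sqrt (\<kappa> t s))" for s
      have w2: "(w s)\<^sup>2 = ennreal (\<kappa> t s)" for s using schur_nonneg[OF assms] by (simp add: w_def ennreal_power)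
      have [measurable]: "w \<in> borel_measurable borel" unfolding w_def[abs_def] by measurable
      have "ennreal (\<kappa> t s) * f s = w s * (w s * f s)" for s
        unfolding w2[symmetric] by (simp add: power2_eq_square mult.assoc)
      then have "(\<integral>\<^sup>+s. ennreal (\<kappa> t s) * f s \<partial>lborel)\<^sup>2 = (\<integral>\<^sup>+s. w s * (w s * f s) \<partial>lborel)\<^sup>2" by simp
      also have "\<dots> \<le> (\<integral>\<^sup>+s. (w s)\<^sup>2 \<partial>lborel) * (\<integral>\<^sup>+s. (w s * f s)\<^sup>2 \<partial>lborel)"
        by (rule Cauchy_Schwarz_nn_integral; measurable)
      also have "\<dots> \<le> ennreal N * (\<integral>\<^sup>+s. ennreal (\<kappa> t s) * (f s)\<^sup>2 \<partial>lborel)"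
        unfolding power_mult_distrib w2 by (intro mult_right_mono N) simp
      finally show ?thesis .
    qed
    have "(\<integral>\<^sup>+t. (\<integral>\<^sup>+s. ennreal (\<kappa> t s) * f s \<partial>lborel)\<^sup>2 \<partial>lborel) \<le> (\<integral>\<^sup>+t. ennreal N * (\<integral>\<^sup>+s. ennreal (\<kappa> t s) * (f s)\<^sup>2 \<partial>lborel) \<partial>lborel)"
      by (intro nn_integral_mono cs)
    also have "\<dots> = ennreal N * (\<integral>\<^sup>+t. (\<integral>\<^sup>+s. ennreal (\<kappa> t s) * (f s)\<^sup>2 \<partial>lborel) \<partial>lborel)"
      by (rule nn_integral_cmult) measurable
    also have "(\<integral>\<^sup>+t. (\<integral>\<^sup>+s. ennreal (\<kappa> t s) * (f s)\<^sup>2 \<partial>lborel) \<partial>lborel) = (\<integral>\<^sup>+s. (\<integral>\<^sup>+t. ennreal (\<kappa> t s) * (f s)\<^sup>2 \<partial>lborel) \<partial>lborel)"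
      by (rule lborel_pair.Fubini') measurable
    finally have a: "(\<integral>\<^sup>+t. (\<integral>\<^sup>+s. ennreal (\<kappa> t s) * f s \<partial>lborel)\<^sup>2 \<partial>lborel) \<le> ennreal N * (\<integral>\<^sup>+s. (\<integral>\<^sup>+t. ennreal (\<kappa> t s) * (f s)\<^sup>2 \<partial>lborel) \<partial>lborel)" .
    have "(\<integral>\<^sup>+s. (\<integral>\<^sup>+t. ennreal (\<kappa> t s) * (f s)\<^sup>2 \<partial>lborel) \<partial>lborel) = (\<integral>\<^sup>+s. (\<integral>\<^sup>+t. ennreal (\<kappa> t s) \<partial>lborel) * (f s)\<^sup>2 \<partial>lborel)"
      by (intro nn_integral_cong nn_integral_multc) measurable
    also have "\<dots> \<le> (\<integral>\<^sup>+s. ennreal N * (f s)\<^sup>2 \<partial>lborel)"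
      by (intro nn_integral_mono mult_right_mono N) simp
    also have "\<dots> = ennreal N * (\<integral>\<^sup>+s. (f s)\<^sup>2 \<partial>lborel)"
      by (rule nn_integral_cmult) measurable
    finally have b: "(\<integral>\<^sup>+s. (\<integral>\<^sup>+t. ennreal (\<kappa> t s) * (f s)\<^sup>2 \<partial>lborel) \<partial>lborel) \<le> ennreal N * (\<integral>\<^sup>+s. (f s)\<^sup>2 \<partial>lborel)" .
    have "ennreal (N\<^sup>2) = ennreal N * ennreal N" using N by (simp add: power2_eq_square ennreal_mult)
    then show ?thesis using order_trans[OF a mult_left_mono[OF b]] by (simp only: mult.assoc zero_le)
  qed
  with N(1) show ?thesis by (rule that)
qed

lemma iop_measurable:
  assumes "schur \<kappa>" "f \<in> borel_measurable borel"
  shows "iop \<kappa> f \<in> borel_measurable borel"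
proof -
  note [measurable] = schur_meas(2)[OF assms(1)] assms(2)
  show ?thesis unfolding iop_def[abs_def] by measurable
qed

lemma iop_integrable_AE:
  assumes \<kappa>: "schur \<kappa>" and f: "f \<in> L2 lborel"
  shows "AE t in lborel. integrable lborel (\<lambda>s. \<kappa> t s * f s)"
proof -
  note [measurable] = schur_meas(2)[OF \<kappa>]
  have [measurable]: "f \<in> borel_measurable borel" using L2_measurable[OF f] by simp
  obtain N :: real where N: "N \<ge> 0" "\<And>f. f \<in> borel_measurable borel \<Longrightarrow>
    (\<integral>\<^sup>+t. (\<integral>\<^sup>+s. ennreal (\<kappa> t s) * f s \<partial>lborel)\<^sup>2 \<partial>lborel) \<le> ennreal (N\<^sup>2) * (\<integral>\<^sup>+s. (f s)\<^sup>2 \<partial>lborel)"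
    using schur_young[OF \<kappa>] by blast
  have "(\<integral>\<^sup>+t. (\<integral>\<^sup>+s. ennreal (\<kappa> t s) * ennreal \<bar>f s\<bar> \<partial>lborel)\<^sup>2 \<partial>lborel) \<le> ennreal (N\<^sup>2) * (\<integral>\<^sup>+s. (ennreal \<bar>f s\<bar>)\<^sup>2 \<partial>lborel)"
    by (rule N(2)) measurable
  also have "\<dots> = ennreal (N\<^sup>2) * (\<integral>\<^sup>+s. ennreal ((f s)\<^sup>2) \<partial>lborel)" by (simp add: ennreal_power)
  also have "\<dots> < \<infinity>" using f by (auto simp: L2_iff_nn ennreal_mult_less_top)
  finally have "(\<integral>\<^sup>+t. (\<integral>\<^sup>+s. ennreal (\<kappa> t s) * ennreal \<bar>f s\<bar> \<partial>lborel)\<^sup>2 \<partial>lborel) \<noteq> \<infinity>" by simp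
  then have "AE t in lborel. (\<integral>\<^sup>+s. ennreal (\<kappa> t s) * ennreal \<bar>f s\<bar> \<partial>lborel)\<^sup>2 \<noteq> \<infinity>"
    by (intro nn_integral_PInf_AE) measurable
  then show ?thesis
  proof (rule AE_mp, intro AE_I2 impI)
    fix t assume "(\<integral>\<^sup>+s. ennreal (\<kappa> t s) * ennreal \<bar>f s\<bar> \<partial>lborel)\<^sup>2 \<noteq> \<infinity>"
    then have "(\<integral>\<^sup>+s. ennreal (\<kappa> t s) * ennreal \<bar>f s\<bar> \<partial>lborel) < \<infinity>"
      by (auto simp: power2_eq_square ennreal_mult_eq_top_iff less_top[symmetric])
    then show "integrable lborel (\<lambda>s. \<kappa> t s * f s)"
      unfolding integrable_iff_bounded using schur_nonneg[OF \<kappa>]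
      by (simp add: abs_mult ennreal_mult)
  qed
qed

lemma iop_L2:
  assumes \<kappa>: "schur \<kappa>" and f: "f \<in> L2 lborel"
  shows "iop \<kappa> f \<in> L2 lborel"
proof -
  note [measurable] = schur_meas(2)[OF \<kappa>]
  have [measurable]: "f \<in> borel_measurable borel" using L2_measurable[OF f] by simp
  obtain N :: real where N: "N \<ge> 0" "\<And>f. f \<in> borel_measurable borel \<Longrightarrow>
    (\<integral>\<^sup>+t. (\<integral>\<^sup>+s. ennreal (\<kappa> t s) * f s \<partial>lborel)\<^sup>2 \<partial>lborel) \<le> ennreal (N\<^sup>2) * (\<integral>\<^sup>+s. (f s)\<^sup>2 \<partial>lborel)"
    using schur_young[OF \<kappa>] by blast
  have "(\<integral>\<^sup>+t. ennreal ((iop \<kappa> f t)\<^sup>2) \<partial>lborel) \<le> (\<integral>\<^sup>+t. (\<integral>\<^sup>+s. ennreal (\<kappa> t s) * ennreal \<bar>f s\<bar> \<partial>lborel)\<^sup>2 \<partial>lborel)"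
  proof (rule nn_integral_mono_AE, rule AE_mp[OF iop_integrable_AE[OF \<kappa> f]], intro AE_I2 impI)
    fix t assume "integrable lborel (\<lambda>s. \<kappa> t s * f s)"
    from integral_norm_bound_ennreal[OF this]
    have "ennreal \<bar>iop \<kappa> f t\<bar> \<le> (\<integral>\<^sup>+s. ennreal (\<kappa> t s) * ennreal \<bar>f s\<bar> \<partial>lborel)"
      using schur_nonneg[OF \<kappa>] by (simp add: iop_def abs_mult ennreal_mult)
    from power_mono[OF this, of 2]
    show "ennreal ((iop \<kappa> f t)\<^sup>2) \<le> (\<integral>\<^sup>+s. ennreal (\<kappa> t s) * ennreal \<bar>f s\<bar> \<partial>lborel)\<^sup>2"
      by (simp add: ennreal_power)
  qed
  also have "\<dots> \<le> ennreal (N\<^sup>2) * (\<integral>\<^sup>+s. (ennreal \<bar>f s\<bar>)\<^sup>2 \<partial>lborel)"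
    by (rule N(2)) measurable
  also have "\<dots> = ennreal (N\<^sup>2) * (\<integral>\<^sup>+s. ennreal ((f s)\<^sup>2) \<partial>lborel)" by (simp add: ennreal_power)
  also have "\<dots> < \<infinity>" using f by (auto simp: L2_iff_nn ennreal_mult_less_top)
  finally show ?thesis unfolding L2_iff_nn using iop_measurable[OF \<kappa>, of f] by simp
qed

lemma iop_cong_AE:
  assumes "schur \<kappa>" "f \<in> borel_measurable borel" "g \<in> borel_measurable borel" "AE s in lborel. f s = g s"
  shows "iop \<kappa> f = iop \<kappa> g"
proof
  note [measurable] = schur_meas(2)[OF assms(1)] assms(2,3)
  fix t show "iop \<kappa> f t = iop \<kappa> g t"
    unfolding iop_def by (intro integral_cong_AE) (use assms(4) in auto)
qed

text \<open>An arbitrary representative is chosen; by \<open>iop_cong_AE\<close> the function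
  \<open>iop\<close> does not depend on it, at any point t.\<close>

definition op :: "(real \<Rightarrow> real \<Rightarrow> real) \<Rightarrow> real l2 \<Rightarrow> real l2" where
  "op \<kappa> x = mk (iop \<kappa> (SOME f. f \<in> L2 lborel \<and> x = mk f))"

lemma op_mk:
  assumes "schur \<kappa>" "f \<in> L2 lborel"
  shows "op \<kappa> (mk f) = mk (iop \<kappa> f)"
proof -
  define g where "g = (SOME g. g \<in> L2 lborel \<and> mk f = mk g)"
  have g: "g \<in> L2 lborel" "mk f = mk g"
    using someI[of "\<lambda>g. g \<in> L2 lborel \<and> mk f = mk g" f] assms by (auto simp: g_def)
  then have "AE x in lborel. f x = g x" using assms mk_eq_iff by blast
  then have "iop \<kappa> f = iop \<kappa> g"
    using L2_measurable[OF assms(2)] L2_measurable[OF g(1)] by (intro iop_cong_AE assms) auto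
  then show ?thesis by (simp add: op_def g_def)
qed

lemma linear_op:
  assumes \<kappa>: "schur \<kappa>"
  shows "linear (op \<kappa>)"
proof (rule linearI)
  fix x y :: "real l2" and c :: real
  obtain f where f: "f \<in> L2 lborel" "x = mk f" using mk_surj .
  obtain g where g: "g \<in> L2 lborel" "y = mk g" using mk_surj .
  have "AE t in lborel. iop \<kappa> (\<lambda>s. f s + g s) t = iop \<kappa> f t + iop \<kappa> g t"
    using iop_integrable_AE[OF \<kappa> f(1)] iop_integrable_AE[OF \<kappa> g(1)]
    by eventually_elim (simp add: iop_def distrib_left)
  then have "mk (iop \<kappa> (\<lambda>s. f s + g s)) = mk (\<lambda>t. iop \<kappa> f t + iop \<kappa> g t)"
    by (intro mk_cong iop_L2 L2_add \<kappa> f g)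
  then show "op \<kappa> (x + y) = op \<kappa> x + op \<kappa> y"
    using f g by (simp add: mk_add[symmetric] op_mk[OF \<kappa>] L2_add) (simp add: mk_add iop_L2[OF \<kappa>])
  have "iop \<kappa> (\<lambda>s. c * f s) = (\<lambda>t. c * iop \<kappa> f t)"
    by (simp add: iop_def fun_eq_iff mult.left_commute)
  then show "op \<kappa> (c *\<^sub>R x) = c *\<^sub>R op \<kappa> x"
    using f by (simp add: mk_scale[symmetric] op_mk[OF \<kappa>] L2_cmult) (simp add: mk_scale iop_L2[OF \<kappa>])
qed

text \<open>For nonnegative f and g the bilinear form is an iterated integral in the extended reals,
  where the order of integration may be exchanged freely. Adjoints, compositions and the integral
  over r below are all computed through this formula.\<close>

lemma inner_op_nonneg:
  assumes \<kappa>: "schur \<kappa>" and f: "f \<in> L2 lborel" "\<And>s. 0 \<le> f s" and g: "g \<in> L2 lborel" "\<And>s. 0 \<le> g s"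
  shows "ennreal (inner (op \<kappa> (mk f)) (mk g)) = (\<integral>\<^sup>+t. \<integral>\<^sup>+s. ennreal (\<kappa> t s * f s * g t) \<partial>lborel \<partial>lborel)"
    and "0 \<le> inner (op \<kappa> (mk f)) (mk g)"
proof -
  note [measurable] = schur_meas(2)[OF \<kappa>]
  have [measurable]: "f \<in> borel_measurable borel" "g \<in> borel_measurable borel" using L2_measurable[OF f(1)] L2_measurable[OF g(1)] by simp_all
  have p: "0 \<le> iop \<kappa> f t" for t
    unfolding iop_def by (intro Bochner_Integration.integral_nonneg mult_nonneg_nonneg schur_nonneg[OF \<kappa>] f)
  have I: "inner (op \<kappa> (mk f)) (mk g) = (\<integral>t. iop \<kappa> f t * g t \<partial>lborel)"
    by (simp add: op_mk[OF \<kappa> f(1)] inner_mk iop_L2 \<kappa> f g ip_def)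
  show "0 \<le> inner (op \<kappa> (mk f)) (mk g)" unfolding I
    by (intro Bochner_Integration.integral_nonneg mult_nonneg_nonneg p g)
  have "ennreal (inner (op \<kappa> (mk f)) (mk g)) = (\<integral>\<^sup>+t. ennreal (iop \<kappa> f t * g t) \<partial>lborel)"
    unfolding I by (rule nn_integral_eq_integral[symmetric])
      (auto intro!: L2_mult_integrable iop_L2 \<kappa> f g p mult_nonneg_nonneg)
  also have "\<dots> = (\<integral>\<^sup>+t. \<integral>\<^sup>+s. ennreal (\<kappa> t s * f s * g t) \<partial>lborel \<partial>lborel)"
  proof (rule nn_integral_cong_AE, rule AE_mp[OF iop_integrable_AE[OF \<kappa> f(1)]], intro AE_I2 impI)
    fix t assume i: "integrable lborel (\<lambda>s. \<kappa> t s * f s)"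
    have "ennreal (iop \<kappa> f t) = (\<integral>\<^sup>+s. ennreal (\<kappa> t s * f s) \<partial>lborel)"
      unfolding iop_def by (rule nn_integral_eq_integral[OF i, symmetric]) (simp add: schur_nonneg[OF \<kappa>] f)
    then have "ennreal (iop \<kappa> f t * g t) = (\<integral>\<^sup>+s. ennreal (\<kappa> t s * f s) \<partial>lborel) * ennreal (g t)"
      using p g by (simp add: ennreal_mult)
    also have "\<dots> = (\<integral>\<^sup>+s. ennreal (\<kappa> t s * f s) * ennreal (g t) \<partial>lborel)"
      by (rule nn_integral_multc[symmetric]) measurable
    also have "\<dots> = (\<integral>\<^sup>+s. ennreal (\<kappa> t s * f s * g t) \<partial>lborel)"
      using schur_nonneg[OF \<kappa>] f g by (simp add: ennreal_mult)
    finally show "ennreal (iop \<kappa> f t * g t) = (\<integral>\<^sup>+s. ennreal (\<kappa> t s * f s * g t) \<partial>lborel)" .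
  qed
  finally show "ennreal (inner (op \<kappa> (mk f)) (mk g)) = (\<integral>\<^sup>+t. \<integral>\<^sup>+s. ennreal (\<kappa> t s * f s * g t) \<partial>lborel \<partial>lborel)" .
qed

lemma mk_pos_neg:
  fixes x :: "'a::euclidean_space l2"
  obtains f g where "f \<in> L2 lborel" "g \<in> L2 lborel" "\<And>s. 0 \<le> f s" "\<And>s. 0 \<le> g s" "x = mk f - mk g"
proof -
  obtain h where h: "h \<in> L2 lborel" "x = mk h" using mk_surj .
  have p: "(\<lambda>s. max 0 (h s)) \<in> L2 lborel" "(\<lambda>s. max 0 (- h s)) \<in> L2 lborel"
    using L2_measurable[OF h(1)] by (auto intro!: L2_bounded_by[OF h(1)])
  have "(\<lambda>s. max 0 (h s) - max 0 (- h s)) = h" by (auto simp: max_def)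
  then have "x = mk (\<lambda>s. max 0 (h s)) - mk (\<lambda>s. max 0 (- h s))" using mk_diff[OF p] h by simp
  then show ?thesis by (rule that[OF p, rotated 2]) auto
qed

text \<open>Every class is a difference of two nonnegative functions, which determine a linear
  map.\<close>

lemma linear_ext_nonneg:
  fixes A B :: "'a::euclidean_space l2 \<Rightarrow> 'c::real_vector"
  assumes "linear A" "linear B" "\<And>f. f \<in> L2 lborel \<Longrightarrow> (\<And>s. 0 \<le> f s) \<Longrightarrow> A (mk f) = B (mk f)"
  shows "A x = B x"
proof -
  obtain f g where "f \<in> L2 lborel" "g \<in> L2 lborel" "\<And>s. 0 \<le> f s" "\<And>s. 0 \<le> g s" "x = mk f - mk g" by (rule mk_pos_neg[of x]) (rule that)
  then show ?thesis using assms(3) by (simp add: linear_diff[OF assms(1)] linear_diff[OF assms(2)])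
qed

lemma bilinear_ext_nonneg:
  fixes A B :: "'a::euclidean_space l2 \<Rightarrow> 'a l2 \<Rightarrow> 'c::real_vector"
  assumes "\<And>y. linear (\<lambda>x. A x y)" "\<And>y. linear (\<lambda>x. B x y)" "\<And>x. linear (A x)" "\<And>x. linear (B x)"
    and "\<And>f g. f \<in> L2 lborel \<Longrightarrow> (\<And>s. 0 \<le> f s) \<Longrightarrow> g \<in> L2 lborel \<Longrightarrow> (\<And>s. 0 \<le> g s) \<Longrightarrow> A (mk f) (mk g) = B (mk f) (mk g)"
  shows "A x y = B x y"
proof (rule linear_ext_nonneg[OF assms(1,2), of y])
  fix f :: "'a \<Rightarrow> real" assume f: "f \<in> L2 lborel" "\<And>s. 0 \<le> f s"
  show "A (mk f) y = B (mk f) y"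
    by (rule linear_ext_nonneg[OF assms(3,4)]) (rule assms(5)[OF f])
qed

lemma linear_inner1: "linear A \<Longrightarrow> linear (\<lambda>x. inner (A x) y)"
  by (auto intro!: linearI simp: linear_add linear_scale inner_add)

lemma linear_inner2: "linear A \<Longrightarrow> linear (\<lambda>x. inner y (A x))"
  by (auto intro!: linearI simp: linear_add linear_scale inner_add)

lemma linear_inner_left: "linear (\<lambda>x. inner x y)"
  by (auto intro!: linearI simp: inner_add)

lemma linear_inner_right: "linear (inner y)"
  by (auto intro!: linearI simp: inner_add)

lemma op_adj:
  assumes \<kappa>: "schur \<kappa>"
  shows "inner (op \<kappa> x) y = inner x (op (transp \<kappa>) y)"
proof (rule bilinear_ext_nonneg[of "\<lambda>x y. inner (op \<kappa> x) y" "\<lambda>x y. inner x (op (transp \<kappa>) y)"])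
  note \<kappa>' = schur_transp[OF \<kappa>]
  note [measurable] = schur_meas(2)[OF \<kappa>]
  fix f g :: "real \<Rightarrow> real" assume f: "f \<in> L2 lborel" "\<And>s. 0 \<le> f s" and g: "g \<in> L2 lborel" "\<And>s. 0 \<le> g s"
  have [measurable]: "f \<in> borel_measurable borel" "g \<in> borel_measurable borel" using L2_measurable[OF f(1)] L2_measurable[OF g(1)] by simp_all
  have "(\<integral>\<^sup>+t. \<integral>\<^sup>+s. ennreal (\<kappa> t s * f s * g t) \<partial>lborel \<partial>lborel) = (\<integral>\<^sup>+s. \<integral>\<^sup>+t. ennreal (\<kappa> t s * f s * g t) \<partial>lborel \<partial>lborel)"
    by (rule lborel_pair.Fubini') measurable
  then have "ennreal (inner (op \<kappa> (mk f)) (mk g)) = ennreal (inner (op (transp \<kappa>) (mk g)) (mk f))"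
    unfolding inner_op_nonneg(1)[OF \<kappa> f g] inner_op_nonneg(1)[OF \<kappa>' g f] by (simp add: transp_def mult_ac)
  then show "inner (op \<kappa> (mk f)) (mk g) = inner (mk f) (op (transp \<kappa>) (mk g))"
    using inner_op_nonneg(2)[OF \<kappa> f g] inner_op_nonneg(2)[OF \<kappa>' g f] by (simp add: inner_commute)
qed (rule linear_inner1[OF linear_op[OF \<kappa>]] linear_inner_left linear_inner_right linear_inner2[OF linear_op[OF schur_transp[OF \<kappa>]]])+

lemma op_eqI:
  fixes A B :: "real l2 \<Rightarrow> real l2"
  assumes "linear A" "linear B"
    and "\<And>f g. f \<in> L2 lborel \<Longrightarrow> (\<And>s. 0 \<le> f s) \<Longrightarrow> g \<in> L2 lborel \<Longrightarrow> (\<And>s. 0 \<le> g s) \<Longrightarrow> inner (A (mk f)) (mk g) = inner (B (mk f)) (mk g)"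
  shows "A x = B x"
proof -
  have "inner (A x) y = inner (B x) y" for y
    by (rule bilinear_ext_nonneg[of "\<lambda>x y. inner (A x) y" "\<lambda>x y. inner (B x) y"])
      (rule linear_inner1[OF assms(1)] linear_inner1[OF assms(2)] linear_inner_right assms(3) | assumption)+
  then have "inner (A x - B x) (A x - B x) = 0" by (simp add: inner_diff_left)
  then show ?thesis by simp
qed

lemma op_comp:
  assumes \<kappa>: "schur \<kappa>" and l: "schur l" and m: "schur m"
    and eq: "\<And>t r. (\<integral>\<^sup>+s. ennreal (\<kappa> t s * l s r) \<partial>lborel) = ennreal (m t r)"
  shows "op \<kappa> (op l x) = op m x"
proof (rule op_eqI[of "\<lambda>x. op \<kappa> (op l x)"])
  show "linear (\<lambda>x. op \<kappa> (op l x))" using linear_compose[OF linear_op[OF l] linear_op[OF \<kappa>]] by (simp add: comp_def)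
  show "linear (op m)" by (rule linear_op[OF m])
  note [measurable] = schur_meas(2)[OF \<kappa>] schur_meas(2)[OF l] schur_meas(2)[OF m]
  fix f g :: "real \<Rightarrow> real" assume f: "f \<in> L2 lborel" "\<And>s. 0 \<le> f s" and g: "g \<in> L2 lborel" "\<And>s. 0 \<le> g s"
  have [measurable]: "f \<in> borel_measurable borel" "g \<in> borel_measurable borel" using L2_measurable[OF f(1)] L2_measurable[OF g(1)] by simp_all
  note \<kappa>0 = schur_nonneg[OF \<kappa>] and l0 = schur_nonneg[OF l] and m0 = schur_nonneg[OF m]
  have p: "0 \<le> iop l f t" for t
    unfolding iop_def by (intro Bochner_Integration.integral_nonneg mult_nonneg_nonneg l0 f)
  have "ennreal (inner (op \<kappa> (op l (mk f))) (mk g)) = (\<integral>\<^sup>+t. \<integral>\<^sup>+s. ennreal (\<kappa> t s * iop l f s * g t) \<partial>lborel \<partial>lborel)"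
    unfolding op_mk[OF l f(1)] by (rule inner_op_nonneg(1)[OF \<kappa> iop_L2[OF l f(1)] p g])
  also have "\<dots> = (\<integral>\<^sup>+t. \<integral>\<^sup>+s. \<integral>\<^sup>+r. ennreal (\<kappa> t s * l s r) * ennreal (f r * g t) \<partial>lborel \<partial>lborel \<partial>lborel)"
  proof (rule nn_integral_cong, rule nn_integral_cong_AE, rule AE_mp[OF iop_integrable_AE[OF l f(1)]], intro AE_I2 impI)
    fix t s assume i: "integrable lborel (\<lambda>r. l s r * f r)"
    have "ennreal (iop l f s) = (\<integral>\<^sup>+r. ennreal (l s r * f r) \<partial>lborel)"
      unfolding iop_def by (rule nn_integral_eq_integral[OF i, symmetric]) (simp add: l0 f)
    then have "ennreal (\<kappa> t s * iop l f s * g t) = (\<integral>\<^sup>+r. ennreal (l s r * f r) \<partial>lborel) * ennreal (\<kappa> t s * g t)"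
      using p g \<kappa>0 by (simp add: ennreal_mult[symmetric] mult_ac) (simp add: ennreal_mult mult_ac)
    also have "\<dots> = (\<integral>\<^sup>+r. ennreal (l s r * f r) * ennreal (\<kappa> t s * g t) \<partial>lborel)"
      by (rule nn_integral_multc[symmetric]) measurable
    also have "\<dots> = (\<integral>\<^sup>+r. ennreal (\<kappa> t s * l s r) * ennreal (f r * g t) \<partial>lborel)"
      by (intro nn_integral_cong) (simp add: ennreal_mult[symmetric] \<kappa>0 l0 f g mult_ac)
    finally show "ennreal (\<kappa> t s * iop l f s * g t) = (\<integral>\<^sup>+r. ennreal (\<kappa> t s * l s r) * ennreal (f r * g t) \<partial>lborel)" .
  qed
  also have "\<dots> = (\<integral>\<^sup>+t. \<integral>\<^sup>+r. \<integral>\<^sup>+s. ennreal (\<kappa> t s * l s r) * ennreal (f r * g t) \<partial>lborel \<partial>lborel \<partial>lborel)"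
    by (rule nn_integral_cong, rule lborel_pair.Fubini') measurable
  also have "\<dots> = (\<integral>\<^sup>+t. \<integral>\<^sup>+r. ennreal (m t r * f r * g t) \<partial>lborel \<partial>lborel)"
  proof (intro nn_integral_cong)
    fix t r
    have "(\<integral>\<^sup>+s. ennreal (\<kappa> t s * l s r) * ennreal (f r * g t) \<partial>lborel) = ennreal (m t r) * ennreal (f r * g t)"
      unfolding eq[symmetric] by (rule nn_integral_multc) measurable
    then show "(\<integral>\<^sup>+s. ennreal (\<kappa> t s * l s r) * ennreal (f r * g t) \<partial>lborel) = ennreal (m t r * f r * g t)"
      by (simp add: ennreal_mult[symmetric] m0 f g mult_ac)
  qed
  also have "\<dots> = ennreal (inner (op m (mk f)) (mk g))" by (rule inner_op_nonneg(1)[OF m f g, symmetric])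
  finally show "inner (op \<kappa> (op l (mk f))) (mk g) = inner (op m (mk f)) (mk g)"
    using inner_op_nonneg(2)[OF m f g] inner_op_nonneg(2)[OF \<kappa> iop_L2[OF l f(1)] p g]
    by (simp add: op_mk[OF l f(1)])
qed

lemma op_add:
  assumes \<kappa>: "schur \<kappa>" and l: "schur l" and m: "schur m" and eq: "\<And>t s. m t s = a * \<kappa> t s + b * l t s"
  shows "op m x = a *\<^sub>R op \<kappa> x + b *\<^sub>R op l x"
proof -
  obtain f where f: "f \<in> L2 lborel" "x = mk f" using mk_surj .
  have "AE t in lborel. iop m f t = a * iop \<kappa> f t + b * iop l f t"
    using iop_integrable_AE[OF \<kappa> f(1)] iop_integrable_AE[OF l f(1)]
    by eventually_elim (simp add: iop_def eq distrib_right mult.assoc)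
  then have "mk (iop m f) = mk (\<lambda>t. a * iop \<kappa> f t + b * iop l f t)"
    by (intro mk_cong iop_L2 L2_add L2_cmult \<kappa> l m f)
  then show ?thesis using f by (simp add: op_mk \<kappa> l m mk_add mk_scale iop_L2 L2_cmult)
qed

section \<open>Backward convolution operators on an interval\<close>

text \<open>Both variables are confined to (0,T), so the operator acts on square-integrable
  functions of the whole line but ignores its argument outside the interval and yields zero
  there.\<close>

definition tri :: "real \<Rightarrow> (real \<Rightarrow> real) \<Rightarrow> real \<Rightarrow> real \<Rightarrow> real" where
  "tri T k t s = (if 0 < t \<and> t < s \<and> s < T then k (s - t) else 0)"

text \<open>The integral over (0,T) is a Schur constant of \<open>tri T k\<close>, for rows and
  columns alike. The sign is prescribed at positive arguments only, since s - t > 0 in the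
  triangle.\<close>

definition ker :: "real \<Rightarrow> (real \<Rightarrow> real) \<Rightarrow> bool" where
  "ker T k \<longleftrightarrow> k \<in> borel_measurable borel \<and> (\<forall>u>0. 0 \<le> k u) \<and> (\<integral>\<^sup>+u\<in>{0<..<T}. ennreal (k u) \<partial>lborel) < \<infinity>"

lemma ker_meas: "ker T k \<Longrightarrow> k \<in> borel_measurable borel" by (simp add: ker_def)

lemma ker_nonneg: "ker T k \<Longrightarrow> u > 0 \<Longrightarrow> 0 \<le> k u" by (simp add: ker_def)

lemma nn_integral_shift:
  assumes "(f :: real \<Rightarrow> ennreal) \<in> borel_measurable borel"
  shows "(\<integral>\<^sup>+s. f s \<partial>lborel) = (\<integral>\<^sup>+u. f (t + u) \<partial>lborel)"
    and "(\<integral>\<^sup>+s. f s \<partial>lborel) = (\<integral>\<^sup>+u. f (t - u) \<partial>lborel)"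
  using nn_integral_real_affine[OF assms, of 1 t] nn_integral_real_affine[OF assms, of "-1" t] by simp_all

lemma schur_tri:
  assumes k: "ker T k"
  shows "schur (tri T k)"
  unfolding schur_def
proof (intro conjI allI)
  note [measurable] = ker_meas[OF k]
  show "(\<lambda>(t, s). tri T k t s) \<in> borel_measurable (borel \<Otimes>\<^sub>M borel)"
    unfolding tri_def by measurable
  show "0 \<le> tri T k t s" for t s using ker_nonneg[OF k] by (simp add: tri_def)
  obtain N where N: "(\<integral>\<^sup>+u\<in>{0<..<T}. ennreal (k u) \<partial>lborel) = ennreal N" "N \<ge> 0"
    using k by (cases "\<integral>\<^sup>+u\<in>{0<..<T}. ennreal (k u) \<partial>lborel") (auto simp: ker_def)
  have [measurable]: "(\<lambda>s. tri T k t s) \<in> borel_measurable borel" "(\<lambda>s. tri T k s t) \<in> borel_measurable borel" for t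
    unfolding tri_def by measurable
  have "(\<integral>\<^sup>+s. ennreal (tri T k t s) \<partial>lborel) \<le> ennreal N" for t
  proof -
    have "(\<integral>\<^sup>+s. ennreal (tri T k t s) \<partial>lborel) = (\<integral>\<^sup>+u. ennreal (tri T k t (t + u)) \<partial>lborel)"
      by (rule nn_integral_shift) measurable
    also have "\<dots> \<le> (\<integral>\<^sup>+u\<in>{0<..<T}. ennreal (k u) \<partial>lborel)"
      by (intro nn_integral_mono) (auto simp: tri_def)
    finally show ?thesis by (simp add: N)
  qed
  moreover have "(\<integral>\<^sup>+s. ennreal (tri T k s t) \<partial>lborel) \<le> ennreal N" for t
  proof -
    have "(\<integral>\<^sup>+s. ennreal (tri T k s t) \<partial>lborel) = (\<integral>\<^sup>+u. ennreal (tri T k (t - u) t) \<partial>lborel)"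
      by (rule nn_integral_shift) measurable
    also have "\<dots> \<le> (\<integral>\<^sup>+u\<in>{0<..<T}. ennreal (k u) \<partial>lborel)"
      by (intro nn_integral_mono) (auto simp: tri_def)
    finally show ?thesis by (simp add: N)
  qed
  ultimately show "\<exists>N\<ge>0. \<forall>t. (\<integral>\<^sup>+s. ennreal (tri T k t s) \<partial>lborel) \<le> ennreal N \<and> (\<integral>\<^sup>+s. ennreal (tri T k s t) \<partial>lborel) \<le> ennreal N"
    using N by blast
qed

lemma ker_bounded:
  assumes "k \<in> borel_measurable borel" "\<And>u. u > 0 \<Longrightarrow> 0 \<le> k u" "\<And>u. u \<in> {0<..<T} \<Longrightarrow> k u \<le> B"
  shows "ker T k"
proof -
  have "(\<integral>\<^sup>+u\<in>{0<..<T}. ennreal (k u) \<partial>lborel) \<le> (\<integral>\<^sup>+u. ennreal B * indicator {0<..<T} u \<partial>lborel)"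
    using assms(3) by (intro nn_integral_mono) (auto simp: indicator_def intro: ennreal_leI)
  also have "\<dots> = ennreal B * emeasure lborel {0<..<T}" by (rule nn_integral_cmult_indicator) simp
  also have "\<dots> < \<infinity>" by (cases "0 \<le> T") (simp_all add: ennreal_mult_less_top)
  finally show ?thesis using assms by (simp add: ker_def)
qed

lemma tri_comp:
  assumes k: "ker T k" and l: "ker T l" and m: "ker T m"
    and eq: "\<And>u. u \<in> {0<..<T} \<Longrightarrow> (\<integral>\<^sup>+w\<in>{0<..<u}. ennreal (k w * l (u - w)) \<partial>lborel) = ennreal (m u)"
  shows "op (tri T k) (op (tri T l) x) = op (tri T m) x"
proof (rule op_comp[OF schur_tri[OF k] schur_tri[OF l] schur_tri[OF m]])
  note [measurable] = ker_meas[OF k] ker_meas[OF l]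
  fix t r
  show "(\<integral>\<^sup>+s. ennreal (tri T k t s * tri T l s r) \<partial>lborel) = ennreal (tri T m t r)"
  proof (cases "0 < t \<and> t < r \<and> r < T")
    case True
    have "(\<integral>\<^sup>+s. ennreal (tri T k t s * tri T l s r) \<partial>lborel) = (\<integral>\<^sup>+w. ennreal (tri T k t (t + w) * tri T l (t + w) r) \<partial>lborel)"
      by (rule nn_integral_shift) (unfold tri_def, measurable)
    also have "\<dots> = (\<integral>\<^sup>+w\<in>{0<..<r - t}. ennreal (k w * l (r - t - w)) \<partial>lborel)"
      using True by (intro nn_integral_cong) (auto simp: tri_def indicator_def algebra_simps)
    also have "\<dots> = ennreal (tri T m t r)" using eq[of "r - t"] True by (simp add: tri_def)
    finally show ?thesis .
  next
    case False
    then have "tri T k t s * tri T l s r = 0" "tri T m t r = 0" for s by (auto simp: tri_def)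
    then show ?thesis by (simp only: nn_integral_const ennreal_0 mult_zero_left)
  qed
qed

lemma nn_open_FTC:
  assumes "f \<in> borel_measurable borel" "u \<ge> 0"
    "\<And>w. w \<in> {0..u} \<Longrightarrow> (F has_real_derivative f w) (at w)" "\<And>w. w \<in> {0..u} \<Longrightarrow> 0 \<le> f w"
  shows "(\<integral>\<^sup>+w\<in>{0<..<u}. ennreal (f w) \<partial>lborel) = ennreal (F u - F 0)"
proof -
  have "(\<integral>\<^sup>+w\<in>{0<..<u}. ennreal (f w) \<partial>lborel) = (\<integral>\<^sup>+w. ennreal (f w) * indicator {0..u} w \<partial>lborel)"
  proof (rule nn_integral_cong_AE)
    have "AE w in lborel. w \<noteq> 0 \<and> w \<noteq> u" by (intro AE_conjI AE_lborel_singleton)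
    then show "AE w in lborel. ennreal (f w) * indicator {0<..<u} w = ennreal (f w) * indicator {0..u} w"
      by eventually_elim (auto simp: indicator_def)
  qed
  also have "\<dots> = ennreal (F u - F 0)" by (rule nn_integral_FTC_Icc) (use assms in auto)
  finally show ?thesis .
qed

definition pk :: "real \<Rightarrow> real \<Rightarrow> real" where "pk a u = u powr (a - 1) / Gamma a"

text \<open>The gamma density of shape i + 1 and scale r, normalised so that convolving it with
  \<open>ek 0 r\<close> gives the density of the next shape.\<close>

definition ek :: "nat \<Rightarrow> real \<Rightarrow> real \<Rightarrow> real" where
  "ek i r u = u ^ i * exp (- (u / r)) / (fact i * r ^ Suc i)"

lemma pk_meas [measurable]: "pk a \<in> borel_measurable borel"
  unfolding pk_def[abs_def] by measurable

lemma ek_meas [measurable]: "f \<in> borel_measurable M \<Longrightarrow> g \<in> borel_measurable M \<Longrightarrow> (\<lambda>x. ek i (f x) (g x)) \<in> borel_measurable M"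
  unfolding ek_def by (intro borel_measurable_divide borel_measurable_times borel_measurable_power
    borel_measurable_const borel_measurable_exp[THEN measurable_compose[rotated]] borel_measurable_uminus)

lemma ker_pk: assumes "a > 0" shows "ker T (pk a)"
proof (cases "T \<ge> 0")
  case True
  have G: "Gamma a > 0" using assms by (rule Gamma_real_pos)
  have "(\<integral>\<^sup>+u\<in>{0<..<T}. ennreal (pk a u) \<partial>lborel) \<le> (\<integral>\<^sup>+u. ennreal (1 / Gamma a) * (ennreal (u powr (a - 1)) * indicator {0..T} u) \<partial>lborel)"
    using G by (intro nn_integral_mono) (auto simp: pk_def indicator_def ennreal_mult[symmetric])
  also have "\<dots> = ennreal (1 / Gamma a) * ennreal (T powr (a - 1 + 1) / (a - 1 + 1))"
    using nn_integral_powr_0[of "a - 1" T] assms True by (subst nn_integral_cmult) auto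
  also have "\<dots> < \<infinity>" by (simp add: ennreal_mult_less_top)
  finally show ?thesis using G by (simp add: ker_def pk_def)
next
  case False
  then show ?thesis using Gamma_real_pos[OF assms] by (simp add: ker_def pk_def)
qed

lemma ker_ek: assumes "r > 0" shows "ker T (ek i r)"
proof (rule ker_bounded[of _ _ "T ^ i / (fact i * r ^ Suc i)"])
  show "ek i r \<in> borel_measurable borel" by measurable
  show "0 \<le> ek i r u" if "u > 0" for u using that assms by (simp add: ek_def)
  show "ek i r u \<le> T ^ i / (fact i * r ^ Suc i)" if "u \<in> {0<..<T}" for u
  proof -
    have "u ^ i * exp (- (u / r)) \<le> T ^ i * 1" using that assms by (intro mult_mono power_mono) auto
    then show ?thesis unfolding ek_def using assms by (intro divide_right_mono) auto
  qed
qed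

text \<open>The semigroup law of fractional integration: scaling w = u z turns the convolution into
  the Beta integral, and Beta a b = Gamma a * Gamma b / Gamma (a + b) fixes the
  normalisation.\<close>

lemma pk_pk:
  assumes ab: "a > 0" "b > 0" and u: "u > 0"
  shows "(\<integral>\<^sup>+w\<in>{0<..<u}. ennreal (pk a w * pk b (u - w)) \<partial>lborel) = ennreal (pk (a + b) u)"
proof -
  have G: "Gamma a > 0" "Gamma b > 0" "Gamma (a + b) > 0" using ab by (auto intro: Gamma_real_pos)
  have "(\<integral>\<^sup>+w\<in>{0<..<u}. ennreal (pk a w * pk b (u - w)) \<partial>lborel) =
    ennreal \<bar>u\<bar> * (\<integral>\<^sup>+z. ennreal (pk a (0 + u * z) * pk b (u - (0 + u * z))) * indicator {0<..<u} (0 + u * z) \<partial>lborel)"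
    using u by (intro nn_integral_real_affine) auto
  also have "(\<integral>\<^sup>+z. ennreal (pk a (0 + u * z) * pk b (u - (0 + u * z))) * indicator {0<..<u} (0 + u * z) \<partial>lborel) =
     (\<integral>\<^sup>+z. ennreal (u powr (a + b - 2) / (Gamma a * Gamma b)) * (ennreal (z powr (a - 1) * (1 - z) powr (b - 1)) * indicator {0..1} z) \<partial>lborel)"
  proof (rule nn_integral_cong)
    fix z :: real
    show "ennreal (pk a (0 + u * z) * pk b (u - (0 + u * z))) * indicator {0<..<u} (0 + u * z) =
      ennreal (u powr (a + b - 2) / (Gamma a * Gamma b)) * (ennreal (z powr (a - 1) * (1 - z) powr (b - 1)) * indicator {0..1} z)"
    proof (cases "0 < z \<and> z < 1")
      case True
      have e: "u - u * z = u * (1 - z)" by (simp add: algebra_simps)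
      have "u powr (a - 1) * u powr (b - 1) = u powr (a + b - 2)" by (simp add: powr_add[symmetric])
      then have "pk a (0 + u * z) * pk b (u - (0 + u * z)) = u powr (a + b - 2) / (Gamma a * Gamma b) * (z powr (a - 1) * (1 - z) powr (b - 1))"
        using True u by (simp add: pk_def e powr_mult mult_ac)
      moreover have "0 < u * z" "u * z < u" using True u by auto
      ultimately show ?thesis using True G by (simp add: ennreal_mult[symmetric])
    next
      case False
      then have "z \<le> 0 \<or> z \<ge> 1" by auto
      then have "\<not> (0 < u * z \<and> u * z < u)" using u by (auto simp: zero_less_mult_iff)
      moreover have "indicator {0..1} z = (0::ennreal) \<or> z = 0 \<or> z = 1" using False by (auto simp: indicator_def)
      ultimately show ?thesis by (auto simp: indicator_def)
    qed
  qed
  also have "\<dots> = ennreal (u powr (a + b - 2) / (Gamma a * Gamma b)) * ennreal (Beta a b)"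
    using nn_integral_has_integral_lebesgue'[OF _ has_integral_Beta_real[OF ab]] by (subst nn_integral_cmult) auto
  also have "ennreal \<bar>u\<bar> * \<dots> = ennreal (u * (u powr (a + b - 2) / (Gamma a * Gamma b) * Beta a b))"
    using u G by (simp add: ennreal_mult[symmetric] Beta_def)
  also have "u * (u powr (a + b - 2) / (Gamma a * Gamma b) * Beta a b) = pk (a + b) u"
  proof -
    have "u * u powr (a + b - 2) = u powr (a + b - 1)" using u powr_add[of u 1 "a + b - 2"] by simp
    then show ?thesis using G by (simp add: pk_def Beta_def)
  qed
  finally show ?thesis .
qed

lemma ek_0_ek:
  assumes "r > 0" "u > 0"
  shows "(\<integral>\<^sup>+w\<in>{0<..<u}. ennreal (ek i r w * ek 0 r (u - w)) \<partial>lborel) = ennreal (ek (Suc i) r u)"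
proof -
  have e: "ek i r w * ek 0 r (u - w) = exp (- (u / r)) / (fact i * r ^ Suc (Suc i)) * w ^ i" for w
    using assms by (simp add: ek_def exp_add[symmetric] field_simps)
  have "(\<integral>\<^sup>+w\<in>{0<..<u}. ennreal (ek i r w * ek 0 r (u - w)) \<partial>lborel) =
     ennreal (exp (- (u / r)) / (fact i * r ^ Suc (Suc i)) * (u ^ Suc i / Suc i) - exp (- (u / r)) / (fact i * r ^ Suc (Suc i)) * (0 ^ Suc i / Suc i))"
    unfolding e
  proof (rule nn_open_FTC)
    fix w
    have "((\<lambda>w. w ^ Suc i / real (Suc i)) has_real_derivative w ^ i) (at w)"
      by (auto intro!: derivative_eq_intros simp del: of_nat_Suc power_Suc)
    from DERIV_cmult[OF this] show "((\<lambda>w. exp (- (u / r)) / (fact i * r ^ Suc (Suc i)) * (w ^ Suc i / real (Suc i))) has_real_derivative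
       exp (- (u / r)) / (fact i * r ^ Suc (Suc i)) * w ^ i) (at w)" .
  qed (use assms in auto)
  also have "\<dots> = ennreal (ek (Suc i) r u)"
    by (rule arg_cong[of _ _ ennreal]) (simp add: ek_def field_simps)
  finally show ?thesis .
qed

lemma pk_ek:
  assumes "r > 0" "u > 0"
  shows "(\<integral>\<^sup>+w\<in>{0<..<u}. ennreal (pk 1 w * ek 0 r (u - w)) \<partial>lborel) = ennreal (1 - exp (- (u / r)))"
proof -
  have "(\<integral>\<^sup>+w\<in>{0<..<u}. ennreal (pk 1 w * ek 0 r (u - w)) \<partial>lborel) = (\<integral>\<^sup>+w\<in>{0<..<u}. ennreal (exp (- ((u - w) / r)) / r) \<partial>lborel)"
    by (intro nn_integral_cong) (auto simp: pk_def ek_def indicator_def)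
  also have "\<dots> = ennreal (exp (- ((u - u) / r)) - exp (- ((u - 0) / r)))"
    by (rule nn_open_FTC) (use assms in \<open>auto intro!: derivative_eq_intros\<close>)
  finally show ?thesis by simp
qed

lemma ek_ek:
  assumes "r > 0" "s > 0" "r \<noteq> s" "u > 0"
  shows "(\<integral>\<^sup>+w\<in>{0<..<u}. ennreal (ek 0 r w * ek 0 s (u - w)) \<partial>lborel) = ennreal ((exp (- (u / r)) - exp (- (u / s))) / (r - s))"
proof -
  have "(\<integral>\<^sup>+w\<in>{0<..<u}. ennreal (ek 0 r w * ek 0 s (u - w)) \<partial>lborel) =
     ennreal (exp (- (u / r) - (u - u) / s) / (r - s) - exp (- (0 / r) - (u - 0) / s) / (r - s))"
  proof (rule nn_open_FTC)
    fix w
    have "- (1 / r) + 1 / s = (r - s) / (r * s)" using assms by (simp add: field_simps)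
    moreover have "((\<lambda>w. exp (- (w / r) - (u - w) / s) / (r - s)) has_real_derivative exp (- (w / r) - (u - w) / s) * (- (1 / r) + 1 / s) / (r - s)) (at w)"
      using assms by (auto intro!: derivative_eq_intros)
    moreover have "exp (- (w / r) - (u - w) / s) = exp (- (w / r)) * exp (- ((u - w) / s))"
      by (simp add: exp_add[symmetric])
    ultimately show "((\<lambda>w. exp (- (w / r) - (u - w) / s) / (r - s)) has_real_derivative ek 0 r w * ek 0 s (u - w)) (at w)"
      using assms by (simp add: ek_def)
  qed (use assms in \<open>auto simp: ek_def\<close>)
  then show ?thesis by (simp add: diff_divide_distrib)
qed

section \<open>Fractional integrals and resolvents of backward integration\<close>

abbreviation fint :: "real \<Rightarrow> real \<Rightarrow> real l2 \<Rightarrow> real l2" where "fint T a \<equiv> op (tri T (pk a))"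
abbreviation fint' :: "real \<Rightarrow> real \<Rightarrow> real l2 \<Rightarrow> real l2" where "fint' T a \<equiv> op (transp (tri T (pk a)))"
abbreviation rsv :: "real \<Rightarrow> real \<Rightarrow> real l2 \<Rightarrow> real l2" where "rsv T r \<equiv> op (tri T (ek 0 r))"
abbreviation rsv' :: "real \<Rightarrow> real \<Rightarrow> real l2 \<Rightarrow> real l2" where "rsv' T r \<equiv> op (transp (tri T (ek 0 r)))"

lemmas schur_fint = schur_tri[OF ker_pk]
lemmas schur_rsv = schur_tri[OF ker_ek]
lemmas linear_fint = linear_op[OF schur_fint]
lemmas linear_fint' = linear_op[OF schur_transp[OF schur_fint]]
lemmas linear_rsv = linear_op[OF schur_rsv]

lemma fint_fint: "a > 0 \<Longrightarrow> b > 0 \<Longrightarrow> fint T a (fint T b x) = fint T (a + b) x"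
  by (rule tri_comp[OF ker_pk ker_pk ker_pk]) (auto intro: pk_pk)

lemma inner_ext: "(\<And>y. inner x y = inner z y) \<Longrightarrow> x = (z::'a::real_inner)"
  by (metis inner_diff_left inner_eq_zero_iff right_minus_eq)

lemma fint'_fint': "a > 0 \<Longrightarrow> b > 0 \<Longrightarrow> fint' T a (fint' T b x) = fint' T (a + b) x"
proof (rule inner_ext)
  fix y assume ab: "a > 0" "b > 0"
  then have "inner y (fint' T a (fint' T b x)) = inner (fint T b (fint T a y)) x"
    by (simp add: op_adj[OF schur_fint])
  also have "\<dots> = inner y (fint' T (a + b) x)"
    using ab by (simp add: fint_fint op_adj[OF schur_fint] add.commute)
  finally show "inner (fint' T a (fint' T b x)) y = inner (fint' T (a + b) x) y" by (simp add: inner_commute)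
qed

lemma rsv_rsv: "r > 0 \<Longrightarrow> rsv T r (rsv T r x) = op (tri T (ek 1 r)) x"
  by (rule tri_comp[OF ker_ek ker_ek ker_ek]) (use ek_0_ek[of r _ 0] in auto)

lemma rsv3: "r > 0 \<Longrightarrow> rsv T r (rsv T r (rsv T r x)) = op (tri T (ek 2 r)) x"
proof -
  assume r: "r > 0"
  have "op (tri T (ek 1 r)) (rsv T r x) = op (tri T (ek 2 r)) x"
    by (rule tri_comp[OF ker_ek ker_ek ker_ek]) (use ek_0_ek[of r _ 1] r in \<open>auto simp: numeral_2_eq_2\<close>)
  then show ?thesis using rsv_rsv[OF r, of T "rsv T r x"] by simp
qed

text \<open>This is V = (V + r) R_r, the statement that \<open>rsv T r\<close> is V (V + r)^-1. On
  kernels it reads 1 = (1 - exp (- u / r)) + r * ek 0 r u.\<close>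

lemma fint_rsv: "r > 0 \<Longrightarrow> fint T 1 x = fint T 1 (rsv T r x) + r *\<^sub>R rsv T r x"
proof -
  assume r: "r > 0"
  define m where "m u = 1 - exp (- (u / r))" for u
  have [measurable]: "m \<in> borel_measurable borel" unfolding m_def[abs_def] by measurable
  have m: "ker T m" by (rule ker_bounded[of _ _ 1]) (use r in \<open>auto simp: m_def\<close>)
  have "fint T 1 (rsv T r x) = op (tri T m) x"
    by (rule tri_comp[OF ker_pk ker_ek m]) (use pk_ek[OF r] r in \<open>auto simp: m_def\<close>)
  moreover have "fint T 1 x = 1 *\<^sub>R op (tri T m) x + r *\<^sub>R rsv T r x"
    by (rule op_add[OF schur_tri[OF m] schur_rsv[OF r] schur_fint]) (use r in \<open>auto simp: tri_def m_def pk_def ek_def\<close>)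
  ultimately show ?thesis by simp
qed

text \<open>Partial fractions: the kernel of the product is a divided difference of exp (- u / r) in
  r. It is symmetric in r and s, so both orders of composition share it.\<close>

lemma rsv_comp: "r > 0 \<Longrightarrow> s > 0 \<Longrightarrow> r > s \<Longrightarrow>
   (r - s) *\<^sub>R rsv T r (rsv T s x) = r *\<^sub>R rsv T r x - s *\<^sub>R rsv T s x \<and>
   (r - s) *\<^sub>R rsv T s (rsv T r x) = r *\<^sub>R rsv T r x - s *\<^sub>R rsv T s x"
proof -
  assume rs: "r > 0" "s > 0" "r > s"
  define m where "m u = (exp (- (u / r)) - exp (- (u / s))) / (r - s)" for u
  have [measurable]: "m \<in> borel_measurable borel" unfolding m_def[abs_def] by measurable
  have le: "exp (- (u / s)) \<le> exp (- (u / r))" if "u > 0" for u using that rs by (simp add: frac_le)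
  have m: "ker T m"
  proof (rule ker_bounded[of _ _ "1 / (r - s)"])
    show "0 \<le> m u" if "u > 0" for u using le[OF that] rs by (simp add: m_def)
    show "m u \<le> 1 / (r - s)" if "u \<in> {0<..<T}" for u
    proof -
      have "exp (- (u / r)) \<le> 1" "exp (- (u / s)) \<ge> 0" using that rs by auto
      then have "exp (- (u / r)) - exp (- (u / s)) \<le> 1" by linarith
      then show ?thesis unfolding m_def using rs by (intro divide_right_mono) auto
    qed
  qed measurable
  have 1: "rsv T r (rsv T s x) = op (tri T m) x"
    by (rule tri_comp[OF ker_ek ker_ek m]) (use ek_ek[of r s] rs in \<open>auto simp: m_def\<close>)
  have ms: "(exp (- (u / s)) - exp (- (u / r))) / (s - r) = m u" for u
    using rs by (simp add: m_def divide_simps algebra_simps)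
  have 2: "rsv T s (rsv T r x) = op (tri T m) x"
    by (rule tri_comp[OF ker_ek ker_ek m]) (use ek_ek[of s r] rs ms in auto)
  have "rsv T r x = ((r - s) / r) *\<^sub>R op (tri T m) x + (s / r) *\<^sub>R rsv T s x"
    by (rule op_add[OF schur_tri[OF m] schur_rsv schur_rsv]) (use rs in \<open>auto simp: tri_def m_def ek_def field_simps\<close>)
  then have "r *\<^sub>R rsv T r x = (r - s) *\<^sub>R op (tri T m) x + s *\<^sub>R rsv T s x"
    using rs by (simp add: scaleR_add_right)
  then show ?thesis unfolding 1 2 by simp
qed

lemma rsv_resid:
  assumes "r > 0" "s > 0"
  shows "rsv T r x - rsv T s x = (s / r - 1) *\<^sub>R rsv T s (x - rsv T r x)"
proof -
  have e: "(s - r) *\<^sub>R rsv T s (rsv T r x) = s *\<^sub>R rsv T s x - r *\<^sub>R rsv T r x"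
  proof (cases r s rule: linorder_cases)
    case less then show ?thesis using rsv_comp[of s r T x] assms by simp
  next
    case greater
    have "(s - r) *\<^sub>R rsv T s (rsv T r x) = - ((r - s) *\<^sub>R rsv T s (rsv T r x))"
      by (metis minus_diff_eq scaleR_minus_left)
    then show ?thesis using rsv_comp[of r s T x] assms greater by simp
  qed simp
  have "r *\<^sub>R ((s / r - 1) *\<^sub>R rsv T s (x - rsv T r x)) = (s - r) *\<^sub>R (rsv T s x - rsv T s (rsv T r x))"
  proof -
    have "r * (s / r - 1) = s - r" using assms by (simp add: field_simps)
    then show ?thesis by (simp add: linear_diff[OF linear_rsv[OF assms(2)]])
  qed
  also have "\<dots> = r *\<^sub>R (rsv T r x - rsv T s x)" unfolding scaleR_diff_right e by (simp add: algebra_simps)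
  finally show ?thesis using assms by (simp only: scaleR_cancel_left) auto
qed

text \<open>Replacing w by u - w exchanges the two kernels. The bound on l keeps their convolution
  bounded on (0,T), so it is itself an admissible kernel, though it has no closed form here.\<close>

lemma tri_commute:
  assumes k: "ker T k" and l: "ker T l" and B: "\<And>u. u \<in> {0<..<T} \<Longrightarrow> l u \<le> B"
  shows "op (tri T k) (op (tri T l) x) = op (tri T l) (op (tri T k) x)"
proof -
  note [measurable] = ker_meas[OF k] ker_meas[OF l]
  define M where "M u = (\<integral>\<^sup>+w. (if 0 < w \<and> w < u then ennreal (k w * l (u - w)) else 0) \<partial>lborel)" for u
  have M: "(\<integral>\<^sup>+w\<in>{0<..<u}. ennreal (k w * l (u - w)) \<partial>lborel) = M u" for u
    unfolding M_def by (intro nn_integral_cong) (auto simp: indicator_def)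
  have M': "(\<integral>\<^sup>+w\<in>{0<..<u}. ennreal (l w * k (u - w)) \<partial>lborel) = M u" for u
  proof -
    have "(\<integral>\<^sup>+w\<in>{0<..<u}. ennreal (l w * k (u - w)) \<partial>lborel) = (\<integral>\<^sup>+w. ennreal (l (u - w) * k (u - (u - w))) * indicator {0<..<u} (u - w) \<partial>lborel)"
      by (rule nn_integral_shift) measurable
    also have "\<dots> = M u" unfolding M_def by (intro nn_integral_cong) (auto simp: indicator_def mult.commute)
    finally show ?thesis .
  qed
  obtain N where N: "(\<integral>\<^sup>+u\<in>{0<..<T}. ennreal (k u) \<partial>lborel) = ennreal N" "N \<ge> 0"
    using k by (cases "\<integral>\<^sup>+u\<in>{0<..<T}. ennreal (k u) \<partial>lborel") (auto simp: ker_def)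
  have fin: "M u \<le> ennreal (\<bar>B\<bar> * N)" if u: "u \<in> {0<..<T}" for u
  proof -
    have "M u \<le> (\<integral>\<^sup>+w. ennreal \<bar>B\<bar> * (ennreal (k w) * indicator {0<..<T} w) \<partial>lborel)"
      unfolding M_def
    proof (rule nn_integral_mono)
      fix w
      have "k w * l (u - w) \<le> \<bar>B\<bar> * k w" if "0 < w" "w < u"
        using B[of "u - w"] that u ker_nonneg[OF k that(1)] mult_left_mono[of "l (u - w)" "\<bar>B\<bar>" "k w"]
        by (auto simp: mult.commute abs_le_iff)
      then show "(if 0 < w \<and> w < u then ennreal (k w * l (u - w)) else 0) \<le> ennreal \<bar>B\<bar> * (ennreal (k w) * indicator {0<..<T} w)"
        using u ker_nonneg[OF k, of w] by (auto simp: ennreal_mult[symmetric] intro!: ennreal_leI)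
    qed
    also have "\<dots> = ennreal (\<bar>B\<bar> * N)" using N by (subst nn_integral_cmult) (auto simp: ennreal_mult)
    finally show ?thesis .
  qed
  define m where "m u = enn2real (M u)" for u
  have [measurable]: "m \<in> borel_measurable borel" unfolding m_def[abs_def] M_def by measurable
  have e: "M u = ennreal (m u)" if "u \<in> {0<..<T}" for u
    unfolding m_def using le_less_trans[OF fin[OF that] ennreal_less_top] by simp
  have m: "ker T m"
  proof (rule ker_bounded[of _ _ "\<bar>B\<bar> * N"])
    show "m u \<le> \<bar>B\<bar> * N" if "u \<in> {0<..<T}" for u
      using fin[OF that] N unfolding e[OF that] by (subst (asm) ennreal_le_iff) auto
  qed (auto simp: m_def)
  show ?thesis
    using tri_comp[OF k l m, of x] tri_comp[OF l k m, of x] e M M' by simp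
qed

lemma fint_rsv_commute: "a > 0 \<Longrightarrow> r > 0 \<Longrightarrow> rsv T r (fint T a x) = fint T a (rsv T r x)"
  by (rule tri_commute[OF ker_pk ker_ek, where B = "1 / r", symmetric]) (auto simp: ek_def divide_right_mono)

definition one_on :: "real \<Rightarrow> real l2" where "one_on T = mk (indicator {0<..<T})"

lemma indicator_L2: "(indicator {0<..<T} :: real \<Rightarrow> real) \<in> L2 lborel"
proof -
  have "(\<integral>\<^sup>+x. ennreal ((indicator {0<..<T} x)\<^sup>2) \<partial>lborel) = emeasure lborel {0<..<T}"
    by (subst nn_integral_indicator[symmetric]) (simp, rule nn_integral_cong, simp split: split_indicator)
  also have "\<dots> < \<infinity>" by (cases "0 \<le> T") simp_all
  finally show ?thesis by (simp add: L2_iff_nn)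
qed

text \<open>V plus its adjoint has the kernel 1 on the square off the diagonal, so it is the
  rank-one form of the two integrals over (0,T). For x = y the right-hand side is a square, which
  makes V accretive.\<close>

lemma fint_1_sym: "inner (fint T 1 x) y + inner (fint T 1 y) x = inner x (one_on T) * inner y (one_on T)"
proof (rule bilinear_ext_nonneg[of "\<lambda>x y. inner (fint T 1 x) y + inner (fint T 1 y) x" "\<lambda>x y. inner x (one_on T) * inner y (one_on T)"])
  note lf = linear_fint[of 1, simplified, of T]
  show "linear (\<lambda>x. inner (fint T 1 x) y + inner (fint T 1 y) x)" for y
    by (auto intro!: linearI simp: linear_add[OF lf] linear_scale[OF lf] inner_add algebra_simps)
  show "linear (\<lambda>y. inner (fint T 1 x) y + inner (fint T 1 y) x)" for x
    by (auto intro!: linearI simp: linear_add[OF lf] linear_scale[OF lf] inner_add algebra_simps)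
  show "linear (\<lambda>x. inner x (one_on T) * inner y (one_on T))" "linear (\<lambda>x. inner y (one_on T) * inner x (one_on T))" for y
    by (auto intro!: linearI simp: inner_add algebra_simps)
  fix f g :: "real \<Rightarrow> real" assume f: "f \<in> L2 lborel" "\<And>s. 0 \<le> f s" and g: "g \<in> L2 lborel" "\<And>s. 0 \<le> g s"
  have [measurable]: "f \<in> borel_measurable borel" "g \<in> borel_measurable borel" using L2_measurable[OF f(1)] L2_measurable[OF g(1)] by simp_all
  have s: "schur (tri T (pk 1))" by (rule schur_fint) simp
  note [measurable] = schur_meas(2)[OF s]
  let ?U = "indicator {0<..<T} :: real \<Rightarrow> real"
  have one: "ennreal (inner (mk f) (one_on T)) = (\<integral>\<^sup>+s. ennreal (f s * ?U s) \<partial>lborel)" "0 \<le> inner (mk f) (one_on T)"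
    if f: "f \<in> L2 lborel" "\<And>s. 0 \<le> f s" for f
    using f unfolding one_on_def inner_mk[OF f(1) indicator_L2] ip_def
    by (auto intro!: nn_integral_eq_integral[symmetric] L2_mult_integrable indicator_L2 Bochner_Integration.integral_nonneg)
  have "ennreal (inner (fint T 1 (mk f)) (mk g)) + ennreal (inner (fint T 1 (mk g)) (mk f)) =
     (\<integral>\<^sup>+t. \<integral>\<^sup>+s. ennreal (tri T (pk 1) t s * f s * g t) \<partial>lborel \<partial>lborel) + (\<integral>\<^sup>+t. \<integral>\<^sup>+s. ennreal (tri T (pk 1) t s * g s * f t) \<partial>lborel \<partial>lborel)"
    unfolding inner_op_nonneg(1)[OF s f g] inner_op_nonneg(1)[OF s g f] ..
  also have "(\<integral>\<^sup>+t. \<integral>\<^sup>+s. ennreal (tri T (pk 1) t s * g s * f t) \<partial>lborel \<partial>lborel) = (\<integral>\<^sup>+s. \<integral>\<^sup>+t. ennreal (tri T (pk 1) t s * g s * f t) \<partial>lborel \<partial>lborel)"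
    by (rule lborel_pair.Fubini') measurable
  also have "(\<integral>\<^sup>+t. \<integral>\<^sup>+s. ennreal (tri T (pk 1) t s * f s * g t) \<partial>lborel \<partial>lborel) + \<dots> =
     (\<integral>\<^sup>+t. (\<integral>\<^sup>+s. ennreal (tri T (pk 1) t s * f s * g t) \<partial>lborel) + (\<integral>\<^sup>+s. ennreal (tri T (pk 1) s t * g t * f s) \<partial>lborel) \<partial>lborel)"
    by (rule nn_integral_add[symmetric]) measurable
  also have "\<dots> = (\<integral>\<^sup>+t. \<integral>\<^sup>+s. ennreal (f s * ?U s) * ennreal (g t * ?U t) \<partial>lborel \<partial>lborel)"
  proof (rule nn_integral_cong)
    fix t
    have "(\<integral>\<^sup>+s. ennreal (tri T (pk 1) t s * f s * g t) \<partial>lborel) + (\<integral>\<^sup>+s. ennreal (tri T (pk 1) s t * g t * f s) \<partial>lborel) =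
       (\<integral>\<^sup>+s. ennreal (tri T (pk 1) t s * f s * g t) + ennreal (tri T (pk 1) s t * g t * f s) \<partial>lborel)"
      by (rule nn_integral_add[symmetric]) measurable
    \<comment> \<open>Inside the square and off the diagonal exactly one of (t, s) and (s, t) lies
      in the triangle; the diagonal is a null set.\<close>
    also have "\<dots> = (\<integral>\<^sup>+s. ennreal (f s * ?U s) * ennreal (g t * ?U t) \<partial>lborel)"
    proof (rule nn_integral_cong_AE, rule AE_mp[OF AE_lborel_singleton[of t]], intro AE_I2 impI)
      fix s assume "s \<noteq> t"
      then show "ennreal (tri T (pk 1) t s * f s * g t) + ennreal (tri T (pk 1) s t * g t * f s) = ennreal (f s * ?U s) * ennreal (g t * ?U t)"
        using f(2) g(2) by (cases s t rule: linorder_cases) (auto simp: tri_def pk_def indicator_def ennreal_mult[symmetric] mult.commute)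
    qed
    finally show "(\<integral>\<^sup>+s. ennreal (tri T (pk 1) t s * f s * g t) \<partial>lborel) + (\<integral>\<^sup>+s. ennreal (tri T (pk 1) s t * g t * f s) \<partial>lborel)
      = (\<integral>\<^sup>+s. ennreal (f s * ?U s) * ennreal (g t * ?U t) \<partial>lborel)" .
  qed
  also have "\<dots> = (\<integral>\<^sup>+t. (\<integral>\<^sup>+s. ennreal (f s * ?U s) \<partial>lborel) * ennreal (g t * ?U t) \<partial>lborel)"
    by (intro nn_integral_cong nn_integral_multc) measurable
  also have "\<dots> = (\<integral>\<^sup>+s. ennreal (f s * ?U s) \<partial>lborel) * (\<integral>\<^sup>+t. ennreal (g t * ?U t) \<partial>lborel)"
    by (rule nn_integral_cmult) measurable
  also have "\<dots> = ennreal (inner (mk f) (one_on T) * inner (mk g) (one_on T))"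
    using one[OF f] one[OF g] by (simp add: ennreal_mult)
  finally have "ennreal (inner (fint T 1 (mk f)) (mk g) + inner (fint T 1 (mk g)) (mk f)) = ennreal (inner (mk f) (one_on T) * inner (mk g) (one_on T))"
    using inner_op_nonneg(2)[OF s f g] inner_op_nonneg(2)[OF s g f] by simp
  then show "inner (fint T 1 (mk f)) (mk g) + inner (fint T 1 (mk g)) (mk f) = inner (mk f) (one_on T) * inner (mk g) (one_on T)"
    using inner_op_nonneg(2)[OF s f g] inner_op_nonneg(2)[OF s g f] one(2)[OF f] one(2)[OF g]
    by (subst (asm) ennreal_inj) (auto intro: mult_nonneg_nonneg add_nonneg_nonneg)
qed

lemma fint_1_accretive: "0 \<le> inner (fint T 1 x) x"
  using fint_1_sym[of T x x] by (simp add: inner_commute) (metis zero_le_square mult_2 zero_le_double_add_iff_zero_le_single_add)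

text \<open>For y = x - R_r x the identity V = (V + r) R_r gives V y = r R_r x, so (R_r x, y) is (V
  y, y) / r and accretivity of V applies.\<close>

lemma resolvent_rsv: "resolvent (rsv T)"
proof (rule resolvent.intro)
  show "linear (rsv T r)" if "r > 0" for r by (rule linear_rsv[OF that])
  show "rsv T r x - rsv T s x = (s / r - 1) *\<^sub>R rsv T s (x - rsv T r x)" if "r > 0" "s > 0" for r s x
    by (rule rsv_resid[OF that])
  fix r :: real and x :: "real l2"
  assume r: "r > 0"
  have "fint T 1 (x - rsv T r x) = r *\<^sub>R rsv T r x"
    using fint_rsv[OF r, of T x] by (simp add: linear_diff[OF linear_fint])
  then have "r * inner (rsv T r x) (x - rsv T r x) = inner (fint T 1 (x - rsv T r x)) (x - rsv T r x)" by simp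
  then have "0 \<le> r * inner (rsv T r x) (x - rsv T r x)" using fint_1_accretive by simp
  then show "0 \<le> inner (rsv T r x) (x - rsv T r x)" using r by (simp add: zero_le_mult_iff)
qed

text \<open>The adjoint of V has the same quadratic form as V, so it is accretive too; the
  identities are transposed by pairing with an arbitrary vector.\<close>

lemma resolvent_rsv': "resolvent (rsv' T)"
proof (rule resolvent.intro)
  interpret resolvent "rsv T" by (rule resolvent_rsv)
  show "linear (rsv' T r)" if "r > 0" for r by (rule linear_op[OF schur_transp[OF schur_rsv[OF that]]])
  fix r :: real and x :: "real l2"
  assume r: "r > 0"
  note adj = op_adj[OF schur_rsv[OF r]] and adjV = op_adj[OF schur_fint[OF zero_less_one]]
  let ?y = "x - rsv' T r x"
  have "fint' T 1 ?y = r *\<^sub>R rsv' T r x"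
  proof (rule inner_ext, subst (1 2) inner_commute)
    fix z
    have "inner z (fint' T 1 ?y) = inner (fint T 1 z - rsv T r (fint T 1 z)) x"
      by (simp add: adjV[symmetric] inner_diff adj)
    also have "fint T 1 z - rsv T r (fint T 1 z) = r *\<^sub>R rsv T r z"
      using fint_rsv[OF r, of T z] fint_rsv_commute[of 1 r T z] r by simp
    finally show "inner z (fint' T 1 ?y) = inner z (r *\<^sub>R rsv' T r x)" by (simp add: adj)
  qed
  then have "r * inner (rsv' T r x) ?y = inner (fint' T 1 ?y) ?y" by simp
  also have "\<dots> = inner (fint T 1 ?y) ?y" by (subst adjV) (rule inner_commute)
  finally have "0 \<le> r * inner (rsv' T r x) ?y" using fint_1_accretive by simp
  then show "0 \<le> inner (rsv' T r x) ?y" using r by (simp add: zero_le_mult_iff)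
  fix s :: real assume s: "s > 0"
  note adjs = op_adj[OF schur_rsv[OF s]]
  show "rsv' T r x - rsv' T s x = (s / r - 1) *\<^sub>R rsv' T s (x - rsv' T r x)"
  proof (rule inner_ext, subst (1 2) inner_commute)
    fix z
    have "inner z (rsv' T r x - rsv' T s x) = inner (rsv T r z - rsv T s z) x" by (simp add: inner_diff adj adjs)
    also have "\<dots> = (s / r - 1) * inner (rsv T s z - rsv T r (rsv T s z)) x"
      unfolding resid[OF r s] by (simp add: R_diff[OF s] R_commute[OF r s])
    also have "\<dots> = inner z ((s / r - 1) *\<^sub>R rsv' T s (x - rsv' T r x))"
      by (simp add: inner_diff adj adjs linear_diff[OF linear_op[OF schur_transp[OF schur_rsv[OF s]]]])
    finally show "inner z (rsv' T r x - rsv' T s x) = inner z ((s / r - 1) *\<^sub>R rsv' T s (x - rsv' T r x))" .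
  qed
qed

section \<open>Weak derivatives on an interval\<close>

text \<open>Pointwise version of V on functions rather than classes, defined for every real t:
  boundary values need such a representative.\<close>

definition bint :: "real \<Rightarrow> (real \<Rightarrow> real) \<Rightarrow> real \<Rightarrow> real" where
  "bint T f t = (\<integral>s. indicator {0<..<T} s * (if t < s then f s else 0) \<partial>lborel)"

lemma mon_integrable_iff: "integrable (mon {0<..<T}) f \<longleftrightarrow> integrable lborel (\<lambda>s. indicator {0<..<T::real} s * f s)"
  for f :: "real \<Rightarrow> real"
  by (simp add: integrable_restrict_space)

lemma mon_integral: "(\<integral>s. f s \<partial>mon {0<..<T}) = (\<integral>s. indicator {0<..<T::real} s * f s \<partial>lborel)"
  for f :: "real \<Rightarrow> real"
  by (simp add: integral_restrict_space)

lemma bint_integrable: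
  fixes T :: real
  assumes "f \<in> L2 (mon {0<..<T})"
  shows "integrable lborel (\<lambda>s. indicator {0<..<T} s * (if t < s then f s else 0))"
proof -
  have i: "integrable lborel (\<lambda>s. indicator {0<..<T} s * f s)"
    using L2_integrable_mon[OF assms] by (simp add: mon_integrable_iff)
  have "integrable lborel (\<lambda>s. indicator {t<..} s * (indicator {0<..<T} s * f s))"
    using integrable_mult_indicator[OF _ i, of "{t<..}"] by simp
  moreover have "(\<lambda>s. indicator {t<..} s * (indicator {0<..<T} s * f s)) = (\<lambda>s. indicator {0<..<T} s * (if t < s then f s else 0))"
    by (auto simp: indicator_def fun_eq_iff)
  ultimately show ?thesis by simp
qed

lemma bint_continuous:
  assumes f: "f \<in> L2 (mon {0<..<T})"
  shows "continuous_on UNIV (bint T f)"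
proof -
  have "bint T f \<midarrow>t\<rightarrow> bint T f t" for t
  proof (rule tendsto_at_iff_sequentially[THEN iffD2], intro allI impI)
    fix X assume X: "\<forall>i. X i \<in> UNIV - {t}" "X \<longlonglongrightarrow> t"
    have "(\<lambda>i. \<integral>s. indicator {0<..<T} s * (if X i < s then f s else 0) \<partial>lborel) \<longlonglongrightarrow>
       (\<integral>s. indicator {0<..<T} s * (if t < s then f s else 0) \<partial>lborel)"
    proof (rule integral_dominated_convergence[where w = "\<lambda>s. \<bar>indicator {0<..<T} s * f s\<bar>"])
      show "AE s in lborel. (\<lambda>i. indicator {0<..<T} s * (if X i < s then f s else 0)) \<longlonglongrightarrow> indicator {0<..<T} s * (if t < s then f s else 0)"
      proof (rule AE_mp[OF AE_lborel_singleton[of t]], intro AE_I2 impI)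
        fix s :: real assume "s \<noteq> t"
        then consider "t < s" | "s < t" by linarith
        then have "eventually (\<lambda>i. (X i < s) = (t < s)) sequentially"
        proof cases
          case 1 then show ?thesis using order_tendstoD(2)[OF X(2), of s] by (auto elim: eventually_mono)
        next
          case 2 then show ?thesis using order_tendstoD(1)[OF X(2), of s] by (auto elim: eventually_mono)
        qed
        then show "(\<lambda>i. indicator {0<..<T} s * (if X i < s then f s else 0)) \<longlonglongrightarrow> indicator {0<..<T} s * (if t < s then f s else 0)"
        proof (intro tendsto_eventually, elim eventually_mono)
          fix i assume "(X i < s) = (t < s)"
          then show "indicator {0<..<T} s * (if X i < s then f s else 0) = indicator {0<..<T} s * (if t < s then f s else 0)" by simp
        qed
      qed
      show "integrable lborel (\<lambda>s. \<bar>indicator {0<..<T} s * f s\<bar>)"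
        using L2_integrable_mon[OF f] by (simp add: mon_integrable_iff)
    qed (use bint_integrable[OF f] in \<open>auto intro: borel_measurable_integrable simp: abs_mult indicator_def\<close>)
    then show "((bint T f) \<circ> X) \<longlonglongrightarrow> bint T f t" by (simp add: comp_def bint_def)
  qed
  then show ?thesis by (simp add: continuous_on_eq_continuous_at isCont_def)
qed

lemma bint_at_end: "bint T f T = 0"
proof -
  have "(\<lambda>s. indicator {0<..<T} s * (if T < s then f s else 0)) = (\<lambda>s. 0)" by (auto simp: indicator_def)
  then show ?thesis by (simp only: bint_def) simp
qed

lemma bint_cong_AE:
  assumes "f \<in> L2 (mon {0<..<T})" "g \<in> L2 (mon {0<..<T})" "AE s in mon {0<..<T}. f s = g s"
  shows "bint T f t = bint T g t"
  unfolding bint_def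
proof (rule integral_cong_AE)
  show "AE s in lborel. indicator {0<..<T} s * (if t < s then f s else 0) = indicator {0<..<T} s * (if t < s then g s else 0)"
    using assms(3) by (subst (asm) AE_restrict_space_iff) (auto elim: AE_mp simp: indicator_def)
qed (use bint_integrable assms in \<open>blast intro: borel_measurable_integrable\<close>)+

lemma bint_bounded:
  assumes f: "f \<in> L2 (mon {0<..<T})"
  shows "\<bar>bint T f t\<bar> \<le> (\<integral>s. \<bar>f s\<bar> \<partial>mon {0<..<T})"
  unfolding bint_def mon_integral
  by (rule integral_abs_bound_integral[OF bint_integrable[OF f]])
     (use L2_integrable_mon[OF f] in \<open>auto simp: mon_integrable_iff indicator_def abs_mult dest: integrable_abs\<close>)

lemma bint_L2: "f \<in> L2 (mon {0<..<T}) \<Longrightarrow> bint T f \<in> L2 (mon {0<..<T})"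
  by (intro L2_bounded_mon[OF _ bint_bounded] measurable_restrict_space1)
     (simp_all add: borel_measurable_continuous_onI[OF bint_continuous])

text \<open>For fixed s the integral of \<open>deriv \<psi>\<close> over (0,s) is \<psi> s, because
  \<psi> vanishes at 0; the rest is an exchange of the order of integration.\<close>

lemma bint_parts:
  assumes f: "f \<in> L2 (mon {0<..<T})" and T: "T > 0" and psi: "\<psi> \<in> test_functions {0<..<T}"
  shows "ip (mon {0<..<T}) (bint T f) (deriv \<psi>) = ip (mon {0<..<T}) f \<psi>"
proof -
  let ?U = "indicator {0<..<T} :: real \<Rightarrow> real"
  note d = smooth_realD[OF test_smooth[OF psi]]
  have dt: "deriv \<psi> \<in> test_functions {0<..<T}" by (rule test_deriv[OF psi T])
  obtain B where B: "\<And>x. \<bar>deriv \<psi> x\<bar> \<le> B" using test_bounded[OF dt T] by blast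
  have [measurable]: "deriv \<psi> \<in> borel_measurable borel" "\<psi> \<in> borel_measurable borel"
    using test_measurable[OF dt] test_measurable[OF psi] by auto
  have fi: "integrable lborel (\<lambda>s. ?U s * f s)" using L2_integrable_mon[OF f] by (simp add: mon_integrable_iff)
  define F where "F s = ?U s * f s" for s
  have [measurable]: "F \<in> borel_measurable borel" using fi unfolding F_def[abs_def] by (simp add: borel_measurable_integrable)
  have p0: "\<psi> 0 = 0" using test_functionsE[OF psi T] by (metis atLeastAtMost_iff not_less)
  have inner: "(\<integral>t. ?U t * (if t < s then F s else 0) * deriv \<psi> t \<partial>lborel) = F s * \<psi> s" for s
  proof (cases "s \<in> {0<..<T}")
    case True
    have "(\<integral>t. ?U t * (if t < s then F s else 0) * deriv \<psi> t \<partial>lborel) = (\<integral>t. F s * (deriv \<psi> t * indicator {0..s} t) \<partial>lborel)"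
    proof (rule integral_cong_AE)
      have "AE t in lborel. t \<noteq> 0 \<and> t \<noteq> s" by (intro AE_conjI AE_lborel_singleton)
      then show "AE t in lborel. ?U t * (if t < s then F s else 0) * deriv \<psi> t = F s * (deriv \<psi> t * indicator {0..s} t)"
        by eventually_elim (use True in \<open>auto simp: indicator_def\<close>)
    qed measurable
    also have "\<dots> = F s * (\<psi> s - \<psi> 0)"
      using True d(1) smooth_cont[OF test_smooth[OF dt], of UNIV]
      by (subst integral_mult_right_zero, subst integral_FTC_Icc_real) (auto simp: continuous_on_eq_continuous_at)
    finally show ?thesis using p0 by simp
  next
    case False
    then have "F s = 0" by (simp add: F_def)
    then have "?U t * (if t < s then F s else 0) * deriv \<psi> t = 0" for t by simp
    then show ?thesis using \<open>F s = 0\<close> by (simp only: Bochner_Integration.integral_zero mult_zero_left)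
  qed
  have "ip (mon {0<..<T}) (bint T f) (deriv \<psi>) = (\<integral>t. ?U t * (bint T f t * deriv \<psi> t) \<partial>lborel)"
    by (simp add: ip_def mon_integral)
  also have "\<dots> = (\<integral>t. \<integral>s. ?U t * (if t < s then F s else 0) * deriv \<psi> t \<partial>lborel \<partial>lborel)"
  proof (rule Bochner_Integration.integral_cong[OF refl])
    fix t
    have "bint T f t = (\<integral>s. (if t < s then F s else 0) \<partial>lborel)"
      unfolding bint_def by (intro Bochner_Integration.integral_cong) (auto simp: F_def)
    then have "?U t * (bint T f t * deriv \<psi> t) = (?U t * deriv \<psi> t) * (\<integral>s. (if t < s then F s else 0) \<partial>lborel)" by simp
    also have "\<dots> = (\<integral>s. (?U t * deriv \<psi> t) * (if t < s then F s else 0) \<partial>lborel)" by simp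
    finally show "?U t * (bint T f t * deriv \<psi> t) = (\<integral>s. ?U t * (if t < s then F s else 0) * deriv \<psi> t \<partial>lborel)"
      by (simp add: mult_ac)
  qed
  also have "\<dots> = (\<integral>s. \<integral>t. ?U t * (if t < s then F s else 0) * deriv \<psi> t \<partial>lborel \<partial>lborel)"
  proof (rule lborel_pair.Fubini_integral[symmetric])
    have "integrable (lborel \<Otimes>\<^sub>M lborel) (\<lambda>(t, s). (?U t * B) * F s)"
    proof (rule lborel_pair.Fubini_integrable)
      have "integrable lborel (\<lambda>t. \<bar>?U t * B\<bar> * (\<integral>s. \<bar>F s\<bar> \<partial>lborel))"
        using T by (intro integrable_mult_left) (auto simp: abs_mult intro!: integrable_mult_left integrable_real_indicator)
      then show "integrable lborel (\<lambda>x. \<integral>y. norm (case (x, y) of (t, s) \<Rightarrow> ?U t * B * F s) \<partial>lborel)"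
        by (simp add: abs_mult)
      show "AE x in lborel. integrable lborel (\<lambda>y. case (x, y) of (t, s) \<Rightarrow> ?U t * B * F s)"
        using fi by (auto simp: F_def[abs_def])
    qed measurable
    then show "integrable (lborel \<Otimes>\<^sub>M lborel) (\<lambda>(t, s). ?U t * (if t < s then F s else 0) * deriv \<psi> t)"
    proof (rule Bochner_Integration.integrable_bound)
      show "AE x in lborel \<Otimes>\<^sub>M lborel. norm (case x of (t, s) \<Rightarrow> ?U t * (if t < s then F s else 0) * deriv \<psi> t) \<le> norm (case x of (t, s) \<Rightarrow> ?U t * B * F s)"
      proof (rule AE_I2)
        fix x :: "real \<times> real"
        obtain t s where x: "x = (t, s)" by (cases x)
        have "\<bar>?U t * (if t < s then F s else 0)\<bar> * \<bar>deriv \<psi> t\<bar> \<le> \<bar>?U t * F s\<bar> * \<bar>B\<bar>"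
          using order_trans[OF B abs_ge_self] by (intro mult_mono) (auto simp: abs_mult)
        then show "norm (case x of (t, s) \<Rightarrow> ?U t * (if t < s then F s else 0) * deriv \<psi> t) \<le> norm (case x of (t, s) \<Rightarrow> ?U t * B * F s)"
          unfolding x by (simp add: abs_mult mult_ac)
      qed
    qed measurable
  qed
  also have "\<dots> = (\<integral>s. F s * \<psi> s \<partial>lborel)" unfolding inner ..
  also have "\<dots> = ip (mon {0<..<T}) f \<psi>" by (simp add: ip_def mon_integral F_def mult.assoc)
  finally show ?thesis .
qed

lemma weak_deriv_unique:
  assumes "has_weak_deriv T k v w" "has_weak_deriv T k v w'" "T > 0"
  shows "AE t in mon {0<..<T}. w t = w' t"
proof -
  have L: "w \<in> L2 (mon {0<..<T})" "w' \<in> L2 (mon {0<..<T})" using assms by (auto simp: has_weak_deriv_def)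
  have "AE t in mon {0<..<T}. w t - w' t = 0"
  proof (rule test_functions_separating[OF L2_diff[OF L] assms(3)])
    fix \<psi> :: "real \<Rightarrow> real" assume psi: "\<psi> \<in> test_functions {0<..<T}"
    have "ip (mon {0<..<T}) (\<lambda>t. w t - w' t) \<psi> = ip (mon {0<..<T}) w \<psi> - ip (mon {0<..<T}) w' \<psi>"
      using L2_mult_integrable[OF L(1) test_L2[OF psi assms(3)]] L2_mult_integrable[OF L(2) test_L2[OF psi assms(3)]]
      by (simp add: ip_def left_diff_distrib)
    moreover have "(-1) ^ k * ip (mon {0<..<T}) w \<psi> = (-1) ^ k * ip (mon {0<..<T}) w' \<psi>"
      using assms(1,2) psi unfolding has_weak_deriv_def by metis
    ultimately show "ip (mon {0<..<T}) (\<lambda>t. w t - w' t) \<psi> = 0" by simp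
  qed
  then show ?thesis by simp
qed

lemma has_weak_deriv_cong_left:
  assumes "has_weak_deriv T k v w" "v \<in> borel_measurable (mon {0<..<T})" "v' \<in> borel_measurable (mon {0<..<T})"
    "AE t in mon {0<..<T}. v t = v' t" "T > 0"
  shows "has_weak_deriv T k v' w"
proof -
  have "ip (mon {0<..<T}) v ((deriv ^^ k) \<psi>) = ip (mon {0<..<T}) v' ((deriv ^^ k) \<psi>)" if "\<psi> \<in> test_functions {0<..<T}" for \<psi>
  proof -
    have "(deriv ^^ k) \<psi> \<in> test_functions {0<..<T}" by (induction k) (use that test_deriv assms(5) in auto)
    then have [measurable]: "(deriv ^^ k) \<psi> \<in> borel_measurable (mon {0<..<T})" by (intro measurable_restrict_space1) (simp add: test_measurable)
    show ?thesis unfolding ip_def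
      by (rule integral_cong_AE) (use assms in auto)
  qed
  then show ?thesis using assms(1) by (simp add: has_weak_deriv_def)
qed

lemma has_weak_deriv_SOME: "has_weak_deriv T k v w \<Longrightarrow> has_weak_deriv T k v (weak_deriv T k v)"
  unfolding weak_deriv_def by (rule someI[of "has_weak_deriv T k v"])

lemma weak_deriv_AE: "has_weak_deriv T k v w \<Longrightarrow> T > 0 \<Longrightarrow> AE t in mon {0<..<T}. weak_deriv T k v t = w t"
  using weak_deriv_unique[OF has_weak_deriv_SOME] by blast

lemma has_weak_deriv_0: "v \<in> L2 (mon {0<..<T}) \<Longrightarrow> has_weak_deriv T 0 v v"
  by (simp add: has_weak_deriv_def)

lemma has_weak_deriv_bint: "f \<in> L2 (mon {0<..<T}) \<Longrightarrow> T > 0 \<Longrightarrow> has_weak_deriv T 1 (bint T f) (\<lambda>t. - f t)"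
  unfolding has_weak_deriv_def using bint_parts[of f T] by (auto simp: ip_def)

lemma has_weak_deriv_bint2:
  assumes "f \<in> L2 (mon {0<..<T})" "T > 0"
  shows "has_weak_deriv T 2 (bint T (bint T f)) f"
proof -
  have "ip (mon {0<..<T}) (bint T (bint T f)) (deriv (deriv \<psi>)) = ip (mon {0<..<T}) f \<psi>" if "\<psi> \<in> test_functions {0<..<T}" for \<psi>
    using bint_parts[OF bint_L2[OF assms(1)] assms(2) test_deriv[OF that assms(2)]] bint_parts[OF assms that] by simp
  then show ?thesis using assms by (simp add: has_weak_deriv_def numeral_2_eq_2)
qed

text \<open>v and the backward integral of - w have the same weak derivative, so they differ by a
  constant. The continuous representatives both vanish at T, hence so does the constant.\<close>

lemma weak_deriv_bint:
  assumes v: "v \<in> L2 (mon {0<..<T})" and w: "has_weak_deriv T 1 v w" and e: "has_value_at T v T 0" and T: "T > 0"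
  shows "AE t in mon {0<..<T}. v t = bint T (\<lambda>t. - w t) t"
proof -
  have wL: "w \<in> L2 (mon {0<..<T})" using w by (simp add: has_weak_deriv_def)
  let ?b = "bint T (\<lambda>t. - w t)"
  have bL: "?b \<in> L2 (mon {0<..<T})" by (rule bint_L2[OF L2_uminus[OF wL]])
  have "\<exists>c. AE t in mon {0<..<T}. v t - ?b t = c"
  proof (rule du_Bois_Reymond[OF L2_diff[OF v bL] T])
    fix \<psi> assume psi: "\<psi> \<in> test_functions {0<..<T}"
    note dL = test_L2[OF test_deriv[OF psi T] T]
    have "ip (mon {0<..<T}) (\<lambda>t. v t - ?b t) (deriv \<psi>) = ip (mon {0<..<T}) v (deriv \<psi>) - ip (mon {0<..<T}) ?b (deriv \<psi>)"
      using L2_mult_integrable[OF v dL] L2_mult_integrable[OF bL dL] by (simp add: ip_def left_diff_distrib)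
    also have "ip (mon {0<..<T}) ?b (deriv \<psi>) = ip (mon {0<..<T}) (\<lambda>t. - w t) \<psi>" by (rule bint_parts[OF L2_uminus[OF wL] T psi])
    also have "ip (mon {0<..<T}) v (deriv \<psi>) = - ip (mon {0<..<T}) w \<psi>"
      using w psi by (simp add: has_weak_deriv_def)
    finally show "ip (mon {0<..<T}) (\<lambda>t. v t - ?b t) (deriv \<psi>) = 0" by (simp add: ip_def)
  qed
  then obtain c where c: "AE t in mon {0<..<T}. v t - ?b t = c" by blast
  obtain h where h: "continuous_on {0..T} h" "AE t in mon {0<..<T}. v t = h t" "h T = 0"
    using e by (auto simp: has_value_at_def)
  have "AE t in mon {0<..<T}. h t - ?b t = c" using c h(2) by eventually_elim simp
  then have ae: "AE t in lborel. t \<in> {0<..<T} \<longrightarrow> h t - ?b t = c" by (subst (asm) AE_restrict_space_iff) auto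
  have cont: "continuous_on {0..T} (\<lambda>t. h t - ?b t)"
    by (intro continuous_intros h(1) continuous_on_subset[OF bint_continuous[OF L2_uminus[OF wL]]]) auto
  \<comment> \<open>Otherwise continuity keeps the difference away from c on an interval (a,T) of
    positive measure, against the equality almost everywhere.\<close>
  have "h T - ?b T = c"
  proof (rule ccontr)
    assume ne: "h T - ?b T \<noteq> c"
    have "((\<lambda>t. h t - ?b t) \<longlongrightarrow> h T - ?b T) (at T within {0..T})"
      using cont T by (simp add: continuous_on_def)
    then have "eventually (\<lambda>t. h t - ?b t \<noteq> c) (at T within {0..T})"
      using ne by (rule tendsto_imp_eventually_ne)
    then obtain d where d: "d > 0" "\<And>t. t \<in> {0..T} \<Longrightarrow> t \<noteq> T \<Longrightarrow> dist t T < d \<Longrightarrow> h t - ?b t \<noteq> c"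
      by (auto simp: eventually_at)
    define a where "a = max (T / 2) (T - d / 2)"
    have a: "0 < a" "a < T" "T - d < a" using T d(1) by (auto simp: a_def max_def)
    have "AE t in lborel. t \<notin> {a<..<T}"
      using ae
    proof (rule AE_mp, intro AE_I2 impI notI)
      fix t assume "t \<in> {0<..<T} \<longrightarrow> h t - ?b t = c" "t \<in> {a<..<T}"
      then show False using d(2)[of t] a by (auto simp: dist_real_def)
    qed
    then have "emeasure lborel {t \<in> space lborel. \<not> t \<notin> {a<..<T}} = 0" by (subst (asm) AE_iff_null) (auto simp: null_sets_def)
    moreover have "{t \<in> space lborel. \<not> t \<notin> {a<..<T}} = {a<..<T}" by auto
    ultimately have "emeasure lborel {a<..<T} = 0" by (simp only:)
    then show False using a by simp
  qed
  then have "c = 0" using h(3) bint_at_end by simp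
  then show ?thesis using c by (auto elim: AE_mp)
qed

lemma has_value_at_bint: 
  assumes "f \<in> L2 (mon {0<..<T})" "AE t in mon {0<..<T}. v t = c * bint T f t"
  shows "has_value_at T v T 0"
  unfolding has_value_at_def
  by (rule exI[of _ "\<lambda>t. c * bint T f t"])
     (use assms bint_at_end in \<open>auto intro!: continuous_intros continuous_on_subset[OF bint_continuous]\<close>)

text \<open>With its converse \<open>H0_int_1E\<close> this identifies the space of order one with V
  L2, normed by the preimage; \<open>H0_int_2I\<close> and \<open>H0_int_2E\<close> do the same for
  V^2. The condition at T excludes constants of integration.\<close>

lemma H0_int_1I:
  assumes f: "f \<in> L2 (mon {0<..<T})" and T: "T > 0" and v: "v \<in> borel_measurable (mon {0<..<T})" "AE t in mon {0<..<T}. v t = bint T f t"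
  shows "v \<in> H0_int T 1" "H0_int_norm T 1 v = L2norm (mon {0<..<T}) f"
proof -
  note bL = bint_L2[OF f]
  have AE': "AE t in mon {0<..<T}. bint T f t = v t" using v(2) by (auto elim: AE_mp)
  have vL: "v \<in> L2 (mon {0<..<T})" by (rule L2_AE_cong[OF bL v(1) AE'])
  have d1: "has_weak_deriv T 1 v (\<lambda>t. - f t)"
    by (rule has_weak_deriv_cong_left[OF has_weak_deriv_bint[OF f T] L2_measurable[OF bL] v(1) AE' T])
  have "has_value_at T (weak_deriv T 0 v) T 0"
  proof (rule has_value_at_bint[OF f, of _ 1])
    show "AE t in mon {0<..<T}. weak_deriv T 0 v t = 1 * bint T f t"
      using weak_deriv_AE[OF has_weak_deriv_0[OF vL] T] v(2) by eventually_elim simp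
  qed
  then show "v \<in> H0_int T 1"
    using vL d1 has_weak_deriv_0[OF vL] by (auto simp: H0_int_def le_Suc_eq)
  have "(\<integral>t. (weak_deriv T 1 v t)\<^sup>2 \<partial>mon {0<..<T}) = (\<integral>t. (f t)\<^sup>2 \<partial>mon {0<..<T})"
  proof (rule integral_cong_AE)
    have "weak_deriv T 1 v \<in> L2 (mon {0<..<T})" using has_weak_deriv_SOME[OF d1] by (simp add: has_weak_deriv_def)
    then show "(\<lambda>t. (weak_deriv T 1 v t)\<^sup>2) \<in> borel_measurable (mon {0<..<T})" using L2_measurable by measurable
    show "(\<lambda>t. (f t)\<^sup>2) \<in> borel_measurable (mon {0<..<T})" using L2_measurable[OF f] by measurable
    show "AE t in mon {0<..<T}. (weak_deriv T 1 v t)\<^sup>2 = (f t)\<^sup>2"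
      using weak_deriv_AE[OF d1 T] by eventually_elim simp
  qed
  then show "H0_int_norm T 1 v = L2norm (mon {0<..<T}) f" by (simp add: H0_int_norm_def L2norm_def)
qed

lemma H0_int_1E:
  assumes "v \<in> H0_int T 1" "T > 0"
  obtains f where "f \<in> L2 (mon {0<..<T})" "AE t in mon {0<..<T}. v t = bint T f t"
proof -
  have vL: "v \<in> L2 (mon {0<..<T})" using assms by (simp add: H0_int_def)
  obtain w where w: "has_weak_deriv T 1 v w" using assms by (auto simp: H0_int_def)
  have e0: "has_value_at T (weak_deriv T 0 v) T 0" using assms by (auto simp: H0_int_def)
  have "has_value_at T v T 0"
  proof -
    obtain c where c: "continuous_on {0..T} c" "AE t in mon {0<..<T}. weak_deriv T 0 v t = c t" "c T = 0"
      using e0 by (auto simp: has_value_at_def)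
    have "AE t in mon {0<..<T}. v t = c t" using c(2) weak_deriv_AE[OF has_weak_deriv_0[OF vL] assms(2)] by eventually_elim simp
    then show ?thesis using c by (auto simp: has_value_at_def)
  qed
  from weak_deriv_bint[OF vL w this assms(2)] show ?thesis
    using that[of "\<lambda>t. - w t"] w by (auto simp: has_weak_deriv_def)
qed

lemma H0_int_2I:
  assumes f: "f \<in> L2 (mon {0<..<T})" and T: "T > 0" and v: "v \<in> borel_measurable (mon {0<..<T})" "AE t in mon {0<..<T}. v t = bint T (bint T f) t"
  shows "v \<in> H0_int T 2" "H0_int_norm T 2 v = L2norm (mon {0<..<T}) f"
proof -
  note bL = bint_L2[OF f] note bbL = bint_L2[OF bL]
  have AE': "AE t in mon {0<..<T}. bint T (bint T f) t = v t" using v(2) by (auto elim: AE_mp)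
  have vL: "v \<in> L2 (mon {0<..<T})" by (rule L2_AE_cong[OF bbL v(1) AE'])
  have d1: "has_weak_deriv T 1 v (\<lambda>t. - bint T f t)"
    by (rule has_weak_deriv_cong_left[OF has_weak_deriv_bint[OF bL T] L2_measurable[OF bbL] v(1) AE' T])
  have d2: "has_weak_deriv T 2 v f"
    by (rule has_weak_deriv_cong_left[OF has_weak_deriv_bint2[OF f T] L2_measurable[OF bbL] v(1) AE' T])
  have "has_value_at T (weak_deriv T 0 v) T 0"
  proof (rule has_value_at_bint[OF bL, of _ 1])
    show "AE t in mon {0<..<T}. weak_deriv T 0 v t = 1 * bint T (bint T f) t"
      using weak_deriv_AE[OF has_weak_deriv_0[OF vL] T] v(2) by eventually_elim simp
  qed
  moreover have "has_value_at T (weak_deriv T 1 v) T 0"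
  proof (rule has_value_at_bint[OF f, of _ "-1"])
    show "AE t in mon {0<..<T}. weak_deriv T 1 v t = -1 * bint T f t"
      using weak_deriv_AE[OF d1 T] by eventually_elim simp
  qed
  moreover have "k = 0 \<or> k = 1 \<or> k = 2" if "k \<le> 2" for k :: nat using that by auto
  moreover have "k = 0 \<or> k = 1" if "k < 2" for k :: nat using that by auto
  ultimately show "v \<in> H0_int T 2"
    using vL d1 d2 has_weak_deriv_0[OF vL] unfolding H0_int_def by blast
  have "(\<integral>t. (weak_deriv T 2 v t)\<^sup>2 \<partial>mon {0<..<T}) = (\<integral>t. (f t)\<^sup>2 \<partial>mon {0<..<T})"
  proof (rule integral_cong_AE)
    have "weak_deriv T 2 v \<in> L2 (mon {0<..<T})" using has_weak_deriv_SOME[OF d2] by (simp add: has_weak_deriv_def)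
    then show "(\<lambda>t. (weak_deriv T 2 v t)\<^sup>2) \<in> borel_measurable (mon {0<..<T})" using L2_measurable by measurable
    show "(\<lambda>t. (f t)\<^sup>2) \<in> borel_measurable (mon {0<..<T})" using L2_measurable[OF f] by measurable
    show "AE t in mon {0<..<T}. (weak_deriv T 2 v t)\<^sup>2 = (f t)\<^sup>2"
      using weak_deriv_AE[OF d2 T] by eventually_elim simp
  qed
  then show "H0_int_norm T 2 v = L2norm (mon {0<..<T}) f" by (simp add: H0_int_norm_def L2norm_def)
qed

lemma H0_int_2E:
  assumes "v \<in> H0_int T 2" "T > 0"
  obtains f where "f \<in> L2 (mon {0<..<T})" "AE t in mon {0<..<T}. v t = bint T (bint T f) t"
proof -
  have vL: "v \<in> L2 (mon {0<..<T})" using assms by (simp add: H0_int_def)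
  have "v \<in> H0_int T 1" using assms by (auto simp: H0_int_def)
  have ex: "\<exists>w. has_weak_deriv T k v w" if "k \<le> 2" for k using assms that by (auto simp: H0_int_def)
  have ends: "has_value_at T (weak_deriv T k v) T 0" if "k < 2" for k using assms that by (auto simp: H0_int_def)
  define w1 where "w1 = weak_deriv T 1 v"
  have w1: "has_weak_deriv T 1 v w1" unfolding w1_def using ex[of 1] has_weak_deriv_SOME by auto
  have w1L: "w1 \<in> L2 (mon {0<..<T})" using w1 by (simp add: has_weak_deriv_def)
  obtain w2 where w2: "has_weak_deriv T 2 v w2" using ex[of 2] by auto
  \<comment> \<open>Derivatives of test functions are test functions, so the second weak derivative
    is the weak derivative of the first, and the first-order representation can be used
    twice.\<close>
  have "has_weak_deriv T 1 w1 w2"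
    unfolding has_weak_deriv_def
  proof (intro conjI ballI)
    show w2L: "w2 \<in> L2 (mon {0<..<T})" using w2 by (simp add: has_weak_deriv_def)
    fix \<psi> :: "real \<Rightarrow> real" assume psi: "\<psi> \<in> test_functions {0<..<T}"
    have "ip (mon {0<..<T}) v (deriv (deriv \<psi>)) = - ip (mon {0<..<T}) w1 (deriv \<psi>)"
      using w1 test_deriv[OF psi assms(2)] by (simp add: has_weak_deriv_def)
    moreover have "ip (mon {0<..<T}) v (deriv (deriv \<psi>)) = ip (mon {0<..<T}) w2 \<psi>"
      using w2 psi by (simp add: has_weak_deriv_def numeral_2_eq_2)
    ultimately show "ip (mon {0<..<T}) w1 ((deriv ^^ 1) \<psi>) = (-1) ^ 1 * ip (mon {0<..<T}) w2 \<psi>" by simp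
  qed
  from weak_deriv_bint[OF w1L this ends[of 1, folded w1_def] assms(2)]
  have a1: "AE t in mon {0<..<T}. w1 t = bint T (\<lambda>t. - w2 t) t" by simp
  have w2L: "w2 \<in> L2 (mon {0<..<T})" using w2 by (simp add: has_weak_deriv_def)
  have m: "bint T (\<lambda>t. - w2 t) = (\<lambda>t. - bint T w2 t)"
    unfolding bint_def by (auto simp: fun_eq_iff if_distrib[of uminus] if_distrib[of "(*) _"] simp flip: Bochner_Integration.integral_minus intro!: Bochner_Integration.integral_cong)
  have "has_value_at T v T 0"
  proof -
    obtain c where c: "continuous_on {0..T} c" "AE t in mon {0<..<T}. weak_deriv T 0 v t = c t" "c T = 0"
      using ends[of 0] by (auto simp: has_value_at_def)
    have "AE t in mon {0<..<T}. v t = c t" using c(2) weak_deriv_AE[OF has_weak_deriv_0[OF vL] assms(2)] by eventually_elim simp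
    then show ?thesis using c by (auto simp: has_value_at_def)
  qed
  from weak_deriv_bint[OF vL w1 this assms(2)] have "AE t in mon {0<..<T}. v t = bint T (\<lambda>t. - w1 t) t" .
  moreover have "bint T (\<lambda>t. - w1 t) t = bint T (bint T w2) t" for t
    by (rule bint_cong_AE[OF L2_uminus[OF w1L] bint_L2[OF w2L]]) (use a1 m in \<open>auto elim: AE_mp\<close>)
  ultimately show ?thesis using that[OF w2L] by simp
qed

section \<open>Fractional powers as integrals over resolvents\<close>

lemma nn_integral_inverse_gamma:
  assumes z: "z > 0" and u: "u > 0"
  shows "(\<integral>\<^sup>+r\<in>{0<..}. ennreal (r powr (-1 - z) * exp (- (u / r))) \<partial>lborel) = ennreal (u powr (-z) * Gamma z)"
proof -
  let ?f = "\<lambda>t::real. t powr (z - 1) / exp t"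
  have G: "(?f has_integral Gamma z) {0<..}"
  proof (subst has_integral_spike_set_eq[of _ "{0..}"])
    show "negligible {x \<in> {0<..} - {0..}. ?f x \<noteq> 0}" by (rule negligible_subset[of "{0}"]) auto
    show "negligible {x \<in> {0..} - {0<..}. ?f x \<noteq> 0}" by (rule negligible_subset[of "{0}"]) auto
  qed (rule Gamma_integral_real[OF z])
  have abs: "?f absolutely_integrable_on {0<..}"
    by (rule nonnegative_absolutely_integrable_1) (use G in \<open>auto intro: has_integral_integrable\<close>)
  have img: "(\<lambda>r. u / r) ` {0<..} = {0<..}"
  proof (intro equalityI subsetI)
    fix x :: real assume "x \<in> {0<..}"
    then show "x \<in> (\<lambda>r. u / r) ` {0<..}" using u by (intro image_eqI[of _ _ "u / x"]) auto
  qed (use u in auto)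
  \<comment> \<open>The substitution t = u / r in Euler's integral for Gamma z.\<close>
  have "(\<lambda>r. \<bar>- u / r\<^sup>2\<bar> * ?f (u / r)) absolutely_integrable_on {0<..} \<and>
      integral {0<..} (\<lambda>r. \<bar>- u / r\<^sup>2\<bar> * ?f (u / r)) = Gamma z"
  proof (rule iffD2[OF has_absolute_integral_change_of_variables_1'[where S = "{0<..}" and f = ?f and g = "\<lambda>r. u / r" and g' = "\<lambda>r. - u / r\<^sup>2" and b = "Gamma z"]])
    show "((\<lambda>r. u / r) has_field_derivative - u / r\<^sup>2) (at r within {0<..})" if "r \<in> {0<..}" for r
      using that by (auto intro!: derivative_eq_intros simp: power2_eq_square)
    show "inj_on (\<lambda>r. u / r) {0<..}" using u by (auto simp: inj_on_def)
    show "?f absolutely_integrable_on (\<lambda>r. u / r) ` {0<..} \<and> integral ((\<lambda>r. u / r) ` {0<..}) ?f = Gamma z"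
      unfolding img using abs G by (auto simp: integral_unique)
  qed simp
  then have "((\<lambda>r. \<bar>- u / r\<^sup>2\<bar> * ?f (u / r)) has_integral Gamma z) {0<..}"
    using set_lebesgue_integral_eq_integral(1) absolutely_integrable_on_def has_integral_integral by metis
  then have "((\<lambda>r. u powr z * (r powr (-1 - z) * exp (- (u / r)))) has_integral Gamma z) {0<..}"
  proof (rule has_integral_eq[rotated])
    fix r :: real assume "r \<in> {0<..}"
    then have r: "r > 0" by simp
    have "u powr z = u * u powr (z - 1)" "r powr (-1 - z) = 1 / (r\<^sup>2 * r powr (z - 1))"
      using u r powr_add[of u 1 "z - 1"] powr_add[of r 2 "z - 1"] by (simp_all add: powr_minus_divide[of r "1 + z", simplified] powr_minus_divide)
    then show "\<bar>- u / r\<^sup>2\<bar> * ?f (u / r) = u powr z * (r powr (-1 - z) * exp (- (u / r)))"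
      using u r by (simp add: powr_divide exp_minus field_simps)
  qed
  from has_integral_mult_right[OF this, of "u powr (-z)"]
  have "((\<lambda>r. r powr (-1 - z) * exp (- (u / r))) has_integral u powr (-z) * Gamma z) {0<..}"
    using u by (simp add: mult.assoc[symmetric] powr_minus)
  from nn_integral_has_integral_lebesgue'[OF _ this] show ?thesis by simp
qed

text \<open>The inverse-gamma integral with exponent z = i + 1 - \<theta>; for i = 0 its convergence
  is where \<theta> < 1 enters. The powers of u combine to u powr (\<theta> - 1), the kernel of
  V^\<theta> up to normalisation.\<close>

lemma ek_laplace:
  assumes \<theta>: "0 < \<theta>" "\<theta> < 1" and u: "u > 0"
  shows "(\<integral>\<^sup>+r\<in>{0<..}. ennreal (r powr (\<theta> - 1) * ek i r u) \<partial>lborel) = ennreal (Gamma (real i + 1 - \<theta>) * Gamma \<theta> / fact i * pk \<theta> u)"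
proof -
  define z where "z = real i + 1 - \<theta>"
  have z: "z > 0" using \<theta> by (simp add: z_def)
  have G: "Gamma \<theta> > 0" "Gamma z > 0" using \<theta> z by (auto intro: Gamma_real_pos)
  have "(\<integral>\<^sup>+r\<in>{0<..}. ennreal (r powr (\<theta> - 1) * ek i r u) \<partial>lborel) =
     (\<integral>\<^sup>+r. ennreal (u ^ i / fact i) * (ennreal (r powr (-1 - z) * exp (- (u / r))) * indicator {0<..} r) \<partial>lborel)"
  proof (rule nn_integral_cong)
    fix r :: real
    show "ennreal (r powr (\<theta> - 1) * ek i r u) * indicator {0<..} r =
      ennreal (u ^ i / fact i) * (ennreal (r powr (-1 - z) * exp (- (u / r))) * indicator {0<..} r)"
    proof (cases "r > 0")
      case r: True
      have "r powr (\<theta> - 1) / r ^ Suc i = r powr (-1 - z)"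
        using r by (simp add: z_def powr_realpow[symmetric] powr_diff[symmetric] del: power_Suc)
      then have "r powr (\<theta> - 1) * ek i r u = u ^ i / fact i * (r powr (-1 - z) * exp (- (u / r)))"
      proof -
        have "r powr (\<theta> - 1) * ek i r u = u ^ i / fact i * ((r powr (\<theta> - 1) / r ^ Suc i) * exp (- (u / r)))"
          by (simp add: ek_def field_simps del: power_Suc)
        then show ?thesis using \<open>r powr (\<theta> - 1) / r ^ Suc i = r powr (-1 - z)\<close> by (simp only:)
      qed
      then show ?thesis using r u by (simp add: ennreal_mult[symmetric])
    qed simp
  qed
  also have "\<dots> = ennreal (u ^ i / fact i) * ennreal (u powr (-z) * Gamma z)"
    using nn_integral_inverse_gamma[OF z u] by (subst nn_integral_cmult) auto
  also have "\<dots> = ennreal (u ^ i / fact i * (u powr (-z) * Gamma z))"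
    using u G by (intro ennreal_mult[symmetric]) auto
  also have "u ^ i / fact i * (u powr (-z) * Gamma z) = Gamma z * Gamma \<theta> / fact i * pk \<theta> u"
  proof -
    have "u ^ i * u powr (-z) = u powr (\<theta> - 1)"
      using u by (simp add: z_def powr_realpow[symmetric] powr_add[symmetric])
    then show ?thesis using G by (simp add: pk_def field_simps)
  qed
  finally show ?thesis by (simp add: z_def)
qed

text \<open>\<^term>\<open>ek i r\<close> is the kernel of the power \<open>i + 1\<close> of the resolvent \<^term>\<open>rsv T r\<close>; this is the
  Balakrishnan representation of a fractional power by its resolvents.\<close>

lemma laplace_representation:
  assumes \<theta>: "0 < \<theta>" "\<theta> < 1"
  shows "has_bochner_integral lborel (\<lambda>r. indicator {0<..} r * (r powr (\<theta> - 1) * inner (op (tri T (ek i r)) x) y))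
    (Gamma (real i + 1 - \<theta>) * Gamma \<theta> / fact i * inner (fint T \<theta> x) y)"
proof -
  define c where "c = Gamma (real i + 1 - \<theta>) * Gamma \<theta> / fact i"
  have c: "c > 0" unfolding c_def using \<theta> by (auto intro!: divide_pos_pos mult_pos_pos Gamma_real_pos)
  note sp = schur_fint[OF \<theta>(1), of T]
  have nonneg: "has_bochner_integral lborel (\<lambda>r. indicator {0<..} r * (r powr (\<theta> - 1) * inner (op (tri T (ek i r)) (mk f)) (mk g)))
    (c * inner (fint T \<theta> (mk f)) (mk g))"
    if f: "f \<in> L2 lborel" "\<And>s. 0 \<le> f s" and g: "g \<in> L2 lborel" "\<And>s. 0 \<le> g s" for f g
  proof -
    have [measurable]: "f \<in> borel_measurable borel" "g \<in> borel_measurable borel" using L2_measurable[OF f(1)] L2_measurable[OF g(1)] by simp_all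
    note [measurable] = schur_meas(2)[OF sp]
    define I where "I r = (\<integral>\<^sup>+t. \<integral>\<^sup>+s. ennreal (tri T (ek i r) t s * f s * g t) \<partial>lborel \<partial>lborel)" for r
    have I: "ennreal (inner (op (tri T (ek i r)) (mk f)) (mk g)) = I r" "0 \<le> inner (op (tri T (ek i r)) (mk f)) (mk g)" if "r > 0" for r
      using inner_op_nonneg[OF schur_rsv[OF that] f g] by (simp_all add: I_def)
    have trim [measurable]: "(\<lambda>x. tri T (ek i (a x)) (b x) (d x)) \<in> borel_measurable M"
      if [measurable]: "a \<in> borel_measurable M" "b \<in> borel_measurable M" "d \<in> borel_measurable M" for a b d and M :: "'z measure"
      unfolding tri_def by measurable
    have [measurable]: "I \<in> borel_measurable borel" unfolding I_def[abs_def] by measurable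
    have eq: "indicator {0<..} r * (r powr (\<theta> - 1) * inner (op (tri T (ek i r)) (mk f)) (mk g)) = indicator {0<..} r * (r powr (\<theta> - 1) * enn2real (I r))" for r
    proof (cases "r > 0")
      case True
      then show ?thesis using I[OF True] by (metis enn2real_ennreal)
    qed simp
    have "(\<integral>\<^sup>+r. ennreal (indicator {0<..} r * (r powr (\<theta> - 1) * inner (op (tri T (ek i r)) (mk f)) (mk g))) \<partial>lborel) =
      (\<integral>\<^sup>+r. \<integral>\<^sup>+t. \<integral>\<^sup>+s. ennreal (indicator {0<..} r * r powr (\<theta> - 1) * tri T (ek i r) t s) * ennreal (f s * g t) \<partial>lborel \<partial>lborel \<partial>lborel)"
    proof (rule nn_integral_cong)
      fix r :: real
      show "ennreal (indicator {0<..} r * (r powr (\<theta> - 1) * inner (op (tri T (ek i r)) (mk f)) (mk g))) =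
        (\<integral>\<^sup>+t. \<integral>\<^sup>+s. ennreal (indicator {0<..} r * r powr (\<theta> - 1) * tri T (ek i r) t s) * ennreal (f s * g t) \<partial>lborel \<partial>lborel)"
      proof (cases "r > 0")
        case True
        have t0: "0 \<le> tri T (ek i r) t s" for t s by (rule schur_nonneg[OF schur_rsv[OF True]])
        have "ennreal (indicator {0<..} r * (r powr (\<theta> - 1) * inner (op (tri T (ek i r)) (mk f)) (mk g))) = ennreal (r powr (\<theta> - 1)) * I r"
          using True I[OF True] by (simp add: ennreal_mult)
        also have "\<dots> = (\<integral>\<^sup>+t. ennreal (r powr (\<theta> - 1)) * (\<integral>\<^sup>+s. ennreal (tri T (ek i r) t s * f s * g t) \<partial>lborel) \<partial>lborel)"
          unfolding I_def by (rule nn_integral_cmult[symmetric]) measurable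
        also have "\<dots> = (\<integral>\<^sup>+t. \<integral>\<^sup>+s. ennreal (r powr (\<theta> - 1)) * ennreal (tri T (ek i r) t s * f s * g t) \<partial>lborel \<partial>lborel)"
          by (intro nn_integral_cong nn_integral_cmult[symmetric]) measurable
        also have "\<dots> = (\<integral>\<^sup>+t. \<integral>\<^sup>+s. ennreal (indicator {0<..} r * r powr (\<theta> - 1) * tri T (ek i r) t s) * ennreal (f s * g t) \<partial>lborel \<partial>lborel)"
          using True f g t0 by (intro nn_integral_cong) (simp add: ennreal_mult[symmetric] mult_ac)
        finally show ?thesis .
      qed simp
    qed
    also have "\<dots> = (\<integral>\<^sup>+t. \<integral>\<^sup>+r. \<integral>\<^sup>+s. ennreal (indicator {0<..} r * r powr (\<theta> - 1) * tri T (ek i r) t s) * ennreal (f s * g t) \<partial>lborel \<partial>lborel \<partial>lborel)"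
      by (rule lborel_pair.Fubini') measurable
    also have "\<dots> = (\<integral>\<^sup>+t. \<integral>\<^sup>+s. \<integral>\<^sup>+r. ennreal (indicator {0<..} r * r powr (\<theta> - 1) * tri T (ek i r) t s) * ennreal (f s * g t) \<partial>lborel \<partial>lborel \<partial>lborel)"
      by (rule nn_integral_cong, rule lborel_pair.Fubini') measurable
    \<comment> \<open>After Tonelli the integral over r is innermost and can be evaluated pointwise
      in (t, s) by \<open>ek_laplace\<close>.\<close>
    also have "\<dots> = (\<integral>\<^sup>+t. \<integral>\<^sup>+s. ennreal c * ennreal (tri T (pk \<theta>) t s * f s * g t) \<partial>lborel \<partial>lborel)"
    proof (intro nn_integral_cong)
      fix t s :: real
      have "(\<integral>\<^sup>+r. ennreal (indicator {0<..} r * r powr (\<theta> - 1) * tri T (ek i r) t s) \<partial>lborel) = ennreal (c * tri T (pk \<theta>) t s)"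
      proof (cases "0 < t \<and> t < s \<and> s < T")
        case True
        have "(\<integral>\<^sup>+r. ennreal (indicator {0<..} r * r powr (\<theta> - 1) * tri T (ek i r) t s) \<partial>lborel) =
           (\<integral>\<^sup>+r\<in>{0<..}. ennreal (r powr (\<theta> - 1) * ek i r (s - t)) \<partial>lborel)"
          using True by (intro nn_integral_cong) (simp add: tri_def split: split_indicator)
        also have "\<dots> = ennreal (c * tri T (pk \<theta>) t s)"
          using True ek_laplace[OF \<theta>, of "s - t" i] by (simp add: tri_def c_def)
        finally show ?thesis .
      next
        case False
        then have "tri T k t s = 0" for k by (simp only: tri_def if_False)
        then show ?thesis by (simp only: mult_zero_right ennreal_0 nn_integral_const mult_zero_left)
      qed
      then show "(\<integral>\<^sup>+r. ennreal (indicator {0<..} r * r powr (\<theta> - 1) * tri T (ek i r) t s) * ennreal (f s * g t) \<partial>lborel) =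
         ennreal c * ennreal (tri T (pk \<theta>) t s * f s * g t)"
        using c f g schur_nonneg[OF sp, of t s]
        by (subst nn_integral_multc) (measurable, simp add: ennreal_mult[symmetric] mult_ac)
    qed
    also have "\<dots> = (\<integral>\<^sup>+t. ennreal c * (\<integral>\<^sup>+s. ennreal (tri T (pk \<theta>) t s * f s * g t) \<partial>lborel) \<partial>lborel)"
      by (intro nn_integral_cong nn_integral_cmult) measurable
    also have "\<dots> = ennreal c * ennreal (inner (fint T \<theta> (mk f)) (mk g))"
      unfolding inner_op_nonneg(1)[OF sp f g]
    proof (rule nn_integral_cmult)
      note [measurable] = schur_meas(2)[OF sp]
      show "(\<lambda>t. \<integral>\<^sup>+s. ennreal (tri T (pk \<theta>) t s * f s * g t) \<partial>lborel) \<in> borel_measurable lborel" by measurable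
    qed
    also have "\<dots> = ennreal (c * inner (fint T \<theta> (mk f)) (mk g))"
      using c inner_op_nonneg(2)[OF sp f g] by (simp add: ennreal_mult)
    finally have nn: "(\<integral>\<^sup>+r. ennreal (indicator {0<..} r * (r powr (\<theta> - 1) * inner (op (tri T (ek i r)) (mk f)) (mk g))) \<partial>lborel) = ennreal (c * inner (fint T \<theta> (mk f)) (mk g))" .
    show ?thesis
    proof (rule has_bochner_integral_nn_integral[OF _ _ _ nn])
      show "(\<lambda>r. indicator {0<..} r * (r powr (\<theta> - 1) * inner (op (tri T (ek i r)) (mk f)) (mk g))) \<in> borel_measurable lborel"
        unfolding eq by measurable
      show "AE r in lborel. 0 \<le> indicator {0<..} r * (r powr (\<theta> - 1) * inner (op (tri T (ek i r)) (mk f)) (mk g))"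
        unfolding eq by (auto intro!: mult_nonneg_nonneg)
      show "0 \<le> c * inner (fint T \<theta> (mk f)) (mk g)" using c inner_op_nonneg(2)[OF sp f g] by simp
    qed
  qed
  obtain f1 f2 where f: "f1 \<in> L2 lborel" "f2 \<in> L2 lborel" "\<And>s. 0 \<le> f1 s" "\<And>s. 0 \<le> f2 s" "x = mk f1 - mk f2"
    by (rule mk_pos_neg[of x]) (rule that)
  obtain g1 g2 where g: "g1 \<in> L2 lborel" "g2 \<in> L2 lborel" "\<And>s. 0 \<le> g1 s" "\<And>s. 0 \<le> g2 s" "y = mk g1 - mk g2"
    by (rule mk_pos_neg[of y]) (rule that)
  \<comment> \<open>The pairing is bilinear, so the four nonnegative cases combine with signs to the
    general one.\<close>
  let ?h = "\<lambda>f g r. indicator {0<..} r * (r powr (\<theta> - 1) * inner (op (tri T (ek i r)) (mk f)) (mk g))"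
  have "has_bochner_integral lborel (\<lambda>r. ?h f1 g1 r - ?h f2 g1 r - (?h f1 g2 r - ?h f2 g2 r))
     (c * inner (fint T \<theta> (mk f1)) (mk g1) - c * inner (fint T \<theta> (mk f2)) (mk g1) - (c * inner (fint T \<theta> (mk f1)) (mk g2) - c * inner (fint T \<theta> (mk f2)) (mk g2)))"
    by (intro has_bochner_integral_diff nonneg f g)
  moreover have "?h f1 g1 r - ?h f2 g1 r - (?h f1 g2 r - ?h f2 g2 r) = indicator {0<..} r * (r powr (\<theta> - 1) * inner (op (tri T (ek i r)) x) y)" for r
  proof (cases "r > 0")
    case True
    then show ?thesis by (simp add: f(5) g(5) linear_diff[OF linear_rsv[OF True]] inner_diff algebra_simps)
  qed simp
  moreover have "c * inner (fint T \<theta> (mk f1)) (mk g1) - c * inner (fint T \<theta> (mk f2)) (mk g1) - (c * inner (fint T \<theta> (mk f1)) (mk g2) - c * inner (fint T \<theta> (mk f2)) (mk g2)) = c * inner (fint T \<theta> x) y"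
    by (simp add: f(5) g(5) linear_diff[OF linear_fint[OF \<theta>(1)]] inner_diff algebra_simps)
  ultimately show ?thesis unfolding c_def by simp
qed

lemma Gamma_step: "z > 0 \<Longrightarrow> Gamma (z + 1) = z * Gamma (z::real)"
  by (rule Gamma_plus1) (auto simp: nonpos_Ints_def)

text \<open>The constants of the representation for i = 1 and i = 2 differ by this amount, since
  Gamma (3 - \<theta>) = (2 - \<theta>) * Gamma (2 - \<theta>) and 1 - (2 - \<theta>) / 2 = \<theta>
  / 2.\<close>

definition qconst :: "real \<Rightarrow> real" where "qconst \<theta> = Gamma (2 - \<theta>) * Gamma \<theta> * \<theta> / 2"

lemma qconst_pos: "0 < \<theta> \<Longrightarrow> \<theta> < 1 \<Longrightarrow> qconst \<theta> > 0"
  by (auto simp: qconst_def intro!: mult_pos_pos Gamma_real_pos)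

text \<open>R_r (Q_r x) is the second minus the third power of R_r applied to x, so two
  representations are subtracted. The factor Q_r is the one that the quadratic estimate
  controls.\<close>

lemma laplace_representation_Q:
  assumes \<theta>: "0 < \<theta>" "\<theta> < 1"
  shows "has_bochner_integral lborel (\<lambda>r. indicator {0<..} r * (r powr (\<theta> - 1) * inner (rsv T r (resolvent.Q (rsv T) r x)) y))
    (qconst \<theta> * inner (fint T \<theta> x) y)"
proof -
  interpret resolvent "rsv T" by (rule resolvent_rsv)
  let ?h = "\<lambda>i r. indicator {0<..} r * (r powr (\<theta> - 1) * inner (op (tri T (ek i r)) x) y)"
  have "has_bochner_integral lborel (\<lambda>r. ?h 1 r - ?h 2 r)
    (Gamma (real 1 + 1 - \<theta>) * Gamma \<theta> / fact 1 * inner (fint T \<theta> x) y - Gamma (real 2 + 1 - \<theta>) * Gamma \<theta> / fact 2 * inner (fint T \<theta> x) y)"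
    by (intro has_bochner_integral_diff laplace_representation \<theta>)
  moreover have "?h 1 r - ?h 2 r = indicator {0<..} r * (r powr (\<theta> - 1) * inner (rsv T r (Q r x)) y)" for r
  proof (cases "r > 0")
    case True
    have "rsv T r (Q r x) = op (tri T (ek 1 r)) x - op (tri T (ek 2 r)) x"
      using rsv_rsv[OF True, of T x] rsv3[OF True, of T x] by (simp add: Q_def R_diff[OF True])
    then show ?thesis using True by (simp add: inner_diff_left right_diff_distrib)
  qed simp
  moreover have "Gamma (real 1 + 1 - \<theta>) * Gamma \<theta> / fact 1 * inner (fint T \<theta> x) y - Gamma (real 2 + 1 - \<theta>) * Gamma \<theta> / fact 2 * inner (fint T \<theta> x) y = qconst \<theta> * inner (fint T \<theta> x) y"
  proof -
    have "3 - \<theta> = 2 - \<theta> + 1" by simp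
    then have "Gamma (3 - \<theta>) = (2 - \<theta>) * Gamma (2 - \<theta>)" using Gamma_step[of "2 - \<theta>"] \<theta> by (simp only:)
    then have e: "Gamma (real 2 + 1 - \<theta>) = (2 - \<theta>) * Gamma (2 - \<theta>)" by simp
    show ?thesis unfolding e qconst_def by (simp add: field_simps)
  qed
  ultimately show ?thesis by simp
qed

text \<open>The sector constant is half the ratio of the representation constants for the first and
  the second power of R_r, and Gamma (2 - \<beta>) = (1 - \<beta>) * Gamma (1 - \<beta>) evaluates
  it.\<close>

lemma fint_sector:
  assumes \<beta>: "0 < \<beta>" "\<beta> < 1"
  shows "\<bar>inner (fint T \<beta> x) y\<bar> \<le> 1 / (2 * (1 - \<beta>)) * (inner (fint T \<beta> x) x + inner (fint T \<beta> y) y)"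
proof -
  have G: "Gamma (1 - \<beta>) > 0" "Gamma \<beta> > 0" using \<beta> by (auto intro: Gamma_real_pos)
  have G2: "Gamma (2 - \<beta>) = (1 - \<beta>) * Gamma (1 - \<beta>)" using Gamma_step[of "1 - \<beta>"] \<beta> by (simp add: algebra_simps)
  have "\<bar>inner (fint T \<beta> x) y\<bar> \<le> (Gamma (1 - \<beta>) * Gamma \<beta>) / (2 * (Gamma (2 - \<beta>) * Gamma \<beta>)) * (inner (fint T \<beta> x) x + inner (fint T \<beta> y) y)"
  proof (rule sector_bound[OF resolvent_rsv[of T] resolvent_rsv'[of T], where p = "\<beta> - 1"])
    show "inner (rsv T r x) y = inner x (rsv' T r y)" if "r > 0" for r x y by (rule op_adj[OF schur_rsv[OF that]])
    show "0 < Gamma (2 - \<beta>) * Gamma \<beta>" "0 \<le> Gamma (1 - \<beta>) * Gamma \<beta>" using G G2 \<beta> by auto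
    show "has_bochner_integral lborel (\<lambda>r. indicator {0<..} r * (r powr (\<beta> - 1) * inner (rsv T r x) y)) (Gamma (1 - \<beta>) * Gamma \<beta> * inner (fint T \<beta> x) y)" for x y
      using laplace_representation[OF \<beta>, of T 0 x y] by simp
    have "(\<lambda>r. indicator {0<..} r * (r powr (\<beta> - 1) * inner (rsv T r (rsv T r x)) y)) = (\<lambda>r. indicator {0<..} r * (r powr (\<beta> - 1) * inner (op (tri T (ek 1 r)) x) y))" for x y
      by (auto simp: fun_eq_iff indicator_def rsv_rsv)
    then show "has_bochner_integral lborel (\<lambda>r. indicator {0<..} r * (r powr (\<beta> - 1) * inner (rsv T r (rsv T r x)) y)) (Gamma (2 - \<beta>) * Gamma \<beta> * inner (fint T \<beta> x) y)" for x y
      using laplace_representation[OF \<beta>, of T 1 x y] by simp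
  qed
  also have "(Gamma (1 - \<beta>) * Gamma \<beta>) / (2 * (Gamma (2 - \<beta>) * Gamma \<beta>)) = 1 / (2 * (1 - \<beta>))"
    using G by (simp add: G2)
  finally show ?thesis .
qed

text \<open>Equals 1 + 2 K with the sector constant K = 1 / (2 (1 - \<alpha> / 2)) of the fractional
  integral of order \<alpha> / 2.\<close>

definition coer :: "real \<Rightarrow> real" where "coer \<alpha> = 1 + 1 / (1 - \<alpha> / 2)"

text \<open>\<open>sector_coercive\<close> with W of order \<alpha> / 2 and \<mu> = sqrt l. The
  sector bound is symmetric in its two arguments, so it passes to the adjoint with the same
  constant.\<close>

lemma fint_coercive:
  assumes \<alpha>: "1 < \<alpha>" "\<alpha> < 2" and lam: "l \<ge> 0"
  shows "norm g \<le> coer \<alpha> * norm (g + l *\<^sub>R fint T \<alpha> g)"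
    and "norm g \<le> coer \<alpha> * norm (g + l *\<^sub>R fint' T \<alpha> g)"
proof -
  define \<beta> where "\<beta> = \<alpha> / 2"
  have \<beta>: "0 < \<beta>" "\<beta> < 1" using \<alpha> by (auto simp: \<beta>_def)
  define K where "K = 1 / (2 * (1 - \<beta>))"
  have K: "K \<ge> 0" "1 + 2 * K = coer \<alpha>" using \<beta> by (auto simp: K_def coer_def \<beta>_def field_simps)
  have a: "fint T \<alpha> g = fint T \<beta> (fint T \<beta> g)" "fint' T \<alpha> g = fint' T \<beta> (fint' T \<beta> g)" for g
    using \<beta> by (simp_all add: fint_fint fint'_fint' \<beta>_def)
  have lam2: "l = (sqrt l)\<^sup>2" using lam by simp
  have s: "\<bar>inner (fint T \<beta> x) y\<bar> \<le> K * (inner (fint T \<beta> x) x + inner (fint T \<beta> y) y)" for x y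
    unfolding K_def by (rule fint_sector[OF \<beta>])
  show "norm g \<le> coer \<alpha> * norm (g + l *\<^sub>R fint T \<alpha> g)"
    unfolding a K(2)[symmetric] by (subst lam2, rule sector_coercive[OF linear_fint[OF \<beta>(1)] K(1) _ s]) (use lam in simp)
  have adj: "inner (fint' T \<beta> x) y = inner (fint T \<beta> y) x" for x y
    using op_adj[OF schur_fint[OF \<beta>(1)], of T y x] by (simp add: inner_commute)
  have s': "\<bar>inner (fint' T \<beta> x) y\<bar> \<le> K * (inner (fint' T \<beta> x) x + inner (fint' T \<beta> y) y)" for x y
    unfolding adj using s[of y x] by (simp add: add.commute)
  show "norm g \<le> coer \<alpha> * norm (g + l *\<^sub>R fint' T \<alpha> g)"
    unfolding a K(2)[symmetric] by (subst lam2, rule sector_coercive[OF linear_fint'[OF \<beta>(1)] K(1) _ s']) (use lam in simp)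
qed

text \<open>The square of the Schur constant over \<open>qconst\<close>, halved by the factor 1/2 of
  the quadratic estimate.\<close>

definition upc :: "real \<Rightarrow> real" where "upc \<theta> = ((1 / \<theta> + 1 / (1 - \<theta>)) / qconst \<theta>)\<^sup>2 / 2"

lemma fint_interp_upper:
  assumes \<theta>: "0 < \<theta>" "\<theta> < 1"
  shows "(\<integral>\<^sup>+s\<in>{0<..}. ennreal ((s powr (-\<theta>) * norm (fint T \<theta> x - rsv T s (fint T \<theta> x)))\<^sup>2 / s) \<partial>lborel) \<le> ennreal (upc \<theta> * (norm x)\<^sup>2)"
proof -
  interpret resolvent "rsv T" by (rule resolvent_rsv)
  have "(\<integral>\<^sup>+s\<in>{0<..}. ennreal ((s powr (-\<theta>) * norm (fint T \<theta> x - rsv T s (fint T \<theta> x)))\<^sup>2 / s) \<partial>lborel) \<le>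
     ennreal (((1 / \<theta> + 1 / (1 - \<theta>)) / qconst \<theta>)\<^sup>2 * (norm x)\<^sup>2 / 2)"
    by (rule interp_upper[OF \<theta> qconst_pos[OF \<theta>] linear_fint[OF \<theta>(1)] laplace_representation_Q[OF \<theta>]])
       (rule fint_rsv_commute[OF \<theta>(1)])
  then show ?thesis by (simp add: upc_def)
qed

text \<open>The conclusion is x = V^\<theta> g, integrated once more: in this form the functional
  taking y to (V x, y) can be bounded by the norm of the adjoint of V^(1+\<theta>) at y. Riesz'
  theorem on the range of that adjoint produces g, with the bound as bound on its norm.\<close>

lemma fint_interp_lower:
  assumes \<theta>: "0 < \<theta>" "\<theta> < 1"
    and N: "(\<integral>\<^sup>+s\<in>{0<..}. ennreal ((s powr (-\<theta>) * norm (x - rsv T s x))\<^sup>2 / s) \<partial>lborel) \<le> ennreal N" "N \<ge> 0"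
  shows "\<exists>g. fint T 1 x = fint T (1 + \<theta>) g \<and> norm g \<le> sqrt N / qconst (1 - \<theta>)"
proof -
  interpret R: resolvent "rsv T" by (rule resolvent_rsv)
  interpret R': resolvent "rsv' T" by (rule resolvent_rsv')
  have \<theta>': "0 < 1 - \<theta>" "1 - \<theta> < 1" using \<theta> by auto
  define c where "c = qconst (1 - \<theta>)"
  have c: "c > 0" unfolding c_def by (rule qconst_pos[OF \<theta>'])
  have bound: "\<bar>inner (fint T 1 x) y\<bar> \<le> (sqrt N / c) * norm (fint' T (1 + \<theta>) y)" for y
  proof -
    define z where "z = fint' T \<theta> y"
    define v where "v = fint' T (1 + \<theta>) y"
    have vz: "v = fint' T 1 z" using \<theta> by (simp add: v_def z_def fint'_fint')
    \<comment> \<open>V is split as V^\<theta> V^(1-\<theta>): the first factor goes to y, the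
      second is represented by resolvents, with weight s powr (-\<theta>).\<close>
    have "inner (fint T 1 x) y = inner (fint T \<theta> (fint T (1 - \<theta>) x)) y" using \<theta> by (simp add: fint_fint)
    also have "\<dots> = inner (fint T (1 - \<theta>) x) z" unfolding z_def by (rule op_adj[OF schur_fint[OF \<theta>(1)]])
    finally have e: "inner (fint T 1 x) y = inner (fint T (1 - \<theta>) x) z" .
    let ?h = "\<lambda>s. indicator {0<..} s * (s powr (1 - \<theta> - 1) * inner (rsv T s (R.Q s x)) z)"
    have h: "has_bochner_integral lborel ?h (c * inner (fint T 1 x) y)"
      unfolding e c_def by (rule laplace_representation_Q[OF \<theta>'])
    have "ennreal (c * \<bar>inner (fint T 1 x) y\<bar>) = ennreal (norm (\<integral>s. ?h s \<partial>lborel))"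
      using h c by (simp add: has_bochner_integral_iff abs_mult)
    also have "\<dots> \<le> (\<integral>\<^sup>+s. ennreal (norm (?h s)) \<partial>lborel)"
      by (rule integral_norm_bound_ennreal) (use h in \<open>simp add: has_bochner_integral_iff\<close>)
    also have "\<dots> \<le> (\<integral>\<^sup>+s\<in>{0<..}. ennreal (s powr (-\<theta> - 1) * (norm (x - rsv T s x) * norm (R'.Q s v))) \<partial>lborel)"
    proof (rule nn_integral_mono)
      fix s :: real
      show "ennreal (norm (?h s)) \<le> ennreal (s powr (-\<theta> - 1) * (norm (x - rsv T s x) * norm (R'.Q s v))) * indicator {0<..} s"
      proof (cases "s > 0")
        case s: True
        note adj = op_adj[OF schur_rsv[OF s]]
        \<comment> \<open>This trades a resolvent for one more integration and a factor 1 / s; the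
          integration is moved to z and yields v.\<close>
        have V: "s *\<^sub>R rsv T s w = fint T 1 (w - rsv T s w)" for w
          using fint_rsv[OF s, of T w] by (simp add: linear_diff[OF linear_fint])
        have "s * inner (rsv T s (R.Q s x)) z = inner (s *\<^sub>R rsv T s (R.Q s x)) z" by simp
        also have "\<dots> = inner (R.Q s x - rsv T s (R.Q s x)) v"
          unfolding V vz by (rule op_adj[OF schur_fint]) simp
        also have "\<dots> = inner (x - rsv T s x) (R'.Q s v)"
          by (simp add: R.Q_def R'.Q_def R.R_diff[OF s] R'.R_diff[OF s] inner_diff adj)
        finally have "\<bar>inner (rsv T s (R.Q s x)) z\<bar> = \<bar>inner (x - rsv T s x) (R'.Q s v)\<bar> / s"
          using s by (metis abs_mult abs_of_pos nonzero_mult_div_cancel_left less_irrefl)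
        also have "\<dots> \<le> norm (x - rsv T s x) * norm (R'.Q s v) / s"
          using s by (intro divide_right_mono Cauchy_Schwarz_ineq2) auto
        finally have "s powr (-\<theta>) * \<bar>inner (rsv T s (R.Q s x)) z\<bar> \<le> s powr (-\<theta>) * (norm (x - rsv T s x) * norm (R'.Q s v) / s)"
          by (intro mult_left_mono) auto
        also have "\<dots> = s powr (-\<theta> - 1) * (norm (x - rsv T s x) * norm (R'.Q s v))"
          using s by (simp add: powr_diff)
        finally show ?thesis using s by (simp add: abs_mult ennreal_leI)
      qed simp
    qed
    also have "\<dots> \<le> ennreal (sqrt N * norm v)"
      by (rule R.interp_lower[OF resolvent_rsv' N])
    finally have "c * \<bar>inner (fint T 1 x) y\<bar> \<le> sqrt N * norm v"
      using N(2) by (subst (asm) ennreal_le_iff) auto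
    then show ?thesis using c by (simp add: v_def field_simps)
  qed
  have l: "linear (fint' T (1 + \<theta>))" using \<theta> by (intro linear_fint') auto
  obtain g where g: "norm g \<le> sqrt N / c" "\<And>y. inner g (fint' T (1 + \<theta>) y) = inner (fint T 1 x) y"
    using riesz_parametrised[of UNIV "fint' T (1 + \<theta>)" "\<lambda>y. inner (fint T 1 x) y" "sqrt N / c"] bound c N(2)
    by (auto simp: linear_add[OF l, symmetric] linear_scale[OF l, symmetric] inner_add_right[symmetric] inner_scaleR_right[symmetric] simp del: inner_scaleR_right)
  have "fint T 1 x = fint T (1 + \<theta>) g"
  proof (rule inner_ext)
    fix y
    show "inner (fint T 1 x) y = inner (fint T (1 + \<theta>) g) y"
      using g(2)[of y] \<theta> by (simp add: op_adj[OF schur_fint])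
  qed
  then show ?thesis using g(1) by (auto simp: c_def)
qed

section \<open>The fractional Sobolev space as the range of a fractional integral\<close>

text \<open>The class of the extension by zero. It embeds L2 of any Borel set isometrically into L2
  of the whole space, where the operators are defined.\<close>

definition cl :: "'a::euclidean_space set \<Rightarrow> ('a \<Rightarrow> real) \<Rightarrow> 'a l2" where
  "cl S f = mk (\<lambda>x. indicator S x * f x)"

lemma L2_mon_iff:
  assumes "S \<in> sets (borel :: 'a::euclidean_space measure)"
  shows "f \<in> L2 (mon S) \<longleftrightarrow> (\<lambda>x. indicator S x * f x) \<in> L2 (lborel :: 'a measure)"
proof -
  have "(\<lambda>x. (indicator S x * f x)\<^sup>2) = (\<lambda>x. indicator S x * (f x)\<^sup>2)"
    by (auto simp: indicator_def fun_eq_iff)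
  then show ?thesis
    using assms by (simp add: L2_def borel_measurable_restrict_space_iff integrable_restrict_space)
qed

lemma ip_mon:
  assumes "S \<in> sets (borel :: 'a::euclidean_space measure)" "f \<in> L2 (mon S)" "g \<in> L2 (mon S)"
  shows "ip (mon S) f g = inner (cl S f) (cl S g)"
proof -
  have "(\<lambda>x. indicator S x * f x * (indicator S x * g x)) = (\<lambda>x. indicator S x * (f x * g x))"
    by (auto simp: indicator_def fun_eq_iff)
  then show ?thesis
    using assms by (simp add: cl_def inner_mk L2_mon_iff ip_def integral_restrict_space)
qed

lemma L2norm_mon:
  assumes "S \<in> sets (borel :: 'a::euclidean_space measure)" "f \<in> L2 (mon S)"
  shows "L2norm (mon S) f = norm (cl S f)"
  using ip_mon[OF assms assms(2)] by (simp add: L2norm_def ip_def norm_eq_sqrt_inner power2_eq_square)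

lemma cl_eq_iff:
  assumes "S \<in> sets (borel :: 'a::euclidean_space measure)" "f \<in> L2 (mon S)" "g \<in> L2 (mon S)"
  shows "cl S f = cl S g \<longleftrightarrow> (AE x in mon S. f x = g x)"
proof -
  have "(AE x in mon S. f x = g x) \<longleftrightarrow> (AE x in lborel. indicator S x * f x = indicator S x * g x)"
    using assms(1) by (subst AE_restrict_space_iff) (auto intro!: AE_cong simp: indicator_def)
  then show ?thesis using assms by (simp add: cl_def mk_eq_iff L2_mon_iff)
qed

lemma cl_add:
  assumes "S \<in> sets (borel :: 'a::euclidean_space measure)" "f \<in> L2 (mon S)" "g \<in> L2 (mon S)"
  shows "cl S (\<lambda>x. f x + g x) = cl S f + cl S g"
  using assms by (simp add: cl_def mk_add[symmetric] L2_mon_iff distrib_left)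

lemma cl_diff:
  assumes "S \<in> sets (borel :: 'a::euclidean_space measure)" "f \<in> L2 (mon S)" "g \<in> L2 (mon S)"
  shows "cl S (\<lambda>x. f x - g x) = cl S f - cl S g"
  using assms by (simp add: cl_def mk_diff[symmetric] L2_mon_iff right_diff_distrib)

lemma cl_scale:
  assumes "S \<in> sets (borel :: 'a::euclidean_space measure)" "f \<in> L2 (mon S)"
  shows "cl S (\<lambda>x. c * f x) = c *\<^sub>R cl S f"
  using assms by (simp add: cl_def mk_scale[symmetric] L2_mon_iff mult.left_commute)

lemma U_sets: "{0<..<T::real} \<in> sets borel" by simp

definition conv :: "real \<Rightarrow> (real \<Rightarrow> real) \<Rightarrow> (real \<Rightarrow> real) \<Rightarrow> real \<Rightarrow> real" where
  "conv T k f t = (\<integral>s. (if t < s \<and> s < T then k (s - t) * f s else 0) \<partial>lborel)"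

lemma iop_tri: "iop (tri T k) (\<lambda>s. indicator {0<..<T} s * f s) t = indicator {0<..<T} t * conv T k f t"
proof (cases "t \<in> {0<..<T}")
  case True
  then show ?thesis unfolding iop_def conv_def
    by (simp, intro Bochner_Integration.integral_cong) (auto simp: tri_def)
next
  case False
  then have "tri T k t s = 0" for s by (auto simp: tri_def)
  then show ?thesis using False by (simp add: iop_def)
qed

lemma conv_L2:
  assumes "ker T k" "f \<in> L2 (mon {0<..<T})"
  shows "conv T k f \<in> L2 (mon {0<..<T})" "cl {0<..<T} (conv T k f) = op (tri T k) (cl {0<..<T} f)"
proof -
  have f: "(\<lambda>s. indicator {0<..<T} s * f s) \<in> L2 lborel" using assms(2) by (simp add: L2_mon_iff)
  have e: "iop (tri T k) (\<lambda>s. indicator {0<..<T} s * f s) = (\<lambda>t. indicator {0<..<T} t * conv T k f t)"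
    using iop_tri by (auto simp: fun_eq_iff)
  show "conv T k f \<in> L2 (mon {0<..<T})"
    using iop_L2[OF schur_tri[OF assms(1)] f] by (simp add: L2_mon_iff e)
  show "cl {0<..<T} (conv T k f) = op (tri T k) (cl {0<..<T} f)"
    using op_mk[OF schur_tri[OF assms(1)] f] by (simp add: cl_def e)
qed

lemma bint_conv: "t \<ge> 0 \<Longrightarrow> bint T f t = conv T (pk 1) f t"
  unfolding bint_def conv_def
  by (intro Bochner_Integration.integral_cong) (auto simp: pk_def indicator_def)

lemma cl_bint:
  assumes "f \<in> L2 (mon {0<..<T})"
  shows "cl {0<..<T} (bint T f) = fint T 1 (cl {0<..<T} f)"
proof -
  have "(\<lambda>t. indicator {0<..<T} t * bint T f t) = (\<lambda>t. indicator {0<..<T} t * conv T (pk 1) f t)"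
    by (auto simp: fun_eq_iff indicator_def bint_conv)
  then have "cl {0<..<T} (bint T f) = cl {0<..<T} (conv T (pk 1) f)" by (simp add: cl_def)
  then show ?thesis using conv_L2(2)[OF ker_pk assms, of 1] by simp
qed

lemma op_tri_cl:
  assumes "ker T k"
  obtains f where "f \<in> L2 (mon {0<..<T})" "op (tri T k) x = cl {0<..<T} f"
proof -
  obtain h where h: "h \<in> L2 lborel" "x = mk h" by (rule mk_surj[of x]) (rule that)
  let ?f = "iop (tri T k) h"
  have e: "(\<lambda>t. indicator {0<..<T} t * ?f t) = ?f"
  proof
    fix t
    show "indicator {0<..<T} t * ?f t = ?f t"
    proof (cases "t \<in> {0<..<T}")
      case False
      then have "tri T k t s = 0" for s by (auto simp: tri_def)
      then show ?thesis by (simp add: iop_def)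
    qed simp
  qed
  have "?f \<in> L2 (mon {0<..<T})" using iop_L2[OF schur_tri[OF assms] h(1)] by (simp add: L2_mon_iff e)
  moreover have "op (tri T k) x = cl {0<..<T} ?f" using op_mk[OF schur_tri[OF assms] h(1)] h by (simp add: cl_def e)
  ultimately show ?thesis by (rule that)
qed

lemma op_tri_mk:
  assumes k: "ker T k" and h: "h \<in> L2 lborel"
  shows "op (tri T k) (mk h) = op (tri T k) (cl {0<..<T} h)"
proof -
  have hU: "(\<lambda>s. indicator {0<..<T} s * h s) \<in> L2 lborel" using h by (intro L2_indicator_mult) auto
  have "iop (tri T k) h = iop (tri T k) (\<lambda>s. indicator {0<..<T} s * h s)"
    unfolding iop_def by (intro ext Bochner_Integration.integral_cong) (auto simp: tri_def)
  then show ?thesis using op_mk[OF schur_tri[OF k] h] op_mk[OF schur_tri[OF k] hU] by (simp add: cl_def)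
qed

text \<open>Riesz' theorem delivers a class on the whole line; the operator sees only its
  restriction to (0,T), whose norm is no larger.\<close>

lemma op_tri_restrict:
  assumes "ker T k"
  obtains f where "f \<in> L2 (mon {0<..<T})" "op (tri T k) x = op (tri T k) (cl {0<..<T} f)" "norm (cl {0<..<T} f) \<le> norm x"
proof -
  obtain h where h: "h \<in> L2 lborel" "x = mk h" by (rule mk_surj[of x]) (rule that)
  have hU: "(\<lambda>s. indicator {0<..<T} s * h s) \<in> L2 lborel" using h by (intro L2_indicator_mult) auto
  have "op (tri T k) x = op (tri T k) (cl {0<..<T} h)" unfolding h(2) by (rule op_tri_mk[OF assms h(1)])
  moreover have "norm (cl {0<..<T} h) \<le> norm x"
    unfolding cl_def h(2) by (rule norm_mk_mono[OF hU h(1)]) (auto simp: indicator_def)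
  moreover have "h \<in> L2 (mon {0<..<T})" using hU by (simp add: L2_mon_iff)
  ultimately show ?thesis using that by blast
qed

lemma bint_inj:
  assumes "f \<in> L2 (mon {0<..<T})" "g \<in> L2 (mon {0<..<T})" "T > 0" "AE t in mon {0<..<T}. bint T f t = bint T g t"
  shows "AE t in mon {0<..<T}. f t = g t"
proof -
  have "has_weak_deriv T 1 (bint T g) (\<lambda>t. - f t)"
    by (rule has_weak_deriv_cong_left[OF has_weak_deriv_bint[OF assms(1,3)] L2_measurable[OF bint_L2[OF assms(1)]] L2_measurable[OF bint_L2[OF assms(2)]] assms(4,3)])
  from weak_deriv_unique[OF this has_weak_deriv_bint[OF assms(2,3)] assms(3)] show ?thesis by simp
qed

section \<open>The K-functional and the range of the fractional integral\<close>

context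
  fixes \<alpha> T :: real
  assumes \<alpha>: "1 < \<alpha>" "\<alpha> < 2" and T: "T > 0"
begin

abbreviation (input) "U \<equiv> {0<..<T}"

lemma alpha_ceil: "nat \<lceil>\<alpha>\<rceil> = 2"
proof -
  have "\<lceil>\<alpha>\<rceil> = 2" by (rule ceiling_unique) (use \<alpha> in auto)
  then show ?thesis by simp
qed

lemma H0_alpha: "H0 T \<alpha> = interp_space (H0_int T 1) (H0_int_norm T 1) (H0_int T 2) (H0_int_norm T 2) (\<alpha> - 1)"
  using \<alpha> by (simp add: H0_def alpha_ceil Let_def)

lemma H0_norm_alpha: "H0_norm T \<alpha> v = interp_norm (H0_int T 1) (H0_int_norm T 1) (H0_int T 2) (H0_int_norm T 2) (\<alpha> - 1) v"
  using \<alpha> by (simp add: H0_norm_def alpha_ceil Let_def)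

abbreviation (input) "KF \<equiv> K_functional (H0_int T 1) (H0_int_norm T 1) (H0_int T 2) (H0_int_norm T 2)"

lemma KF_bdd: "bdd_below {H0_int_norm T 1 a + s * H0_int_norm T 2 b |a b. a \<in> H0_int T 1 \<and> b \<in> H0_int T 2 \<and> v = (\<lambda>x. a x + b x)}" if "s > 0"
  using that by (auto simp: bdd_below_def H0_int_norm_def L2norm_def intro!: exI[of _ 0] add_nonneg_nonneg mult_nonneg_nonneg Bochner_Integration.integral_nonneg)

text \<open>With y = (x - R_s x) / s one has V y = R_s x, so v = V x splits into V (x - R_s x) and
  V^2 y. The first term costs the norm of x - R_s x, and so does s times the norm of y: hence the
  factor 2.\<close>

lemma KF_upper:
  assumes v: "v \<in> borel_measurable (mon U)" and x: "x \<in> L2 (mon U)" "AE t in mon U. v t = bint T x t" and s: "s > 0"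
  shows "KF s v \<le> 2 * norm (cl U x - rsv T s (cl U x))"
    and "\<exists>a\<in>H0_int T 1. \<exists>b\<in>H0_int T 2. v = (\<lambda>t. a t + b t)"
proof -
  obtain r where r: "r \<in> L2 (mon U)" "rsv T s (cl U x) = cl U r" by (rule op_tri_cl[OF ker_ek[OF s, of T 0], of "cl U x"]) (rule that)
  define y where "y t = (1 / s) * (x t - r t)" for t
  have xr: "(\<lambda>t. x t - r t) \<in> L2 (mon U)" using x r by auto
  have yL: "y \<in> L2 (mon U)" unfolding y_def[abs_def] by (intro L2_cmult xr)
  have "cl U y = (1 / s) *\<^sub>R cl U (\<lambda>t. x t - r t)" unfolding y_def[abs_def] by (rule cl_scale[OF U_sets xr])
  then have cy: "cl U y = (1 / s) *\<^sub>R (cl U x - cl U r)" using x r by (simp add: cl_diff)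
  have "fint T 1 (cl U x - cl U r) = s *\<^sub>R cl U r"
    using fint_rsv[OF s, of T "cl U x"] by (simp add: linear_diff[OF linear_fint] r(2))
  then have "fint T 1 (cl U y) = cl U r" using s by (simp add: cy linear_scale[OF linear_fint])
  then have Vy: "AE t in mon U. bint T y t = r t"
    using yL r bint_L2[OF yL] by (simp add: cl_bint[symmetric] cl_eq_iff)
  define b where "b = bint T (bint T y)"
  have bL: "b \<in> L2 (mon U)" unfolding b_def by (intro bint_L2 yL)
  have b: "b \<in> H0_int T 2" "H0_int_norm T 2 b = L2norm (mon U) y"
    using H0_int_2I[OF yL T L2_measurable[OF bL]] by (auto simp: b_def)
  define a where "a t = v t - b t" for t
  have "AE t in mon U. a t = bint T (\<lambda>t. x t - r t) t"
    using x(2)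
  proof eventually_elim
    case (elim t)
    have "b t = bint T r t" unfolding b_def by (rule bint_cong_AE[OF bint_L2[OF yL] r(1) Vy])
    moreover have "bint T (\<lambda>t. x t - r t) t = bint T x t - bint T r t"
    proof -
      have "bint T x t - bint T r t = (\<integral>s. indicator U s * (if t < s then x s else 0) - indicator U s * (if t < s then r s else 0) \<partial>lborel)"
        unfolding bint_def by (rule Bochner_Integration.integral_diff[OF bint_integrable[OF x(1)] bint_integrable[OF r(1)], symmetric])
      then show ?thesis unfolding bint_def by (simp add: right_diff_distrib if_distrib cong: if_cong)
    qed
    ultimately show ?case using elim by (simp add: a_def)
  qed
  moreover have "a \<in> borel_measurable (mon U)" unfolding a_def[abs_def] using v L2_measurable[OF bL] by measurable
  ultimately have a: "a \<in> H0_int T 1" "H0_int_norm T 1 a = L2norm (mon U) (\<lambda>t. x t - r t)"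
    using H0_int_1I[OF xr T] by auto
  have vab: "v = (\<lambda>t. a t + b t)" by (simp add: a_def)
  show "\<exists>a\<in>H0_int T 1. \<exists>b\<in>H0_int T 2. v = (\<lambda>t. a t + b t)" using a(1) b(1) vab by blast
  have "KF s v \<le> H0_int_norm T 1 a + s * H0_int_norm T 2 b"
    unfolding K_functional_def by (rule cInf_lower[OF _ KF_bdd[OF s]]) (use a b vab in blast)
  also have "\<dots> = 2 * norm (cl U x - rsv T s (cl U x))"
    unfolding a(2) b(2) using s by (simp add: L2norm_mon xr yL cl_diff x r cy)
  finally show "KF s v \<le> 2 * norm (cl U x - rsv T s (cl U x))" .
qed

text \<open>Any splitting v = V f + V^2 y forces x = f + V y. Since (1 - R_s) V = s R_s, the defect
  x - R_s x is the defect of f plus s R_s y, and both 1 - R_s and R_s are contractions.\<close>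

lemma KF_lower:
  assumes x: "x \<in> L2 (mon U)" "AE t in mon U. v t = bint T x t" and s: "s > 0"
    and dec: "\<exists>a\<in>H0_int T 1. \<exists>b\<in>H0_int T 2. v = (\<lambda>t. a t + b t)"
  shows "norm (cl U x - rsv T s (cl U x)) \<le> KF s v"
  unfolding K_functional_def
proof (rule cInf_greatest)
  show "{H0_int_norm T 1 a + s * H0_int_norm T 2 b |a b. a \<in> H0_int T 1 \<and> b \<in> H0_int T 2 \<and> v = (\<lambda>x. a x + b x)} \<noteq> {}"
    using dec by blast
  interpret resolvent "rsv T" by (rule resolvent_rsv)
  fix z assume "z \<in> {H0_int_norm T 1 a + s * H0_int_norm T 2 b |a b. a \<in> H0_int T 1 \<and> b \<in> H0_int T 2 \<and> v = (\<lambda>x. a x + b x)}"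
  then obtain a b where ab: "z = H0_int_norm T 1 a + s * H0_int_norm T 2 b" "a \<in> H0_int T 1" "b \<in> H0_int T 2" "v = (\<lambda>x. a x + b x)" by blast
  obtain f where f: "f \<in> L2 (mon U)" "AE t in mon U. a t = bint T f t" by (rule H0_int_1E[OF ab(2) T]) (rule that)
  obtain y where y: "y \<in> L2 (mon U)" "AE t in mon U. b t = bint T (bint T y) t" by (rule H0_int_2E[OF ab(3) T]) (rule that)
  have aL: "a \<in> borel_measurable (mon U)" "b \<in> borel_measurable (mon U)" using ab(2,3) by (auto simp: H0_int_def intro: L2_measurable)
  have na: "H0_int_norm T 1 a = norm (cl U f)" "H0_int_norm T 2 b = norm (cl U y)"
    using H0_int_1I(2)[OF f(1) T aL(1) f(2)] H0_int_2I(2)[OF y(1) T aL(2) y(2)] f y by (simp_all add: L2norm_mon)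
  have yb: "bint T y \<in> L2 (mon U)" by (rule bint_L2[OF y(1)])
  have fy: "(\<lambda>t. f t + bint T y t) \<in> L2 (mon U)" using f yb by auto
  have "AE t in mon U. bint T x t = bint T (\<lambda>t. f t + bint T y t) t"
    using x(2) f(2) y(2)
  proof eventually_elim
    case (elim t)
    have "bint T f t + bint T (bint T y) t = (\<integral>s. indicator U s * (if t < s then f s else 0) + indicator U s * (if t < s then bint T y s else 0) \<partial>lborel)"
      unfolding bint_def[of T f] bint_def[of T "bint T y"] by (rule Bochner_Integration.integral_add[OF bint_integrable[OF f(1)] bint_integrable[OF yb], symmetric])
    also have "\<dots> = bint T (\<lambda>t. f t + bint T y t) t"
      unfolding bint_def[of T "\<lambda>t. f t + bint T y t"] by (intro Bochner_Integration.integral_cong) (auto simp: distrib_left)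
    finally show ?case using elim ab(4) by simp
  qed
  from bint_inj[OF x(1) fy T this] have "cl U x = cl U (\<lambda>t. f t + bint T y t)" using x fy by (simp add: cl_eq_iff)
  also have "\<dots> = cl U f + fint T 1 (cl U y)" using f yb y by (simp add: cl_add cl_bint)
  finally have cx: "cl U x = cl U f + fint T 1 (cl U y)" .
  have "cl U x - rsv T s (cl U x) = (cl U f - rsv T s (cl U f)) + (fint T 1 (cl U y) - rsv T s (fint T 1 (cl U y)))"
    unfolding cx by (simp add: linear_add[OF linear_rsv[OF s]])
  also have "fint T 1 (cl U y) - rsv T s (fint T 1 (cl U y)) = s *\<^sub>R rsv T s (cl U y)"
    using fint_rsv[OF s, of T "cl U y"] fint_rsv_commute[OF _ s, of 1 T "cl U y"] by simp
  finally have "norm (cl U x - rsv T s (cl U x)) \<le> norm (cl U f - rsv T s (cl U f)) + norm (s *\<^sub>R rsv T s (cl U y))"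
    using norm_triangle_ineq by metis
  also have "\<dots> \<le> norm (cl U f) + s * norm (cl U y)"
    using norm_compl_le[OF s, of "cl U f"] norm_R_le[OF s, of "cl U y"] s by (simp add: add_mono)
  finally show "norm (cl U x - rsv T s (cl U x)) \<le> z" unfolding ab(1) na .
qed

text \<open>With x = V^(\<alpha>-1) g one has v = V x, and the K-functional is at most twice the
  defect of x; squaring brings the factor 4.\<close>

theorem H0_fint:
  assumes g: "g \<in> L2 (mon U)" and v: "v \<in> borel_measurable (mon U)" "AE t in mon U. v t = conv T (pk \<alpha>) g t"
  shows "v \<in> H0 T \<alpha>" "(H0_norm T \<alpha> v)\<^sup>2 \<le> 4 * upc (\<alpha> - 1) * (norm (cl U g))\<^sup>2"
proof -
  define \<theta> where "\<theta> = \<alpha> - 1"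
  have \<theta>: "0 < \<theta>" "\<theta> < 1" using \<alpha> by (auto simp: \<theta>_def)
  define x where "x = conv T (pk \<theta>) g"
  have x: "x \<in> L2 (mon U)" "cl U x = fint T \<theta> (cl U g)" using conv_L2[OF ker_pk[OF \<theta>(1)] g] by (auto simp: x_def)
  note ca = conv_L2[OF ker_pk[of \<alpha>] g]
  have "cl U (bint T x) = fint T \<alpha> (cl U g)"
    unfolding cl_bint[OF x(1)] x(2) using \<theta> by (simp add: fint_fint \<theta>_def)
  then have "AE t in mon U. conv T (pk \<alpha>) g t = bint T x t"
    using ca \<alpha> bint_L2[OF x(1)] by (subst cl_eq_iff[symmetric]) auto
  with v(2) have vx: "AE t in mon U. v t = bint T x t" by eventually_elim simp
  have "interp_sq (H0_int T 1) (H0_int_norm T 1) (H0_int T 2) (H0_int_norm T 2) \<theta> v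
     \<le> (\<integral>\<^sup>+s. ennreal 4 * (ennreal ((s powr (-\<theta>) * norm (cl U x - rsv T s (cl U x)))\<^sup>2 / s) * indicator {0<..} s) \<partial>lborel)"
    unfolding interp_sq_def
  proof (rule nn_integral_mono)
    fix s :: real
    show "ennreal ((s powr (-\<theta>) * KF s v)\<^sup>2 / s) * indicator {0<..} s \<le> ennreal 4 * (ennreal ((s powr (-\<theta>) * norm (cl U x - rsv T s (cl U x)))\<^sup>2 / s) * indicator {0<..} s)"
    proof (cases "s > 0")
      case True
      have dec: "\<exists>a\<in>H0_int T 1. \<exists>b\<in>H0_int T 2. v = (\<lambda>t. a t + b t)" by (rule KF_upper(2)[OF v(1) x(1) vx True])
      \<comment> \<open>The functional is an infimum of reals; that it is nonnegative, as squaring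
        the upper bound requires, follows from the lower bound.\<close>
      have "0 \<le> KF s v" using order_trans[OF norm_ge_zero KF_lower[OF x(1) vx True dec]] .
      then have "(s powr (-\<theta>) * KF s v)\<^sup>2 \<le> (s powr (-\<theta>) * (2 * norm (cl U x - rsv T s (cl U x))))\<^sup>2"
        using KF_upper(1)[OF v(1) x(1) vx True] by (intro power_mono mult_left_mono) auto
      also have "\<dots> = 4 * (s powr (-\<theta>) * norm (cl U x - rsv T s (cl U x)))\<^sup>2" by (simp add: power_mult_distrib)
      finally have "(s powr (-\<theta>) * KF s v)\<^sup>2 / s \<le> 4 * ((s powr (-\<theta>) * norm (cl U x - rsv T s (cl U x)))\<^sup>2 / s)"
        using True by (simp add: divide_right_mono)
      then have "ennreal ((s powr (-\<theta>) * KF s v)\<^sup>2 / s) \<le> ennreal 4 * ennreal ((s powr (-\<theta>) * norm (cl U x - rsv T s (cl U x)))\<^sup>2 / s)"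
        using True by (subst ennreal_mult[symmetric]) (auto intro: ennreal_leI)
      then show ?thesis using True by simp
    qed simp
  qed
  also have "\<dots> = ennreal 4 * (\<integral>\<^sup>+s\<in>{0<..}. ennreal ((s powr (-\<theta>) * norm (cl U x - rsv T s (cl U x)))\<^sup>2 / s) \<partial>lborel)"
  proof (rule nn_integral_cmult)
    interpret resolvent "rsv T" by (rule resolvent_rsv)
    have "(\<lambda>s. indicator {0<..} s * ((s powr (-\<theta>) * norm (cl U x - rsv T s (cl U x)))\<^sup>2 / s)) \<in> borel_measurable borel"
      by (rule measurable_on_pos) (auto intro!: continuous_intros continuous_on_R)
    from measurable_compose[OF this measurable_ennreal]
    have F: "(\<lambda>s. ennreal (indicator {0<..} s * ((s powr (-\<theta>) * norm (cl U x - rsv T s (cl U x)))\<^sup>2 / s))) \<in> borel_measurable lborel" by (simp only: measurable_lborel2)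
    have e: "ennreal (indicator {0<..} s * a) = ennreal a * indicator {0<..} s" for s a :: real by (simp add: indicator_def)
    show "(\<lambda>s. ennreal ((s powr (-\<theta>) * norm (cl U x - rsv T s (cl U x)))\<^sup>2 / s) * indicator {0<..} s) \<in> borel_measurable lborel" using F unfolding e .
  qed
  also have "\<dots> \<le> ennreal 4 * ennreal (upc \<theta> * (norm (cl U g))\<^sup>2)"
    unfolding x(2) by (intro mult_left_mono fint_interp_upper \<theta>) simp
  also have "\<dots> = ennreal (4 * upc \<theta> * (norm (cl U g))\<^sup>2)" by (subst ennreal_mult[symmetric]) (auto simp: upc_def mult.assoc)
  finally have le: "interp_sq (H0_int T 1) (H0_int_norm T 1) (H0_int T 2) (H0_int_norm T 2) \<theta> v \<le> ennreal (4 * upc \<theta> * (norm (cl U g))\<^sup>2)" .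
  show "v \<in> H0 T \<alpha>"
    unfolding H0_alpha interp_space_def using KF_upper(2)[OF v(1) x(1) vx zero_less_one] le_less_trans[OF le ennreal_less_top] by (simp add: \<theta>_def)
  show "(H0_norm T \<alpha> v)\<^sup>2 \<le> 4 * upc (\<alpha> - 1) * (norm (cl U g))\<^sup>2"
    using enn2real_mono[OF le] unfolding H0_norm_alpha interp_norm_def by (simp add: \<theta>_def upc_def)
qed

text \<open>One splitting of v gives v = V x. Bounding the defect of x by the K-functional transfers
  the finite interpolation norm to x, and \<open>fint_interp_lower\<close> with \<theta> = \<alpha>
  - 1 rewrites V x as V^\<alpha> g; this is why \<open>qconst\<close> is taken at 2 -
  \<alpha>.\<close>

theorem H0_imp_fint:
  assumes v: "v \<in> H0 T \<alpha>"
  shows "\<exists>g\<in>L2 (mon U). v \<in> L2 (mon U) \<and> cl U v = fint T \<alpha> (cl U g) \<and> norm (cl U g) \<le> H0_norm T \<alpha> v / qconst (2 - \<alpha>)"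
proof -
  define \<theta> where "\<theta> = \<alpha> - 1"
  have \<theta>: "0 < \<theta>" "\<theta> < 1" using \<alpha> by (auto simp: \<theta>_def)
  have dec: "\<exists>a\<in>H0_int T 1. \<exists>b\<in>H0_int T 2. v = (\<lambda>t. a t + b t)" and fin: "interp_sq (H0_int T 1) (H0_int_norm T 1) (H0_int T 2) (H0_int_norm T 2) \<theta> v < \<infinity>"
    using v by (auto simp: H0_alpha interp_space_def \<theta>_def)
  obtain a b where ab: "a \<in> H0_int T 1" "b \<in> H0_int T 2" "v = (\<lambda>t. a t + b t)" using dec by blast
  obtain f where f: "f \<in> L2 (mon U)" "AE t in mon U. a t = bint T f t" by (rule H0_int_1E[OF ab(1) T]) (rule that)
  obtain y where y: "y \<in> L2 (mon U)" "AE t in mon U. b t = bint T (bint T y) t" by (rule H0_int_2E[OF ab(2) T]) (rule that)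
  have yb: "bint T y \<in> L2 (mon U)" by (rule bint_L2[OF y(1)])
  define x where "x t = f t + bint T y t" for t
  have xL: "x \<in> L2 (mon U)" unfolding x_def[abs_def] using f yb by auto
  have vx: "AE t in mon U. v t = bint T x t"
    using f(2) y(2)
  proof eventually_elim
    case (elim t)
    have "bint T f t + bint T (bint T y) t = (\<integral>s. indicator U s * (if t < s then f s else 0) + indicator U s * (if t < s then bint T y s else 0) \<partial>lborel)"
      unfolding bint_def[of T f] bint_def[of T "bint T y"] by (rule Bochner_Integration.integral_add[OF bint_integrable[OF f(1)] bint_integrable[OF yb], symmetric])
    also have "\<dots> = bint T x t"
      unfolding bint_def[of T x] by (intro Bochner_Integration.integral_cong) (auto simp: distrib_left x_def)
    finally show ?case using elim ab(3) by simp
  qed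
  have vm: "v \<in> L2 (mon U)" using ab by (auto simp: H0_int_def)
  define N where "N = enn2real (interp_sq (H0_int T 1) (H0_int_norm T 1) (H0_int T 2) (H0_int_norm T 2) \<theta> v)"
  have N: "interp_sq (H0_int T 1) (H0_int_norm T 1) (H0_int T 2) (H0_int_norm T 2) \<theta> v = ennreal N" "N \<ge> 0"
    using fin by (auto simp: N_def)
  have "(\<integral>\<^sup>+s\<in>{0<..}. ennreal ((s powr (-\<theta>) * norm (cl U x - rsv T s (cl U x)))\<^sup>2 / s) \<partial>lborel) \<le> ennreal N"
    unfolding N(1)[symmetric] interp_sq_def
  proof (rule nn_integral_mono)
    fix s :: real
    show "ennreal ((s powr (-\<theta>) * norm (cl U x - rsv T s (cl U x)))\<^sup>2 / s) * indicator {0<..} s \<le> ennreal ((s powr (-\<theta>) * KF s v)\<^sup>2 / s) * indicator {0<..} s"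
    proof (cases "s > 0")
      case True
      have "(s powr (-\<theta>) * norm (cl U x - rsv T s (cl U x)))\<^sup>2 \<le> (s powr (-\<theta>) * KF s v)\<^sup>2"
        using KF_lower[OF xL vx True dec] by (intro power_mono mult_left_mono) auto
      then show ?thesis using True by (simp add: divide_right_mono ennreal_leI)
    qed simp
  qed
  from fint_interp_lower[OF \<theta> this N(2)] obtain g0 where g0: "fint T 1 (cl U x) = fint T (1 + \<theta>) g0" "norm g0 \<le> sqrt N / qconst (1 - \<theta>)" by blast
  obtain g where g: "g \<in> L2 (mon U)" "fint T \<alpha> g0 = fint T \<alpha> (cl U g)" "norm (cl U g) \<le> norm g0"
    by (rule op_tri_restrict[OF ker_pk[of \<alpha>], of T g0]) (use \<alpha> in simp, rule that)
  have "cl U v = cl U (bint T x)" using vx vm bint_L2[OF xL] by (simp add: cl_eq_iff)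
  also have "\<dots> = fint T \<alpha> (cl U g)" using g0(1) g(2) by (simp add: cl_bint[OF xL] \<theta>_def)
  finally have "cl U v = fint T \<alpha> (cl U g)" .
  moreover have "norm (cl U g) \<le> H0_norm T \<alpha> v / qconst (2 - \<alpha>)"
    using g(3) g0(2) by (simp add: H0_norm_alpha interp_norm_def N_def \<theta>_def)
  ultimately show ?thesis using g(1) vm by blast
qed

end

section \<open>Fourier coefficients on the space-time cylinder\<close>

lemma sigma_finite_mon: "S \<in> sets borel \<Longrightarrow> sigma_finite_measure (mon (S::'a::euclidean_space set))"
  by (rule sigma_finite_measure_restrict_space[OF sigma_finite_lborel]) simp

text \<open>Both measures agree on measurable rectangles. Functions on the cylinder thereby become
  elements of the Hilbert space \<open>l2\<close> over pairs of time and space.\<close>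

lemma cylinder_eq:
  fixes \<Omega> :: "'a::euclidean_space set"
  assumes Om: "\<Omega> \<in> sets borel"
  shows "cylinder T \<Omega> = mon ({0<..<T} \<times> \<Omega>)"
proof (rule pair_measure_eqI)
  let ?U = "{0<..<T}"
  have S: "?U \<times> \<Omega> \<in> sets (borel :: (real \<times> 'a) measure)" using Om by (simp add: borel_prod[symmetric])
  show "sigma_finite_measure (mon ?U)" "sigma_finite_measure (mon \<Omega>)" using Om by (auto intro: sigma_finite_mon)
  show "sets (cylinder T \<Omega>) = sets (mon (?U \<times> \<Omega>))"
  proof (intro equalityI subsetI)
    have "{a \<times> b |a b. a \<in> sets (mon ?U) \<and> b \<in> sets (mon \<Omega>)} \<subseteq> sets (mon (?U \<times> \<Omega>))"
    proof safe
      fix a b assume "a \<in> sets (mon ?U)" "b \<in> sets (mon \<Omega>)"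
      then have "a \<in> sets borel" "a \<subseteq> ?U" "b \<in> sets borel" "b \<subseteq> \<Omega>" using Om by (auto simp: sets_restrict_space_iff)
      then have "a \<times> b \<in> sets (borel :: (real \<times> 'a) measure)" "a \<times> b \<subseteq> ?U \<times> \<Omega>" by (auto simp: borel_prod[symmetric])
      then show "a \<times> b \<in> sets (mon (?U \<times> \<Omega>))" using S by (simp add: sets_restrict_space_iff)
    qed
    then have "sigma_sets (space (mon ?U) \<times> space (mon \<Omega>)) {a \<times> b |a b. a \<in> sets (mon ?U) \<and> b \<in> sets (mon \<Omega>)} \<subseteq> sets (mon (?U \<times> \<Omega>))"
      using sets.sigma_sets_subset[of _ "mon (?U \<times> \<Omega>)"] by (simp add: space_restrict_space)
    then show "X \<in> sets (mon (?U \<times> \<Omega>))" if "X \<in> sets (cylinder T \<Omega>)" for X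
      using that by (auto simp: sets_pair_measure)
    fix X assume "X \<in> sets (mon (?U \<times> \<Omega>))"
    then have "X \<in> sets (lborel :: (real \<times> 'a) measure)" "X \<subseteq> ?U \<times> \<Omega>"
      using S by (auto simp: sets_restrict_space_iff)
    then have X: "X \<in> sets (lborel \<Otimes>\<^sub>M lborel)" "X \<subseteq> ?U \<times> \<Omega>" unfolding lborel_prod by auto
    have m: "(\<lambda>t. t) \<in> measurable (mon ?U) lborel" "(\<lambda>x. x) \<in> measurable (mon \<Omega>) lborel"
      by (auto intro: measurable_restrict_space1)
    have pm: "(\<lambda>p. (fst p, snd p)) \<in> measurable (cylinder T \<Omega>) (lborel \<Otimes>\<^sub>M lborel)"
      by (rule measurable_Pair[OF measurable_compose[OF measurable_fst m(1)] measurable_compose[OF measurable_snd m(2)]])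
    from measurable_sets[OF pm X(1)]
    have "(\<lambda>p. p) -` X \<inter> space (cylinder T \<Omega>) \<in> sets (cylinder T \<Omega>)" by simp
    moreover have "(\<lambda>p. p) -` X \<inter> space (cylinder T \<Omega>) = X" using X(2) by (auto simp: space_pair_measure space_restrict_space)
    ultimately show "X \<in> sets (cylinder T \<Omega>)" by simp
  qed
  fix A B assume "A \<in> sets (mon ?U)" "B \<in> sets (mon \<Omega>)"
  then have AB: "A \<in> sets borel" "A \<subseteq> ?U" "B \<in> sets borel" "B \<subseteq> \<Omega>" using Om by (auto simp: sets_restrict_space_iff)
  have "emeasure (mon (?U \<times> \<Omega>)) (A \<times> B) = emeasure lborel (A \<times> B)"
    using AB S by (intro emeasure_restrict_space) auto
  also have "\<dots> = emeasure lborel A * emeasure lborel B"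
    using AB by (simp add: lborel_prod[symmetric] lborel.emeasure_pair_measure_Times)
  finally show "emeasure (mon ?U) A * emeasure (mon \<Omega>) B = emeasure (mon (?U \<times> \<Omega>)) (A \<times> B)"
    using AB Om by (simp add: emeasure_restrict_space)
qed

lemma L2norm_sq: "f \<in> L2 M \<Longrightarrow> (\<integral>\<^sup>+x. ennreal ((f x)\<^sup>2) \<partial>M) = ennreal ((L2norm M f)\<^sup>2)"
  by (subst nn_integral_eq_integral) (auto simp: L2_def L2norm_def)

text \<open>The bound is a Schur constant, which may depend on T. It serves only to show that
  convolutions are square-integrable on the cylinder and never enters the final estimate.\<close>

lemma op_bounded:
  assumes "schur \<kappa>"
  shows "\<exists>B\<ge>0. \<forall>x. norm (op \<kappa> x) \<le> B * norm x"
proof -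
  obtain N :: real where N: "N \<ge> 0" "\<And>f. f \<in> borel_measurable borel \<Longrightarrow>
    (\<integral>\<^sup>+t. (\<integral>\<^sup>+s. ennreal (\<kappa> t s) * f s \<partial>lborel)\<^sup>2 \<partial>lborel) \<le> ennreal (N\<^sup>2) * (\<integral>\<^sup>+s. (f s)\<^sup>2 \<partial>lborel)"
    using schur_young[OF assms] by blast
  have "norm (op \<kappa> x) \<le> N * norm x" for x
  proof -
    obtain f where f: "f \<in> L2 lborel" "x = mk f" by (rule mk_surj[of x]) (rule that)
    have [measurable]: "f \<in> borel_measurable borel" using L2_measurable[OF f(1)] by simp
    have "ennreal ((norm (op \<kappa> x))\<^sup>2) = (\<integral>\<^sup>+t. ennreal ((iop \<kappa> f t)\<^sup>2) \<partial>lborel)"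
      unfolding f(2) op_mk[OF assms f(1)] by (rule nn_integral_sq_mk[symmetric]) (rule iop_L2[OF assms f(1)])
    also have "\<dots> \<le> (\<integral>\<^sup>+t. (\<integral>\<^sup>+s. ennreal (\<kappa> t s) * ennreal \<bar>f s\<bar> \<partial>lborel)\<^sup>2 \<partial>lborel)"
    proof (rule nn_integral_mono_AE, rule AE_mp[OF iop_integrable_AE[OF assms f(1)]], intro AE_I2 impI)
      fix t assume "integrable lborel (\<lambda>s. \<kappa> t s * f s)"
      from integral_norm_bound_ennreal[OF this]
      have "ennreal \<bar>iop \<kappa> f t\<bar> \<le> (\<integral>\<^sup>+s. ennreal (\<kappa> t s) * ennreal \<bar>f s\<bar> \<partial>lborel)"
        using schur_nonneg[OF assms] by (simp add: iop_def abs_mult ennreal_mult)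
      from power_mono[OF this, of 2]
      show "ennreal ((iop \<kappa> f t)\<^sup>2) \<le> (\<integral>\<^sup>+s. ennreal (\<kappa> t s) * ennreal \<bar>f s\<bar> \<partial>lborel)\<^sup>2"
        by (simp add: ennreal_power)
    qed
    also have "\<dots> \<le> ennreal (N\<^sup>2) * (\<integral>\<^sup>+s. (ennreal \<bar>f s\<bar>)\<^sup>2 \<partial>lborel)"
      by (rule N(2)) measurable
    also have "(\<integral>\<^sup>+s. (ennreal \<bar>f s\<bar>)\<^sup>2 \<partial>lborel) = ennreal ((norm x)\<^sup>2)"
      using nn_integral_sq_mk[OF f(1)] f(2) by (simp add: ennreal_power)
    finally have "ennreal ((norm (op \<kappa> x))\<^sup>2) \<le> ennreal ((N * norm x)\<^sup>2)"
      by (simp add: ennreal_mult[symmetric] power_mult_distrib)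
    then have "(norm (op \<kappa> x))\<^sup>2 \<le> (N * norm x)\<^sup>2" by (subst (asm) ennreal_le_iff) auto
    then show ?thesis by (rule power2_le_imp_le) (use N(1) in simp)
  qed
  then show ?thesis using N(1) by blast
qed

lemma sums_of_ennreal:
  assumes "\<And>n. 0 \<le> a n" "0 \<le> b" "(\<Sum>n. ennreal (a n)) = ennreal b"
  shows "a sums b"
proof -
  have s: "summable a" by (rule summable_suminf_not_top) (use assms in auto)
  then have "ennreal (suminf a) = ennreal b" using assms by (simp add: suminf_ennreal2)
  then have "suminf a = b" using assms(1) by (subst (asm) ennreal_inj) (auto intro: suminf_nonneg s assms(2))
  then show ?thesis using summable_sums[OF s] by simp
qed

locale cyl =
  fixes T :: real and \<Omega> :: "'a::euclidean_space set" and \<phi> :: "nat \<Rightarrow> 'a \<Rightarrow> real" and lam :: "nat \<Rightarrow> real"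
  assumes T: "T > 0" and Om: "\<Omega> \<in> sets borel" and eig: "dirichlet_eigenbasis \<Omega> \<phi> lam"
begin

abbreviation "I \<equiv> {0<..<T}"
abbreviation "M \<equiv> mon I"
abbreviation "N \<equiv> mon \<Omega>"
abbreviation "P \<equiv> cylinder T \<Omega>"
abbreviation "S \<equiv> I \<times> \<Omega>"

sublocale MN: pair_sigma_finite M N
  by (intro pair_sigma_finite.intro sigma_finite_mon Om) simp

lemma S_sets: "S \<in> sets (borel :: (real \<times> 'a) measure)"
  using Om by (simp add: borel_prod[symmetric])

lemma P_eq: "P = mon S" by (rule cylinder_eq[OF Om])

lemma I_sets: "I \<in> sets borel" by simp

lemmas clM = cl_add[OF I_sets] cl_diff[OF I_sets] cl_scale[OF I_sets]
lemmas clM_eq = cl_eq_iff[OF I_sets]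
lemmas clN_eq = cl_eq_iff[OF Om]
lemmas clP_eq = cl_eq_iff[OF S_sets, folded P_eq]

lemma phi_L2: "\<phi> n \<in> L2 N"
  using eig by (simp add: dirichlet_eigenbasis_def orthonormal_basis_def)

lemma lam_pos: "0 < lam n"
proof -
  have "lam 0 \<le> lam n" using eig by (auto simp: dirichlet_eigenbasis_def mono_def)
  then show ?thesis using eig by (auto simp: dirichlet_eigenbasis_def)
qed

abbreviation "e n \<equiv> cl \<Omega> (\<phi> n)"

lemma e_orth: "inner (e m) (e n) = (if m = n then 1 else 0)"
  using eig ip_mon[OF Om phi_L2 phi_L2, of m n] by (simp add: dirichlet_eigenbasis_def orthonormal_basis_def)

lemma cl_partial_sum: "f \<in> L2 N \<Longrightarrow> cl \<Omega> (\<lambda>x. \<Sum>n<K. c n * \<phi> n x) = (\<Sum>n<K. c n *\<^sub>R e n)"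
proof (induction K)
  case 0 then show ?case by (simp add: cl_def mk_zero)
next
  case (Suc K)
  have a: "(\<lambda>x. \<Sum>n<K. c n * \<phi> n x) \<in> L2 N" by (intro L2_sum L2_cmult phi_L2)
  have b: "(\<lambda>x. c K * \<phi> K x) \<in> L2 N" by (intro L2_cmult phi_L2)
  show ?case using cl_add[OF Om a b] Suc by (simp add: cl_scale[OF Om phi_L2])
qed

lemma fourier_tendsto:
  assumes f: "f \<in> L2 N"
  shows "(\<lambda>K. \<Sum>n<K. ip N f (\<phi> n) *\<^sub>R e n) \<longlonglongrightarrow> cl \<Omega> f"
proof -
  have "(\<lambda>K. L2norm N (\<lambda>x. f x - (\<Sum>n<K. ip N f (\<phi> n) * \<phi> n x))) \<longlonglongrightarrow> 0"
    using eig f by (simp add: dirichlet_eigenbasis_def orthonormal_basis_def)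
  moreover have "L2norm N (\<lambda>x. f x - (\<Sum>n<K. ip N f (\<phi> n) * \<phi> n x)) = norm (cl \<Omega> f - (\<Sum>n<K. ip N f (\<phi> n) *\<^sub>R e n))" for K
  proof -
    have s: "(\<lambda>x. \<Sum>n<K. ip N f (\<phi> n) * \<phi> n x) \<in> L2 N" by (intro L2_sum L2_cmult phi_L2)
    show ?thesis by (simp add: L2norm_mon[OF Om L2_diff[OF f s]] cl_diff[OF Om f s] cl_partial_sum[OF f])
  qed
  ultimately have "(\<lambda>K. norm (cl \<Omega> f - (\<Sum>n<K. ip N f (\<phi> n) *\<^sub>R e n))) \<longlonglongrightarrow> 0" by simp
  then have "(\<lambda>K. cl \<Omega> f - (\<Sum>n<K. ip N f (\<phi> n) *\<^sub>R e n)) \<longlonglongrightarrow> 0" by (rule tendsto_norm_zero_cancel)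
  from tendsto_diff[OF tendsto_const this, of "cl \<Omega> f"] show ?thesis by simp
qed

lemma parseval:
  assumes f: "f \<in> L2 N" and g: "g \<in> L2 N"
  shows "(\<lambda>n. ip N f (\<phi> n) * ip N g (\<phi> n)) sums ip N f g"
proof -
  have "(\<lambda>K. inner (\<Sum>n<K. ip N f (\<phi> n) *\<^sub>R e n) (cl \<Omega> g)) \<longlonglongrightarrow> inner (cl \<Omega> f) (cl \<Omega> g)"
    by (intro tendsto_intros fourier_tendsto f)
  moreover have "inner (\<Sum>n<K. ip N f (\<phi> n) *\<^sub>R e n) (cl \<Omega> g) = (\<Sum>n<K. ip N f (\<phi> n) * ip N g (\<phi> n))" for K
    unfolding ip_mon[OF Om g phi_L2] inner_sum_left inner_scaleR_left
    by (intro sum.cong refl) (simp add: inner_commute)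
  ultimately show ?thesis by (simp add: sums_def ip_mon[OF Om f g])
qed

lemma parseval_sq: "f \<in> L2 N \<Longrightarrow> (\<lambda>n. (ip N f (\<phi> n))\<^sup>2) sums (L2norm N f)\<^sup>2"
  using parseval[of f f] by (simp add: power2_eq_square[symmetric] L2norm_def ip_def)

lemma coefs_eq_imp_AE:
  assumes "f \<in> L2 N" "g \<in> L2 N" "\<And>n. ip N f (\<phi> n) = ip N g (\<phi> n)"
  shows "AE x in N. f x = g x"
proof -
  have "cl \<Omega> f = cl \<Omega> g"
    using LIMSEQ_unique[OF fourier_tendsto[OF assms(1)]] fourier_tendsto[OF assms(2)] by (simp add: assms(3))
  then show ?thesis using assms by (simp add: clN_eq)
qed

lemma measurable_section:
  fixes v :: "real \<times> 'a \<Rightarrow> real" and x :: 'a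
  assumes "v \<in> borel_measurable P"
  shows "t \<in> I \<Longrightarrow> (\<lambda>x. v (t, x)) \<in> borel_measurable N" "x \<in> \<Omega> \<Longrightarrow> (\<lambda>t. v (t, x)) \<in> borel_measurable M"
proof -
  show "(\<lambda>x. v (t, x)) \<in> borel_measurable N" if "t \<in> I"
    by (rule measurable_Pair2[OF assms]) (use that in \<open>simp add: space_restrict_space\<close>)
  show "(\<lambda>t. v (t, x)) \<in> borel_measurable M" if "x \<in> \<Omega>"
    by (rule measurable_Pair1[OF assms]) (use that in \<open>simp add: space_restrict_space\<close>)
qed

lemma nn_section_measurable:
  fixes v :: "real \<times> 'a \<Rightarrow> real"
  assumes "v \<in> borel_measurable P"
  shows "(\<lambda>x. \<integral>\<^sup>+t. ennreal ((v (t, x))\<^sup>2) \<partial>M) \<in> borel_measurable N"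
proof -
  have "(\<lambda>p. v (snd p, fst p)) \<in> borel_measurable (N \<Otimes>\<^sub>M M)"
    using measurable_pair_swap[OF assms] by (simp add: case_prod_beta')
  then have "(\<lambda>p. ennreal ((v (snd p, fst p))\<^sup>2)) \<in> borel_measurable (N \<Otimes>\<^sub>M M)"
    by (intro measurable_compose[OF _ measurable_ennreal] borel_measurable_power)
  from MN.M1.borel_measurable_nn_integral_fst[OF this] show ?thesis by simp
qed

lemma L2_section1: assumes "v \<in> L2 P" shows "AE t in M. (\<lambda>x. v (t, x)) \<in> L2 N"
proof -
  have "AE t in M. integrable N (\<lambda>x. (v (t, x))\<^sup>2)"
    using assms MN.AE_integrable_fst'[of "\<lambda>p. (v p)\<^sup>2"] by (simp add: L2_def)
  moreover have "AE t in M. t \<in> I" by (rule AE_I2) (simp add: space_restrict_space)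
  ultimately show ?thesis
    by eventually_elim (use measurable_section(1)[OF L2_measurable[OF assms]] in \<open>simp add: L2_def\<close>)
qed

lemma L2_section2: assumes "v \<in> L2 P" shows "AE x in N. (\<lambda>t. v (t, x)) \<in> L2 M"
proof -
  have "AE x in N. integrable M (\<lambda>t. (v (t, x))\<^sup>2)"
  proof (rule MN.AE_integrable_snd)
    have "(\<lambda>(t, x). (v (t, x))\<^sup>2) = (\<lambda>p. (v p)\<^sup>2)" by auto
    then show "integrable P (\<lambda>(t, x). (v (t, x))\<^sup>2)" using assms by (simp only: L2_def mem_Collect_eq)
  qed
  moreover have "AE x in N. x \<in> \<Omega>" by (rule AE_I2) (simp add: space_restrict_space)
  ultimately show ?thesis
    by eventually_elim (use measurable_section(2)[OF L2_measurable[OF assms]] in \<open>simp add: L2_def\<close>)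
qed

lemma tensor_L2:
  assumes a: "a \<in> L2 M" and b: "b \<in> L2 N"
  shows "(\<lambda>(t, x). a t * b x) \<in> L2 P"
proof -
  note [measurable] = L2_measurable[OF a] L2_measurable[OF b]
  have m: "(\<lambda>(t, x). a t * b x) \<in> borel_measurable P" by measurable
  have "(\<integral>\<^sup>+p. ennreal ((case p of (t, x) \<Rightarrow> a t * b x)\<^sup>2) \<partial>P) = (\<integral>\<^sup>+t. \<integral>\<^sup>+x. ennreal ((a t * b x)\<^sup>2) \<partial>N \<partial>M)"
    by (subst MN.M2.nn_integral_fst[symmetric]) (use m in auto)
  also have "\<dots> = (\<integral>\<^sup>+t. ennreal ((a t)\<^sup>2) * ennreal ((L2norm N b)\<^sup>2) \<partial>M)"
    unfolding L2norm_sq[OF b, symmetric]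
    by (intro nn_integral_cong, subst nn_integral_cmult[symmetric]) (auto simp: power_mult_distrib ennreal_mult)
  also have "\<dots> = ennreal ((L2norm M a)\<^sup>2) * ennreal ((L2norm N b)\<^sup>2)"
    unfolding L2norm_sq[OF a, symmetric] by (rule nn_integral_multc) measurable
  also have "\<dots> < \<infinity>" by (simp add: ennreal_mult_less_top)
  finally show ?thesis using m by (simp add: L2_iff_nn)
qed

text \<open>Tensor products are the test elements of the cylinder. Integrating in space first yields
  coefficient functions; integrating in time first lets one-dimensional operators act at fixed x.
  Equating the two transfers statements between them.\<close>

lemma ip_tensor1:
  assumes v: "v \<in> L2 P" and a: "a \<in> L2 M" and b: "b \<in> L2 N"
  shows "ip P v (\<lambda>(t, x). a t * b x) = ip M (\<lambda>t. ip N (\<lambda>x. v (t, x)) b) a"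
    and "ip P v (\<lambda>(t, x). a t * b x) = ip N (\<lambda>x. ip M (\<lambda>t. v (t, x)) a) b"
proof -
  have i: "integrable P (\<lambda>p. v p * (case p of (t, x) \<Rightarrow> a t * b x))" by (rule L2_mult_integrable[OF v tensor_L2[OF a b]])
  have "ip P v (\<lambda>(t, x). a t * b x) = (\<integral>t. \<integral>x. v (t, x) * (a t * b x) \<partial>N \<partial>M)"
    unfolding ip_def by (subst MN.integral_fst'[OF i, symmetric]) simp
  also have "\<dots> = (\<integral>t. (\<integral>x. v (t, x) * b x \<partial>N) * a t \<partial>M)"
  proof (rule Bochner_Integration.integral_cong[OF refl])
    fix t
    have "(\<integral>x. v (t, x) * (a t * b x) \<partial>N) = (\<integral>x. (v (t, x) * b x) * a t \<partial>N)" by (simp add: mult_ac)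
    then show "(\<integral>x. v (t, x) * (a t * b x) \<partial>N) = (\<integral>x. v (t, x) * b x \<partial>N) * a t" by simp
  qed
  finally show "ip P v (\<lambda>(t, x). a t * b x) = ip M (\<lambda>t. ip N (\<lambda>x. v (t, x)) b) a" by (simp add: ip_def)
  have "ip P v (\<lambda>(t, x). a t * b x) = (\<integral>x. \<integral>t. v (t, x) * (a t * b x) \<partial>M \<partial>N)"
    unfolding ip_def using MN.integral_snd[of "\<lambda>t x. v (t, x) * (a t * b x)"] i by (simp add: case_prod_beta')
  also have "\<dots> = (\<integral>x. (\<integral>t. v (t, x) * a t \<partial>M) * b x \<partial>N)"
  proof (rule Bochner_Integration.integral_cong[OF refl])
    fix x
    have "(\<integral>t. v (t, x) * (a t * b x) \<partial>M) = (\<integral>t. (v (t, x) * a t) * b x \<partial>M)" by (simp add: mult_ac)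
    then show "(\<integral>t. v (t, x) * (a t * b x) \<partial>M) = (\<integral>t. v (t, x) * a t \<partial>M) * b x" by simp
  qed
  finally show "ip P v (\<lambda>(t, x). a t * b x) = ip N (\<lambda>x. ip M (\<lambda>t. v (t, x)) a) b" by (simp add: ip_def)
qed

abbreviation "cf n v \<equiv> coeff \<Omega> \<phi> n v"

lemma cf_measurable:
  assumes "v \<in> borel_measurable P"
  shows "cf n v \<in> borel_measurable M"
proof -
  note [measurable] = assms L2_measurable[OF phi_L2[of n]]
  show ?thesis unfolding coeff_def[abs_def] ip_def by measurable
qed

lemma coeff_sums_AE: "v \<in> L2 P \<Longrightarrow> AE t in M. (\<lambda>n. (cf n v t)\<^sup>2) sums (L2norm N (\<lambda>x. v (t, x)))\<^sup>2"
  using L2_section1 by (rule AE_mp) (auto simp: coeff_def intro!: AE_I2 parseval_sq)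

lemma nn_sum_cf:
  assumes v: "v \<in> L2 P"
  shows "(\<Sum>n. \<integral>\<^sup>+t. ennreal ((cf n v t)\<^sup>2) \<partial>M) = ennreal ((L2norm P v)\<^sup>2)"
proof -
  have "(\<Sum>n. \<integral>\<^sup>+t. ennreal ((cf n v t)\<^sup>2) \<partial>M) = (\<integral>\<^sup>+t. (\<Sum>n. ennreal ((cf n v t)\<^sup>2)) \<partial>M)"
    by (intro nn_integral_suminf[symmetric] measurable_compose[OF _ measurable_ennreal] borel_measurable_power cf_measurable L2_measurable v)
  also have "\<dots> = (\<integral>\<^sup>+t. (\<integral>\<^sup>+x. ennreal ((v (t, x))\<^sup>2) \<partial>N) \<partial>M)"
  proof (rule nn_integral_cong_AE)
    show "AE t in M. (\<Sum>n. ennreal ((cf n v t)\<^sup>2)) = (\<integral>\<^sup>+x. ennreal ((v (t, x))\<^sup>2) \<partial>N)"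
      using coeff_sums_AE[OF v] L2_section1[OF v]
      by eventually_elim (simp add: L2norm_sq suminf_ennreal2 sums_summable sums_unique[symmetric])
  qed
  also have "\<dots> = (\<integral>\<^sup>+p. ennreal ((v p)\<^sup>2) \<partial>P)"
    using L2_measurable[OF v] by (subst MN.M2.nn_integral_fst[symmetric]) auto
  finally show ?thesis by (simp add: L2norm_sq[OF v])
qed

lemma cf_L2: assumes v: "v \<in> L2 P" shows "cf n v \<in> L2 M"
proof -
  have "(\<integral>\<^sup>+t. ennreal ((cf n v t)\<^sup>2) \<partial>M) = (\<Sum>m\<in>{n}. \<integral>\<^sup>+t. ennreal ((cf m v t)\<^sup>2) \<partial>M)" by simp
  also have "\<dots> \<le> (\<Sum>n. \<integral>\<^sup>+t. ennreal ((cf n v t)\<^sup>2) \<partial>M)" by (rule sum_le_suminf) auto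
  also have "\<dots> < \<infinity>" by (simp add: nn_sum_cf[OF v])
  finally show ?thesis using cf_measurable[OF L2_measurable[OF v]] by (simp add: L2_iff_nn)
qed

abbreviation "C n v \<equiv> cl I (cf n v)"

lemma norm_cl_sq: "a \<in> L2 M \<Longrightarrow> (\<integral>\<^sup>+t. ennreal ((a t)\<^sup>2) \<partial>M) = ennreal ((norm (cl I a))\<^sup>2)"
  by (simp add: L2norm_sq L2norm_mon)

text \<open>Parseval in space for almost every t, integrated in time: taking coefficients is an
  isometry into square-summable sequences of functions of time.\<close>

lemma C_sums:
  assumes v: "v \<in> L2 P"
  shows "(\<lambda>n. (norm (C n v))\<^sup>2) sums (norm (cl S v))\<^sup>2"
proof -
  have "(\<Sum>n. ennreal ((norm (C n v))\<^sup>2)) = ennreal ((norm (cl S v))\<^sup>2)"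
    using nn_sum_cf[OF v] L2norm_mon[OF S_sets, of v] v by (simp add: norm_cl_sq[OF cf_L2[OF v]] P_eq)
  then show ?thesis by (intro sums_of_ennreal) auto
qed

lemma C_inner: "v \<in> L2 P \<Longrightarrow> a \<in> L2 M \<Longrightarrow> inner (C n v) (cl I a) = ip P v (\<lambda>(t, x). a t * \<phi> n x)"
  using ip_tensor1(1)[of v a "\<phi> n"] phi_L2 ip_mon[OF I_sets cf_L2, of v a n] by (simp add: coeff_def[abs_def])

lemma cl_I_eqI:
  assumes "\<And>a. a \<in> L2 M \<Longrightarrow> inner (cl I f) (cl I a) = inner (cl I g) (cl I a)" "f \<in> L2 M" "g \<in> L2 M"
  shows "cl I f = cl I g"
proof -
  have d: "cl I f - cl I g = cl I (\<lambda>t. f t - g t)" using assms(2,3) by (simp add: clM)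
  have "inner (cl I f - cl I g) (cl I (\<lambda>t. f t - g t)) = 0"
    using assms(1)[of "\<lambda>t. f t - g t"] assms(2,3) by (simp add: inner_diff_left L2_diff)
  then show ?thesis unfolding d[symmetric] by simp
qed

lemma C_lin:
  assumes v: "v \<in> L2 P" and w: "w \<in> L2 P"
  shows "C n (\<lambda>p. v p + w p) = C n v + C n w" "C n (\<lambda>p. v p - w p) = C n v - C n w" "C n (\<lambda>p. c * v p) = c *\<^sub>R C n v"
    and "AE t in M. cf n (\<lambda>p. v p + w p) t = cf n v t + cf n w t" "cf n (\<lambda>p. c * v p) t = c * cf n v t"
proof -
  have a: "AE t in M. cf n (\<lambda>p. v p + w p) t = cf n v t + cf n w t \<and> cf n (\<lambda>p. v p - w p) t = cf n v t - cf n w t"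
    using L2_section1[OF v] L2_section1[OF w]
    by eventually_elim (simp add: coeff_def ip_def left_diff_distrib distrib_right L2_mult_integrable phi_L2)
  have b: "AE t in M. cf n (\<lambda>p. v p - w p) t = cf n v t - cf n w t" using a by eventually_elim simp
  have c: "AE t in M. cf n (\<lambda>p. v p + w p) t = cf n v t + cf n w t" using a by eventually_elim simp
  then show "AE t in M. cf n (\<lambda>p. v p + w p) t = cf n v t + cf n w t" .
  have s: "cf n (\<lambda>p. c * v p) t = c * cf n v t" for t by (simp add: coeff_def ip_def mult.assoc)
  show "cf n (\<lambda>p. c * v p) t = c * cf n v t" by (rule s)
  note V = cf_L2[OF v, of n] and W = cf_L2[OF w, of n]
  have "C n (\<lambda>p. v p + w p) = cl I (\<lambda>t. cf n v t + cf n w t)"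
    using c clM_eq[OF cf_L2[OF L2_add[OF v w], of n] L2_add[OF V W]] by simp
  then show "C n (\<lambda>p. v p + w p) = C n v + C n w" by (simp add: clM V W)
  have "C n (\<lambda>p. v p - w p) = cl I (\<lambda>t. cf n v t - cf n w t)"
    using b clM_eq[OF cf_L2[OF L2_diff[OF v w], of n] L2_diff[OF V W]] by simp
  then show "C n (\<lambda>p. v p - w p) = C n v - C n w" by (simp add: clM V W)
  have "cf n (\<lambda>p. c * v p) = (\<lambda>t. c * cf n v t)" using s by auto
  then show "C n (\<lambda>p. c * v p) = c *\<^sub>R C n v" by (simp add: clM V)
qed

lemma cl_S_lin:
  assumes v: "v \<in> L2 P" and w: "w \<in> L2 P"
  shows "cl S (\<lambda>p. v p + w p) = cl S v + cl S w" "cl S (\<lambda>p. v p - w p) = cl S v - cl S w" "cl S (\<lambda>p. c * v p) = c *\<^sub>R cl S v"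
  using cl_add[OF S_sets] cl_diff[OF S_sets] cl_scale[OF S_sets] v w by (simp_all add: P_eq)

lemma C_eq_imp:
  assumes v: "v \<in> L2 P" and w: "w \<in> L2 P" and eq: "\<And>n. C n v = C n w"
  shows "cl S v = cl S w" "AE p in P. v p = w p"
proof -
  have "(\<lambda>n. (norm (C n (\<lambda>p. v p - w p)))\<^sup>2) sums (norm (cl S (\<lambda>p. v p - w p)))\<^sup>2" by (rule C_sums[OF L2_diff[OF v w]])
  then have "(\<lambda>n. 0) sums (norm (cl S v - cl S w))\<^sup>2" by (simp add: C_lin[OF v w] cl_S_lin[OF v w] eq)
  then have "(norm (cl S v - cl S w))\<^sup>2 = 0" using sums_unique2 sums_zero by blast
  then show "cl S v = cl S w" by simp
  then show "AE p in P. v p = w p" using v w by (simp add: clP_eq)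
qed

text \<open>Limits and Riesz representatives are classes over all of space-time. Against functions
  supported in the cylinder they act like their restriction, which is a function on the
  cylinder.\<close>

lemma L2_cl_lift: "\<exists>v\<in>L2 P. \<forall>w\<in>L2 P. inner x (cl S w) = inner (cl S v) (cl S w)"
proof -
  obtain h where h: "h \<in> L2 lborel" "x = mk h" by (rule mk_surj[of x]) (rule that)
  have hS: "(\<lambda>p. indicator S p * h p) \<in> L2 lborel" using h S_sets by (intro L2_indicator_mult) auto
  have hP: "h \<in> L2 P" using hS by (simp add: P_eq L2_mon_iff[OF S_sets])
  moreover have "inner x (cl S w) = inner (cl S h) (cl S w)" if "w \<in> L2 P" for w
  proof -
    have wS: "(\<lambda>p. indicator S p * w p) \<in> L2 lborel" using that by (simp add: P_eq L2_mon_iff[OF S_sets])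
    have "(\<lambda>p. h p * (indicator S p * w p)) = (\<lambda>p. (indicator S p * h p) * (indicator S p * w p))"
      by (auto simp: indicator_def)
    then show ?thesis by (simp add: h(2) cl_def inner_mk h hS wS ip_def)
  qed
  ultimately show ?thesis by blast
qed

lemma cf_tensor: "cf m (\<lambda>(t, x). a t * \<phi> n x) t = (if m = n then a t else 0)"
proof -
  have "ip N (\<lambda>x. a t * \<phi> n x) (\<phi> m) = a t * ip N (\<phi> n) (\<phi> m)" by (simp add: ip_def mult.assoc)
  also have "ip N (\<phi> n) (\<phi> m) = (if m = n then 1 else 0)" using e_orth[of n m] by (simp add: ip_mon[OF Om phi_L2 phi_L2])
  finally show ?thesis by (simp add: coeff_def)
qed

text \<open>The isometry is onto: the terms g n t * \<phi> n x are orthogonal, so their partial sums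
  form a Cauchy sequence, and pairing the limit with a tensor product reads off its
  coefficients.\<close>

lemma riesz_fischer:
  assumes g: "\<And>n. g n \<in> L2 M" and s: "summable (\<lambda>n. (norm (cl I (g n)))\<^sup>2)"
  shows "\<exists>v\<in>L2 P. \<forall>n. C n v = cl I (g n)"
proof -
  define y where "y n = cl S (\<lambda>(t, x). g n t * \<phi> n x)" for n
  note tL = tensor_L2[OF g phi_L2]
  have iy: "inner (y m) (cl S v) = inner (C m v) (cl I (g m))" if "v \<in> L2 P" for m v
    using C_inner[OF that g, of m m] ip_mon[OF S_sets, of v "\<lambda>(t, x). g m t * \<phi> m x"] that tL[of m m]
    by (simp add: y_def P_eq inner_commute)
  have oy: "inner (y m) (y n) = (if m = n then (norm (cl I (g n)))\<^sup>2 else 0)" for m n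
  proof -
    have "C m (\<lambda>(t, x). g n t * \<phi> n x) = (if m = n then cl I (g n) else 0)"
      using cf_tensor[of m "g n" n] by (auto simp: cl_def mk_zero)
    then show ?thesis using iy[OF tL[of n n], of m] by (auto simp: y_def[symmetric] power2_norm_eq_inner)
  qed
  define Y where "Y K = (\<Sum>n<K. y n)" for K
  have diff: "(norm (Y k - Y j))\<^sup>2 = (\<Sum>n\<in>{j..<k}. (norm (cl I (g n)))\<^sup>2)" if "j \<le> k" for j k
  proof -
    have "Y k - Y j = (\<Sum>n\<in>{j..<k}. y n)" using that by (simp add: Y_def sum_diff_nat_ivl lessThan_atLeast0)
    then have "(norm (Y k - Y j))\<^sup>2 = (\<Sum>n\<in>{j..<k}. \<Sum>m\<in>{j..<k}. inner (y m) (y n))"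
      by (simp add: power2_norm_eq_inner inner_sum_left inner_sum_right)
    also have "\<dots> = (\<Sum>n\<in>{j..<k}. (norm (cl I (g n)))\<^sup>2)" by (intro sum.cong) (auto simp: oy)
    finally show ?thesis .
  qed
  have "Cauchy Y"
  proof (rule metric_CauchyI)
    fix r :: real assume r: "r > 0"
    obtain K where K: "\<And>m n. m \<ge> K \<Longrightarrow> norm (sum (\<lambda>n. (norm (cl I (g n)))\<^sup>2) {m..<n}) < r\<^sup>2"
      using s[unfolded summable_Cauchy, rule_format, of "r\<^sup>2"] r by auto
    have "dist (Y m) (Y n) < r" if "K \<le> m" "m \<le> n" for m n
    proof -
      have "(norm (Y n - Y m))\<^sup>2 < r\<^sup>2" using K[OF that(1), of n] diff[OF that(2)] by (simp add: sum_nonneg)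
      then show ?thesis using r by (simp add: dist_norm norm_minus_commute power_less_imp_less_base)
    qed
    then show "\<exists>K. \<forall>m\<ge>K. \<forall>n\<ge>K. dist (Y m) (Y n) < r" by (metis dist_commute linorder_linear)
  qed
  then obtain x where x: "Y \<longlonglongrightarrow> x" by (auto simp: Cauchy_convergent_iff convergent_def)
  obtain v where v: "v \<in> L2 P" "\<And>w. w \<in> L2 P \<Longrightarrow> inner x (cl S w) = inner (cl S v) (cl S w)" using L2_cl_lift by blast
  have "C m v = cl I (g m)" for m
  proof (rule cl_I_eqI[OF _ cf_L2[OF v(1)] g])
    fix a assume a: "a \<in> L2 M"
    let ?w = "\<lambda>(t, x). a t * \<phi> m x"
    have wL: "?w \<in> L2 P" by (rule tensor_L2[OF a phi_L2])
    have Cw: "C n ?w = (if n = m then cl I a else 0)" for n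
      using cf_tensor[of n a m] by (auto simp: cl_def mk_zero)
    have "inner (C m v) (cl I a) = inner x (cl S ?w)"
      using C_inner[OF v(1) a, of m] ip_mon[OF S_sets, of v ?w] v wL by (simp add: P_eq)
    also have "\<dots> = inner (cl I (g m)) (cl I a)"
    proof (rule LIMSEQ_unique)
      show "(\<lambda>K. inner (Y K) (cl S ?w)) \<longlonglongrightarrow> inner x (cl S ?w)" by (intro tendsto_intros x)
      have "inner (Y K) (cl S ?w) = inner (cl I (g m)) (cl I a)" if "K > m" for K
      proof -
        have "inner (Y K) (cl S ?w) = (\<Sum>n<K. inner (C n ?w) (cl I (g n)))" by (simp add: Y_def inner_sum_left iy[OF wL])
        also have "\<dots> = (\<Sum>n<K. if n = m then inner (cl I (g m)) (cl I a) else 0)"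
          by (intro sum.cong) (auto simp: Cw inner_commute)
        finally show ?thesis using that by simp
      qed
      then show "(\<lambda>K. inner (Y K) (cl S ?w)) \<longlonglongrightarrow> inner (cl I (g m)) (cl I a)"
        by (intro tendsto_eventually eventually_sequentiallyI[of "Suc m"]) auto
    qed
    finally show "inner (C m v) (cl I a) = inner (cl I (g m)) (cl I a)" .
  qed
  then show ?thesis using v(1) by blast
qed

section \<open>Convolution in time on the cylinder\<close>

definition cconv :: "(real \<Rightarrow> real) \<Rightarrow> (real \<times> 'a \<Rightarrow> real) \<Rightarrow> real \<times> 'a \<Rightarrow> real" where
  "cconv k v = (\<lambda>(t, x). conv T k (\<lambda>s. v (s, x)) t)"

lemma cconv_measurable:
  assumes k: "ker T k" and v: "v \<in> borel_measurable P"
  shows "cconv k v \<in> borel_measurable P"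
proof -
  \<comment> \<open>Extension by zero makes the integrand jointly Borel on the product of the whole
    spaces.\<close>
  define v0 where "v0 p = indicator S p * v p" for p
  have "v0 \<in> borel_measurable lborel"
    using v S_sets borel_measurable_restrict_space_iff[of S lborel v] by (simp add: v0_def[abs_def] P_eq)
  then have [measurable]: "v0 \<in> borel_measurable (borel \<Otimes>\<^sub>M borel)" by (simp add: borel_prod)
  note [measurable] = ker_meas[OF k]
  have "(\<lambda>(t, x). \<integral>s. (if t < s \<and> s < T then k (s - t) * v0 (s, x) else 0) \<partial>lborel) \<in> borel_measurable (borel \<Otimes>\<^sub>M borel)"
    by measurable
  then have "(\<lambda>(t, x). \<integral>s. (if t < s \<and> s < T then k (s - t) * v0 (s, x) else 0) \<partial>lborel) \<in> borel_measurable P"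
    unfolding P_eq by (intro measurable_restrict_space1) (simp add: borel_prod)
  moreover have "(case p of (t, x) \<Rightarrow> \<integral>s. (if t < s \<and> s < T then k (s - t) * v0 (s, x) else 0) \<partial>lborel) = cconv k v p" if "p \<in> space P" for p
  proof (cases p)
    case (Pair t x)
    then have "t \<in> I" "x \<in> \<Omega>" using that by (auto simp: space_pair_measure space_restrict_space)
    then show ?thesis unfolding Pair cconv_def conv_def v0_def
      by (simp, intro Bochner_Integration.integral_cong) auto
  qed
  ultimately show ?thesis by (subst measurable_cong[symmetric]) auto
qed

lemma cconv_L2:
  assumes k: "ker T k" and v: "v \<in> L2 P"
  shows "cconv k v \<in> L2 P"
proof -
  obtain B where B: "B \<ge> 0" "\<And>x. norm (op (tri T k) x) \<le> B * norm x" using op_bounded[OF schur_tri[OF k]] by blast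
  note m = cconv_measurable[OF k L2_measurable[OF v]]
  have "(\<integral>\<^sup>+p. ennreal ((cconv k v p)\<^sup>2) \<partial>P) = (\<integral>\<^sup>+x. \<integral>\<^sup>+t. ennreal ((cconv k v (t, x))\<^sup>2) \<partial>M \<partial>N)"
    using m by (subst MN.nn_integral_snd[symmetric]) auto
  also have "\<dots> \<le> (\<integral>\<^sup>+x. ennreal (B\<^sup>2) * (\<integral>\<^sup>+t. ennreal ((v (t, x))\<^sup>2) \<partial>M) \<partial>N)"
  proof (rule nn_integral_mono_AE)
    show "AE x in N. (\<integral>\<^sup>+t. ennreal ((cconv k v (t, x))\<^sup>2) \<partial>M) \<le> ennreal (B\<^sup>2) * (\<integral>\<^sup>+t. ennreal ((v (t, x))\<^sup>2) \<partial>M)"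
      using L2_section2[OF v]
    proof eventually_elim
      case (elim x)
      note c = conv_L2[OF k elim]
      have "(\<integral>\<^sup>+t. ennreal ((cconv k v (t, x))\<^sup>2) \<partial>M) = ennreal ((norm (op (tri T k) (cl I (\<lambda>t. v (t, x)))))\<^sup>2)"
        using norm_cl_sq[OF c(1)] c(2) by (simp add: cconv_def)
      also have "\<dots> \<le> ennreal ((B * norm (cl I (\<lambda>t. v (t, x))))\<^sup>2)"
        by (intro ennreal_leI power_mono B norm_ge_zero)
      finally show ?case using norm_cl_sq[OF elim] by (simp add: power_mult_distrib ennreal_mult)
    qed
  qed
  also have "\<dots> = ennreal (B\<^sup>2) * (\<integral>\<^sup>+x. (\<integral>\<^sup>+t. ennreal ((v (t, x))\<^sup>2) \<partial>M) \<partial>N)"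
    by (rule nn_integral_cmult[OF nn_section_measurable[OF L2_measurable[OF v]]])
  also have "(\<integral>\<^sup>+x. (\<integral>\<^sup>+t. ennreal ((v (t, x))\<^sup>2) \<partial>M) \<partial>N) = (\<integral>\<^sup>+p. ennreal ((v p)\<^sup>2) \<partial>P)"
    using L2_measurable[OF v] by (subst MN.nn_integral_snd[symmetric]) auto
  also have "ennreal (B\<^sup>2) * \<dots> < \<infinity>" using v by (auto simp: L2_iff_nn ennreal_mult_less_top)
  finally show ?thesis using m by (simp add: L2_iff_nn)
qed

text \<open>Both sides are tested with a t * \<phi> n x. Integrating in time first, the convolution
  is moved for almost every x onto a through its adjoint, and the result h does not depend on x;
  integrating in space first then leaves the coefficient of v.\<close>

lemma C_cconv:
  assumes k: "ker T k" and v: "v \<in> L2 P"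
  shows "C n (cconv k v) = op (tri T k) (C n v)"
proof -
  note wL = cconv_L2[OF k v]
  have vc: "op (tri T k) (C n v) = cl I (conv T k (cf n v))" using conv_L2(2)[OF k cf_L2[OF v]] by simp
  show ?thesis unfolding vc
  proof (rule cl_I_eqI[OF _ cf_L2[OF wL] conv_L2(1)[OF k cf_L2[OF v]]])
    fix a assume a: "a \<in> L2 M"
    obtain h where h: "h \<in> L2 lborel" "op (transp (tri T k)) (cl I a) = mk h"
      by (rule mk_surj[of "op (transp (tri T k)) (cl I a)"]) (rule that)
    have hI: "(\<lambda>t. indicator I t * h t) \<in> L2 lborel" using h by (intro L2_indicator_mult) auto
    have hM: "h \<in> L2 M" using hI by (simp add: L2_mon_iff)
    have ih: "inner (cl I f) (mk h) = inner (cl I f) (cl I h)" if "f \<in> L2 M" for f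
    proof -
      have fI: "(\<lambda>t. indicator I t * f t) \<in> L2 lborel" using that by (simp add: L2_mon_iff)
      have "(\<lambda>t. indicator I t * f t * h t) = (\<lambda>t. indicator I t * f t * (indicator I t * h t))" by (auto simp: indicator_def)
      then show ?thesis using fI h hI by (simp add: cl_def inner_mk ip_def)
    qed
    have key: "inner (op (tri T k) (cl I f)) (cl I a) = inner (cl I f) (cl I h)" if "f \<in> L2 M" for f
      using op_adj[OF schur_tri[OF k], of "cl I f" "cl I a"] h(2) ih[OF that] by simp
    have "inner (C n (cconv k v)) (cl I a) = ip N (\<lambda>x. ip M (\<lambda>t. cconv k v (t, x)) a) (\<phi> n)"
      using C_inner[OF wL a] ip_tensor1(2)[OF wL a phi_L2] by simp
    also have "\<dots> = ip N (\<lambda>x. ip M (\<lambda>t. v (t, x)) h) (\<phi> n)"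
      unfolding ip_def[of N]
    proof (rule integral_cong_AE)
      show "AE x in N. ip M (\<lambda>t. cconv k v (t, x)) a * \<phi> n x = ip M (\<lambda>t. v (t, x)) h * \<phi> n x"
        using L2_section2[OF v]
      proof eventually_elim
        case (elim x)
        have "ip M (\<lambda>t. cconv k v (t, x)) a = inner (op (tri T k) (cl I (\<lambda>t. v (t, x)))) (cl I a)"
          using ip_mon[OF I_sets conv_L2(1)[OF k elim] a] conv_L2(2)[OF k elim] by (simp add: cconv_def)
        also have "\<dots> = ip M (\<lambda>t. v (t, x)) h" using key[OF elim] ip_mon[OF I_sets elim hM] by simp
        finally show ?case by simp
      qed
      note [measurable] = L2_measurable[OF wL] L2_measurable[OF v] L2_measurable[OF a] L2_measurable[OF hM] L2_measurable[OF phi_L2[of n]]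
      show "(\<lambda>x. ip M (\<lambda>t. cconv k v (t, x)) a * \<phi> n x) \<in> borel_measurable N" unfolding ip_def by measurable
      show "(\<lambda>x. ip M (\<lambda>t. v (t, x)) h * \<phi> n x) \<in> borel_measurable N" unfolding ip_def by measurable
    qed
    also have "\<dots> = inner (C n v) (cl I h)"
      using C_inner[OF v hM] ip_tensor1(2)[OF v hM phi_L2] by simp
    also have "\<dots> = inner (cl I (conv T k (cf n v))) (cl I a)"
      unfolding vc[symmetric] by (rule key[OF cf_L2[OF v], symmetric])
    finally show "inner (C n (cconv k v)) (cl I a) = inner (cl I (conv T k (cf n v))) (cl I a)" .
  qed
qed

lemma frac_int_cconv: "\<beta> > 0 \<Longrightarrow> frac_int T \<beta> v = cconv (pk \<beta>) v"
proof (rule ext)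
  fix p :: "real \<times> 'a" assume b: "\<beta> > 0"
  obtain t x where p: "p = (t, x)" by (cases p)
  have "1 / Gamma \<beta> * (\<integral>s\<in>{t<..<T}. (s - t) powr (\<beta> - 1) * v (s, x) \<partial>lborel) = (\<integral>s. 1 / Gamma \<beta> * (indicator {t<..<T} s * ((s - t) powr (\<beta> - 1) * v (s, x))) \<partial>lborel)"
    by (simp add: set_lebesgue_integral_def)
  also have "\<dots> = conv T (pk \<beta>) (\<lambda>s. v (s, x)) t"
    unfolding conv_def by (intro Bochner_Integration.integral_cong) (auto simp: pk_def indicator_def)
  finally show "frac_int T \<beta> v p = cconv (pk \<beta>) v p" using b by (simp add: frac_int_def cconv_def p)
qed

end

section \<open>Time derivatives and initial values on the cylinder\<close>

context cyl
begin

lemma eq_sets_P: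
  fixes f g :: "real \<times> 'a \<Rightarrow> real"
  assumes "f \<in> borel_measurable P" "g \<in> borel_measurable P"
  shows "{p \<in> space P. f p = g p} \<in> sets P"
  using assms by measurable

lemma AE_P_fst: "AE p in P. Q p \<Longrightarrow> AE t in M. AE x in N. Q (t, x)"
  by (rule MN.AE_pair)

lemma AE_P_snd:
  fixes f g :: "real \<times> 'a \<Rightarrow> real"
  assumes m: "f \<in> borel_measurable P" "g \<in> borel_measurable P" and eq: "AE p in P. f p = g p"
  shows "AE x in N. AE t in M. f (t, x) = g (t, x)"
  using MN.AE_commute[of "\<lambda>t x. f (t, x) = g (t, x)"] eq_sets_P[OF m] AE_P_fst[OF eq] by simp

lemma AE_P_fst_iff:
  fixes f g :: "real \<times> 'a \<Rightarrow> real"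
  assumes m: "f \<in> borel_measurable P" "g \<in> borel_measurable P"
  shows "(AE p in P. f p = g p) \<longleftrightarrow> (AE t in M. AE x in N. f (t, x) = g (t, x))"
  using AE_P_fst MN.AE_pair_measure[OF eq_sets_P[OF m]] by blast

lemma AE_in_M: "AE t in M. t \<in> I" and AE_in_N: "AE x in N. x \<in> \<Omega>"
  by (rule AE_I2, simp add: space_restrict_space)+

lemma ip_M_cong:
  assumes "f \<in> borel_measurable M" "g \<in> borel_measurable M" "a \<in> borel_measurable M" "AE t in M. f t = g t"
  shows "ip M f a = ip M g a"
  unfolding ip_def using assms by (intro integral_cong_AE borel_measurable_times) auto

lemma ip_section_measurable:
  assumes v: "v \<in> L2 P" and a: "a \<in> L2 M"
  shows "(\<lambda>x. ip M (\<lambda>t. v (t, x)) a) \<in> borel_measurable N"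
proof -
  note [measurable] = L2_measurable[OF v] L2_measurable[OF a]
  show ?thesis unfolding ip_def by measurable
qed

lemma ip_section_L2:
  assumes v: "v \<in> L2 P" and a: "a \<in> L2 M"
  shows "(\<lambda>x. ip M (\<lambda>t. v (t, x)) a) \<in> L2 N"
    and "L2norm N (\<lambda>x. ip M (\<lambda>t. v (t, x)) a) \<le> L2norm P v * norm (cl I a)"
proof -
  have "(\<integral>\<^sup>+x. ennreal ((ip M (\<lambda>t. v (t, x)) a)\<^sup>2) \<partial>N) \<le> (\<integral>\<^sup>+x. ennreal ((norm (cl I a))\<^sup>2) * (\<integral>\<^sup>+t. ennreal ((v (t, x))\<^sup>2) \<partial>M) \<partial>N)"
  proof (rule nn_integral_mono_AE)
    show "AE x in N. ennreal ((ip M (\<lambda>t. v (t, x)) a)\<^sup>2) \<le> ennreal ((norm (cl I a))\<^sup>2) * (\<integral>\<^sup>+t. ennreal ((v (t, x))\<^sup>2) \<partial>M)"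
      using L2_section2[OF v]
    proof eventually_elim
      case (elim x)
      have "\<bar>ip M (\<lambda>t. v (t, x)) a\<bar> \<le> norm (cl I (\<lambda>t. v (t, x))) * norm (cl I a)"
        unfolding ip_mon[OF I_sets elim a] by (rule Cauchy_Schwarz_ineq2)
      then have "\<bar>ip M (\<lambda>t. v (t, x)) a\<bar>\<^sup>2 \<le> (norm (cl I (\<lambda>t. v (t, x))) * norm (cl I a))\<^sup>2" by (intro power_mono) auto
      then have "ennreal ((ip M (\<lambda>t. v (t, x)) a)\<^sup>2) \<le> ennreal ((norm (cl I (\<lambda>t. v (t, x))) * norm (cl I a))\<^sup>2)" by (intro ennreal_leI) simp
      then show ?case by (simp add: norm_cl_sq[OF elim] power_mult_distrib ennreal_mult mult.commute)
    qed
  qed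
  also have "\<dots> = ennreal ((norm (cl I a))\<^sup>2) * (\<integral>\<^sup>+x. (\<integral>\<^sup>+t. ennreal ((v (t, x))\<^sup>2) \<partial>M) \<partial>N)"
    by (rule nn_integral_cmult[OF nn_section_measurable[OF L2_measurable[OF v]]])
  also have "(\<integral>\<^sup>+x. (\<integral>\<^sup>+t. ennreal ((v (t, x))\<^sup>2) \<partial>M) \<partial>N) = (\<integral>\<^sup>+p. ennreal ((v p)\<^sup>2) \<partial>P)"
    using L2_measurable[OF v] by (subst MN.nn_integral_snd[symmetric]) auto
  also have "\<dots> = ennreal ((L2norm P v)\<^sup>2)" by (rule L2norm_sq[OF v])
  finally have le: "(\<integral>\<^sup>+x. ennreal ((ip M (\<lambda>t. v (t, x)) a)\<^sup>2) \<partial>N) \<le> ennreal ((L2norm P v * norm (cl I a))\<^sup>2)"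
    by (simp add: power_mult_distrib ennreal_mult mult.commute)
  also have "\<dots> < \<infinity>" by simp
  finally show L: "(\<lambda>x. ip M (\<lambda>t. v (t, x)) a) \<in> L2 N"
    using ip_section_measurable[OF v a] by (simp add: L2_iff_nn)
  have "(L2norm N (\<lambda>x. ip M (\<lambda>t. v (t, x)) a))\<^sup>2 \<le> (L2norm P v * norm (cl I a))\<^sup>2"
    using le unfolding L2norm_sq[OF L] by (subst (asm) ennreal_le_iff) auto
  then show "L2norm N (\<lambda>x. ip M (\<lambda>t. v (t, x)) a) \<le> L2norm P v * norm (cl I a)"
    by (rule power2_le_imp_le) (simp add: L2norm_def)
qed

lemma C_cong:
  assumes v: "v \<in> L2 P" and w: "w \<in> L2 P" and eq: "AE p in P. v p = w p"
  shows "C n v = C n w" "cl S v = cl S w"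
proof -
  show s: "cl S v = cl S w" using v w eq by (simp add: clP_eq)
  have "(\<lambda>n. (norm (C n v - C n w))\<^sup>2) sums 0"
    using C_sums[OF L2_diff[OF v w]] by (simp add: C_lin[OF v w] cl_S_lin[OF v w] s)
  then have "(norm (C n v - C n w))\<^sup>2 \<le> 0" using sums_unique sums_summable sum_le_suminf[of "\<lambda>n. (norm (C n v - C n w))\<^sup>2" "{n}"] by fastforce
  then show "C n v = C n w" by simp
qed

lemma cconv_bint:
  "t \<in> I \<Longrightarrow> cconv (pk 1) h (t, x) = bint T (\<lambda>s. h (s, x)) t"
  by (simp add: cconv_def bint_conv)

lemma cconv_bint2:
  assumes t: "t \<in> I" and h: "(\<lambda>s. h (s, x)) \<in> L2 M"
  shows "cconv (pk 1) (cconv (pk 1) h) (t, x) = bint T (bint T (\<lambda>s. h (s, x))) t"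
proof -
  have "bint T (\<lambda>s. cconv (pk 1) h (s, x)) t = bint T (bint T (\<lambda>s. h (s, x))) t"
  proof (rule bint_cong_AE[OF _ bint_L2[OF h]])
    show "(\<lambda>s. cconv (pk 1) h (s, x)) \<in> L2 M"
      unfolding cconv_def by (simp add: conv_L2(1)[OF ker_pk h])
    show "AE s in M. cconv (pk 1) h (s, x) = bint T (\<lambda>s. h (s, x)) s"
      using AE_in_M by eventually_elim (rule cconv_bint)
  qed
  then show ?thesis using t by (simp add: cconv_bint)
qed

lemma has_neg_deriv_bint:
  assumes h: "h \<in> L2 P" and w: "w \<in> borel_measurable P" "AE p in P. w p = cconv (pk 1) h p"
  shows "has_neg_deriv T \<Omega> 1 w h"
  unfolding has_neg_deriv_def
proof (intro conjI h ballI)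
  fix \<psi> assume psi: "\<psi> \<in> test_functions {0<..<T}"
  note mc = L2_measurable[OF cconv_L2[OF ker_pk[OF zero_less_one] h]]
  show "AE x in N. ip M (\<lambda>t. w (t, x)) ((deriv ^^ 1) \<psi>) = ip M (\<lambda>t. h (t, x)) \<psi>"
    using AE_P_snd[OF w(1) mc w(2)] L2_section2[OF h] AE_in_N
  proof eventually_elim
    case (elim x)
    have "AE t in M. w (t, x) = bint T (\<lambda>s. h (s, x)) t"
      using elim(1) AE_in_M by eventually_elim (simp add: cconv_bint)
    then have "ip M (\<lambda>t. w (t, x)) (deriv \<psi>) = ip M (bint T (\<lambda>s. h (s, x))) (deriv \<psi>)"
      by (intro ip_M_cong measurable_section(2)[OF w(1) elim(3)] L2_measurable bint_L2 elim test_L2 test_deriv psi T)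
    then show ?case using bint_parts[OF elim(2) T psi] by simp
  qed
qed

lemma has_neg_deriv_bint2:
  assumes h: "h \<in> L2 P" and w: "w \<in> borel_measurable P" "AE p in P. w p = cconv (pk 1) (cconv (pk 1) h) p"
  shows "has_neg_deriv T \<Omega> 2 w h"
  unfolding has_neg_deriv_def
proof (intro conjI h ballI)
  fix \<psi> assume psi: "\<psi> \<in> test_functions {0<..<T}"
  have dpsi: "deriv \<psi> \<in> test_functions {0<..<T}" by (rule test_deriv[OF psi T])
  note mc = L2_measurable[OF cconv_L2[OF ker_pk[OF zero_less_one] cconv_L2[OF ker_pk[OF zero_less_one] h]]]
  show "AE x in N. ip M (\<lambda>t. w (t, x)) ((deriv ^^ 2) \<psi>) = ip M (\<lambda>t. h (t, x)) \<psi>"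
    using AE_P_snd[OF w(1) mc w(2)] L2_section2[OF h] AE_in_N
  proof eventually_elim
    case (elim x)
    have "AE t in M. w (t, x) = bint T (bint T (\<lambda>s. h (s, x))) t"
      using elim(1) AE_in_M by eventually_elim (simp add: cconv_bint2 elim(2))
    then have "ip M (\<lambda>t. w (t, x)) (deriv (deriv \<psi>)) = ip M (bint T (bint T (\<lambda>s. h (s, x)))) (deriv (deriv \<psi>))"
      by (intro ip_M_cong measurable_section(2)[OF w(1) elim(3)] L2_measurable bint_L2 elim(2) test_L2 test_deriv psi T)
    then show ?case using bint_parts[OF elim(2) T psi] bint_parts[OF bint_L2[OF elim(2)] T dpsi] by (simp add: numeral_2_eq_2)
  qed
qed

text \<open>The exceptional set of x may depend on the test function, so x cannot be fixed.
  Integrating against \<phi> n removes x, and the coefficient functions in time are separated by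
  test functions.\<close>

lemma has_neg_deriv_unique:
  assumes g: "has_neg_deriv T \<Omega> j w g" and h: "has_neg_deriv T \<Omega> j w h"
  shows "AE p in P. g p = h p"
proof -
  have gL: "g \<in> L2 P" and hL: "h \<in> L2 P" using g h by (auto simp: has_neg_deriv_def)
  have "C n g = C n h" for n
  proof -
    have "AE t in M. cf n g t - cf n h t = 0"
    proof (rule test_functions_separating[OF L2_diff[OF cf_L2[OF gL] cf_L2[OF hL]] T])
      fix \<psi> assume psi: "\<psi> \<in> test_functions {0<..<T}"
      note pL = test_L2[OF psi T]
      have "AE x in N. ip M (\<lambda>t. w (t, x)) ((deriv ^^ j) \<psi>) = ip M (\<lambda>t. g (t, x)) \<psi>"
        "AE x in N. ip M (\<lambda>t. w (t, x)) ((deriv ^^ j) \<psi>) = ip M (\<lambda>t. h (t, x)) \<psi>"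
        using g h psi by (auto simp: has_neg_deriv_def)
      then have e: "AE x in N. ip M (\<lambda>t. g (t, x)) \<psi> = ip M (\<lambda>t. h (t, x)) \<psi>"
        by eventually_elim simp
      have "ip N (\<lambda>x. ip M (\<lambda>t. g (t, x)) \<psi>) (\<phi> n) = ip N (\<lambda>x. ip M (\<lambda>t. h (t, x)) \<psi>) (\<phi> n)"
        unfolding ip_def[of N]
        by (rule integral_cong_AE[OF borel_measurable_times[OF ip_section_measurable[OF gL pL] L2_measurable[OF phi_L2]]
              borel_measurable_times[OF ip_section_measurable[OF hL pL] L2_measurable[OF phi_L2]]])
           (use e in eventually_elim, simp)
      then have "ip P g (\<lambda>(t, x). \<psi> t * \<phi> n x) = ip P h (\<lambda>(t, x). \<psi> t * \<phi> n x)"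
        by (simp add: ip_tensor1(2)[OF gL pL phi_L2] ip_tensor1(2)[OF hL pL phi_L2])
      then have "ip M (cf n g) \<psi> = ip M (cf n h) \<psi>"
        by (simp add: ip_tensor1(1)[OF gL pL phi_L2] ip_tensor1(1)[OF hL pL phi_L2] coeff_def[abs_def])
      then show "ip M (\<lambda>t. cf n g t - cf n h t) \<psi> = 0"
        using L2_mult_integrable[OF cf_L2[OF gL] pL, of n] L2_mult_integrable[OF cf_L2[OF hL] pL, of n]
        by (simp add: ip_def left_diff_distrib)
    qed
    then show ?thesis using clM_eq[OF cf_L2[OF gL, of n] cf_L2[OF hL, of n]] by simp
  qed
  from C_eq_imp(2)[OF gL hL this] show ?thesis .
qed

lemma has_neg_deriv_some:
  assumes "has_neg_deriv T \<Omega> j w g"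
  shows "(SOME g. has_neg_deriv T \<Omega> j w g) \<in> L2 P" "AE p in P. (SOME g. has_neg_deriv T \<Omega> j w g) p = g p"
proof -
  have s: "has_neg_deriv T \<Omega> j w (SOME g. has_neg_deriv T \<Omega> j w g)" by (rule someI[of "has_neg_deriv T \<Omega> j w", OF assms])
  then show "(SOME g. has_neg_deriv T \<Omega> j w g) \<in> L2 P" by (simp add: has_neg_deriv_def)
  show "AE p in P. (SOME g. has_neg_deriv T \<Omega> j w g) p = g p" by (rule has_neg_deriv_unique[OF s assms])
qed

text \<open>All three orders use the same integral of order 2 - \<alpha>, because j minus the order
  equals 2 - \<alpha> for j = 2, 1, 0. Applied to v = V^\<alpha> g it gives V^2 g, and each
  application of - D strips one V.\<close>

lemma frac_deriv_eq:
  assumes \<alpha>: "1 < \<alpha>" "\<alpha> < 2" and v: "v \<in> L2 P" and g: "g \<in> L2 P" and eq: "\<And>n. C n v = fint T \<alpha> (C n g)"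
  shows "frac_deriv T \<Omega> \<alpha> v \<in> L2 P" "AE p in P. frac_deriv T \<Omega> \<alpha> v p = g p"
    and "frac_deriv T \<Omega> (\<alpha> - 1) v \<in> L2 P" "AE p in P. frac_deriv T \<Omega> (\<alpha> - 1) v p = cconv (pk 1) g p"
    and "frac_deriv T \<Omega> (\<alpha> - 2) v \<in> L2 P" "AE p in P. frac_deriv T \<Omega> (\<alpha> - 2) v p = cconv (pk 1) (cconv (pk 1) g) p"
proof -
  define w where "w = frac_int T (2 - \<alpha>) v"
  have w: "w = cconv (pk (2 - \<alpha>)) v" using \<alpha> by (simp add: w_def frac_int_cconv)
  have k: "ker T (pk (2 - \<alpha>))" "ker T (pk 1)" using \<alpha> by (auto intro: ker_pk)
  note g1 = cconv_L2[OF k(2) g] and g2 = cconv_L2[OF k(2) cconv_L2[OF k(2) g]]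
  have wL: "w \<in> L2 P" unfolding w by (rule cconv_L2[OF k(1) v])
  have weq: "AE p in P. w p = cconv (pk 1) (cconv (pk 1) g) p"
  proof (rule C_eq_imp(2)[OF wL g2])
    fix n
    show "C n w = C n (cconv (pk 1) (cconv (pk 1) g))"
      unfolding w C_cconv[OF k(1) v] C_cconv[OF k(2) g1] C_cconv[OF k(2) g] eq
      using \<alpha> by (simp add: fint_fint)
  qed
  have c: "nat \<lceil>\<alpha>\<rceil> = 2" "nat \<lceil>\<alpha> - 1\<rceil> = 1"
  proof -
    have "\<lceil>\<alpha>\<rceil> = 2" by (rule ceiling_unique) (use \<alpha> in auto)
    then show "nat \<lceil>\<alpha>\<rceil> = 2" "nat \<lceil>\<alpha> - 1\<rceil> = 1" by auto
  qed
  have D: "frac_deriv T \<Omega> \<alpha> v = (SOME g. has_neg_deriv T \<Omega> 2 w g)"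
    using \<alpha> unfolding frac_deriv_def c Let_def w_def by auto
  have D1: "frac_deriv T \<Omega> (\<alpha> - 1) v = (SOME g. has_neg_deriv T \<Omega> 1 w g)"
    using \<alpha> unfolding frac_deriv_def c Let_def w_def by auto
  have D2: "frac_deriv T \<Omega> (\<alpha> - 2) v = w" using \<alpha> by (simp add: frac_deriv_def w_def)
  note h2 = has_neg_deriv_bint2[OF g L2_measurable[OF wL] weq] and h1 = has_neg_deriv_bint[OF g1 L2_measurable[OF wL] weq]
  show "frac_deriv T \<Omega> \<alpha> v \<in> L2 P" "AE p in P. frac_deriv T \<Omega> \<alpha> v p = g p"
    unfolding D by (rule has_neg_deriv_some[OF h2])+
  show "frac_deriv T \<Omega> (\<alpha> - 1) v \<in> L2 P" "AE p in P. frac_deriv T \<Omega> (\<alpha> - 1) v p = cconv (pk 1) g p"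
    unfolding D1 by (rule has_neg_deriv_some[OF h1])+
  show "frac_deriv T \<Omega> (\<alpha> - 2) v \<in> L2 P" "AE p in P. frac_deriv T \<Omega> (\<alpha> - 2) v p = cconv (pk 1) (cconv (pk 1) g) p"
    unfolding D2 using wL weq by auto
qed

lemma indicator_diff_norm: "(norm (cl I (\<lambda>u. indicator {s<..} u - indicator {t<..} u)))\<^sup>2 \<le> \<bar>s - t\<bar>"
proof -
  let ?a = "\<lambda>u::real. indicator {s<..} u - indicator {t<..} u :: real"
  have aL: "?a \<in> L2 M" by (rule L2_bounded_mon[of _ _ 1]) (auto simp: indicator_def intro!: measurable_restrict_space1)
  have "ennreal ((norm (cl I ?a))\<^sup>2) = (\<integral>\<^sup>+u. ennreal ((?a u)\<^sup>2) \<partial>M)" by (rule norm_cl_sq[OF aL, symmetric])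
  also have "\<dots> = (\<integral>\<^sup>+u. ennreal ((?a u)\<^sup>2) * indicator I u \<partial>lborel)" by (rule nn_integral_restrict_space) simp
  also have "\<dots> \<le> (\<integral>\<^sup>+u. indicator {min s t..max s t} u \<partial>lborel)"
    by (intro nn_integral_mono) (auto simp: indicator_def)
  also have "\<dots> = ennreal \<bar>s - t\<bar>" by (simp add: min_def max_def)
  finally show ?thesis by (subst (asm) ennreal_le_iff) auto
qed

text \<open>V h at time t pairs h with the indicator of the times after t. Two such indicators
  differ in norm by at most the square root of the time difference, so V h is Hoelder continuous of
  order 1/2 with values in L2 of the domain.\<close>

lemma has_initial_value_bint:
  assumes h: "h \<in> L2 P" and w: "w \<in> borel_measurable P" "AE p in P. w p = cconv (pk 1) h p"
  shows "\<exists>y. has_initial_value T \<Omega> w y"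
proof -
  define W where "W t x = ip M (\<lambda>s. h (s, x)) (indicator {t<..})" for t x
  have iL: "(indicator {t<..} :: real \<Rightarrow> real) \<in> L2 M" for t
    by (rule L2_bounded_mon[of _ _ 1]) (auto simp: indicator_def intro!: measurable_restrict_space1)
  have WL: "W t \<in> L2 N" for t unfolding W_def[abs_def] by (rule ip_section_L2(1)[OF h iL])
  have Wb: "W t x = bint T (\<lambda>s. h (s, x)) t" for t x
    unfolding W_def ip_def mon_integral bint_def by (intro Bochner_Integration.integral_cong) (auto simp: indicator_def)
  have Wd: "L2norm N (\<lambda>x. W s x - W t x) \<le> L2norm P h * sqrt \<bar>s - t\<bar>" for s t
  proof -
    let ?a = "\<lambda>u::real. indicator {s<..} u - indicator {t<..} u :: real"
    note d = ip_section_L2[OF h L2_diff[OF iL iL, of s t]]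
    have "AE x in N. W s x - W t x = ip M (\<lambda>s. h (s, x)) ?a"
      using L2_section2[OF h]
    proof eventually_elim
      case (elim x)
      show ?case unfolding W_def ip_mon[OF I_sets elim iL] ip_mon[OF I_sets elim L2_diff[OF iL iL]]
        by (simp add: clM iL inner_diff_right)
    qed
    then have "cl \<Omega> (\<lambda>x. W s x - W t x) = cl \<Omega> (\<lambda>x. ip M (\<lambda>s. h (s, x)) ?a)"
      using clN_eq[OF L2_diff[OF WL WL, of s t] d(1)] by simp
    then have "L2norm N (\<lambda>x. W s x - W t x) \<le> L2norm P h * norm (cl I ?a)"
      using d by (simp add: L2norm_mon[OF Om] L2_diff WL)
    also have "\<dots> \<le> L2norm P h * sqrt \<bar>s - t\<bar>"
      by (intro mult_left_mono real_le_rsqrt indicator_diff_norm) (simp add: L2norm_def)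
    finally show ?thesis .
  qed
  have "has_initial_value T \<Omega> w (W 0)"
    unfolding has_initial_value_def
  proof (intro conjI exI[of _ W] ballI WL)
    fix t :: real
    show "((\<lambda>s. L2norm N (\<lambda>x. W s x - W t x)) \<longlongrightarrow> 0) (at t within {0..T})"
    proof (rule Lim_null_comparison)
      show "\<forall>\<^sub>F s in at t within {0..T}. norm (L2norm N (\<lambda>x. W s x - W t x)) \<le> L2norm P h * sqrt \<bar>s - t\<bar>"
        using Wd by (intro always_eventually allI) (simp add: L2norm_def)
      have "((\<lambda>s. L2norm P h * sqrt \<bar>s - t\<bar>) \<longlongrightarrow> L2norm P h * sqrt \<bar>t - t\<bar>) (at t within {0..T})"
        by (intro tendsto_intros)
      then show "((\<lambda>s. L2norm P h * sqrt \<bar>s - t\<bar>) \<longlongrightarrow> 0) (at t within {0..T})" by simp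
    qed
  next
    show "AE t in M. AE x in N. w (t, x) = W t x"
      using AE_P_fst[OF w(2)] AE_in_M by eventually_elim (simp add: cconv_bint Wb)
  qed simp
  then show ?thesis by blast
qed

lemma has_initial_value_lin:
  assumes v: "has_initial_value T \<Omega> v y" and w: "has_initial_value T \<Omega> w z"
    and u: "AE t in M. AE x in N. u (t, x) = v (t, x) + c * w (t, x)"
  shows "has_initial_value T \<Omega> u (\<lambda>x. y x + c * z x)"
proof -
  obtain V where V: "\<And>t. t \<in> {0..T} \<Longrightarrow> V t \<in> L2 N"
      "\<And>t. t \<in> {0..T} \<Longrightarrow> ((\<lambda>s. L2norm N (\<lambda>x. V s x - V t x)) \<longlongrightarrow> 0) (at t within {0..T})"
      "AE t in M. AE x in N. v (t, x) = V t x" "AE x in N. y x = V 0 x" and y: "y \<in> L2 N"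
    using v unfolding has_initial_value_def by blast
  obtain W where W: "\<And>t. t \<in> {0..T} \<Longrightarrow> W t \<in> L2 N"
      "\<And>t. t \<in> {0..T} \<Longrightarrow> ((\<lambda>s. L2norm N (\<lambda>x. W s x - W t x)) \<longlongrightarrow> 0) (at t within {0..T})"
      "AE t in M. AE x in N. w (t, x) = W t x" "AE x in N. z x = W 0 x" and z: "z \<in> L2 N"
    using w unfolding has_initial_value_def by blast
  define X where "X t x = V t x + c * W t x" for t x
  have XL: "X t \<in> L2 N" if "t \<in> {0..T}" for t
    unfolding X_def[abs_def] by (intro L2_add L2_cmult V W that)
  show ?thesis unfolding has_initial_value_def
  proof (intro conjI exI[of _ X] ballI XL L2_add L2_cmult y z)
    fix t assume t: "t \<in> {0..T}"
    show "((\<lambda>s. L2norm N (\<lambda>x. X s x - X t x)) \<longlongrightarrow> 0) (at t within {0..T})"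
    proof (rule Lim_null_comparison)
      have "norm (L2norm N (\<lambda>x. X s x - X t x)) \<le> L2norm N (\<lambda>x. V s x - V t x) + \<bar>c\<bar> * L2norm N (\<lambda>x. W s x - W t x)" if s: "s \<in> {0..T}" for s
      proof -
        have "cl \<Omega> (\<lambda>x. X s x - X t x) = cl \<Omega> (\<lambda>x. (V s x - V t x) + c * (W s x - W t x))"
          by (simp add: X_def algebra_simps)
        also have "\<dots> = cl \<Omega> (\<lambda>x. V s x - V t x) + c *\<^sub>R cl \<Omega> (\<lambda>x. W s x - W t x)"
          using cl_add[OF Om L2_diff[OF V(1)[OF s] V(1)[OF t]] L2_cmult[OF L2_diff[OF W(1)[OF s] W(1)[OF t]]], of c]
            cl_scale[OF Om L2_diff[OF W(1)[OF s] W(1)[OF t]], of c] by simp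
        finally show ?thesis
          using norm_triangle_ineq[of "cl \<Omega> (\<lambda>x. V s x - V t x)" "c *\<^sub>R cl \<Omega> (\<lambda>x. W s x - W t x)"]
          by (simp add: L2norm_mon[OF Om L2_diff[OF V(1)[OF s] V(1)[OF t]]] L2norm_mon[OF Om L2_diff[OF W(1)[OF s] W(1)[OF t]]]
              L2norm_mon[OF Om L2_diff[OF XL[OF s] XL[OF t]]])
      qed
      then show "\<forall>\<^sub>F s in at t within {0..T}. norm (L2norm N (\<lambda>x. X s x - X t x)) \<le> L2norm N (\<lambda>x. V s x - V t x) + \<bar>c\<bar> * L2norm N (\<lambda>x. W s x - W t x)"
        by (auto simp: eventually_at_filter)
      have "((\<lambda>s. L2norm N (\<lambda>x. V s x - V t x) + \<bar>c\<bar> * L2norm N (\<lambda>x. W s x - W t x)) \<longlongrightarrow> 0 + \<bar>c\<bar> * 0) (at t within {0..T})"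
        by (intro tendsto_intros V W t)
      then show "((\<lambda>s. L2norm N (\<lambda>x. V s x - V t x) + \<bar>c\<bar> * L2norm N (\<lambda>x. W s x - W t x)) \<longlongrightarrow> 0) (at t within {0..T})" by simp
    qed
  next
    show "AE t in M. AE x in N. u (t, x) = X t x"
      using u V(3) W(3)
    proof eventually_elim
      case (elim t)
      then show ?case by eventually_elim (simp add: X_def)
    qed
    show "AE x in N. y x + c * z x = X 0 x" using V(4) W(4) by eventually_elim (simp add: X_def)
  qed
qed

end

section \<open>The Laplacian and the test space in Fourier coefficients\<close>

lemma smooth_continuous:
  fixes f :: "'a::euclidean_space \<Rightarrow> real"
  assumes "smooth f"
  shows "continuous_on UNIV f"
    and "b \<in> Basis \<Longrightarrow> c \<in> Basis \<Longrightarrow> continuous_on UNIV (partial b (partial c f))"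
proof -
  have d: "foldr partial bs f differentiable_on UNIV" if "set bs \<subseteq> Basis" for bs
    using assms that by (simp add: smooth_def)
  show "continuous_on UNIV f" using d[of "[]"] by (auto intro: differentiable_imp_continuous_on)
  show "continuous_on UNIV (partial b (partial c f))" if "b \<in> Basis" "c \<in> Basis"
    using d[of "[b, c]"] that by (auto intro: differentiable_imp_continuous_on)
qed

lemma partial_zero:
  fixes f :: "'a::euclidean_space \<Rightarrow> real"
  assumes "open A" "x \<in> A" "\<And>y. y \<in> A \<Longrightarrow> f y = 0"
  shows "partial b f x = 0"
proof -
  have "(f has_derivative (\<lambda>h. 0)) (at x)"
    by (rule has_derivative_transform_within_open[OF has_derivative_const[of 0] assms(1,2)]) (use assms(3) in auto)
  then show ?thesis by (simp add: partial_def frechet_derivative_at[symmetric])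
qed

lemma compact_support_L2:
  fixes f :: "'a::euclidean_space \<Rightarrow> real"
  assumes c: "continuous_on UNIV f" and K: "compact K" "\<And>x. x \<notin> K \<Longrightarrow> f x = 0" and Om: "\<Omega> \<in> sets borel"
  shows "f \<in> L2 (mon \<Omega>)"
proof -
  have m: "f \<in> borel_measurable borel" by (rule borel_measurable_continuous_onI[OF c])
  have "compact (f ` K)" by (rule compact_continuous_image[OF continuous_on_subset[OF c] K(1)]) simp
  then obtain B where B: "\<And>x. x \<in> K \<Longrightarrow> \<bar>f x\<bar> \<le> B" using compact_imp_bounded[of "f ` K"] by (auto simp: bounded_iff)
  have Ks: "K \<in> sets borel" using K(1) by (simp add: compact_imp_closed)
  have fin: "emeasure lborel K < \<infinity>" by (rule emeasure_bounded_finite[OF compact_imp_bounded[OF K(1)]])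
  have "(\<integral>\<^sup>+x. ennreal ((f x)\<^sup>2) \<partial>lborel) \<le> (\<integral>\<^sup>+x. ennreal (B\<^sup>2) * indicator K x \<partial>lborel)"
  proof (intro nn_integral_mono)
    fix x
    show "ennreal ((f x)\<^sup>2) \<le> ennreal (B\<^sup>2) * indicator K x"
    proof (cases "x \<in> K")
      case True
      then have "\<bar>f x\<bar>\<^sup>2 \<le> B\<^sup>2" using B by (intro power_mono) auto
      then show ?thesis using True by (simp add: ennreal_leI)
    qed (simp add: K(2))
  qed
  also have "\<dots> = ennreal (B\<^sup>2) * emeasure lborel K" using Ks by (simp add: nn_integral_cmult_indicator)
  also have "\<dots> < \<infinity>" using fin by (simp add: ennreal_mult_less_top)
  finally have "f \<in> L2 lborel" using m by (simp add: L2_iff_nn)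
  then show ?thesis unfolding L2_mon_iff[OF Om] by (rule L2_indicator_mult[rotated]) (use Om in simp)
qed

lemma test_function_L2:
  fixes \<psi> :: "'a::euclidean_space \<Rightarrow> real"
  assumes psi: "\<psi> \<in> test_functions A" and Om: "\<Omega> \<in> sets borel"
  shows "\<psi> \<in> L2 (mon \<Omega>)" "(\<lambda>x. \<Sum>b\<in>Basis. partial b (partial b \<psi>) x) \<in> L2 (mon \<Omega>)"
proof -
  let ?K = "closure {x. \<psi> x \<noteq> 0}"
  have s: "smooth \<psi>" and K: "compact ?K" using psi by (auto simp: test_functions_def)
  have z: "\<psi> x = 0" if "x \<notin> ?K" for x using that closure_subset[of "{x. \<psi> x \<noteq> 0}"] by blast
  have o: "open (- ?K)" by (simp add: open_Compl)
  have z2: "partial b (partial b \<psi>) x = 0" if "x \<notin> ?K" for x b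
  proof (rule partial_zero[OF o])
    show "x \<in> - ?K" using that by simp
    show "partial b \<psi> y = 0" if "y \<in> - ?K" for y by (rule partial_zero[OF o that]) (rule z, erule ComplD)
  qed
  show "\<psi> \<in> L2 (mon \<Omega>)" by (rule compact_support_L2[OF smooth_continuous(1)[OF s] K z Om])
  have "partial b (partial b \<psi>) \<in> L2 (mon \<Omega>)" if "b \<in> Basis" for b
    by (rule compact_support_L2[OF smooth_continuous(2)[OF s that that] K z2 Om])
  then show "(\<lambda>x. \<Sum>b\<in>Basis. partial b (partial b \<psi>) x) \<in> L2 (mon \<Omega>)" by (rule L2_sum)
qed

context cyl
begin

text \<open>Membership of \<phi> n in \<open>H10\<close> supplies test functions converging to it in
  L2, so the difference of two candidates is orthogonal to every \<phi> n.\<close>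

lemma has_laplacian_unique:
  assumes f: "has_laplacian \<Omega> f g" and h: "has_laplacian \<Omega> f h"
  shows "AE x in N. g x = h x"
proof -
  have g: "g \<in> L2 N" and h': "h \<in> L2 N" using f h by (auto simp: has_laplacian_def)
  have eq: "inner (cl \<Omega> g - cl \<Omega> h) (cl \<Omega> \<psi>) = 0" if "\<psi> \<in> test_functions \<Omega>" for \<psi>
  proof -
    have "ip N g \<psi> = ip N h \<psi>" using f h that by (simp add: has_laplacian_def)
    then show ?thesis using test_function_L2(1)[OF that Om] g h' by (simp add: ip_mon[OF Om] inner_diff_left)
  qed
  show ?thesis
  proof (rule coefs_eq_imp_AE[OF g h'])
    fix n
    have "\<phi> n \<in> H10 \<Omega>" using eig by (simp add: dirichlet_eigenbasis_def)
    then obtain \<psi> where psi: "\<And>k. \<psi> k \<in> test_functions \<Omega>" "(\<lambda>k. L2norm N (\<lambda>x. \<psi> k x - \<phi> n x)) \<longlonglongrightarrow> 0"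
      unfolding H10_def by blast
    have pL: "\<psi> k \<in> L2 N" for k by (rule test_function_L2(1)[OF psi(1) Om])
    have "(\<lambda>k. norm (cl \<Omega> (\<psi> k) - e n)) \<longlonglongrightarrow> 0"
      using psi(2) by (simp add: L2norm_mon[OF Om] L2_diff pL phi_L2 cl_diff[OF Om])
    then have "(\<lambda>k. cl \<Omega> (\<psi> k) - e n) \<longlonglongrightarrow> 0" by (rule tendsto_norm_zero_cancel)
    then have "(\<lambda>k. inner (cl \<Omega> g - cl \<Omega> h) (cl \<Omega> (\<psi> k) - e n)) \<longlonglongrightarrow> inner (cl \<Omega> g - cl \<Omega> h) 0"
      by (intro tendsto_intros)
    then have "(\<lambda>k. - inner (cl \<Omega> g - cl \<Omega> h) (e n)) \<longlonglongrightarrow> 0"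
      by (simp add: inner_diff_right[of "cl \<Omega> g - cl \<Omega> h"] eq psi(1))
    then have "inner (cl \<Omega> g - cl \<Omega> h) (e n) = 0" by (simp add: LIMSEQ_const_iff)
    then show "ip N g (\<phi> n) = ip N h (\<phi> n)" using g h' phi_L2 by (simp add: ip_mon[OF Om] inner_diff_left)
  qed
qed

text \<open>The weak eigenvalue equation gives the Laplacian of a test function \<psi> the
  coefficients - lam n times those of \<psi>. Parseval on both sides of the defining identity then
  compares equal series.\<close>

lemma has_laplacian_coeffs:
  assumes f: "f \<in> L2 N" and g: "g \<in> L2 N" and eq: "\<And>n. ip N g (\<phi> n) = - lam n * ip N f (\<phi> n)"
  shows "has_laplacian \<Omega> f g"
  unfolding has_laplacian_def
proof (intro conjI ballI g)
  fix \<psi> assume psi: "\<psi> \<in> test_functions \<Omega>"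
  note L = test_function_L2[OF psi Om]
  let ?D = "\<lambda>x. \<Sum>b\<in>Basis. partial b (partial b \<psi>) x"
  have "ip N (\<phi> n) ?D = - lam n * ip N (\<phi> n) \<psi>" for n
  proof -
    have "has_laplacian \<Omega> (\<phi> n) (\<lambda>x. - lam n * \<phi> n x)" using eig by (simp add: dirichlet_eigenbasis_def)
    then have "ip N (\<phi> n) ?D = ip N (\<lambda>x. - lam n * \<phi> n x) \<psi>" using psi unfolding has_laplacian_def by blast
    also have "\<dots> = - lam n * ip N (\<phi> n) \<psi>"
      unfolding ip_def by (subst integral_mult_right_zero[symmetric]) (simp add: mult.assoc)
    finally show ?thesis .
  qed
  then have "ip N f (\<phi> n) * ip N ?D (\<phi> n) = ip N g (\<phi> n) * ip N \<psi> (\<phi> n)" for n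
    using eq[of n] by (simp add: ip_def mult.commute)
  then have "(\<lambda>n. ip N g (\<phi> n) * ip N \<psi> (\<phi> n)) sums ip N f ?D" using parseval[OF f L(2)] by simp
  then show "ip N f ?D = ip N g \<psi>" using parseval[OF g L(1)] by (rule sums_unique2)
qed

lemma L2_Hdot2_nn:
  assumes v: "v \<in> L2 P"
  shows "(\<Sum>n. ennreal ((lam n)\<^sup>2 * (norm (C n v))\<^sup>2)) = (\<integral>\<^sup>+t. (\<Sum>n. ennreal ((lam n)\<^sup>2 * (cf n v t)\<^sup>2)) \<partial>M)"
proof -
  have m: "(\<lambda>t. ennreal ((cf n v t)\<^sup>2)) \<in> borel_measurable M" for n
    by (intro measurable_compose[OF _ measurable_ennreal] borel_measurable_power cf_measurable L2_measurable v)
  have "ennreal ((lam n)\<^sup>2 * (norm (C n v))\<^sup>2) = (\<integral>\<^sup>+t. ennreal ((lam n)\<^sup>2) * ennreal ((cf n v t)\<^sup>2) \<partial>M)" for n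
    by (simp add: nn_integral_cmult[OF m] norm_cl_sq[OF cf_L2[OF v]] ennreal_mult)
  then have "(\<Sum>n. ennreal ((lam n)\<^sup>2 * (norm (C n v))\<^sup>2)) = (\<Sum>n. \<integral>\<^sup>+t. ennreal ((lam n)\<^sup>2) * ennreal ((cf n v t)\<^sup>2) \<partial>M)" by simp
  also have "\<dots> = (\<integral>\<^sup>+t. (\<Sum>n. ennreal ((lam n)\<^sup>2) * ennreal ((cf n v t)\<^sup>2)) \<partial>M)"
    by (intro nn_integral_suminf[symmetric] borel_measurable_times_ennreal m borel_measurable_const)
  finally show ?thesis by (simp add: ennreal_mult)
qed

lemma Hdot2_norm_sq:
  assumes "f \<in> Hdot2 \<Omega> \<phi> lam"
  shows "(\<Sum>n. ennreal ((lam n)\<^sup>2 * (ip N f (\<phi> n))\<^sup>2)) = ennreal ((Hdot2_norm \<Omega> \<phi> lam f)\<^sup>2)"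
proof -
  have s: "summable (\<lambda>n. (lam n)\<^sup>2 * (ip N f (\<phi> n))\<^sup>2)" using assms by (simp add: Hdot2_def)
  then show ?thesis by (simp add: suminf_ennreal2 Hdot2_norm_def suminf_nonneg)
qed

lemma L2_Hdot2_sums:
  assumes v: "v \<in> L2_Hdot2 T \<Omega> \<phi> lam"
  shows "(\<lambda>n. (lam n)\<^sup>2 * (norm (C n v))\<^sup>2) sums (L2_Hdot2_norm T \<Omega> \<phi> lam v)\<^sup>2"
proof -
  let ?H = "\<lambda>t. (Hdot2_norm \<Omega> \<phi> lam (\<lambda>x. v (t, x)))\<^sup>2"
  have vL: "v \<in> L2 P" and a: "AE t in M. (\<lambda>x. v (t, x)) \<in> Hdot2 \<Omega> \<phi> lam" and i: "integrable M ?H"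
    using v by (auto simp: L2_Hdot2_def)
  have "(\<Sum>n. ennreal ((lam n)\<^sup>2 * (norm (C n v))\<^sup>2)) = (\<integral>\<^sup>+t. ennreal (?H t) \<partial>M)"
    unfolding L2_Hdot2_nn[OF vL]
  proof (rule nn_integral_cong_AE)
    show "AE t in M. (\<Sum>n. ennreal ((lam n)\<^sup>2 * (cf n v t)\<^sup>2)) = ennreal (?H t)"
      using a by eventually_elim (simp only: coeff_def Hdot2_norm_sq)
  qed
  also have "\<dots> = ennreal ((L2_Hdot2_norm T \<Omega> \<phi> lam v)\<^sup>2)"
    by (subst nn_integral_eq_integral[OF i]) (auto simp: L2_Hdot2_norm_def Bochner_Integration.integral_nonneg)
  finally show ?thesis by (intro sums_of_ennreal) auto
qed

lemma L2_Hdot2I: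
  assumes v: "v \<in> L2 P" and s: "summable (\<lambda>n. (lam n)\<^sup>2 * (norm (C n v))\<^sup>2)"
  shows "v \<in> L2_Hdot2 T \<Omega> \<phi> lam"
proof -
  let ?H = "\<lambda>t. (Hdot2_norm \<Omega> \<phi> lam (\<lambda>x. v (t, x)))\<^sup>2"
  let ?s = "\<lambda>t. \<Sum>n. ennreal ((lam n)\<^sup>2 * (cf n v t)\<^sup>2)"
  have m: "(\<lambda>t. ennreal ((lam n)\<^sup>2 * (cf n v t)\<^sup>2)) \<in> borel_measurable M" for n
    by (intro measurable_compose[OF _ measurable_ennreal] borel_measurable_power borel_measurable_times cf_measurable L2_measurable v borel_measurable_const)
  have fin: "(\<integral>\<^sup>+t. ?s t \<partial>M) < \<infinity>"
    unfolding L2_Hdot2_nn[OF v, symmetric] by (subst suminf_ennreal2[OF _ s]) auto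
  then have "AE t in M. ?s t \<noteq> \<infinity>" by (intro nn_integral_PInf_AE borel_measurable_suminf_order m) auto
  then have a: "AE t in M. (\<lambda>x. v (t, x)) \<in> Hdot2 \<Omega> \<phi> lam"
    using L2_section1[OF v]
  proof eventually_elim
    case (elim t)
    have "summable (\<lambda>n. (lam n)\<^sup>2 * (cf n v t)\<^sup>2)"
      by (rule summable_suminf_not_top) (use elim in auto)
    then show ?case using elim by (simp add: Hdot2_def coeff_def)
  qed
  have "?H \<in> borel_measurable M"
  proof -
    have "(\<lambda>t. \<Sum>n. (lam n)\<^sup>2 * (cf n v t)\<^sup>2) \<in> borel_measurable M"
      by (intro borel_measurable_suminf borel_measurable_times borel_measurable_power cf_measurable[OF L2_measurable[OF v]] borel_measurable_const)
    from measurable_compose[OF this borel_measurable_sqrt]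
    show ?thesis unfolding Hdot2_norm_def coeff_def[symmetric] by (rule borel_measurable_power)
  qed
  moreover have "(\<integral>\<^sup>+t. ennreal (?H t) \<partial>M) = (\<integral>\<^sup>+t. ?s t \<partial>M)"
  proof (rule nn_integral_cong_AE)
    show "AE t in M. ennreal (?H t) = ?s t"
      using a by eventually_elim (simp only: coeff_def Hdot2_norm_sq)
  qed
  ultimately have "integrable M ?H" using fin by (simp add: integrable_iff_bounded)
  then show ?thesis using v a by (simp add: L2_Hdot2_def)
qed

text \<open>The series with coefficients - lam n * C n v converges by \<open>riesz_fischer\<close>
  and is the Laplacian at almost every t; uniqueness identifies it with the function chosen by
  \<open>SOME\<close>.\<close>

lemma laplacian_eq:
  assumes v: "v \<in> L2 P" and s: "summable (\<lambda>n. (lam n)\<^sup>2 * (norm (C n v))\<^sup>2)"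
  shows "\<exists>h\<in>L2 P. (\<forall>n. C n h = - lam n *\<^sub>R C n v) \<and> laplacian T \<Omega> v \<in> L2 P \<and>
    (AE t in M. AE x in N. laplacian T \<Omega> v (t, x) = h (t, x))"
proof -
  define g where "g n t = - lam n * cf n v t" for n t
  have gL: "g n \<in> L2 M" and gc: "cl I (g n) = - lam n *\<^sub>R C n v" for n
    using cf_L2[OF v, of n] clM(3)[OF cf_L2[OF v, of n], of "- lam n"] by (auto simp: g_def[abs_def] simp del: mult_minus_left)
  have "summable (\<lambda>n. (norm (cl I (g n)))\<^sup>2)" using s by (simp add: gc power_mult_distrib)
  from riesz_fischer[OF gL this] obtain h where h: "h \<in> L2 P" "\<And>n. C n h = cl I (g n)" by blast
  \<comment> \<open>Countably many modes share one exceptional null set of times.\<close>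
  have "AE t in M. \<forall>n. cf n h t = g n t"
    unfolding AE_all_countable using h(2) clM_eq[OF cf_L2[OF h(1)] gL] by blast
  then have lap: "AE t in M. has_laplacian \<Omega> (\<lambda>x. v (t, x)) (\<lambda>x. h (t, x))"
    using L2_section1[OF v] L2_section1[OF h(1)]
    by eventually_elim (auto intro!: has_laplacian_coeffs simp: g_def coeff_def)
  let ?Q = "\<lambda>w. w \<in> L2 P \<and> (AE t in M. has_laplacian \<Omega> (\<lambda>x. v (t, x)) (\<lambda>x. w (t, x)))"
  have Q: "?Q (laplacian T \<Omega> v)" unfolding laplacian_def by (rule someI[of ?Q h]) (use h lap in simp)
  then have "AE t in M. has_laplacian \<Omega> (\<lambda>x. v (t, x)) (\<lambda>x. laplacian T \<Omega> v (t, x))" by simp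
  then have "AE t in M. AE x in N. laplacian T \<Omega> v (t, x) = h (t, x)"
    using lap by eventually_elim (rule has_laplacian_unique)
  then show ?thesis using h Q gc by auto
qed

lemma H0_L2_imp:
  assumes \<alpha>: "1 < \<alpha>" "\<alpha> < 2" and v: "v \<in> H0_L2 T \<Omega> \<phi> \<alpha>"
  shows "\<exists>g\<in>L2 P. (\<forall>n. C n v = fint T \<alpha> (C n g) \<and> norm (C n g) \<le> H0_norm T \<alpha> (cf n v) / qconst (2 - \<alpha>))"
proof -
  have H: "cf n v \<in> H0 T \<alpha>" for n using v by (simp add: H0_L2_def)
  have s: "summable (\<lambda>n. (H0_norm T \<alpha> (cf n v))\<^sup>2)" using v by (simp add: H0_L2_def)
  have "\<forall>n. \<exists>g. g \<in> L2 M \<and> C n v = fint T \<alpha> (cl I g) \<and> norm (cl I g) \<le> H0_norm T \<alpha> (cf n v) / qconst (2 - \<alpha>)"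
    using H0_imp_fint[OF \<alpha> T H] by blast
  from choice[OF this] obtain g where g: "\<And>n. g n \<in> L2 M" "\<And>n. C n v = fint T \<alpha> (cl I (g n))"
      "\<And>n. norm (cl I (g n)) \<le> H0_norm T \<alpha> (cf n v) / qconst (2 - \<alpha>)" by blast
  have "summable (\<lambda>n. (norm (cl I (g n)))\<^sup>2)"
  proof (rule summable_comparison_test[OF _ summable_divide[OF s, of "(qconst (2 - \<alpha>))\<^sup>2"]], intro exI allI impI)
    fix n
    show "norm ((norm (cl I (g n)))\<^sup>2) \<le> (H0_norm T \<alpha> (cf n v))\<^sup>2 / (qconst (2 - \<alpha>))\<^sup>2"
      using power_mono[OF g(3)[of n], of 2] by (simp add: power_divide)
  qed
  from riesz_fischer[OF g(1) this] obtain h where "h \<in> L2 P" "\<And>n. C n h = cl I (g n)" by blast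
  then show ?thesis using g by (intro bexI[of _ h]) auto
qed

lemma H0_L2I:
  assumes \<alpha>: "1 < \<alpha>" "\<alpha> < 2" and v: "v \<in> L2 P" and g: "g \<in> L2 P" and eq: "\<And>n. C n v = fint T \<alpha> (C n g)"
  shows "v \<in> H0_L2 T \<Omega> \<phi> \<alpha>" "(H0_norm T \<alpha> (cf n v))\<^sup>2 \<le> 4 * upc (\<alpha> - 1) * (norm (C n g))\<^sup>2"
proof -
  have k: "ker T (pk \<alpha>)" using \<alpha> by (auto intro: ker_pk)
  have "AE t in M. cf n v t = conv T (pk \<alpha>) (cf n g) t" for n
    using eq[of n] conv_L2[OF k cf_L2[OF g, of n]] clM_eq[OF cf_L2[OF v, of n], of "conv T (pk \<alpha>) (cf n g)"] by simp
  note H = H0_fint[OF \<alpha> T cf_L2[OF g] L2_measurable[OF cf_L2[OF v]] this]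
  have "summable (\<lambda>n. 4 * upc (\<alpha> - 1) * (norm (C n g))\<^sup>2)"
    by (intro summable_mult sums_summable[OF C_sums[OF g]])
  then have "summable (\<lambda>n. (H0_norm T \<alpha> (cf n v))\<^sup>2)"
    by (rule summable_comparison_test[rotated]) (use H(2) in auto)
  then show "v \<in> H0_L2 T \<Omega> \<phi> \<alpha>" using v H(1) by (simp add: H0_L2_def)
  show "(H0_norm T \<alpha> (cf n v))\<^sup>2 \<le> 4 * upc (\<alpha> - 1) * (norm (C n g))\<^sup>2" by (rule H(2))
qed

end

section \<open>Functionals on the test space and on its trace spaces\<close>

text \<open>The vector v is rescaled into the unit ball. The constant K allows for a norm whose
  homogeneity is known only up to a factor.\<close>

lemma dual_bound:
  fixes A :: "('b \<Rightarrow> real) set"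
  assumes F: "F \<in> dual_space A nA" and v: "v \<in> A" and K: "K > 0"
    and sc: "\<And>c v. v \<in> A \<Longrightarrow> (\<lambda>x. c * v x) \<in> A" "\<And>c v. v \<in> A \<Longrightarrow> nA (\<lambda>x. c * v x) \<le> K * \<bar>c\<bar> * nA v"
    and nn: "\<And>v. v \<in> A \<Longrightarrow> 0 \<le> nA v"
  shows "\<bar>F v\<bar> \<le> K * dual_norm A nA F * nA v" "0 \<le> dual_norm A nA F"
proof -
  let ?X = "{\<bar>F v\<bar> | v. v \<in> A \<and> nA v \<le> 1}"
  obtain B where B: "\<And>v. v \<in> A \<Longrightarrow> \<bar>F v\<bar> \<le> B * nA v" using F unfolding dual_space_def by blast
  have hom: "F (\<lambda>x. c * v x) = c * F v" if "v \<in> A" for c v using F that by (simp add: dual_space_def)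
  have bdd: "bdd_above ?X"
  proof (rule bdd_aboveI[of _ "\<bar>B\<bar>"])
    fix y assume "y \<in> ?X"
    then obtain v where v: "y = \<bar>F v\<bar>" "v \<in> A" "nA v \<le> 1" by auto
    have "B * nA v \<le> \<bar>B\<bar> * nA v" by (intro mult_right_mono nn v) simp
    also have "\<dots> \<le> \<bar>B\<bar> * 1" by (intro mult_left_mono v) simp
    finally show "y \<le> \<bar>B\<bar>" using B[OF v(2)] v(1) by simp
  qed
  have up: "\<bar>F v\<bar> \<le> dual_norm A nA F" if "v \<in> A" "nA v \<le> 1" for v
    unfolding dual_norm_def by (rule cSup_upper[OF _ bdd]) (use that in auto)
  have "nA (\<lambda>x. 0 * v x) \<le> 1" using sc(2)[OF v, of 0] by simp
  from up[OF sc(1)[OF v] this] show D: "0 \<le> dual_norm A nA F" by linarith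
  show "\<bar>F v\<bar> \<le> K * dual_norm A nA F * nA v"
  proof (cases "nA v = 0")
    \<comment> \<open>Here no rescaling is possible, and the bound contained in
      \<open>dual_space\<close> is used instead.\<close>
    case True then show ?thesis using B[OF v] by simp
  next
    case False
    then have p: "nA v > 0" using nn[OF v] by simp
    let ?c = "1 / (K * nA v)"
    have "nA (\<lambda>x. ?c * v x) \<le> 1" using sc(2)[OF v, of ?c] p K by simp
    from up[OF sc(1)[OF v] this] have "\<bar>?c * F v\<bar> \<le> dual_norm A nA F" by (simp only: hom[OF v])
    then show ?thesis using p K by (simp add: abs_mult field_simps)
  qed
qed

text \<open>R relates v to its trace y; it is a relation because traces are fixed only up to null
  sets. The difference of two traces of one v is a trace of 0, so its trace norm is 0 and u vanishes
  on it: hence u depends linearly on v, whichever traces are picked.\<close>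

lemma trace_dual:
  fixes A :: "('b \<Rightarrow> real) set" and R :: "('b \<Rightarrow> real) \<Rightarrow> ('c \<Rightarrow> real) \<Rightarrow> bool" and nA :: "('b \<Rightarrow> real) \<Rightarrow> real"
  defines "B \<equiv> {y. \<exists>v\<in>A. R v y}" and "nB \<equiv> \<lambda>y. Inf {nA v | v. v \<in> A \<and> R v y}"
  assumes u: "u \<in> dual_space B nB" and K: "K > 0"
    and A: "\<And>v w c. v \<in> A \<Longrightarrow> w \<in> A \<Longrightarrow> (\<lambda>x. v x + c * w x) \<in> A"
    and R: "\<And>v w y z c. v \<in> A \<Longrightarrow> w \<in> A \<Longrightarrow> R v y \<Longrightarrow> R w z \<Longrightarrow> R (\<lambda>x. v x + c * w x) (\<lambda>x. y x + c * z x)"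
    and sc: "\<And>c v. v \<in> A \<Longrightarrow> nA (\<lambda>x. c * v x) \<le> K * \<bar>c\<bar> * nA v"
    and nn: "\<And>v. v \<in> A \<Longrightarrow> 0 \<le> nA v"
  shows "v \<in> A \<Longrightarrow> R v y \<Longrightarrow> \<bar>u y\<bar> \<le> K * dual_norm B nB u * nA v \<and> 0 \<le> dual_norm B nB u"
    and "v \<in> A \<Longrightarrow> w \<in> A \<Longrightarrow> R v y \<Longrightarrow> R w z \<Longrightarrow> R (\<lambda>x. v x + c * w x) q \<Longrightarrow> u q = u y + c * u z"
proof -
  have zero: "(\<lambda>x. 0) \<in> A" "R (\<lambda>x. 0) (\<lambda>x. 0)" if "v \<in> A" "R v y" for v y
    using A[of v v "-1"] R[of v v y y "-1"] that by auto
  have scale: "(\<lambda>x. c * v x) \<in> A" "R (\<lambda>x. c * v x) (\<lambda>x. c * y x)" if "v \<in> A" "R v y" for v y c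
    using A[OF zero(1)[OF that] that(1), of c] R[OF zero(1)[OF that] that(1) zero(2)[OF that] that(2), of c] by auto
  have bdd: "bdd_below {nA v | v. v \<in> A \<and> R v y}" for y by (rule bdd_belowI[of _ 0]) (use nn in auto)
  have le: "nB y \<le> nA v" if "v \<in> A" "R v y" for v y
    unfolding nB_def by (rule cInf_lower[OF _ bdd]) (use that in auto)
  have greatest: "b \<le> nB y" if "y \<in> B" "\<And>v. v \<in> A \<Longrightarrow> R v y \<Longrightarrow> b \<le> nA v" for b y
    unfolding nB_def by (rule cInf_greatest) (use that in \<open>auto simp: B_def\<close>)
  have Bsc: "(\<lambda>x. c * y x) \<in> B" if "y \<in> B" for c y using that scale unfolding B_def by blast
  have nBsc: "nB (\<lambda>x. c * y x) \<le> K * \<bar>c\<bar> * nB y" if y: "y \<in> B" for c y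
  proof -
    have *: "nB (\<lambda>x. c * y x) \<le> K * \<bar>c\<bar> * nA v" if "v \<in> A" "R v y" for v
      using le[OF scale[OF that]] sc[OF that(1), of c] by (rule order_trans)
    show ?thesis
    proof (cases "c = 0")
      case True
      obtain v where "v \<in> A" "R v y" using y by (auto simp: B_def)
      from *[OF this] show ?thesis using True by simp
    next
      case False
      then have p: "K * \<bar>c\<bar> > 0" using K by simp
      have "nB (\<lambda>x. c * y x) / (K * \<bar>c\<bar>) \<le> nB y"
        by (rule greatest[OF y]) (use * p in \<open>simp add: pos_divide_le_eq mult.commute\<close>)
      then show ?thesis using p by (simp add: pos_divide_le_eq mult.commute)
    qed
  qed
  have nBnn: "0 \<le> nB y" if "y \<in> B" for y by (rule greatest[OF that nn])
  have bound: "\<bar>u y\<bar> \<le> K * dual_norm B nB u * nA v \<and> 0 \<le> dual_norm B nB u" if "v \<in> A" "R v y" for v y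
  proof -
    have y: "y \<in> B" using that by (auto simp: B_def)
    note d = dual_bound[OF u y K Bsc nBsc nBnn]
    have "K * dual_norm B nB u * nB y \<le> K * dual_norm B nB u * nA v"
      using K d(2) by (intro mult_left_mono le that) simp
    then show ?thesis using d by linarith
  qed
  then show "v \<in> A \<Longrightarrow> R v y \<Longrightarrow> \<bar>u y\<bar> \<le> K * dual_norm B nB u * nA v \<and> 0 \<le> dual_norm B nB u" .
  assume v: "v \<in> A" "w \<in> A" "R v y" "R w z" "R (\<lambda>x. v x + c * w x) q"
  let ?s = "\<lambda>x. y x + c * z x" and ?v = "\<lambda>x. v x + c * w x"
  note vA = A[OF v(1,2), of c] and vR = R[OF v(1-4), of c]
  have "R (\<lambda>x. ?v x + (-1) * ?v x) (\<lambda>x. q x + (-1) * ?s x)" by (rule R[OF vA vA v(5) vR])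
  then have "R (\<lambda>x. 0) (\<lambda>x. q x + (-1) * ?s x)" by simp
  moreover have "nA (\<lambda>x. 0) = 0" using sc[OF v(1), of 0] nn[OF zero(1)[OF v(1,3)]] by simp
  ultimately have "u (\<lambda>x. q x + (-1) * ?s x) = 0" using bound[OF zero(1)[OF v(1,3)], of "\<lambda>x. q x + (-1) * ?s x"] by simp
  moreover have m: "y \<in> B" "z \<in> B" "q \<in> B" "?s \<in> B" using v vA vR by (auto simp: B_def)
  have add: "\<And>a b. a \<in> B \<Longrightarrow> b \<in> B \<Longrightarrow> u (\<lambda>x. a x + b x) = u a + u b"
    and mul: "\<And>c a. a \<in> B \<Longrightarrow> u (\<lambda>x. c * a x) = c * u a" using u by (auto simp: dual_space_def)
  have "u (\<lambda>x. q x + (-1) * ?s x) = u q + (-1) * u ?s"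
    by (simp only: add[OF m(3) Bsc[OF m(4)]] mul[OF m(4)])
  moreover have "u ?s = u y + c * u z" by (simp only: add[OF m(1) Bsc[OF m(2)]] mul[OF m(2)])
  ultimately show "u q = u y + c * u z" by simp
qed

section \<open>The operator and its coercivity\<close>

text \<open>The entry 1 serves the part of the norm in space, which is homogeneous. The other entry
  is the product of the two comparison constants between the fractional Sobolev norm of v and the
  norm of its derivative.\<close>

definition trial_const :: "real \<Rightarrow> real" where
  "trial_const \<alpha> = max 1 (2 * sqrt (upc (\<alpha> - 1)) / qconst (2 - \<alpha>))"

text \<open>One entry for each part of the norm of G: \<open>coer\<close> bounds the derivative in
  time, and the triangle inequality then bounds the Laplacian with 1 + \<open>coer\<close>.\<close>

definition coer_const :: "real \<Rightarrow> real" where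
  "coer_const \<alpha> = max (2 * sqrt (upc (\<alpha> - 1)) * coer \<alpha>) (1 + coer \<alpha>)"

lemma upc_nonneg: "0 \<le> upc \<theta>" by (simp add: upc_def)

lemma sqrt_bound: "x\<^sup>2 \<le> c * y\<^sup>2 \<Longrightarrow> 0 \<le> y \<Longrightarrow> x \<le> sqrt c * y" for x y c :: real
  by (metis real_le_rsqrt real_sqrt_mult real_sqrt_unique)

context cyl
begin

context
  fixes \<alpha> :: real
  assumes \<alpha>: "1 < \<alpha>" "\<alpha> < 2"
begin

text \<open>Here \<open>g\<close> is the derivative of order \<open>\<alpha>\<close> of \<open>v\<close>, and the test space consists of the \<open>v\<close> with such a \<open>g\<close>.\<close>

definition pot :: "(real \<times> 'a \<Rightarrow> real) \<Rightarrow> (real \<times> 'a \<Rightarrow> real) \<Rightarrow> bool" where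
  "pot v g \<longleftrightarrow> v \<in> L2 P \<and> g \<in> L2 P \<and> (\<forall>n. C n v = fint T \<alpha> (C n g)) \<and>
     summable (\<lambda>n. (lam n)\<^sup>2 * (norm (C n v))\<^sup>2)"

abbreviation "GG \<equiv> G \<alpha> T \<Omega> \<phi> lam"
abbreviation "nG \<equiv> G_norm \<alpha> T \<Omega> \<phi> lam"
abbreviation "D j v \<equiv> frac_deriv T \<Omega> (\<alpha> - j) v"
abbreviation "Bop v \<equiv> (\<lambda>p. frac_deriv T \<Omega> \<alpha> v p - laplacian T \<Omega> v p)"

lemma \<alpha>_pos: "\<alpha> > 0" using \<alpha> by simp

lemma pot_G: "pot v g \<Longrightarrow> v \<in> GG"
  using H0_L2I(1)[OF \<alpha>, of v g] L2_Hdot2I[of v] by (auto simp: pot_def G_def)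

lemma H0_L2_norm_upper:
  assumes "pot v g"
  shows "H0_L2_norm T \<Omega> \<phi> \<alpha> v \<le> 2 * sqrt (upc (\<alpha> - 1)) * norm (cl S g)"
proof -
  have v: "v \<in> L2 P" and g: "g \<in> L2 P" and eq: "\<And>n. C n v = fint T \<alpha> (C n g)" using assms by (auto simp: pot_def)
  have s: "summable (\<lambda>n. (H0_norm T \<alpha> (cf n v))\<^sup>2)" using H0_L2I(1)[OF \<alpha> v g eq] by (simp add: H0_L2_def)
  have t: "(\<lambda>n. 4 * upc (\<alpha> - 1) * (norm (C n g))\<^sup>2) sums (4 * upc (\<alpha> - 1) * (norm (cl S g))\<^sup>2)"
    by (intro sums_mult C_sums g)
  have "(\<Sum>n. (H0_norm T \<alpha> (cf n v))\<^sup>2) \<le> (\<Sum>n. 4 * upc (\<alpha> - 1) * (norm (C n g))\<^sup>2)"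
    by (intro suminf_le s sums_summable[OF t] H0_L2I(2)[OF \<alpha> v g eq])
  also have "\<dots> = 4 * upc (\<alpha> - 1) * (norm (cl S g))\<^sup>2" using t by (rule sums_unique[symmetric])
  finally have "H0_L2_norm T \<Omega> \<phi> \<alpha> v \<le> sqrt (4 * upc (\<alpha> - 1) * (norm (cl S g))\<^sup>2)"
    unfolding H0_L2_norm_def by (rule real_sqrt_le_mono)
  then show ?thesis by (simp add: real_sqrt_mult)
qed

lemma G_pot:
  assumes "v \<in> GG"
  shows "\<exists>g. pot v g \<and> norm (cl S g) \<le> H0_L2_norm T \<Omega> \<phi> \<alpha> v / qconst (2 - \<alpha>)"
proof -
  have v: "v \<in> H0_L2 T \<Omega> \<phi> \<alpha>" "v \<in> L2_Hdot2 T \<Omega> \<phi> lam" using assms by (auto simp: G_def)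
  obtain g where g: "g \<in> L2 P" "\<And>n. C n v = fint T \<alpha> (C n g)"
      "\<And>n. norm (C n g) \<le> H0_norm T \<alpha> (cf n v) / qconst (2 - \<alpha>)" using H0_L2_imp[OF \<alpha> v(1)] by blast
  have q: "qconst (2 - \<alpha>) > 0" using \<alpha> by (intro qconst_pos) auto
  have "pot v g" using v g sums_summable[OF L2_Hdot2_sums[OF v(2)]] by (simp add: pot_def H0_L2_def)
  moreover have "norm (cl S g) \<le> H0_L2_norm T \<Omega> \<phi> \<alpha> v / qconst (2 - \<alpha>)"
  proof (rule power2_le_imp_le)
    have s: "summable (\<lambda>n. (H0_norm T \<alpha> (cf n v))\<^sup>2)" using v(1) by (simp add: H0_L2_def)
    have "(norm (cl S g))\<^sup>2 = (\<Sum>n. (norm (C n g))\<^sup>2)" using C_sums[OF g(1)] by (rule sums_unique)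
    also have "\<dots> \<le> (\<Sum>n. (H0_norm T \<alpha> (cf n v))\<^sup>2 / (qconst (2 - \<alpha>))\<^sup>2)"
    proof (intro suminf_le summable_divide s sums_summable[OF C_sums[OF g(1)]])
      fix n
      show "(norm (C n g))\<^sup>2 \<le> (H0_norm T \<alpha> (cf n v))\<^sup>2 / (qconst (2 - \<alpha>))\<^sup>2"
        using power_mono[OF g(3)[of n], of 2] by (simp add: power_divide)
    qed
    also have "\<dots> = (\<Sum>n. (H0_norm T \<alpha> (cf n v))\<^sup>2) / (qconst (2 - \<alpha>))\<^sup>2" by (rule suminf_divide[OF s])
    also have "\<dots> = (H0_L2_norm T \<Omega> \<phi> \<alpha> v / qconst (2 - \<alpha>))\<^sup>2"
      by (simp add: H0_L2_norm_def power_divide suminf_nonneg s)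
    finally show "(norm (cl S g))\<^sup>2 \<le> (H0_L2_norm T \<Omega> \<phi> \<alpha> v / qconst (2 - \<alpha>))\<^sup>2" .
    show "0 \<le> H0_L2_norm T \<Omega> \<phi> \<alpha> v / qconst (2 - \<alpha>)" using q by (simp add: H0_L2_norm_def suminf_nonneg s)
  qed
  ultimately show ?thesis by blast
qed

lemma C_comb:
  assumes "v \<in> L2 P" "w \<in> L2 P"
  shows "C n (\<lambda>p. v p + c * w p) = C n v + c *\<^sub>R C n w"
  using C_lin(1)[OF assms(1) L2_cmult[OF assms(2)]] C_lin(3)[OF assms(2) assms(2)] by simp

lemma pot_comb:
  assumes v: "pot v g" and w: "pot w h"
  shows "pot (\<lambda>p. v p + c * w p) (\<lambda>p. g p + c * h p)"
proof -
  have L: "v \<in> L2 P" "g \<in> L2 P" "w \<in> L2 P" "h \<in> L2 P" using v w by (auto simp: pot_def)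
  have eq: "C n v = fint T \<alpha> (C n g)" "C n w = fint T \<alpha> (C n h)" for n using v w by (auto simp: pot_def)
  have s: "summable (\<lambda>n. 2 * ((lam n)\<^sup>2 * (norm (C n v))\<^sup>2) + 2 * c\<^sup>2 * ((lam n)\<^sup>2 * (norm (C n w))\<^sup>2))"
    using v w by (intro summable_add summable_mult) (auto simp: pot_def)
  have "summable (\<lambda>n. (lam n)\<^sup>2 * (norm (C n v + c *\<^sub>R C n w))\<^sup>2)"
  proof (rule summable_comparison_test[OF _ s], intro exI allI impI)
    fix n
    have "(norm (C n v + c *\<^sub>R C n w))\<^sup>2 \<le> (norm (C n v) + norm (c *\<^sub>R C n w))\<^sup>2"
      by (intro power_mono norm_triangle_ineq norm_ge_zero)
    also have "\<dots> \<le> 2 * (norm (C n v))\<^sup>2 + 2 * (norm (c *\<^sub>R C n w))\<^sup>2"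
      using sum_squares_bound[of "norm (C n v)" "norm (c *\<^sub>R C n w)"] by (simp add: power2_sum)
    also have "\<dots> = 2 * (norm (C n v))\<^sup>2 + 2 * c\<^sup>2 * (norm (C n w))\<^sup>2" by (simp add: power_mult_distrib)
    finally have "(lam n)\<^sup>2 * (norm (C n v + c *\<^sub>R C n w))\<^sup>2 \<le> (lam n)\<^sup>2 * (2 * (norm (C n v))\<^sup>2 + 2 * c\<^sup>2 * (norm (C n w))\<^sup>2)"
      by (rule mult_left_mono) simp
    then show "norm ((lam n)\<^sup>2 * (norm (C n v + c *\<^sub>R C n w))\<^sup>2) \<le> 2 * ((lam n)\<^sup>2 * (norm (C n v))\<^sup>2) + 2 * c\<^sup>2 * ((lam n)\<^sup>2 * (norm (C n w))\<^sup>2)"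
      by (simp add: algebra_simps)
  qed
  moreover have "C n v + c *\<^sub>R C n w = fint T \<alpha> (C n g + c *\<^sub>R C n h)" for n
    unfolding eq linear_add[OF linear_fint[OF \<alpha>_pos]] linear_scale[OF linear_fint[OF \<alpha>_pos]] ..
  ultimately show ?thesis unfolding pot_def C_comb[OF L(1,3)] C_comb[OF L(2,4)] using L by (auto intro: L2_add L2_cmult)
qed

lemma G_comb: "v \<in> GG \<Longrightarrow> w \<in> GG \<Longrightarrow> (\<lambda>p. v p + c * w p) \<in> GG"
  using G_pot[of v] G_pot[of w] by (auto intro: pot_G[OF pot_comb])

lemma G_scale: assumes "v \<in> GG" shows "(\<lambda>p. c * v p) \<in> GG"
proof -
  have "(\<lambda>p. 0) \<in> GG" using G_comb[OF assms assms, of "-1"] by simp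
  from G_comb[OF this assms, of c] show ?thesis by simp
qed

lemma nG_nonneg: "0 \<le> nG v"
  by (simp add: G_norm_def L2_Hdot2_norm_def le_max_iff_disj Bochner_Integration.integral_nonneg)

text \<open>The fractional part is scaled through its derivative: c * g belongs to c * v, and the
  comparison is used once in each direction.\<close>

lemma nG_scale:
  assumes v: "v \<in> GG"
  shows "nG (\<lambda>p. c * v p) \<le> trial_const \<alpha> * \<bar>c\<bar> * nG v"
proof -
  obtain g where g: "pot v g" "norm (cl S g) \<le> H0_L2_norm T \<Omega> \<phi> \<alpha> v / qconst (2 - \<alpha>)" using G_pot[OF v] by blast
  have vL: "v \<in> L2 P" and gL: "g \<in> L2 P" using g by (auto simp: pot_def)
  have v2: "v \<in> L2_Hdot2 T \<Omega> \<phi> lam" "(\<lambda>p. c * v p) \<in> L2_Hdot2 T \<Omega> \<phi> lam" using v G_scale[OF v] by (auto simp: G_def)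
  have t: "1 \<le> trial_const \<alpha>" "2 * sqrt (upc (\<alpha> - 1)) / qconst (2 - \<alpha>) \<le> trial_const \<alpha>" by (auto simp: trial_const_def)
  have mono: "a * \<bar>c\<bar> * b \<le> trial_const \<alpha> * \<bar>c\<bar> * nG v" if "a \<le> trial_const \<alpha>" "b \<le> nG v" "0 \<le> b" for a b
    using that t(1) by (intro mult_mono) auto
  have z: "pot (\<lambda>p. 0) (\<lambda>p. 0)" using pot_comb[OF g(1) g(1), of "-1"] by simp
  have "pot (\<lambda>p. c * v p) (\<lambda>p. c * g p)" using pot_comb[OF z g(1), of c] by simp
  then have "H0_L2_norm T \<Omega> \<phi> \<alpha> (\<lambda>p. c * v p) \<le> 2 * sqrt (upc (\<alpha> - 1)) * norm (cl S (\<lambda>p. c * g p))" by (rule H0_L2_norm_upper)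
  also have "\<dots> = 2 * sqrt (upc (\<alpha> - 1)) * (\<bar>c\<bar> * norm (cl S g))" by (simp add: cl_S_lin(3)[OF gL gL])
  also have "\<dots> \<le> 2 * sqrt (upc (\<alpha> - 1)) * (\<bar>c\<bar> * (H0_L2_norm T \<Omega> \<phi> \<alpha> v / qconst (2 - \<alpha>)))"
    using g(2) upc_nonneg by (intro mult_left_mono) auto
  also have "\<dots> = 2 * sqrt (upc (\<alpha> - 1)) / qconst (2 - \<alpha>) * \<bar>c\<bar> * H0_L2_norm T \<Omega> \<phi> \<alpha> v" by simp
  also have "\<dots> \<le> trial_const \<alpha> * \<bar>c\<bar> * nG v"
  proof (rule mono[OF t(2)])
    have "0 \<le> norm (cl S g)" by simp
    then have "0 \<le> H0_L2_norm T \<Omega> \<phi> \<alpha> v / qconst (2 - \<alpha>)" using g(2) by linarith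
    then show "0 \<le> H0_L2_norm T \<Omega> \<phi> \<alpha> v" using qconst_pos[of "2 - \<alpha>"] \<alpha> by (simp add: zero_le_divide_iff)
  qed (simp add: G_norm_def)
  finally have 1: "H0_L2_norm T \<Omega> \<phi> \<alpha> (\<lambda>p. c * v p) \<le> trial_const \<alpha> * \<bar>c\<bar> * nG v" .
  have "(\<lambda>n. c\<^sup>2 * ((lam n)\<^sup>2 * (norm (C n v))\<^sup>2)) sums (L2_Hdot2_norm T \<Omega> \<phi> lam (\<lambda>p. c * v p))\<^sup>2"
    using L2_Hdot2_sums[OF v2(2)] by (simp add: C_lin(3)[OF vL vL] power_mult_distrib mult.left_commute)
  moreover have "(\<lambda>n. c\<^sup>2 * ((lam n)\<^sup>2 * (norm (C n v))\<^sup>2)) sums (c\<^sup>2 * (L2_Hdot2_norm T \<Omega> \<phi> lam v)\<^sup>2)"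
    by (intro sums_mult L2_Hdot2_sums v2)
  ultimately have "(L2_Hdot2_norm T \<Omega> \<phi> lam (\<lambda>p. c * v p))\<^sup>2 = c\<^sup>2 * (L2_Hdot2_norm T \<Omega> \<phi> lam v)\<^sup>2" by (rule sums_unique2)
  moreover have H: "0 \<le> L2_Hdot2_norm T \<Omega> \<phi> lam v" for v by (simp add: L2_Hdot2_norm_def Bochner_Integration.integral_nonneg)
  ultimately have "L2_Hdot2_norm T \<Omega> \<phi> lam (\<lambda>p. c * v p) \<le> 1 * \<bar>c\<bar> * L2_Hdot2_norm T \<Omega> \<phi> lam v"
    using sqrt_bound[of "L2_Hdot2_norm T \<Omega> \<phi> lam (\<lambda>p. c * v p)" "c\<^sup>2" "L2_Hdot2_norm T \<Omega> \<phi> lam v"] by simp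
  also have "\<dots> \<le> trial_const \<alpha> * \<bar>c\<bar> * nG v" by (rule mono[OF t(1)]) (auto simp: G_norm_def H)
  finally show ?thesis using 1 by (simp add: G_norm_def)
qed

lemma Bop_coeffs:
  assumes "pot v g"
  shows "Bop v \<in> L2 P" "C n (Bop v) = C n g + lam n *\<^sub>R C n v"
proof -
  have v: "v \<in> L2 P" and g: "g \<in> L2 P" and eq: "\<And>n. C n v = fint T \<alpha> (C n g)"
    and s: "summable (\<lambda>n. (lam n)\<^sup>2 * (norm (C n v))\<^sup>2)" using assms by (auto simp: pot_def)
  note d = frac_deriv_eq(1,2)[OF \<alpha> v g eq]
  obtain h where h: "h \<in> L2 P" "\<And>n. C n h = - lam n *\<^sub>R C n v" "laplacian T \<Omega> v \<in> L2 P"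
    "AE t in M. AE x in N. laplacian T \<Omega> v (t, x) = h (t, x)" using laplacian_eq[OF v s] by blast
  have "AE p in P. laplacian T \<Omega> v p = h p"
    using h(4) AE_P_fst_iff[OF L2_measurable[OF h(3)] L2_measurable[OF h(1)]] by blast
  note l = C_cong(1)[OF h(3,1) this]
  show "Bop v \<in> L2 P" by (rule L2_diff[OF d(1) h(3)])
  show "C n (Bop v) = C n g + lam n *\<^sub>R C n v"
    by (simp add: C_lin(2)[OF d(1) h(3)] l h(2) C_cong(1)[OF d(1) g d(2)])
qed

text \<open>Mode by mode \<open>fint_coercive\<close> with l = lam n bounds the coefficient of g,
  and lam n * C n v is the coefficient of B v minus that of g. The constants do not depend on n, so
  the squares can be summed.\<close>

lemma nG_Bop:
  assumes p: "pot v g"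
  shows "nG v \<le> coer_const \<alpha> * norm (cl S (Bop v))"
proof -
  have v: "v \<in> L2 P" and g: "g \<in> L2 P" and eq: "\<And>n. C n v = fint T \<alpha> (C n g)" using p by (auto simp: pot_def)
  note B = Bop_coeffs[OF p]
  have c1: "norm (C n g) \<le> coer \<alpha> * norm (C n (Bop v))" for n
    unfolding B(2) eq by (rule fint_coercive(1)[OF \<alpha>]) (use lam_pos[of n] in simp)
  have c2: "lam n * norm (C n v) \<le> (1 + coer \<alpha>) * norm (C n (Bop v))" for n
  proof -
    have "lam n * norm (C n v) = norm (C n (Bop v) - C n g)" using lam_pos[of n] by (simp add: B(2))
    also have "\<dots> \<le> norm (C n (Bop v)) + norm (C n g)" by (rule norm_triangle_ineq4)
    finally show ?thesis using c1[of n] by (simp add: algebra_simps)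
  qed
  have "coer \<alpha> \<ge> 0" using \<alpha> by (simp add: coer_def)
  note nn = this
  have b: "x \<le> k * norm (cl S (Bop v))" if "a sums x\<^sup>2" "\<And>n. a n \<le> (k * norm (C n (Bop v)))\<^sup>2" "0 \<le> k" for a x k
  proof (rule power2_le_imp_le)
    have "(\<lambda>n. (k * norm (C n (Bop v)))\<^sup>2) sums (k\<^sup>2 * (norm (cl S (Bop v)))\<^sup>2)"
      unfolding power_mult_distrib by (intro sums_mult C_sums B)
    from sums_le[OF that(2) that(1) this] show "x\<^sup>2 \<le> (k * norm (cl S (Bop v)))\<^sup>2" by (simp add: power_mult_distrib)
  qed (use that in simp)
  have "norm (cl S g) \<le> coer \<alpha> * norm (cl S (Bop v))"
    by (rule b[OF C_sums[OF g] _ nn]) (intro power_mono c1 norm_ge_zero)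
  then have "2 * sqrt (upc (\<alpha> - 1)) * norm (cl S g) \<le> 2 * sqrt (upc (\<alpha> - 1)) * (coer \<alpha> * norm (cl S (Bop v)))"
    using upc_nonneg by (intro mult_left_mono) auto
  then have "H0_L2_norm T \<Omega> \<phi> \<alpha> v \<le> (2 * sqrt (upc (\<alpha> - 1)) * coer \<alpha>) * norm (cl S (Bop v))"
    using H0_L2_norm_upper[OF p] by simp
  also have "\<dots> \<le> coer_const \<alpha> * norm (cl S (Bop v))" by (intro mult_right_mono) (auto simp: coer_const_def)
  finally have 1: "H0_L2_norm T \<Omega> \<phi> \<alpha> v \<le> coer_const \<alpha> * norm (cl S (Bop v))" .
  have v2: "v \<in> L2_Hdot2 T \<Omega> \<phi> lam" using pot_G[OF p] by (simp add: G_def)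
  have "L2_Hdot2_norm T \<Omega> \<phi> lam v \<le> (1 + coer \<alpha>) * norm (cl S (Bop v))"
  proof (rule b[OF L2_Hdot2_sums[OF v2]])
    fix n
    have "(lam n * norm (C n v))\<^sup>2 \<le> ((1 + coer \<alpha>) * norm (C n (Bop v)))\<^sup>2"
      by (intro power_mono c2 mult_nonneg_nonneg norm_ge_zero) (use lam_pos[of n] in simp)
    then show "(lam n)\<^sup>2 * (norm (C n v))\<^sup>2 \<le> ((1 + coer \<alpha>) * norm (C n (Bop v)))\<^sup>2" by (simp add: power_mult_distrib)
  qed (use nn in simp)
  also have "\<dots> \<le> coer_const \<alpha> * norm (cl S (Bop v))" by (intro mult_right_mono) (auto simp: coer_const_def)
  finally show ?thesis using 1 by (simp add: G_norm_def)
qed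

lemma D_coeffs:
  assumes "pot v g"
  shows "D 1 v \<in> L2 P" "C n (D 1 v) = fint T 1 (C n g)"
    and "D 2 v \<in> L2 P" "C n (D 2 v) = fint T 1 (fint T 1 (C n g))"
    and "\<exists>y. has_initial_value T \<Omega> (D 1 v) y" "\<exists>y. has_initial_value T \<Omega> (D 2 v) y"
proof -
  have v: "v \<in> L2 P" and g: "g \<in> L2 P" and eq: "\<And>n. C n v = fint T \<alpha> (C n g)" using assms by (auto simp: pot_def)
  have k: "ker T (pk 1)" by (rule ker_pk) simp
  note g1 = cconv_L2[OF k g] and g2 = cconv_L2[OF k cconv_L2[OF k g]]
  note d = frac_deriv_eq(3-6)[OF \<alpha> v g eq]
  show "D 1 v \<in> L2 P" "D 2 v \<in> L2 P" by (rule d)+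
  show "C n (D 1 v) = fint T 1 (C n g)" by (simp add: C_cong(1)[OF d(1) g1 d(2)] C_cconv[OF k g])
  show "C n (D 2 v) = fint T 1 (fint T 1 (C n g))"
    by (simp add: C_cong(1)[OF d(3) g2 d(4)] C_cconv[OF k g1] C_cconv[OF k g])
  show "\<exists>y. has_initial_value T \<Omega> (D 1 v) y" by (rule has_initial_value_bint[OF g L2_measurable[OF d(1)] d(2)])
  show "\<exists>y. has_initial_value T \<Omega> (D 2 v) y" by (rule has_initial_value_bint[OF g1 L2_measurable[OF d(3)] d(4)])
qed

lemma D_initial_comb:
  assumes j: "j = 1 \<or> j = 2" and v: "v \<in> GG" and w: "w \<in> GG"
    and y: "has_initial_value T \<Omega> (D j v) y" and z: "has_initial_value T \<Omega> (D j w) z"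
  shows "has_initial_value T \<Omega> (D j (\<lambda>p. v p + c * w p)) (\<lambda>x. y x + c * z x)"
proof (rule has_initial_value_lin[OF y z])
  obtain g where g: "pot v g" using G_pot[OF v] by blast
  obtain h where h: "pot w h" using G_pot[OF w] by blast
  note gh = pot_comb[OF g h, of c]
  have gL: "g \<in> L2 P" "h \<in> L2 P" using g h by (auto simp: pot_def)
  have L: "D j v \<in> L2 P" "D j w \<in> L2 P" "D j (\<lambda>p. v p + c * w p) \<in> L2 P"
    using j D_coeffs(1,3)[OF g] D_coeffs(1,3)[OF h] D_coeffs(1,3)[OF gh] by auto
  have l: "linear (fint T 1)" by (rule linear_fint) simp
  have "AE p in P. D j (\<lambda>p. v p + c * w p) p = D j v p + c * D j w p"
  proof (rule C_eq_imp(2)[OF L(3) L2_add[OF L(1) L2_cmult[OF L(2)]]])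
    fix n
    show "C n (D j (\<lambda>p. v p + c * w p)) = C n (\<lambda>p. D j v p + c * D j w p)"
      unfolding C_comb[OF L(1,2)] using j
      by (auto simp: D_coeffs(2,4)[OF g] D_coeffs(2,4)[OF h] D_coeffs(2,4)[OF gh] C_comb[OF gL] linear_add[OF l] linear_scale[OF l])
  qed
  then show "AE t in M. AE x in N. D j (\<lambda>p. v p + c * w p) (t, x) = D j v (t, x) + c * D j w (t, x)" by (rule AE_P_fst)
qed

lemma D_initial:
  assumes j: "j = 1 \<or> j = 2" and v: "v \<in> GG"
  shows "has_initial_value T \<Omega> (D j v) (initial_value T \<Omega> (D j v))"
proof -
  obtain g where g: "pot v g" using G_pot[OF v] by blast
  have "\<exists>y. has_initial_value T \<Omega> (D j v) y" using j D_coeffs(5,6)[OF g] by auto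
  then show ?thesis unfolding initial_value_def by (rule someI_ex)
qed

lemma Bop_comb:
  assumes v: "v \<in> GG" and w: "w \<in> GG"
  shows "cl S (Bop (\<lambda>p. v p + c * w p)) = cl S (Bop v) + c *\<^sub>R cl S (Bop w)"
proof -
  obtain g where g: "pot v g" using G_pot[OF v] by blast
  obtain h where h: "pot w h" using G_pot[OF w] by blast
  note gh = pot_comb[OF g h, of c]
  have L: "g \<in> L2 P" "h \<in> L2 P" "v \<in> L2 P" "w \<in> L2 P" using g h by (auto simp: pot_def)
  note B = Bop_coeffs[OF g] Bop_coeffs[OF h] Bop_coeffs[OF gh]
  have "cl S (Bop (\<lambda>p. v p + c * w p)) = cl S (\<lambda>p. Bop v p + c * Bop w p)"
  proof (rule C_eq_imp(1)[OF B(5) L2_add[OF B(1) L2_cmult[OF B(3)]]])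
    fix n
    show "C n (Bop (\<lambda>p. v p + c * w p)) = C n (\<lambda>p. Bop v p + c * Bop w p)"
      unfolding C_comb[OF B(1,3)] B(2,4,6) C_comb[OF L(1,2)] C_comb[OF L(3,4)] by (simp add: algebra_simps)
  qed
  then show ?thesis using cl_S_lin(1)[OF B(1) L2_cmult[OF B(3)], of c] cl_S_lin(3)[OF B(3) B(3), of c] by simp
qed

section \<open>Existence and uniqueness\<close>

text \<open>Testing with V^\<alpha> a times \<phi> n, for arbitrary a, shows that C n d is
  orthogonal to all a + lam n V^\<alpha> a. Hence C n d solves the homogeneous adjoint equation and
  vanishes by coercivity of the adjoint.\<close>

lemma ip_Bop_unique:
  assumes d: "d \<in> L2 P" and 0: "\<And>v. v \<in> GG \<Longrightarrow> ip P d (Bop v) = 0"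
  shows "AE p in P. d p = 0"
proof -
  have k: "ker T (pk \<alpha>)" by (rule ker_pk[OF \<alpha>_pos])
  have "C n d = 0" for n
  proof -
    let ?X = "C n d + lam n *\<^sub>R fint' T \<alpha> (C n d)"
    have key: "inner (C n d) (cl I a + lam n *\<^sub>R fint T \<alpha> (cl I a)) = 0" if a: "a \<in> L2 M" for a
    proof -
      define c where "c = conv T (pk \<alpha>) a"
      have c: "c \<in> L2 M" "cl I c = fint T \<alpha> (cl I a)" unfolding c_def using conv_L2[OF k a] by auto
      let ?t = "\<lambda>a. (\<lambda>(t, x). a t * \<phi> n x)"
      have Ct: "C m (?t b) = (if m = n then cl I b else 0)" for m b
        using cf_tensor[of m b n] by (auto simp: cl_def mk_zero)
      have L: "?t c \<in> L2 P" "?t a \<in> L2 P" by (intro tensor_L2 c a phi_L2)+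
      define b where "b t = a t + lam n * c t" for t
      have bL: "b \<in> L2 M" unfolding b_def[abs_def] by (intro L2_add L2_cmult a c)
      have cb: "cl I b = cl I a + lam n *\<^sub>R cl I c"
        unfolding b_def[abs_def] using clM(1)[OF a L2_cmult[OF c(1)], of "lam n"] clM(3)[OF c(1), of "lam n"] by simp
      have p: "pot (?t c) (?t a)"
        unfolding pot_def
      proof (intro conjI L allI)
        show "C m (?t c) = fint T \<alpha> (C m (?t a))" for m
          by (simp add: Ct c(2) linear_0[OF linear_fint[OF \<alpha>_pos]])
        show "summable (\<lambda>m. (lam m)\<^sup>2 * (norm (C m (?t c)))\<^sup>2)"
          by (rule summable_finite[of "{n}"]) (auto simp: Ct)
      qed
      note B = Bop_coeffs[OF p]
      have tb: "?t b \<in> L2 P" by (rule tensor_L2[OF bL phi_L2])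
      have "cl S (Bop (?t c)) = cl S (?t b)"
        by (rule C_eq_imp(1)[OF B(1) tb]) (simp add: B(2) Ct cb)
      moreover have "ip P d (Bop (?t c)) = inner (cl S d) (cl S (Bop (?t c)))" "ip P d (?t b) = inner (cl S d) (cl S (?t b))"
        unfolding P_eq using ip_mon[OF S_sets] d B(1) tb unfolding P_eq by blast+
      ultimately have "ip P d (?t b) = 0" using 0[OF pot_G[OF p]] by simp
      then show ?thesis using C_inner[OF d bL, of n] by (simp add: cb c(2))
    qed
    \<comment> \<open>Here x is a class on the whole line, while C n d and V^\<alpha> only see its
      restriction to the interval.\<close>
    have "inner ?X x = inner 0 x" for x
    proof -
      obtain h where h: "h \<in> L2 lborel" "x = mk h" by (rule mk_surj[of x]) (rule that)
      have hI: "(\<lambda>t. indicator I t * h t) \<in> L2 lborel" using h by (intro L2_indicator_mult) auto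
      have hM: "h \<in> L2 M" using hI by (simp add: L2_mon_iff)
      have fI: "(\<lambda>t. indicator I t * cf n d t) \<in> L2 lborel" using cf_L2[OF d, of n] by (simp add: L2_mon_iff)
      have "(\<lambda>t. indicator I t * cf n d t * h t) = (\<lambda>t. indicator I t * cf n d t * (indicator I t * h t))" by (auto simp: indicator_def)
      then have "inner (C n d) x = inner (C n d) (cl I h)" using fI h hI by (simp add: cl_def inner_mk ip_def)
      moreover have "inner (fint' T \<alpha> (C n d)) x = inner (C n d) (fint T \<alpha> (cl I h))"
        using op_adj[OF schur_tri[OF k], of x "C n d"] op_tri_mk[OF k h(1)] h(2) by (simp add: inner_commute)
      ultimately show ?thesis using key[OF hM] by (simp add: inner_add_left inner_add_right)
    qed
    then have "?X = 0" by (rule inner_ext)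
    moreover have "norm (C n d) \<le> coer \<alpha> * norm ?X" by (rule fint_coercive(2)[OF \<alpha>]) (use lam_pos[of n] in simp)
    ultimately show ?thesis by simp
  qed
  moreover have "C n (\<lambda>p. 0) = 0" for n by (simp add: coeff_def[abs_def] ip_def cl_def mk_zero)
  ultimately show ?thesis using C_eq_imp(2)[OF d L2_zero] by simp
qed

text \<open>The right-hand side is bounded by the norm of v in G and hence by that of B v:
  \<open>trial_const\<close> comes from the dual norms, \<open>coer_const\<close> from coercivity.
  The values chosen by \<open>initial_value\<close> are linear in v only modulo null sets, so
  linearity of the trace terms goes through \<open>trace_dual\<close>.\<close>

theorem weak_solution_exists_unique:
  assumes f: "f \<in> dual_space GG nG"
    and u0: "u0 \<in> dual_space (G0 \<alpha> T \<Omega> \<phi> lam) (G0_norm \<alpha> T \<Omega> \<phi> lam)"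
    and u1: "u1 \<in> dual_space (G1 \<alpha> T \<Omega> \<phi> lam) (G1_norm \<alpha> T \<Omega> \<phi> lam)"
  shows "\<exists>u. weak_solution \<alpha> T \<Omega> \<phi> lam f u0 u1 u \<and>
    (\<forall>w. weak_solution \<alpha> T \<Omega> \<phi> lam f u0 u1 w \<longrightarrow> (AE p in P. w p = u p)) \<and>
    L2norm P u \<le> trial_const \<alpha> * coer_const \<alpha> * (dual_norm GG nG f +
      dual_norm (G0 \<alpha> T \<Omega> \<phi> lam) (G0_norm \<alpha> T \<Omega> \<phi> lam) u0 +
      dual_norm (G1 \<alpha> T \<Omega> \<phi> lam) (G1_norm \<alpha> T \<Omega> \<phi> lam) u1)"
proof -
  let ?i = "\<lambda>j v. initial_value T \<Omega> (D j v)"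
  let ?df = "dual_norm GG nG f" and ?da = "dual_norm (G0 \<alpha> T \<Omega> \<phi> lam) (G0_norm \<alpha> T \<Omega> \<phi> lam) u0"
    and ?db = "dual_norm (G1 \<alpha> T \<Omega> \<phi> lam) (G1_norm \<alpha> T \<Omega> \<phi> lam) u1"
  define K where "K = trial_const \<alpha>"
  have K: "K > 0" by (simp add: K_def trial_const_def)
  note sc = nG_scale[folded K_def]
  let ?R = "\<lambda>j v y. has_initial_value T \<Omega> (D j v) y"
  have G0: "G0 \<alpha> T \<Omega> \<phi> lam = {g. \<exists>v\<in>GG. ?R 1 v g}"
      "G0_norm \<alpha> T \<Omega> \<phi> lam = (\<lambda>g. Inf {nG v | v. v \<in> GG \<and> ?R 1 v g})"
    by (auto simp: G0_def G0_norm_def)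
  have R0: "?R 1 (\<lambda>p. v p + c * w p) (\<lambda>x. y x + c * z x)"
    if "v \<in> GG" "w \<in> GG" "?R 1 v y" "?R 1 w z" for v w y z c
    by (rule D_initial_comb) (use that in auto)
  have t0: "\<bar>u0 y\<bar> \<le> K * ?da * nG v \<and> 0 \<le> ?da" if "v \<in> GG" "?R 1 v y" for v y
    using that unfolding G0 by - (rule trace_dual(1)[OF u0[unfolded G0] K G_comb R0 sc nG_nonneg], assumption+)
  have a0: "u0 q = u0 y + c * u0 z"
    if "v \<in> GG" "w \<in> GG" "?R 1 v y" "?R 1 w z" "?R 1 (\<lambda>p. v p + c * w p) q" for v w y z q c
    using that by - (rule trace_dual(2)[OF u0[unfolded G0] K G_comb R0 sc nG_nonneg], assumption+)
  have G1: "G1 \<alpha> T \<Omega> \<phi> lam = {g. \<exists>v\<in>GG. ?R 2 v g}"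
      "G1_norm \<alpha> T \<Omega> \<phi> lam = (\<lambda>g. Inf {nG v | v. v \<in> GG \<and> ?R 2 v g})"
    by (auto simp: G1_def G1_norm_def)
  have R1: "?R 2 (\<lambda>p. v p + c * w p) (\<lambda>x. y x + c * z x)"
    if "v \<in> GG" "w \<in> GG" "?R 2 v y" "?R 2 w z" for v w y z c
    by (rule D_initial_comb) (use that in auto)
  have t1: "\<bar>u1 y\<bar> \<le> K * ?db * nG v \<and> 0 \<le> ?db" if "v \<in> GG" "?R 2 v y" for v y
    using that unfolding G1 by - (rule trace_dual(1)[OF u1[unfolded G1] K G_comb R1 sc nG_nonneg], assumption+)
  have a1: "u1 q = u1 y + c * u1 z"
    if "v \<in> GG" "w \<in> GG" "?R 2 v y" "?R 2 w z" "?R 2 (\<lambda>p. v p + c * w p) q" for v w y z q c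
    using that by - (rule trace_dual(2)[OF u1[unfolded G1] K G_comb R1 sc nG_nonneg], assumption+)
  define L where "L v = f v + u0 (?i 1 v) + u1 (?i 2 v)" for v
  have fadd: "f (\<lambda>x. v x + w x) = f v + f w" if "v \<in> GG" "w \<in> GG" for v w
    using f that unfolding dual_space_def by blast
  have fmul: "f (\<lambda>x. c * v x) = c * f v" if "v \<in> GG" for c v
    using f that unfolding dual_space_def by blast
  have L_comb: "L (\<lambda>p. v p + c * w p) = L v + c * L w" if "v \<in> GG" "w \<in> GG" for v w c
  proof -
    have "f (\<lambda>p. v p + c * w p) = f v + c * f w" using fadd[OF that(1) G_scale[OF that(2)]] fmul[OF that(2)] by simp
    moreover have "u0 (?i 1 (\<lambda>p. v p + c * w p)) = u0 (?i 1 v) + c * u0 (?i 1 w)"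
      by (rule a0[OF that D_initial[OF _ that(1)] D_initial[OF _ that(2)] D_initial[OF _ G_comb[OF that]]]) simp_all
    moreover have "u1 (?i 2 (\<lambda>p. v p + c * w p)) = u1 (?i 2 v) + c * u1 (?i 2 w)"
      by (rule a1[OF that D_initial[OF _ that(1)] D_initial[OF _ that(2)] D_initial[OF _ G_comb[OF that]]]) simp_all
    ultimately show ?thesis by (simp add: L_def algebra_simps)
  qed
  have zG: "(\<lambda>p. 0) \<in> GG"
  proof (rule pot_G)
    show "pot (\<lambda>p. 0) (\<lambda>p. 0)"
      unfolding pot_def by (simp add: coeff_def[abs_def] ip_def cl_def mk_zero linear_0[OF linear_fint[OF \<alpha>_pos]])
  qed
  have L0: "L (\<lambda>p. 0) = 0" using L_comb[OF zG zG, of 1] by simp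
  have B0: "cl S (Bop (\<lambda>p. 0)) = 0" using Bop_comb[OF zG zG, of 1] by simp
  define E where "E = K * coer_const \<alpha> * (?df + ?da + ?db)"
  have dn: "0 \<le> ?df" "0 \<le> ?da" "0 \<le> ?db"
    using dual_bound(2)[OF f zG K G_scale sc nG_nonneg] t0[OF zG D_initial[OF _ zG]] t1[OF zG D_initial[OF _ zG]] by auto
  have cc: "coer_const \<alpha> > 0" using \<alpha> by (auto simp: coer_const_def coer_def less_max_iff_disj intro!: add_pos_pos)
  have E: "E \<ge> 0" using K cc dn by (simp add: E_def)
  have bound: "\<bar>L v\<bar> \<le> E * norm (cl S (Bop v))" if v: "v \<in> GG" for v
  proof -
    obtain g where g: "pot v g" using G_pot[OF v] by blast
    have "\<bar>f v\<bar> \<le> K * ?df * nG v" by (rule dual_bound(1)[OF f v K G_scale sc nG_nonneg])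
    moreover have "\<bar>u0 (?i 1 v)\<bar> \<le> K * ?da * nG v" using t0[OF v D_initial[OF _ v]] by simp
    moreover have "\<bar>u1 (?i 2 v)\<bar> \<le> K * ?db * nG v" using t1[OF v D_initial[OF _ v]] by simp
    ultimately have "\<bar>L v\<bar> \<le> K * (?df + ?da + ?db) * nG v" unfolding L_def by (simp add: algebra_simps)
    also have "\<dots> \<le> K * (?df + ?da + ?db) * (coer_const \<alpha> * norm (cl S (Bop v)))"
      using K dn by (intro mult_left_mono nG_Bop[OF g]) simp
    finally show ?thesis by (simp add: E_def mult_ac)
  qed
  \<comment> \<open>The parametrised Riesz theorem is applied to the values B v, which are not known
    to form a closed subspace.\<close>
  have "\<exists>x. norm x \<le> E \<and> (\<forall>v\<in>GG. inner x (cl S (Bop v)) = L v)"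
  proof (rule riesz_parametrised)
    show "GG \<noteq> {}" using zG by blast
    show "\<exists>z\<in>GG. cl S (Bop z) = cl S (Bop v) + cl S (Bop w) \<and> L z = L v + L w" if "v \<in> GG" "w \<in> GG" for v w
      using G_comb[OF that, of 1] Bop_comb[OF that, of 1] L_comb[OF that, of 1] by (intro bexI[of _ "\<lambda>p. v p + 1 * w p"]) auto
    show "\<exists>z\<in>GG. cl S (Bop z) = c *\<^sub>R cl S (Bop v) \<and> L z = c * L v" if "v \<in> GG" for c v
      using G_comb[OF zG that, of c] Bop_comb[OF zG that, of c] L_comb[OF zG that, of c] L0 B0
      by (intro bexI[of _ "\<lambda>p. 0 + c * v p"]) auto
  qed (rule bound E | assumption)+
  then obtain x where x: "norm x \<le> E" "\<And>v. v \<in> GG \<Longrightarrow> inner x (cl S (Bop v)) = L v" by blast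
  \<comment> \<open>The representative is replaced by its restriction to the cylinder; testing with
    u itself shows below that the norm does not increase.\<close>
  obtain u where u: "u \<in> L2 P" "\<And>w. w \<in> L2 P \<Longrightarrow> inner x (cl S w) = inner (cl S u) (cl S w)" using L2_cl_lift by blast
  have BL: "Bop v \<in> L2 P" if "v \<in> GG" for v using Bop_coeffs(1) G_pot[OF that] by blast
  have ipS: "ip P a b = inner (cl S a) (cl S b)" if "a \<in> L2 P" "b \<in> L2 P" for a b
    using ip_mon[OF S_sets, of a b] that unfolding P_eq by blast
  have sol: "weak_solution \<alpha> T \<Omega> \<phi> lam f u0 u1 u"
    unfolding weak_solution_def
  proof (intro conjI ballI u(1))
    fix v assume v: "v \<in> GG"
    show "ip P u (Bop v) = f v + u0 (?i 1 v) + u1 (?i 2 v)"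
      using ipS[OF u(1) BL[OF v]] u(2)[OF BL[OF v]] x(2)[OF v] by (simp add: L_def)
  qed
  have "L2norm P u \<le> E"
  proof -
    have "(norm (cl S u))\<^sup>2 = inner x (cl S u)" using u(2)[OF u(1)] by (simp add: power2_norm_eq_inner)
    also have "\<dots> \<le> norm x * norm (cl S u)" by (rule norm_cauchy_schwarz)
    finally have "norm (cl S u) \<le> norm x" by (cases "norm (cl S u) = 0") (auto simp: power2_eq_square)
    moreover have "L2norm P u = norm (cl S u)" using L2norm_mon[OF S_sets, of u] u(1) unfolding P_eq by blast
    ultimately show ?thesis using x(1) by simp
  qed
  moreover have "AE p in P. w p = u p" if w: "weak_solution \<alpha> T \<Omega> \<phi> lam f u0 u1 w" for w
  proof -
    have wL: "w \<in> L2 P" using w by (simp add: weak_solution_def)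
    have "AE p in P. w p - u p = 0"
    proof (rule ip_Bop_unique[OF L2_diff[OF wL u(1)]])
      fix v assume v: "v \<in> GG"
      have "ip P w (Bop v) = ip P u (Bop v)" using w sol v unfolding weak_solution_def by simp
      then show "ip P (\<lambda>p. w p - u p) (Bop v) = 0"
        using wL u(1) BL[OF v] by (simp add: ipS L2_diff cl_S_lin inner_diff_left)
    qed
    then show ?thesis by simp
  qed
  ultimately show ?thesis using sol unfolding E_def K_def by blast
qed

end

end

lemma solution_constant:
  assumes "1 < \<alpha>" "\<alpha> < 2"
  shows "trial_const \<alpha> * coer_const \<alpha> > 0"
  using assms by (auto simp: trial_const_def coer_const_def coer_def less_max_iff_disj intro!: mult_pos_pos add_pos_pos)

lemma convex_polytope_domain_cyl:
  assumes "T > 0" "convex_polytope_domain \<Omega>" "dirichlet_eigenbasis \<Omega> \<phi> lam"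
  shows "cyl T \<Omega> \<phi> lam"
proof (rule cyl.intro)
  show "\<Omega> \<in> sets borel" using assms(2) by (auto simp: convex_polytope_domain_def)
qed (use assms in auto)

text \<open>The dimension is a type, so the three cases become separate conjuncts. The argument is
  polymorphic in the space, and one constant, fixed before T, the domain and the data, serves them
  all.\<close>

theorem theorem4p4:
  fixes \<alpha> :: real
  assumes "1 < \<alpha>" "\<alpha> < 2"
  shows "\<exists>C>0.
     (\<forall>T>0. \<forall>(\<Omega> :: (real ^ 1) set) \<phi> lam f u0 u1.
        convex_polytope_domain \<Omega> \<longrightarrow>
        dirichlet_eigenbasis \<Omega> \<phi> lam \<longrightarrow>
        f \<in> dual_space (G \<alpha> T \<Omega> \<phi> lam) (G_norm \<alpha> T \<Omega> \<phi> lam) \<longrightarrow>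
        u0 \<in> dual_space (G0 \<alpha> T \<Omega> \<phi> lam) (G0_norm \<alpha> T \<Omega> \<phi> lam) \<longrightarrow>
        u1 \<in> dual_space (G1 \<alpha> T \<Omega> \<phi> lam) (G1_norm \<alpha> T \<Omega> \<phi> lam) \<longrightarrow>
        (\<exists>u. weak_solution \<alpha> T \<Omega> \<phi> lam f u0 u1 u \<and>
          (\<forall>w. weak_solution \<alpha> T \<Omega> \<phi> lam f u0 u1 w \<longrightarrow> (AE p in cylinder T \<Omega>. w p = u p)) \<and>
          L2norm (cylinder T \<Omega>) u \<le>
            C * (dual_norm (G \<alpha> T \<Omega> \<phi> lam) (G_norm \<alpha> T \<Omega> \<phi> lam) f +
                 dual_norm (G0 \<alpha> T \<Omega> \<phi> lam) (G0_norm \<alpha> T \<Omega> \<phi> lam) u0 +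
                 dual_norm (G1 \<alpha> T \<Omega> \<phi> lam) (G1_norm \<alpha> T \<Omega> \<phi> lam) u1))) \<and>
     (\<forall>T>0. \<forall>(\<Omega> :: (real ^ 2) set) \<phi> lam f u0 u1.
        convex_polytope_domain \<Omega> \<longrightarrow>
        dirichlet_eigenbasis \<Omega> \<phi> lam \<longrightarrow>
        f \<in> dual_space (G \<alpha> T \<Omega> \<phi> lam) (G_norm \<alpha> T \<Omega> \<phi> lam) \<longrightarrow>
        u0 \<in> dual_space (G0 \<alpha> T \<Omega> \<phi> lam) (G0_norm \<alpha> T \<Omega> \<phi> lam) \<longrightarrow>
        u1 \<in> dual_space (G1 \<alpha> T \<Omega> \<phi> lam) (G1_norm \<alpha> T \<Omega> \<phi> lam) \<longrightarrow>
        (\<exists>u. weak_solution \<alpha> T \<Omega> \<phi> lam f u0 u1 u \<and>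
          (\<forall>w. weak_solution \<alpha> T \<Omega> \<phi> lam f u0 u1 w \<longrightarrow> (AE p in cylinder T \<Omega>. w p = u p)) \<and>
          L2norm (cylinder T \<Omega>) u \<le>
            C * (dual_norm (G \<alpha> T \<Omega> \<phi> lam) (G_norm \<alpha> T \<Omega> \<phi> lam) f +
                 dual_norm (G0 \<alpha> T \<Omega> \<phi> lam) (G0_norm \<alpha> T \<Omega> \<phi> lam) u0 +
                 dual_norm (G1 \<alpha> T \<Omega> \<phi> lam) (G1_norm \<alpha> T \<Omega> \<phi> lam) u1))) \<and>
     (\<forall>T>0. \<forall>(\<Omega> :: (real ^ 3) set) \<phi> lam f u0 u1.
        convex_polytope_domain \<Omega> \<longrightarrow>
        dirichlet_eigenbasis \<Omega> \<phi> lam \<longrightarrow>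
        f \<in> dual_space (G \<alpha> T \<Omega> \<phi> lam) (G_norm \<alpha> T \<Omega> \<phi> lam) \<longrightarrow>
        u0 \<in> dual_space (G0 \<alpha> T \<Omega> \<phi> lam) (G0_norm \<alpha> T \<Omega> \<phi> lam) \<longrightarrow>
        u1 \<in> dual_space (G1 \<alpha> T \<Omega> \<phi> lam) (G1_norm \<alpha> T \<Omega> \<phi> lam) \<longrightarrow>
        (\<exists>u. weak_solution \<alpha> T \<Omega> \<phi> lam f u0 u1 u \<and>
          (\<forall>w. weak_solution \<alpha> T \<Omega> \<phi> lam f u0 u1 w \<longrightarrow> (AE p in cylinder T \<Omega>. w p = u p)) \<and>
          L2norm (cylinder T \<Omega>) u \<le>
            C * (dual_norm (G \<alpha> T \<Omega> \<phi> lam) (G_norm \<alpha> T \<Omega> \<phi> lam) f +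
                 dual_norm (G0 \<alpha> T \<Omega> \<phi> lam) (G0_norm \<alpha> T \<Omega> \<phi> lam) u0 +
                 dual_norm (G1 \<alpha> T \<Omega> \<phi> lam) (G1_norm \<alpha> T \<Omega> \<phi> lam) u1)))"
proof -
  let ?C = "trial_const \<alpha> * coer_const \<alpha>"
  have "?C > 0" by (rule solution_constant[OF assms])
  then show ?thesis
    by (intro exI[of _ ?C] conjI allI impI cyl.weak_solution_exists_unique convex_polytope_domain_cyl assms)
qed

end
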